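(* Let $n\ge3$ and let $$L=-\Delta+R(x),\qquad R(x)=\sum_{1\le i<j\le n}\frac{C_{ij}}{(x_i-x_j)^2}+\widetilde R(x),$$ where the $C_{ij}$ are constants (some possibly zero), $\widetilde R$ is real analytic at $x=0$, and $L$ commutes with $\Delta_1=\sum_{i=1}^n\partial_i$. Assume that $\mathcal{H}=\{e_i-e_j: i<j,\ C_{ij}\ne0\}$ is irreducible in $V=\{x\in\mathbb{R}^n:\sum_i x_i=0\}$ and that $R$ is generic. Let $$P=\sum_{1\le i<j<k\le n}\partial_i\partial_j\partial_k+\sum_{i=1}^n a_1^i(x)\partial_i+a_0(x)$$ be a differential operator commuting with $\Delta_1$. If $L$ commutes with $P$, then there exist constants $c_1$ and $c_2$ such that $$R(x)=c_1\sum_{1\le i<j\le n}\wp(x_i-x_j\,|\,2\omega_1,2\omega_2)+c_2,$$ where $\wp(t\,|\,2\omega_1,2\omega_2)$ is the Weierstrass elliptic function with primitive periods $2\omega_1$ and $2\omega_2$.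
   Context: $e_1,\dots,e_n$ is the standard basis of $\mathbb{R}^n$, $\langle\cdot,\cdot\rangle$ the standard inner product, $\partial_i=\partial/\partial x_i$, $\Delta=\sum_i\partial_i^2$. $L$ is defined on some open subset of $\mathbb{R}^n$, and $P$ is real analytic in the domain where $L$ is defined. Irreducible in $V$: $\mathcal{H}$ spans $V$ as a real vector space and cannot be partitioned into the union of two proper subsets such that each vector in one is orthogonal to each vector in the other. Generic: $C_{ij}\neq k(k+1)\langle e_i-e_j,e_i-e_j\rangle=2k(k+1)$ for every integer $k$ and every $e_i-e_j\in\mathcal{H}$.
   Formalization: The periods 2ω1, 2ω2 may be infinite, so ℘ may degenerate to a trigonometric function or to 1/t²; with finite periods only, the claim fails for R = Σ C/(x_i−x_j)² with R̃ = 0, which satisfies every hypothesis. *)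

theory Defs
  imports "HOL-Analysis.Analysis"
begin

definition partial :: "'n::finite \<Rightarrow> (real^'n \<Rightarrow> complex) \<Rightarrow> real^'n \<Rightarrow> complex" where
  "partial i f x = vector_derivative (\<lambda>t. f (x + t *\<^sub>R axis i 1)) (at 0)"

text \<open>Smoothness on an open set: total differentiability of every iterated partial derivative
  makes all of them continuous, hence this is \<open>C\<^sup>\<infinity>\<close>.\<close>

definition smooth_on :: "(real^'n::finite) set \<Rightarrow> (real^'n \<Rightarrow> complex) \<Rightarrow> bool" where
  "smooth_on U f \<longleftrightarrow> (\<forall>is. \<forall>x\<in>U. foldr partial is f differentiable (at x))"

text \<open>A complex-valued function of real variables is real analytic at \<open>a\<close> if near \<open>a\<close> it is the sum
  of an unconditionally convergent power series; \<open>\<alpha> :: 'n \<Rightarrow> nat\<close> is a multi-index.\<close>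

definition real_analytic_at :: "(real^'n::finite \<Rightarrow> complex) \<Rightarrow> real^'n \<Rightarrow> bool" where
  "real_analytic_at f a \<longleftrightarrow>
     (\<exists>r>0. \<exists>c :: ('n \<Rightarrow> nat) \<Rightarrow> complex. \<forall>x\<in>ball a r.
        ((\<lambda>\<alpha>. c \<alpha> * of_real (\<Prod>i\<in>UNIV. (x $ i - a $ i) ^ \<alpha> i)) has_sum f x) UNIV)"

definition real_analytic_on :: "(real^'n::finite) set \<Rightarrow> (real^'n \<Rightarrow> complex) \<Rightarrow> bool" where
  "real_analytic_on S f \<longleftrightarrow> (\<forall>a\<in>S. real_analytic_at f a)"

text \<open>Differential operators are represented by their action on functions. On an open set \<open>U\<close> they
  are compared on smooth functions: only the values on \<open>U\<close> matter, since operators are local.\<close>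

type_synonym 'n operator = "(real^'n \<Rightarrow> complex) \<Rightarrow> real^'n \<Rightarrow> complex"

definition commute_on :: "(real^'n::finite) set \<Rightarrow> 'n operator \<Rightarrow> 'n operator \<Rightarrow> bool" where
  "commute_on U A B \<longleftrightarrow> (\<forall>f. smooth_on U f \<longrightarrow> (\<forall>x\<in>U. A (B f) x = B (A f) x))"

definition laplacian :: "'n::finite operator" where
  "laplacian f x = (\<Sum>i\<in>UNIV. partial i (partial i f) x)"

definition Delta1 :: "'n::finite operator" where
  "Delta1 f x = (\<Sum>i\<in>UNIV. partial i f x)"

definition schroedinger :: "(real^'n::finite \<Rightarrow> complex) \<Rightarrow> 'n operator" where
  "schroedinger R f x = - laplacian f x + R x * f x"

definition cubic_operator ::
  "('n \<Rightarrow> real^'n::{finite,linorder} \<Rightarrow> complex) \<Rightarrow> (real^'n::{finite,linorder} \<Rightarrow> complex) \<Rightarrow> 'n operator" where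
  "cubic_operator a1 a0 f x =
     (\<Sum>(i,j,k)\<in>{(i,j,k). i < j \<and> j < k}. partial i (partial j (partial k f)) x)
     + (\<Sum>i\<in>UNIV. a1 i x * partial i f x) + a0 x * f x"

definition root_vectors :: "('n \<Rightarrow> 'n \<Rightarrow> complex) \<Rightarrow> (real^'n::{finite,linorder}) set" where
  "root_vectors C = {axis i 1 - axis j 1 |i j. i < j \<and> C i j \<noteq> 0}"

definition irreducible_in :: "'a::real_inner set \<Rightarrow> 'a set \<Rightarrow> bool" where
  "irreducible_in H V \<longleftrightarrow>
     span H = V \<and>
     \<not> (\<exists>A B. A \<subset> H \<and> B \<subset> H \<and> A \<union> B = H \<and> A \<inter> B = {} \<and> (\<forall>a\<in>A. \<forall>b\<in>B. orthogonal a b))"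

definition generic :: "('n::{finite,linorder} \<Rightarrow> 'n \<Rightarrow> complex) \<Rightarrow> bool" where
  "generic C \<longleftrightarrow>
     (\<forall>i j. i < j \<and> axis i 1 - axis j 1 \<in> root_vectors C \<longrightarrow>
        (\<forall>k::int. C i j \<noteq> of_int (k * (k + 1)) *
           of_real (inner (axis i 1 - axis j 1 :: real^'n::{finite,linorder}) (axis i 1 - axis j 1))))"

text \<open>The function \<open>\<wp>(t | 2 \<omega>\<^sub>1, 2 \<omega>\<^sub>2)\<close>. A half-period may be infinite, written \<^const>\<open>None\<close>; it then
  contributes nothing to the period group. With one infinite period the series below is
  \<open>(\<pi>/(2\<omega>))\<^sup>2 (1/sin\<^sup>2(\<pi>t/(2\<omega>)) - 1/3)\<close>, with two it is \<open>1/t\<^sup>2\<close>. These degenerate cases are needed: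
  the rational and trigonometric potentials also admit a commuting operator of order three.\<close>

fun primitive_half_periods :: "complex option \<Rightarrow> complex option \<Rightarrow> bool" where
  "primitive_half_periods (Some a) (Some b) \<longleftrightarrow> a \<noteq> 0 \<and> b / a \<notin> \<real>"
| "primitive_half_periods (Some a) None \<longleftrightarrow> a \<noteq> 0"
| "primitive_half_periods None (Some b) \<longleftrightarrow> b \<noteq> 0"
| "primitive_half_periods None None \<longleftrightarrow> True"

fun period_multiples :: "complex option \<Rightarrow> complex set" where
  "period_multiples None = {0}"
| "period_multiples (Some \<omega>) = {of_int m * (2 * \<omega>) |m. True}"

definition period_lattice :: "complex option \<Rightarrow> complex option \<Rightarrow> complex set" where
  "period_lattice \<omega>1 \<omega>2 = {u + v |u v. u \<in> period_multiples \<omega>1 \<and> v \<in> period_multiples \<omega>2}"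

definition weierstrass_p :: "complex option \<Rightarrow> complex option \<Rightarrow> complex \<Rightarrow> complex" where
  "weierstrass_p \<omega>1 \<omega>2 t =
     1 / t\<^sup>2 + (\<Sum>\<^sub>\<infinity>w\<in>period_lattice \<omega>1 \<omega>2 - {0}. 1 / (t - w)\<^sup>2 - 1 / w\<^sup>2)"

end

(* The symbol of the commutator shows that the third mixed derivatives of R vanish, so near the origin R is a
   sum of functions u_ij(x_i - x_j) with at most a double pole, and that the coefficients a_1^i agree, up to an
   affine function, with explicit sums of the u_ij. The zeroth-order part of the commutator then becomes a
   functional equation for the u_ij. Its most singular terms at a wall x_i = x_j with C_ij nonzero, together with
   the irreducibility of the root vectors, force all u_ij to equal one even function u = c/z^2 + r(z). Isolating
   three coordinates and letting two of them collide turns the functional equation into G(2q) = 2 G(q) for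
   G = (c/6) u''' - 2 u u', and G(q)/q tends to 0, so G = 0. Hence u/c satisfies the equation of the Weierstrass
   function, but possibly only near 0: the duplication formula extends its solution to the plane, and the poles
   form the period lattice. Finally the formula for R spreads over the connected domain, because a pole met on the
   way would have a coefficient that is a sum of positive numbers, while R minus its singular part is analytic. *)

theory Submission
 imports Defs "HOL-Complex_Analysis.Complex_Analysis"
begin

text \<open>The invariants of the germ u/c are mere integration constants and their discriminant may
  vanish, so no lattice is at hand to compare it with. Duplicating u/c itself would carry its poles
  along. The proof passes to \<sigma> = z exp H with -(log \<sigma>)'' = u/c near 0, for which
  duplication reads \<sigma>(2z) = -(u/c)'(z) \<sigma>(z)^4. With denominators cleared this is a
  polynomial in \<sigma> and its derivatives, so each use doubles the disc without creating poles.
  The zeros of the resulting entire function form a discrete group of rank 0, 1 or 2, and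
  Liouville's theorem identifies -(log \<sigma>)'' with the lattice series in all three cases at
  once. Real walls cut the domain into chambers; identities cross them on complexified segments,
  where a wall is a single point. The constant c/6 in G comes from the error of the trapezoidal
  rule, produced by c/t^2 and -2c/t^3 in a collision. A linear G would satisfy the doubling
  equation, so the expansion of u at 0 has to show that G has no linear term.\<close>

unbundle no fps_syntax

subsection \<open>Real analytic functions\<close>

text \<open>The Weierstrass test for unconditional sums. The theorem on uniform limits of
  holomorphic functions holds along any nontrivial filter, so it applies to
  \<open>finite_subsets_at_top\<close> directly and the index set is never enumerated. Multi-index
  series and lattice series both go through it.\<close>

lemma holomorphic_infsum:
 fixes f :: "'a => complex => complex"
 assumes A: "open A" and hol: "\<And>x. x \<in> X ==> f x holomorphic_on A"
  and bd: "\<And>x z. x \<in> X ==> z \<in> A ==> norm (f x z) \<le> M x" and M: "M summable_on X"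
 shows "(%z. \<Sum>\<^sub>\<infinity>x\<in>X. f x z) holomorphic_on A"
  and "z \<in> A ==> ((%x. deriv (f x) z) has_sum deriv (%z. \<Sum>\<^sub>\<infinity>x\<in>X. f x z) z) X"
proof -
 let ?g = "%z. \<Sum>\<^sub>\<infinity>x\<in>X. f x z"
 have *: "\<exists>g'. (?g has_field_derivative g') (at z) \<and> ((%x. deriv (f x) z) has_sum g') X" if zA: "z \<in> A" for z
 proof -
  obtain r where r: "r > 0" "cball z r \<subseteq> A" using open_contains_cball[THEN iffD1, OF A] zA by blast
  have u: "uniform_limit (cball z r) (%Y y. \<Sum>x\<in>Y. f x y) ?g (finite_subsets_at_top X)"
   using M bd r by (intro Weierstrass_m_test_general[where M = M]) auto
  have der: "(f x has_field_derivative deriv (f x) w) (at w)" if "x \<in> X" "w \<in> A" for x w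
   using hol[OF that(1)] A that(2) holomorphic_derivI by blast
  have ev: "eventually (%Y. continuous_on (cball z r) (%y. \<Sum>x\<in>Y. f x y) \<and>
    (\<forall>w\<in>ball z r. ((%y. \<Sum>x\<in>Y. f x y) has_field_derivative (\<Sum>x\<in>Y. deriv (f x) w)) (at w)))
    (finite_subsets_at_top X)"
  proof (rule eventually_finite_subsets_at_top_weakI, intro conjI ballI)
   fix Y assume Y: "finite Y" "Y \<subseteq> X"
   show "continuous_on (cball z r) (%y. \<Sum>x\<in>Y. f x y)"
    using Y r hol by (intro continuous_on_sum holomorphic_on_imp_continuous_on) (meson holomorphic_on_subset subsetD)
   fix w assume "w \<in> ball z r"
   then show "((%y. \<Sum>x\<in>Y. f x y) has_field_derivative (\<Sum>x\<in>Y. deriv (f x) w)) (at w)"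
    using Y r by (intro DERIV_sum der) (auto simp: subset_iff)
  qed
  obtain g' where g': "\<And>w. w \<in> ball z r ==> (?g has_field_derivative (g' w)) (at w) \<and>
    ((%Y. \<Sum>x\<in>Y. deriv (f x) w) \<longlongrightarrow> g' w) (finite_subsets_at_top X)"
   using has_complex_derivative_uniform_limit[OF ev u finite_subsets_at_top_neq_bot r(1)] by blast
  have "z \<in> ball z r" using r by simp
  then show ?thesis using g'[of z] unfolding has_sum_def by blast
 qed
 show "?g holomorphic_on A"
  unfolding holomorphic_on_open[OF A] using * by blast
 show "((%x. deriv (f x) z) has_sum deriv ?g z) X" if "z \<in> A"
  using *[OF that] DERIV_imp_deriv by metis
qed

text \<open>Keeps radius and coefficients visible, because differentiation is followed on the
  coefficients and costs radius.\<close>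

definition has_ps :: "(real^'n::finite => complex) => real^'n => real => (('n => nat) => complex) => bool" where
 "has_ps f a r c \<longleftrightarrow> r > 0 \<and> (\<forall>x\<in>ball a r.
   ((%\<alpha>. c \<alpha> * of_real (\<Prod>i\<in>UNIV. (x $ i - a $ i) ^ \<alpha> i)) has_sum f x) UNIV)"

lemma real_analytic_at_iff_has_ps: "real_analytic_at f a \<longleftrightarrow> (\<exists>r c. has_ps f a r c)"
 unfolding real_analytic_at_def has_ps_def by blast

text \<open>Unconditional convergence of complex numbers is absolute. Evaluating at the one point
  whose offsets all equal \<open>\<rho>\<close> therefore yields a majorant valid for every
  argument, real or complex, with offsets bounded by \<open>\<rho>\<close>.\<close>

lemma has_ps_abs_summable:
 fixes f :: "real^'n::finite => complex"
 assumes "has_ps f a r c"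
 shows "(%\<alpha>. norm (c \<alpha>) * (r / (2 * CARD('n))) ^ (\<Sum>i\<in>UNIV. \<alpha> i)) summable_on UNIV"
proof -
 \<comment> \<open>The factor \<open>CARD('n)\<close> makes the l1 norm of the constant offset
   vector equal to r / 2, which keeps the point inside the ball.\<close>
 define \<rho> where "\<rho> = r / (2 * CARD('n))"
 define x :: "real^'n" where "x = a + (\<chi> i. \<rho>)"
 have r: "r > 0" using assms by (simp add: has_ps_def)
 have card: "real CARD('n) > 0" by simp
 have rho: "\<rho> > 0" using r by (simp add: \<rho>_def)
 have abs_rho: "\<bar>\<rho>\<bar> = \<rho>" using rho by simp
 have "norm (\<chi> i. \<rho> :: real^'n) \<le> (\<Sum>i\<in>UNIV. \<bar>(\<chi> i. \<rho> :: real^'n) $ i\<bar>)" by (rule norm_le_l1_cart)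
 also have "\<dots> = r / 2" using r by (simp add: abs_rho) (simp add: \<rho>_def)
 also have "\<dots> < r" using r by simp
 finally have "x \<in> ball a r" by (simp add: x_def dist_norm)
 then have "((%\<alpha>. c \<alpha> * of_real (\<Prod>i\<in>UNIV. (x $ i - a $ i) ^ \<alpha> i)) has_sum f x) UNIV"
  using assms by (simp add: has_ps_def)
 then have "(%\<alpha>. norm (c \<alpha> * of_real (\<Prod>i\<in>UNIV. (x $ i - a $ i) ^ \<alpha> i))) summable_on UNIV"
  by (intro summable_on_iff_abs_summable_on_complex[THEN iffD1] has_sum_imp_summable)
 then show ?thesis
  unfolding \<rho>_def[symmetric] x_def norm_mult norm_of_real abs_prod power_abs
  by (simp add: abs_rho power_sum)
qed

text \<open>Only the i-th coordinate is made complex; in it the series may be differentiated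
  termwise. Half of \<open>\<rho>\<close> is spent on the real offset and half on the complex
  increment, whence the new radius \<open>\<rho> / 2\<close>.\<close>

lemma has_ps_partial:
 fixes f :: "real^'n::finite => complex"
 assumes ps: "has_ps f a r c"
 shows "has_ps (partial i f) a (r / (4 * CARD('n)))
  (%\<alpha>. of_nat (Suc (\<alpha> i)) * c (\<alpha>(i := Suc (\<alpha> i))))"
proof -
 define \<rho> where "\<rho> = r / (2 * CARD('n))"
 define M where "M = (%\<alpha>. norm (c \<alpha>) * \<rho> ^ (\<Sum>i\<in>UNIV. \<alpha> i))"
 have r: "r > 0" using ps by (simp add: has_ps_def)
 have rho: "\<rho> > 0" using r by (simp add: \<rho>_def)
 have M: "M summable_on UNIV" using has_ps_abs_summable[OF ps] by (simp add: M_def \<rho>_def)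
 have card1: "real CARD('n) \<ge> 1" by (simp add: Suc_leI)
 have rho_le: "\<rho> \<le> r / 2" using r card1 unfolding \<rho>_def by (intro divide_left_mono) auto
 have "((%\<alpha>. of_nat (Suc (\<alpha> i)) * c (\<alpha>(i := Suc (\<alpha> i))) * of_real (\<Prod>k\<in>UNIV. (x $ k - a $ k) ^ \<alpha> k))
   has_sum partial i f x) UNIV" if x: "x \<in> ball a (\<rho> / 2)" for x
 proof -
  define P where "P = (%\<alpha>. \<Prod>k\<in>UNIV - {i}. (x $ k - a $ k) ^ \<alpha> k)"
  define F where "F = (%\<alpha> z. c \<alpha> * of_real (P \<alpha>) * (of_real (x $ i - a $ i) + z) ^ \<alpha> i)"
  define A where "A = ball (0::complex) (\<rho> / 2)"
  have xk: "\<bar>x $ k - a $ k\<bar> \<le> \<rho> / 2" for k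
  proof -
   have "\<bar>(x - a) $ k\<bar> \<le> norm (x - a)" by (rule component_le_norm_cart)
   also have "\<dots> \<le> \<rho> / 2" using x by (simp add: dist_norm norm_minus_commute)
   finally show ?thesis by simp
  qed
  have xk': "\<bar>x $ k - a $ k\<bar> \<le> \<rho>" for k using xk[of k] rho by linarith
  have split: "(\<Prod>k\<in>UNIV. ((x + t *\<^sub>R axis i 1) $ k - a $ k) ^ \<alpha> k) = P \<alpha> * (x $ i - a $ i + t) ^ \<alpha> i" for t \<alpha>
  proof -
   have "(\<Prod>k\<in>UNIV. ((x + t *\<^sub>R axis i 1) $ k - a $ k) ^ \<alpha> k) =
     ((x + t *\<^sub>R axis i 1) $ i - a $ i) ^ \<alpha> i * (\<Prod>k\<in>UNIV-{i}. ((x + t *\<^sub>R axis i 1) $ k - a $ k) ^ \<alpha> k)"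
    by (rule prod.remove) auto
   also have "(\<Prod>k\<in>UNIV-{i}. ((x + t *\<^sub>R axis i 1) $ k - a $ k) ^ \<alpha> k) = P \<alpha>"
    unfolding P_def by (intro prod.cong) (auto simp: axis_def)
   finally show ?thesis by (simp add: algebra_simps)
  qed
  have bd: "norm (F \<alpha> z) \<le> M \<alpha>" if "z \<in> A" for \<alpha> z
  proof -
   have "\<bar>P \<alpha>\<bar> \<le> (\<Prod>k\<in>UNIV - {i}. \<rho> ^ \<alpha> k)"
    unfolding P_def abs_prod power_abs
    using xk' by (intro prod_mono conjI power_mono) auto
   moreover have "norm (of_real (x $ i - a $ i) + z) \<le> \<rho>"
    using norm_triangle_ineq[of "of_real (x $ i - a $ i)" z] xk[of i] that
    unfolding norm_of_real by (simp add: A_def del: of_real_diff)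
   then have "norm (of_real (x $ i - a $ i) + z) ^ \<alpha> i \<le> \<rho> ^ \<alpha> i" by (intro power_mono) auto
   ultimately have "\<bar>P \<alpha>\<bar> * norm (of_real (x $ i - a $ i) + z) ^ \<alpha> i \<le> (\<Prod>k\<in>UNIV - {i}. \<rho> ^ \<alpha> k) * \<rho> ^ \<alpha> i"
    using rho by (intro mult_mono prod_nonneg ballI zero_le_power) auto
   also have "\<dots> = (\<Prod>k\<in>UNIV. \<rho> ^ \<alpha> k)"
    using prod.remove[of UNIV i "%k. \<rho> ^ \<alpha> k"] by simp
   also have "\<dots> = \<rho> ^ (\<Sum>i\<in>UNIV. \<alpha> i)" by (simp add: power_sum)
   finally show ?thesis
    unfolding F_def M_def norm_mult norm_power mult.assoc by (simp add: mult_left_mono)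
  qed
  have hol: "F \<alpha> holomorphic_on A" for \<alpha> unfolding F_def by (intro holomorphic_intros)
  let ?G = "%z. \<Sum>\<^sub>\<infinity>\<alpha>. F \<alpha> z"
  have G: "?G holomorphic_on A" and dG: "((%\<alpha>. deriv (F \<alpha>) 0) has_sum deriv ?G 0) UNIV"
   using holomorphic_infsum(1)[of A UNIV F M] holomorphic_infsum(2)[of A UNIV F M 0] hol bd M rho
   by (auto simp: A_def)
  have fG: "f (x + t *\<^sub>R axis i 1) = ?G (of_real t)" if "t \<in> {-\<rho>/2<..<\<rho>/2}" for t
  proof -
   have "norm (x + t *\<^sub>R axis i 1 - a) \<le> norm (x - a) + \<bar>t\<bar>"
    using norm_triangle_ineq[of "x - a" "t *\<^sub>R axis i 1"] by (simp add: algebra_simps)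
   also have "\<dots> < r" using x that rho_le rho by (auto simp: dist_norm norm_minus_commute)
   finally have "x + t *\<^sub>R axis i 1 \<in> ball a r" by (simp add: dist_norm norm_minus_commute)
   then have "((%\<alpha>. c \<alpha> * of_real (P \<alpha> * (x $ i - a $ i + t) ^ \<alpha> i)) has_sum f (x + t *\<^sub>R axis i 1)) UNIV"
    using ps unfolding has_ps_def split[symmetric] by blast
   then show ?thesis by (simp add: F_def infsumI mult.assoc)
  qed
  have "(?G has_field_derivative deriv ?G 0) (at (of_real 0))"
   using G rho by (simp add: A_def holomorphic_derivI[of _ "ball 0 (\<rho>/2)"])
  then have "((%t. ?G (of_real t)) has_vector_derivative deriv ?G 0) (at (0::real))"
   by (rule has_vector_derivative_real_field)
  then have "((%t. f (x + t *\<^sub>R axis i 1)) has_vector_derivative deriv ?G 0) (at (0::real))"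
   by (rule has_vector_derivative_transform_within_open[where S = "{-\<rho>/2<..<\<rho>/2}"]) (use fG rho in auto)
  then have par: "partial i f x = deriv ?G 0" unfolding partial_def by (rule vector_derivative_at)
  have dF: "deriv (F \<alpha>) 0 = of_nat (\<alpha> i) * c \<alpha> * of_real (P \<alpha> * (x $ i - a $ i) ^ (\<alpha> i - 1))" for \<alpha>
   unfolding F_def by (rule DERIV_imp_deriv) (auto intro!: derivative_eq_intros)
  \<comment> \<open>A differentiated term carries the factor \<open>\<alpha> i\<close>, so only
    indices in the range of the injective shift \<open>?u\<close> contribute; reindexing by
    \<open>?u\<close> produces the shifted coefficients.\<close>
  let ?u = "%\<alpha>::'n=>nat. \<alpha>(i := Suc (\<alpha> i))"
  let ?h = "%\<alpha>. of_nat (\<alpha> i) * c \<alpha> * of_real (P \<alpha> * (x $ i - a $ i) ^ (\<alpha> i - 1))"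
  have inj: "inj ?u"
  proof (rule injI)
   fix \<alpha> \<beta> assume e: "?u \<alpha> = ?u \<beta>"
   show "\<alpha> = \<beta>"
   proof
    fix k show "\<alpha> k = \<beta> k" using fun_cong[OF e, of k] by (cases "k = i") auto
   qed
  qed
  have range: "\<alpha> \<in> range ?u" if "\<alpha> i > 0" for \<alpha>
   using that by (intro image_eqI[of _ _ "\<alpha>(i := \<alpha> i - 1)"]) auto
  have "(?h has_sum partial i f x) UNIV" using dG unfolding par dF .
  then have "(?h has_sum partial i f x) (range ?u)"
   by (subst has_sum_cong_neutral[of UNIV "range ?u" ?h ?h]) (use range in auto)
  then have "(?h \<circ> ?u has_sum partial i f x) UNIV" using has_sum_reindex[OF inj] by blast
  moreover have "(?h \<circ> ?u) = (%\<alpha>. of_nat (Suc (\<alpha> i)) * c (\<alpha>(i := Suc (\<alpha> i))) * of_real (\<Prod>k\<in>UNIV. (x $ k - a $ k) ^ \<alpha> k))"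
  proof
   fix \<alpha> :: "'n => nat"
   have "P (?u \<alpha>) = P \<alpha>" unfolding P_def by (intro prod.cong) auto
   moreover have "(\<Prod>k\<in>UNIV. (x $ k - a $ k) ^ \<alpha> k) = P \<alpha> * (x $ i - a $ i) ^ \<alpha> i" using split[of 0] by simp
   ultimately show "(?h \<circ> ?u) \<alpha> = of_nat (Suc (\<alpha> i)) * c (\<alpha>(i := Suc (\<alpha> i))) * of_real (\<Prod>k\<in>UNIV. (x $ k - a $ k) ^ \<alpha> k)"
    by simp
  qed
  ultimately show ?thesis by simp
 qed
 moreover have "\<rho> / 2 = r / (4 * CARD('n))" by (simp add: \<rho>_def)
 ultimately show ?thesis using r unfolding has_ps_def by simp
qed

lemma has_ps_center:
 fixes f :: "real^'n::finite => complex"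
 assumes "has_ps f a r c"
 shows "f a = c (%_. 0)"
proof -
 have "((%\<alpha>. c \<alpha> * of_real (\<Prod>i\<in>UNIV. (a $ i - a $ i) ^ \<alpha> i)) has_sum f a) UNIV"
  using assms unfolding has_ps_def by (meson centre_in_ball)
 moreover have "c \<alpha> * of_real (\<Prod>i\<in>UNIV. (a $ i - a $ i) ^ \<alpha> i) = (if \<alpha> = (%_. 0) then c (%_. 0) else 0)" for \<alpha> :: "'n => nat"
 proof -
  show ?thesis
  proof (cases "\<alpha> = (%_. 0)")
   case False
   then obtain k where "\<alpha> k \<noteq> 0" by auto
   then have "(\<Prod>i\<in>UNIV. (a $ i - a $ i) ^ \<alpha> i) = 0" by (intro prod_zero) auto
   then show ?thesis using False by simp
  qed simp
 qed
 ultimately have "((%\<alpha>::'n => nat. if \<alpha> = (%_. 0) then c (%_. 0) else 0) has_sum f a) UNIV" by (simp only:)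
 then have "((%\<alpha>::'n => nat. if \<alpha> = (%_. 0) then c (%_. 0) else 0) has_sum f a) {%_. 0}"
  by (subst has_sum_cong_neutral[where T = UNIV]) auto
 then show ?thesis by (simp add: has_sum_finite_iff)
qed

text \<open>Beyond the constant and linear terms only total degrees at least 2 remain, and these are
  dominated by (|x - a| / \<rho>)^2 times the majorant. Treating the centre suffices: analyticity on
  a set supplies an expansion at each of its points, so power series are never recentred.\<close>

lemma has_ps_differentiable:
 fixes f :: "real^'n::finite => complex"
 assumes ps: "has_ps f a r c"
 shows "f differentiable (at a)"
proof -
 define \<rho> where "\<rho> = r / (2 * CARD('n))"
 define M where "M = (%\<alpha>. norm (c \<alpha>) * \<rho> ^ (\<Sum>i\<in>UNIV. \<alpha> i))"
 define K where "K = (\<Sum>\<^sub>\<infinity>\<alpha>. M \<alpha>)"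
 have r: "r > 0" using ps by (simp add: has_ps_def)
 have rho: "\<rho> > 0" using r by (simp add: \<rho>_def)
 have M: "M summable_on UNIV" using has_ps_abs_summable[OF ps] by (simp add: M_def \<rho>_def)
 have M0: "M \<alpha> \<ge> 0" for \<alpha> using rho by (simp add: M_def)
 have card1: "real CARD('n) \<ge> 1" by (simp add: Suc_leI)
 have rho_le: "\<rho> \<le> r / 2" using r card1 unfolding \<rho>_def by (intro divide_left_mono) auto
 \<comment> \<open>\<open>e i\<close> is the exponent of the monomial in the single coordinate i,
   and \<open>L\<close> below is the linear part of the series.\<close>
 define e :: "'n => 'n => nat" where "e = (%i k. if k = i then 1 else 0)"
 define L where "L = (%y::real^'n. \<Sum>i\<in>UNIV. c (e i) * of_real (y $ i))"
 have inje: "inj e" by (auto simp: inj_def e_def fun_eq_iff split: if_splits)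
 have bl: "bounded_linear L"
 proof -
  have "linear L" unfolding L_def
   by (intro linearI) (auto simp: algebra_simps sum.distrib sum_distrib_left scaleR_conv_of_real[where 'a = complex])
  then show ?thesis by (simp add: linear_conv_bounded_linear)
 qed
 have est: "norm (f x - f a - L (x - a)) \<le> K / \<rho>\<^sup>2 * (norm (x - a))\<^sup>2" if x: "norm (x - a) < \<rho>" for x
 proof -
  let ?t = "%\<alpha>. c \<alpha> * of_real (\<Prod>i\<in>UNIV. (x $ i - a $ i) ^ \<alpha> i)"
  let ?E = "insert (%_. 0) (range e)"
  have "x \<in> ball a r" using x rho_le rho by (simp add: dist_norm norm_minus_commute)
  then have hs: "(?t has_sum f x) UNIV" using ps by (simp add: has_ps_def)
  have finE: "finite ?E" by simp
  have mone: "(\<Prod>k\<in>UNIV. (x $ k - a $ k) ^ e i k) = x $ i - a $ i" for i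
   by (simp add: e_def if_distrib[of "%n. _ ^ n"] cong: if_cong)
  have "(%_. 0) \<notin> range e" by (auto simp: e_def dest: fun_cong split: if_splits)
  then have "(\<Sum>\<alpha>\<in>?E. ?t \<alpha>) = f a + L (x - a)"
   using has_ps_center[OF ps] inje
   by (simp add: sum.reindex L_def mone del: of_real_prod of_real_diff of_real_power)
  then have "(?t has_sum (f a + L (x - a))) ?E" using has_sum_finite[OF finE, of ?t] by simp
  then have hs2: "(?t has_sum (f x - (f a + L (x - a)))) (UNIV - ?E)"
   using has_sum_Diff[OF hs] by simp
  have bd: "norm (?t \<alpha>) \<le> (norm (x - a) / \<rho>)\<^sup>2 * M \<alpha>" if "\<alpha> \<in> UNIV - ?E" for \<alpha>
  proof -
   let ?s = "\<Sum>i\<in>UNIV. \<alpha> i"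
   have s2: "?s \<ge> 2"
   proof (rule ccontr)
    assume "\<not> ?s \<ge> 2"
    then consider "?s = 0" | "?s = 1" by linarith
    then show False
    proof cases
     case 1 then have "\<alpha> = (%_. 0)" by (auto simp: fun_eq_iff)
     then show False using that by auto
    next
     case 2
     then obtain i where i: "\<alpha> i = 1" "\<forall>j\<in>UNIV. j \<noteq> i --> \<alpha> j = 0" by (subst (asm) sum_eq_1_iff) auto
     then have "\<alpha> = e i" by (auto simp: e_def fun_eq_iff)
     then show False using that by auto
    qed
   qed
   have "norm (\<Prod>i\<in>UNIV. (x $ i - a $ i) ^ \<alpha> i) \<le> (\<Prod>i\<in>UNIV. norm (x - a) ^ \<alpha> i)"
    unfolding prod_norm[symmetric] norm_power
    using component_le_norm_cart[of "x - a"] by (intro prod_mono) (auto intro!: power_mono)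
   also have "\<dots> = norm (x - a) ^ ?s" by (simp add: power_sum)
   also have "\<dots> = (norm (x - a) / \<rho>) ^ ?s * \<rho> ^ ?s" using rho by (simp add: power_divide)
   also have "\<dots> \<le> (norm (x - a) / \<rho>)\<^sup>2 * \<rho> ^ ?s"
    using s2 x rho by (intro mult_right_mono power_decreasing) auto
   finally have "norm (c \<alpha>) * norm (\<Prod>i\<in>UNIV. (x $ i - a $ i) ^ \<alpha> i) \<le> norm (c \<alpha>) * ((norm (x - a) / \<rho>)\<^sup>2 * \<rho> ^ ?s)"
    by (rule mult_left_mono) simp
   then show ?thesis
    unfolding M_def norm_mult norm_of_real real_norm_def by (simp only: mult.left_commute)
  qed
  have sM: "(%\<alpha>. (norm (x - a) / \<rho>)\<^sup>2 * M \<alpha>) summable_on (UNIV - ?E)"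
   using M by (intro summable_on_cmult_right) (auto intro: summable_on_subset_banach)
  have "norm (f x - (f a + L (x - a))) = norm (\<Sum>\<^sub>\<infinity>\<alpha>\<in>UNIV - ?E. ?t \<alpha>)" using hs2 by (simp add: infsumI)
  also have "\<dots> \<le> (\<Sum>\<^sub>\<infinity>\<alpha>\<in>UNIV - ?E. (norm (x - a) / \<rho>)\<^sup>2 * M \<alpha>)"
   by (rule norm_infsum_le[OF has_sum_infsum has_sum_infsum]) (use hs2 sM bd in \<open>auto intro: has_sum_imp_summable\<close>)
  also have "\<dots> \<le> (\<Sum>\<^sub>\<infinity>\<alpha>\<in>UNIV. (norm (x - a) / \<rho>)\<^sup>2 * M \<alpha>)"
   using sM M M0 by (intro infsum_mono_neutral) (auto intro!: summable_on_cmult_right)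
  also have "\<dots> = (norm (x - a) / \<rho>)\<^sup>2 * K" unfolding K_def by (rule infsum_cmult_right) (use M in auto)
  finally show ?thesis by (simp add: power_divide algebra_simps)
 qed
 have "(f has_derivative L) (at a)"
  unfolding has_derivative_def
 proof (intro conjI bl)
  have "((%x. K / \<rho>\<^sup>2 * norm (x - a)) \<longlongrightarrow> 0) (at a)" using rho by (auto intro!: tendsto_eq_intros)
  moreover have "eventually (%x. norm ((f x - f (Lim (at a) (%x. x)) - L (x - (Lim (at a) (%x. x)))) /\<^sub>R norm (x - (Lim (at a) (%x. x)))) \<le> K / \<rho>\<^sup>2 * norm (x - a)) (at a)"
  proof (unfold eventually_at, intro exI[of _ \<rho>] conjI ballI impI rho)
   fix x assume "x \<noteq> a \<and> dist x a < \<rho>"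
   then have x: "norm (x - a) < \<rho>" "norm (x - a) > 0" by (auto simp: dist_norm)
   show "norm ((f x - f (Lim (at a) (%x. x)) - L (x - (Lim (at a) (%x. x)))) /\<^sub>R norm (x - (Lim (at a) (%x. x)))) \<le> K / \<rho>\<^sup>2 * norm (x - a)"
   proof -
    have "Lim (at a) (%x. x) = a" by simp
    moreover have "norm ((f x - f a - L (x - a)) /\<^sub>R norm (x - a)) = norm (f x - f a - L (x - a)) / norm (x - a)"
     by (simp add: divide_inverse mult.commute)
    moreover have "\<dots> \<le> K / \<rho>\<^sup>2 * norm (x - a)"
     using est[OF x(1)] x(2) by (simp add: divide_le_eq power2_eq_square mult.assoc)
    ultimately show ?thesis by metis
   qed
  qed
  ultimately show "((%x. (f x - f (Lim (at a) (%x. x)) - L (x - (Lim (at a) (%x. x)))) /\<^sub>R norm (x - (Lim (at a) (%x. x)))) \<longlongrightarrow> 0) (at a)"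
   by (rule Lim_null_comparison[rotated])
 qed
 then show ?thesis by (auto simp: differentiable_def)
qed

text \<open>Along a line the series becomes a power series in the parameter, which may then be
  complex. This turns real analytic identities into identities between holomorphic functions of one
  variable.\<close>

lemma real_analytic_at_line:
 fixes f :: "real^'n::finite => complex"
 assumes "real_analytic_at f a"
 shows "\<exists>\<epsilon>>0. \<exists>G. G holomorphic_on ball 0 \<epsilon> \<and> (\<forall>t. \<bar>t\<bar> < \<epsilon> --> f (a + t *\<^sub>R y) = G (of_real t))"
proof -
 obtain r c where ps: "has_ps f a r c" using assms by (auto simp: real_analytic_at_iff_has_ps)
 define \<rho> where "\<rho> = r / (2 * CARD('n))"
 define M where "M = (%\<alpha>. norm (c \<alpha>) * \<rho> ^ (\<Sum>i\<in>UNIV. \<alpha> i))"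
 have r: "r > 0" using ps by (simp add: has_ps_def)
 have rho: "\<rho> > 0" using r by (simp add: \<rho>_def)
 have M: "M summable_on UNIV" using has_ps_abs_summable[OF ps] by (simp add: M_def \<rho>_def)
 have card1: "real CARD('n) \<ge> 1" by (simp add: Suc_leI)
 have rho_le: "\<rho> \<le> r / 2" using r card1 unfolding \<rho>_def by (intro divide_left_mono) auto
 \<comment> \<open>The summand 1 in the denominator covers y = 0.\<close>
 define \<epsilon> where "\<epsilon> = \<rho> / (norm y + 1)"
 have eps: "\<epsilon> > 0" using rho by (simp add: \<epsilon>_def add_nonneg_pos)
 have ey: "\<epsilon> * norm y \<le> \<rho>"
 proof -
  have "\<epsilon> * norm y \<le> \<epsilon> * (norm y + 1)" using eps by (intro mult_left_mono) auto
  also have "\<dots> = \<rho>" using norm_ge_zero[of y] by (simp add: \<epsilon>_def add_nonneg_eq_0_iff)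
  finally show ?thesis .
 qed
 define F where "F = (%\<alpha> z. c \<alpha> * of_real (\<Prod>i\<in>UNIV. (y $ i) ^ \<alpha> i) * z ^ (\<Sum>i\<in>UNIV. \<alpha> i))"
 have bd: "norm (F \<alpha> z) \<le> M \<alpha>" if "z \<in> ball 0 \<epsilon>" for \<alpha> z
 proof -
  let ?s = "\<Sum>i\<in>UNIV. \<alpha> i"
  have "norm (\<Prod>i\<in>UNIV. (y $ i) ^ \<alpha> i) \<le> (\<Prod>i\<in>UNIV. norm y ^ \<alpha> i)"
   unfolding prod_norm[symmetric] norm_power
   using component_le_norm_cart[of y] by (intro prod_mono) (auto intro!: power_mono)
  also have "\<dots> = norm y ^ ?s" by (simp add: power_sum)
  finally have "norm (\<Prod>i\<in>UNIV. (y $ i) ^ \<alpha> i) * norm z ^ ?s \<le> norm y ^ ?s * \<epsilon> ^ ?s"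
   using that by (intro mult_mono power_mono) auto
  also have "\<dots> = (\<epsilon> * norm y) ^ ?s" by (simp add: power_mult_distrib mult.commute)
  also have "\<dots> \<le> \<rho> ^ ?s" using ey eps by (intro power_mono) auto
  finally show ?thesis unfolding F_def M_def norm_mult norm_power norm_of_real real_norm_def mult.assoc
   by (intro mult_left_mono) auto
 qed
 have "(%z. \<Sum>\<^sub>\<infinity>\<alpha>. F \<alpha> z) holomorphic_on ball 0 \<epsilon>"
  by (rule holomorphic_infsum[where M = M]) (use bd M in \<open>auto simp: F_def intro!: holomorphic_intros\<close>)
 moreover have "f (a + t *\<^sub>R y) = (\<Sum>\<^sub>\<infinity>\<alpha>. F \<alpha> (of_real t))" if "\<bar>t\<bar> < \<epsilon>" for t
 proof -
  have "norm (t *\<^sub>R y) \<le> \<epsilon> * norm y" using that by (simp add: mult_right_mono)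
  then have "a + t *\<^sub>R y \<in> ball a r" using ey rho rho_le by (simp add: dist_norm)
  then have "((%\<alpha>. c \<alpha> * of_real (\<Prod>i\<in>UNIV. (t * y $ i) ^ \<alpha> i)) has_sum f (a + t *\<^sub>R y)) UNIV"
   using ps unfolding has_ps_def by fastforce
  then show ?thesis by (simp add: F_def infsumI power_mult_distrib prod.distrib power_sum mult_ac)
 qed
 ultimately show ?thesis using eps by blast
qed

lemma real_analytic_on_partial: "real_analytic_on S f ==> real_analytic_on S (partial i f)"
 unfolding real_analytic_on_def real_analytic_at_iff_has_ps using has_ps_partial by blast

lemma real_analytic_on_imp_smooth_on:
 assumes "real_analytic_on S f"
 shows "smooth_on S f"
proof -
 have "real_analytic_on S (foldr partial is f)" for "is"
  by (induction "is") (auto intro: assms real_analytic_on_partial)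
 then show ?thesis
  unfolding smooth_on_def real_analytic_on_def real_analytic_at_iff_has_ps using has_ps_differentiable by blast
qed

subsection \<open>Smooth functions and partial derivatives\<close>

lemma partial_eq_derivative:
 assumes "(f has_derivative D) (at x)"
 shows "((%t. f (x + t *\<^sub>R axis i 1)) has_vector_derivative D (axis i 1)) (at 0)"
  and "partial i f x = D (axis i 1)"
proof -
 have "(f has_derivative D) (at (x + 0 *\<^sub>R axis i 1))" using assms by simp
 moreover have "((%t. x + t *\<^sub>R axis i 1) has_derivative (%t. t *\<^sub>R axis i 1)) (at (0::real))"
  by (auto intro!: derivative_eq_intros)
 ultimately have "((%t. f (x + t *\<^sub>R axis i 1)) has_derivative (%t. D (t *\<^sub>R axis i 1))) (at 0)"
  by (rule has_derivative_compose[rotated])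
 moreover have "D (t *\<^sub>R axis i 1) = t *\<^sub>R D (axis i 1)" for t
  using assms by (simp add: has_derivative_linear linear_scale)
 ultimately show "((%t. f (x + t *\<^sub>R axis i 1)) has_vector_derivative D (axis i 1)) (at 0)"
  by (simp add: has_vector_derivative_def)
 then show "partial i f x = D (axis i 1)" unfolding partial_def by (rule vector_derivative_at)
qed

lemma partial_cong:
 assumes "open U" "x \<in> U" "\<And>y. y \<in> U ==> f y = g y"
 shows "partial i f x = partial i g x"
 unfolding partial_def
proof (rule vector_derivative_cong_eq)
 have "((%t. x + t *\<^sub>R axis i 1) \<longlongrightarrow> x) (nhds (0::real))"
  by (rule tendsto_eq_intros filterlim_ident refl | simp)+
 then have "eventually (%t. x + t *\<^sub>R axis i 1 \<in> U) (nhds (0::real))"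
  using assms(1,2) by (rule topological_tendstoD)
 then show "\<forall>\<^sub>F t in nhds 0. t \<in> UNIV --> f (x + t *\<^sub>R axis i 1) = g (x + t *\<^sub>R axis i 1)"
  by eventually_elim (use assms(3) in auto)
qed auto

lemma differentiable_at_cong:
 assumes "open U" "x \<in> U" "\<And>y. y \<in> U ==> f y = g y" "f differentiable (at x)"
 shows "g differentiable (at x)"
proof -
 obtain D where "(f has_derivative D) (at x)" using assms(4) by (auto simp: differentiable_def)
 then have "(g has_derivative D) (at x)"
  by (rule has_derivative_transform_within_open[OF _ assms(1-3)])
 then show ?thesis by (auto simp: differentiable_def)
qed

lemma partial_const [simp]: "partial i (%x. c) = (%x. 0)"
 by (rule ext) (simp add: partial_def)

lemma partial_add:
 assumes "f differentiable (at x)" "g differentiable (at x)"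
 shows "partial i (%x. f x + g x) x = partial i f x + partial i g x"
proof -
 obtain D D' where D: "(f has_derivative D) (at x)" "(g has_derivative D') (at x)"
  using assms by (auto simp: differentiable_def)
 show ?thesis
  using partial_eq_derivative(2)[OF has_derivative_add[OF D], of i]
  by (simp add: partial_eq_derivative(2)[OF D(1)] partial_eq_derivative(2)[OF D(2)])
qed

lemma partial_mult:
 assumes "f differentiable (at x)" "g differentiable (at x)"
 shows "partial i (%x. f x * g x) x = partial i f x * g x + f x * partial i g x"
proof -
 obtain D D' where D: "(f has_derivative D) (at x)" "(g has_derivative D') (at x)"
  using assms by (auto simp: differentiable_def)
 show ?thesis
  using partial_eq_derivative(2)[OF has_derivative_mult[OF D], of i]
  by (simp add: partial_eq_derivative(2)[OF D(1)] partial_eq_derivative(2)[OF D(2)])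
qed

text \<open>\<open>smooth_on\<close> quantifies over lists of derivatives, a form in which the
  product rule cannot be iterated directly. This recursion peels off the innermost derivative, so
  that closure under products becomes an induction on the order.\<close>

fun Ck :: "nat => (real^'n::finite) set => (real^'n => complex) => bool" where
 "Ck 0 U f \<longleftrightarrow> (\<forall>x\<in>U. f differentiable (at x))"
| "Ck (Suc n) U f \<longleftrightarrow> (\<forall>x\<in>U. f differentiable (at x)) \<and> (\<forall>i. Ck n U (partial i f))"

lemma Ck_Suc_D: "Ck (Suc n) U f ==> Ck n U f"
 by (induction n arbitrary: f) auto

lemma Ck_iff_foldr: "Ck n U f \<longleftrightarrow> (\<forall>is. length is \<le> n --> (\<forall>x\<in>U. foldr partial is f differentiable (at x)))"
proof (induction n arbitrary: f)
 case (Suc n)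
 show ?case
 proof (intro iffI allI impI)
  fix js :: "'a list" assume "Ck (Suc n) U f" "length js \<le> Suc n"
  then show "\<forall>x\<in>U. foldr partial js f differentiable (at x)"
   by (cases js rule: rev_cases) (auto simp: Suc)
 next
  assume *: "\<forall>is. length is \<le> Suc n --> (\<forall>x\<in>U. foldr partial is f differentiable (at x))"
  have "Ck n U (partial i f)" for i
   unfolding Suc using *[rule_format, of "_ @ [i]"] by auto
  then show "Ck (Suc n) U f" using *[rule_format, of "[]"] by auto
 qed
qed simp

lemma smooth_on_iff_Ck: "smooth_on U f \<longleftrightarrow> (\<forall>n. Ck n U f)"
 unfolding smooth_on_def Ck_iff_foldr by blast

lemma smooth_on_differentiable: "smooth_on U f ==> x \<in> U ==> f differentiable (at x)"
 unfolding smooth_on_def by (metis foldr.simps(1) id_apply)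

lemma smooth_on_partial: "smooth_on U f ==> smooth_on U (partial i f)"
 unfolding smooth_on_iff_Ck by (metis Ck.simps(2))

lemma smooth_on_subset: "smooth_on U f ==> V \<subseteq> U ==> smooth_on V f"
 unfolding smooth_on_def by blast

lemma Ck_cong:
 assumes "open U"
 shows "(\<And>y. y \<in> U ==> f y = g y) ==> Ck n U f ==> Ck n U g"
proof (induction n arbitrary: f g)
 case 0
 have "g differentiable (at x)" if "x \<in> U" for x
  by (rule differentiable_at_cong[OF assms, of _ f]) (use 0 that in auto)
 then show ?case by simp
next
 case (Suc n)
 have "Ck n U (partial i g)" for i
 proof (rule Suc.IH[of "partial i f"])
  show "partial i f y = partial i g y" if "y \<in> U" for y
   using assms that Suc.prems(1) by (rule partial_cong)
 qed (use Suc.prems in auto)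
 moreover have "g differentiable (at x)" if "x \<in> U" for x
  by (rule differentiable_at_cong[OF assms, of _ f]) (use Suc.prems that in auto)
 ultimately show ?case by simp
qed

lemma smooth_on_cong: "open U ==> (\<And>y. y \<in> U ==> f y = g y) ==> smooth_on U f ==> smooth_on U g"
 unfolding smooth_on_iff_Ck by (metis Ck_cong)

lemma Ck_add:
 assumes "open U"
 shows "Ck n U f ==> Ck n U g ==> Ck n U (%x. f x + g x)"
proof (induction n arbitrary: f g)
 case (Suc n)
 have "Ck n U (partial i (%x. f x + g x))" for i
  by (rule Ck_cong[OF assms, of "%x. partial i f x + partial i g x"])
   (use Suc in \<open>auto simp: partial_add\<close>)
 then show ?case using Suc.prems by auto
qed auto

lemma Ck_mult:
 assumes "open U"
 shows "Ck n U f ==> Ck n U g ==> Ck n U (%x. f x * g x)"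
proof (induction n arbitrary: f g)
 case (Suc n)
 have "Ck n U (partial i (%x. f x * g x))" for i
 proof (rule Ck_cong[OF assms, of "%x. partial i f x * g x + f x * partial i g x"])
  show "Ck n U (%x. partial i f x * g x + f x * partial i g x)"
   using Suc.prems Ck_Suc_D by (intro Ck_add Suc.IH assms) auto
 qed (use Suc.prems in \<open>auto simp: partial_mult\<close>)
 then show ?case using Suc.prems by auto
qed auto

lemma Ck_const: "Ck n U (%x. c)"
 by (induction n arbitrary: c) auto

lemma smooth_on_const: "smooth_on U (%x. c)"
 unfolding smooth_on_iff_Ck by (simp add: Ck_const)

lemma smooth_on_add: "open U ==> smooth_on U f ==> smooth_on U g ==> smooth_on U (%x. f x + g x)"
 unfolding smooth_on_iff_Ck by (simp add: Ck_add)

lemma smooth_on_mult: "open U ==> smooth_on U f ==> smooth_on U g ==> smooth_on U (%x. f x * g x)"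
 unfolding smooth_on_iff_Ck by (simp add: Ck_mult)

lemma smooth_on_cmult: "open U ==> smooth_on U f ==> smooth_on U (%x. c * f x)"
 by (intro smooth_on_mult smooth_on_const)

lemma smooth_on_diff:
 assumes "open U" "smooth_on U f" "smooth_on U g"
 shows "smooth_on U (%x. f x - g x)"
 using smooth_on_add[OF assms(1,2) smooth_on_cmult[OF assms(1,3), of "-1"]] by simp

lemma smooth_on_sum:
 assumes "open U"
 shows "(\<And>i. i \<in> A ==> smooth_on U (f i)) ==> smooth_on U (%x. \<Sum>i\<in>A. f i x)"
 by (induction A rule: infinite_finite_induct) (simp_all add: smooth_on_const smooth_on_add assms)

lemma partial_cmult:
 "f differentiable (at x) ==> partial i (%x. c * f x) x = c * partial i f x"
 by (simp add: partial_mult)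

lemma partial_diff:
 assumes "f differentiable (at x)" "g differentiable (at x)"
 shows "partial i (%x. f x - g x) x = partial i f x - partial i g x"
proof -
 have "partial i (%x. f x + (-1) * g x) x = partial i f x + partial i (%x. (-1) * g x) x"
  using assms by (intro partial_add) auto
 then show ?thesis using assms partial_cmult[of g x i "-1"] by simp
qed

lemma partial_sum:
 "(\<And>j. j \<in> A ==> f j differentiable (at x)) ==>
  partial i (%x. \<Sum>j\<in>A. f j x) x = (\<Sum>j\<in>A. partial i (f j) x)"
 by (induction A rule: infinite_finite_induct) (auto simp: partial_add differentiable_sum)

lemma directional_derivative:
 assumes "f differentiable (at x)"
 shows "(f has_derivative (%y. \<Sum>i\<in>UNIV. y $ i *\<^sub>R partial i f x)) (at x)"
proof -
 obtain D where D: "(f has_derivative D) (at x)" using assms by (auto simp: differentiable_def)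
 have "D y = (\<Sum>i\<in>UNIV. y $ i *\<^sub>R partial i f x)" for y
 proof -
  have "D y = D (\<Sum>i\<in>UNIV. y $ i *\<^sub>R axis i 1)"
   using basis_expansion[of y] by (simp add: scalar_mult_eq_scaleR)
  then show ?thesis
   using has_derivative_linear[OF D] by (simp add: linear_sum linear_scale partial_eq_derivative(2)[OF D])
 qed
 then have "D = (%y. \<Sum>i\<in>UNIV. y $ i *\<^sub>R partial i f x)" by blast
 then show ?thesis using D by simp
qed

text \<open>Young's form of the symmetry of second derivatives. The mean value inequality is applied
  in direction i, and total differentiability of \<open>partial i f\<close> at the single point x
  controls the derivative that appears there.\<close>

lemma mixed_difference:
 fixes f :: "real^'n::finite => complex"
 assumes U: "open U" "x \<in> U" and f: "\<And>y. y \<in> U ==> f differentiable (at y)"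
  and pf: "partial i f differentiable (at x)"
 shows "((%h::real. (f (x + h *\<^sub>R axis i 1 + h *\<^sub>R axis j 1) - f (x + h *\<^sub>R axis i 1) - f (x + h *\<^sub>R axis j 1) + f x) / of_real (h\<^sup>2))
  \<longlongrightarrow> partial j (partial i f) x) (at_right 0)"
proof (rule tendstoI)
 fix e :: real assume e: "e > 0"
 define M where "M = partial j (partial i f) x"
 define g where "g = partial i f"
 obtain D where D: "(g has_derivative D) (at x)" using pf by (auto simp: differentiable_def g_def)
 have lin: "linear D" using D by (rule has_derivative_linear)
 have Dj: "D (axis j 1) = M" unfolding M_def g_def[symmetric] using partial_eq_derivative(2)[OF D] by simp
 \<comment> \<open>Two errors of size (e/8) * (2 * h) will add up to e/2 * h, which leaves room for
   the strict inequality at the end.\<close>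
 obtain d where d: "d > 0" "\<And>y. norm (y - x) < d ==> norm (g y - g x - D (y - x)) \<le> (e/8) * norm (y - x)"
 proof -
  have "e / 8 > 0" using e by simp
  then have "\<exists>d>0. \<forall>y. norm (y - x) < d --> norm (g y - g x - D (y - x)) \<le> (e/8) * norm (y - x)"
   using D unfolding has_derivative_at_alt by blast
  then show ?thesis using that by auto
 qed
 obtain r where r: "r > 0" "ball x r \<subseteq> U" using U by (meson openE)
 define \<delta> where "\<delta> = min (d/2) (r/2)"
 have \<delta>: "\<delta> > 0" using d r by (simp add: \<delta>_def)
 let ?u = "axis i 1 :: real^'n" and ?v = "axis j 1 :: real^'n"
 have "dist ((f (x + h *\<^sub>R ?u + h *\<^sub>R ?v) - f (x + h *\<^sub>R ?u) - f (x + h *\<^sub>R ?v) + f x) / of_real (h\<^sup>2)) M < e"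
  if h: "0 < h" "h < \<delta>" for h
 proof -
  \<comment> \<open>The difference in direction j minus its expected linear growth in s. Its
    derivative is small, and \<phi> h - \<phi> 0 is the second difference minus h^2 times the
    claimed limit.\<close>
  define \<phi> where "\<phi> = (%s. f (x + s *\<^sub>R ?u + h *\<^sub>R ?v) - f (x + s *\<^sub>R ?u) - s *\<^sub>R (of_real h * M))"
  have small: "norm (s *\<^sub>R ?u + t *\<^sub>R ?v) \<le> 2 * h" if "\<bar>s\<bar> \<le> h" "\<bar>t\<bar> \<le> h" for s t
   using norm_triangle_ineq[of "s *\<^sub>R ?u" "t *\<^sub>R ?v"] that by simp
  have inU: "x + s *\<^sub>R ?u + t *\<^sub>R ?v \<in> U" if "\<bar>s\<bar> \<le> h" "\<bar>t\<bar> \<le> h" for s t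
  proof -
   have "dist x (x + s *\<^sub>R ?u + t *\<^sub>R ?v) = norm (s *\<^sub>R ?u + t *\<^sub>R ?v)"
    by (metis add.assoc add_diff_cancel_left' dist_norm norm_minus_commute)
   then show ?thesis using small[OF that] h r by (auto simp: \<delta>_def)
  qed
  have gest: "norm (g (x + s *\<^sub>R ?u + t *\<^sub>R ?v) - g x - D (s *\<^sub>R ?u + t *\<^sub>R ?v)) \<le> (e/8) * (2 * h)" if "\<bar>s\<bar> \<le> h" "\<bar>t\<bar> \<le> h" for s t
  proof -
   have "norm (x + s *\<^sub>R ?u + t *\<^sub>R ?v - x) < d" using small[OF that] h by (simp add: \<delta>_def add.assoc)
   from d(2)[OF this] have "norm (g (x + s *\<^sub>R ?u + t *\<^sub>R ?v) - g x - D (s *\<^sub>R ?u + t *\<^sub>R ?v)) \<le> (e/8) * norm (s *\<^sub>R ?u + t *\<^sub>R ?v)"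
    by (simp add: add.assoc)
   also have "\<dots> \<le> (e/8) * (2 * h)" using small[OF that] e by (intro mult_left_mono) auto
   finally show ?thesis .
  qed
  have der: "((%s. f (x + s *\<^sub>R ?u + t *\<^sub>R ?v)) has_vector_derivative g (x + s *\<^sub>R ?u + t *\<^sub>R ?v)) (at s)"
   if st: "\<bar>s\<bar> \<le> h" "\<bar>t\<bar> \<le> h" for s t
  proof -
   obtain D' where D': "(f has_derivative D') (at (x + s *\<^sub>R ?u + t *\<^sub>R ?v))"
    using f[OF inU[OF st]] by (auto simp: differentiable_def)
   have "((%s. x + s *\<^sub>R ?u + t *\<^sub>R ?v) has_derivative (%\<tau>. \<tau> *\<^sub>R ?u)) (at s)"
    by (auto intro!: derivative_eq_intros)
   then have "((%s. f (x + s *\<^sub>R ?u + t *\<^sub>R ?v)) has_derivative (%\<tau>. D' (\<tau> *\<^sub>R ?u))) (at s)"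
    by (rule has_derivative_compose) (rule D')
   moreover have "D' (\<tau> *\<^sub>R ?u) = \<tau> *\<^sub>R g (x + s *\<^sub>R ?u + t *\<^sub>R ?v)" for \<tau>
    using has_derivative_linear[OF D'] partial_eq_derivative(2)[OF D', of i] by (simp add: linear_scale g_def)
   ultimately show ?thesis by (simp add: has_vector_derivative_def)
  qed
  have Dh: "D (h *\<^sub>R ?v) = of_real h * M" by (simp only: linear_scale[OF lin] Dj) (rule scaleR_conv_of_real)
  have d\<phi>: "(\<phi> has_vector_derivative (g (x + s *\<^sub>R ?u + h *\<^sub>R ?v) - g (x + s *\<^sub>R ?u) - of_real h * M)) (at s within {0..h})"
   if "s \<in> {0..h}" for s
  proof -
   have "((%s. s *\<^sub>R (of_real h * M)) has_vector_derivative of_real h * M) (at s within {0..h})"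
    unfolding has_vector_derivative_def
    by (rule bounded_linear_imp_has_derivative[OF bounded_linear_scaleR_left])
   moreover have b1: "\<bar>s\<bar> \<le> h" "\<bar>h\<bar> \<le> h" "\<bar>0\<bar> \<le> h" using that h by auto
   have "((%s. f (x + s *\<^sub>R ?u + h *\<^sub>R ?v)) has_vector_derivative g (x + s *\<^sub>R ?u + h *\<^sub>R ?v)) (at s within {0..h})"
    by (rule has_vector_derivative_at_within[OF der[OF b1(1,2)]])
   moreover have "((%s. f (x + s *\<^sub>R ?u + 0 *\<^sub>R ?v)) has_vector_derivative g (x + s *\<^sub>R ?u + 0 *\<^sub>R ?v)) (at s within {0..h})"
    by (rule has_vector_derivative_at_within[OF der[OF b1(1,3)]])
   then have "((%s. f (x + s *\<^sub>R ?u)) has_vector_derivative g (x + s *\<^sub>R ?u)) (at s within {0..h})"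
    by (simp only: scaleR_zero_left add_0_right)
   ultimately show ?thesis unfolding \<phi>_def by (intro has_vector_derivative_diff)
  qed
  have bd: "norm (g (x + s *\<^sub>R ?u + h *\<^sub>R ?v) - g (x + s *\<^sub>R ?u) - of_real h * M) \<le> e/2 * h" if "s \<in> {0..h}" for s
  proof -
   have eq: "g (x + s *\<^sub>R ?u + h *\<^sub>R ?v) - g (x + s *\<^sub>R ?u) - of_real h * M =
     (g (x + s *\<^sub>R ?u + h *\<^sub>R ?v) - g x - D (s *\<^sub>R ?u + h *\<^sub>R ?v)) - (g (x + s *\<^sub>R ?u + 0 *\<^sub>R ?v) - g x - D (s *\<^sub>R ?u + 0 *\<^sub>R ?v))"
    using linear_0[OF lin] by (simp only: linear_add[OF lin] Dh scaleR_zero_left add_0_right) simp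
   show ?thesis unfolding eq
   proof (rule order.trans[OF norm_triangle_ineq4])
    have b1: "\<bar>s\<bar> \<le> h" "\<bar>h\<bar> \<le> h" "\<bar>0\<bar> \<le> h" using that h by auto
    show "norm (g (x + s *\<^sub>R ?u + h *\<^sub>R ?v) - g x - D (s *\<^sub>R ?u + h *\<^sub>R ?v)) + norm (g (x + s *\<^sub>R ?u + 0 *\<^sub>R ?v) - g x - D (s *\<^sub>R ?u + 0 *\<^sub>R ?v)) \<le> e / 2 * h"
     using add_mono[OF gest[OF b1(1,2)] gest[OF b1(1,3)]] by argo
   qed
  qed
  have "norm (\<phi> h - \<phi> 0) \<le> e/2 * h * norm (h - 0)"
  proof (rule differentiable_bound[of "{0..h}"])
   show "(\<phi> has_derivative (%\<tau>. \<tau> *\<^sub>R (g (x + s *\<^sub>R ?u + h *\<^sub>R ?v) - g (x + s *\<^sub>R ?u) - of_real h * M))) (at s within {0..h})" if "s \<in> {0..h}" for s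
    using d\<phi>[OF that] by (simp add: has_vector_derivative_def)
   show "onorm (%\<tau>. \<tau> *\<^sub>R (g (x + s *\<^sub>R ?u + h *\<^sub>R ?v) - g (x + s *\<^sub>R ?u) - of_real h * M)) \<le> e / 2 * h" if "s \<in> {0..h}" for s
   proof (rule onorm_le)
    show "norm (\<tau> *\<^sub>R (g (x + s *\<^sub>R ?u + h *\<^sub>R ?v) - g (x + s *\<^sub>R ?u) - of_real h * M)) \<le> e / 2 * h * norm \<tau>" for \<tau> :: real
     unfolding norm_scaleR using mult_left_mono[OF bd[OF that], of "\<bar>\<tau>\<bar>"] by (simp add: mult.commute)
   qed
  qed (use h in auto)
  then have "norm (\<phi> h - \<phi> 0) \<le> e/2 * h\<^sup>2" using h by (simp add: power2_eq_square)
  moreover define A where "A = f (x + h *\<^sub>R ?u + h *\<^sub>R ?v) - f (x + h *\<^sub>R ?u) - f (x + h *\<^sub>R ?v) + f x"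
  have "\<phi> h - \<phi> 0 = A - of_real (h\<^sup>2) * M"
   by (simp add: \<phi>_def A_def scaleR_conv_of_real power2_eq_square)
  moreover have "A / of_real (h\<^sup>2) - M = (A - of_real (h\<^sup>2) * M) / of_real (h\<^sup>2)"
   using h by (simp add: diff_divide_distrib)
  ultimately have "norm (A / of_real (h\<^sup>2) - M) \<le> (e/2 * h\<^sup>2) / h\<^sup>2"
   using h by (simp add: norm_divide norm_power pos_divide_le_eq)
  then have "norm (A / of_real (h\<^sup>2) - M) \<le> e/2"
   using h by simp
  then have "dist (A / of_real (h\<^sup>2)) M < e" using e by (simp add: dist_norm)
  then show ?thesis unfolding A_def .
 qed
 then have "\<forall>\<^sub>F h in at_right 0. dist ((f (x + h *\<^sub>R ?u + h *\<^sub>R ?v) - f (x + h *\<^sub>R ?u) - f (x + h *\<^sub>R ?v) + f x) / of_real (h\<^sup>2)) M < e"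
  unfolding eventually_at_right_field using \<delta> by blast
 then show "\<forall>\<^sub>F h in at_right 0. dist ((f (x + h *\<^sub>R ?u + h *\<^sub>R ?v) - f (x + h *\<^sub>R ?u) - f (x + h *\<^sub>R ?v) + f x) / of_real (h\<^sup>2)) (partial j (partial i f) x) < e"
  unfolding M_def .
qed

text \<open>The second difference quotient is symmetric in i and j, hence converges to both mixed
  derivatives.\<close>

lemma partial_commute:
 assumes "open U" "smooth_on U f" "x \<in> U"
 shows "partial i (partial j f) x = partial j (partial i f) x"
proof -
 have 1: "((%h::real. (f (x + h *\<^sub>R axis i 1 + h *\<^sub>R axis j 1) - f (x + h *\<^sub>R axis i 1) - f (x + h *\<^sub>R axis j 1) + f x) / of_real (h\<^sup>2))
  \<longlongrightarrow> partial j (partial i f) x) (at_right 0)" for i j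
  using assms by (intro mixed_difference[of U]) (auto intro: smooth_on_differentiable smooth_on_partial)
 have "((%h::real. (f (x + h *\<^sub>R axis i 1 + h *\<^sub>R axis j 1) - f (x + h *\<^sub>R axis i 1) - f (x + h *\<^sub>R axis j 1) + f x) / of_real (h\<^sup>2))
  \<longlongrightarrow> partial i (partial j f) x) (at_right 0)"
  using 1[of j i] by (simp add: algebra_simps)
 then show ?thesis using 1[of i j] tendsto_unique trivial_limit_at_right_real by blast
qed

lemma differentiable_complex_of_real_inner:
 fixes \<xi> :: "real^'n::finite"
 shows "((%x. exp (of_real (\<xi> \<bullet> x)) :: complex) has_derivative (%y. of_real (\<xi> \<bullet> y) * exp (of_real (\<xi> \<bullet> x)))) (at x)"
proof -
 have "(exp has_field_derivative exp (of_real (\<xi> \<bullet> x))) (at (of_real (\<xi> \<bullet> x) :: complex))"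
  by (rule DERIV_exp)
 then have 1: "(exp has_derivative (%z. exp (of_real (\<xi> \<bullet> x)) * z)) (at (of_real (\<xi> \<bullet> x) :: complex))"
  by (simp add: has_field_derivative_def)
 have 2: "((%x. of_real (\<xi> \<bullet> x) :: complex) has_derivative (%y. of_real (\<xi> \<bullet> y))) (at x)"
  by (auto intro!: derivative_eq_intros)
 show ?thesis using has_derivative_compose[OF 2 1] by (simp add: mult.commute)
qed

lemma partial_exp:
 "partial i (%x. exp (of_real (\<xi> \<bullet> x))) = (%x. of_real (\<xi> $ i) * exp (of_real (\<xi> \<bullet> x)))"
 by (rule ext) (simp add: partial_eq_derivative(2)[OF differentiable_complex_of_real_inner] inner_axis)

lemma smooth_on_exp: "smooth_on U (%x. exp (of_real (\<xi> \<bullet> x)))"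
proof -
 have d: "(%x. c * exp (of_real (\<xi> \<bullet> x)) :: complex) differentiable (at x)" for x c
  by (intro differentiable_mult differentiable_const differentiableI[OF differentiable_complex_of_real_inner])
 then have p: "partial i (%x. c * exp (of_real (\<xi> \<bullet> x))) = (%x. (c * of_real (\<xi> $ i)) * exp (of_real (\<xi> \<bullet> x)))" for i c
  using d[of 1] by (intro ext) (simp add: partial_cmult partial_exp mult.assoc)
 have "Ck n U (%x. c * exp (of_real (\<xi> \<bullet> x)))" for n c
  by (induction n arbitrary: c) (simp_all add: d p del: differentiable_cmult_left_iff)
 from this[of _ 1] show ?thesis by (simp add: smooth_on_iff_Ck)
qed

lemma holomorphic_difference_derivative:
 fixes x :: "real^'n::finite"
 assumes "f holomorphic_on S" "open S" "of_real (x $ i - x $ j) \<in> S"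
 shows "((%x. f (of_real (x $ i - x $ j))) has_derivative
  (%y. of_real (y $ i - y $ j) * deriv f (of_real (x $ i - x $ j)))) (at x)"
proof -
 have "(f has_field_derivative deriv f (of_real (x $ i - x $ j))) (at (of_real (x $ i - x $ j)))"
  using assms holomorphic_derivI by blast
 then have 1: "(f has_derivative (%z. deriv f (of_real (x $ i - x $ j)) * z)) (at (of_real (x $ i - x $ j)))"
  by (simp add: has_field_derivative_def)
 have 2: "((%x. of_real (x $ i - x $ j) :: complex) has_derivative (%y. of_real (y $ i - y $ j))) (at x)"
  by (intro derivative_intros bounded_linear.has_derivative[OF bounded_linear_of_real])
   (auto intro!: derivative_eq_intros bounded_linear.has_derivative[OF bounded_linear_vec_nth])
 show ?thesis using has_derivative_compose[OF 2 1] by (simp add: mult.commute)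
qed

lemma partial_holomorphic_difference:
 fixes x :: "real^'n::finite"
 assumes "f holomorphic_on S" "open S" "of_real (x $ i - x $ j) \<in> S"
 shows "partial k (%x. f (of_real (x $ i - x $ j))) x =
  (of_bool (k = i) - of_bool (k = j)) * deriv f (of_real (x $ i - x $ j))"
 using partial_eq_derivative(2)[OF holomorphic_difference_derivative[OF assms], of k] by (simp add: axis_def)

lemma smooth_on_holomorphic_difference:
 fixes U :: "(real^'n::finite) set"
 assumes S: "open S" and U: "open U" "\<And>x. x \<in> U ==> of_real (x $ i - x $ j) \<in> S"
 shows "f holomorphic_on S ==> smooth_on U (%x. f (of_real (x $ i - x $ j)))"
proof -
 \<comment> \<open>The factor c absorbs the signs that appear each time x_i - x_j is differentiated,
   so that the induction hypothesis applies again.\<close>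
 have "Ck n U (%x. c * f (of_real (x $ i - x $ j)))" if "f holomorphic_on S" for n c and f :: "complex => complex"
  using that
 proof (induction n arbitrary: c f)
  case 0
  have "(%x. f (of_real (x $ i - x $ j))) differentiable (at x)" if "x \<in> U" for x
   using holomorphic_difference_derivative[OF 0 S U(2)[OF that]] by (auto simp: differentiable_def)
  then show ?case by (auto intro!: derivative_intros)
 next
  case (Suc n)
  have d: "(%x. f (of_real (x $ i - x $ j))) differentiable (at x)" if "x \<in> U" for x
   using holomorphic_difference_derivative[OF Suc.prems S U(2)[OF that]] by (auto simp: differentiable_def)
  have "Ck n U (partial k (%x. c * f (of_real (x $ i - x $ j))))" for k
  proof (rule Ck_cong[OF U(1)])
   show "Ck n U (%x. (c * (of_bool (k = i) - of_bool (k = j))) * deriv f (of_real (x $ i - x $ j)))"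
    using Suc.prems S by (intro Suc.IH holomorphic_deriv)
   fix x assume x: "x \<in> U"
   show "(c * (of_bool (k = i) - of_bool (k = j))) * deriv f (of_real (x $ i - x $ j)) = partial k (%x. c * f (of_real (x $ i - x $ j))) x"
    using d[OF x] partial_holomorphic_difference[OF Suc.prems S U(2)[OF x]] by (simp add: partial_cmult)
  qed
  then show ?case using d by (auto intro!: derivative_intros)
 qed
 from this[of _ _ 1] show "f holomorphic_on S ==> smooth_on U (%x. f (of_real (x $ i - x $ j)))"
  by (simp add: smooth_on_iff_Ck)
qed

subsection \<open>Symbols of differential operators\<close>

text \<open>This is the conjugate of \<open>partial i\<close> by the exponential of \<xi> . x.
  Composing such operators computes the action of a differential operator on a function times an
  exponential, that is, its symbol.\<close>

definition shifted :: "real^'n::finite => 'n => (real^'n => complex) => real^'n => complex" where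
 "shifted \<xi> i g x = partial i g x + of_real (\<xi> $ i) * g x"

lemma smooth_on_shifted: "open U ==> smooth_on U g ==> smooth_on U (shifted \<xi> i g)"
 unfolding shifted_def[abs_def] by (intro smooth_on_add smooth_on_cmult smooth_on_partial)

lemma partial_mult_exp:
 assumes "open U" "smooth_on U g" "x \<in> U"
 shows "partial i (%y. g y * exp (of_real (\<xi> \<bullet> y))) x = shifted \<xi> i g x * exp (of_real (\<xi> \<bullet> x))"
 using partial_mult[OF smooth_on_differentiable[OF assms(2,3)] smooth_on_differentiable[OF smooth_on_exp assms(3)], of i \<xi>]
 by (simp add: partial_exp shifted_def algebra_simps)

lemma partial2_mult_exp:
 assumes "open U" "smooth_on U g" "x \<in> U"
 shows "partial i (partial j (%y. g y * exp (of_real (\<xi> \<bullet> y)))) x = shifted \<xi> i (shifted \<xi> j g) x * exp (of_real (\<xi> \<bullet> x))"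
 by (rule trans[OF partial_cong[OF assms(1,3) partial_mult_exp[OF assms(1,2)]]], assumption, rule partial_mult_exp[OF assms(1) smooth_on_shifted[OF assms(1,2)] assms(3)])

lemma partial3_mult_exp:
 assumes "open U" "smooth_on U g" "x \<in> U"
 shows "partial i (partial j (partial k (%y. g y * exp (of_real (\<xi> \<bullet> y))))) x =
  shifted \<xi> i (shifted \<xi> j (shifted \<xi> k g)) x * exp (of_real (\<xi> \<bullet> x))"
 by (rule trans[OF partial_cong[OF assms(1,3) partial2_mult_exp[OF assms(1,2)]]], assumption, rule partial_mult_exp[OF assms(1) smooth_on_shifted[OF assms(1) smooth_on_shifted[OF assms(1,2)]] assms(3)])

lemma partial_shifted:
 assumes "open U" "smooth_on U g" "x \<in> U"
 shows "partial i (shifted \<xi> j g) x = partial i (partial j g) x + of_real (\<xi> $ j) * partial i g x"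
 unfolding shifted_def[abs_def]
 by (subst partial_add, intro smooth_on_differentiable[of U] smooth_on_partial assms,
   intro smooth_on_differentiable[of U] smooth_on_cmult assms, subst partial_cmult)
  (auto intro: smooth_on_differentiable assms)

lemma shifted2:
 assumes "open U" "smooth_on U g" "x \<in> U"
 shows "shifted \<xi> i (shifted \<xi> j g) x = partial i (partial j g) x + of_real (\<xi> $ j) * partial i g x
  + of_real (\<xi> $ i) * partial j g x + of_real (\<xi> $ i) * of_real (\<xi> $ j) * g x"
 using partial_shifted[OF assms] by (simp add: shifted_def algebra_simps)

lemma shifted3:
 assumes "open U" "smooth_on U g" "x \<in> U"
 shows "shifted \<xi> i (shifted \<xi> j (shifted \<xi> k g)) x = partial i (partial j (partial k g)) x
  + of_real (\<xi> $ k) * partial i (partial j g) x + of_real (\<xi> $ j) * partial i (partial k g) x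
  + of_real (\<xi> $ i) * partial j (partial k g) x
  + of_real (\<xi> $ i) * of_real (\<xi> $ j) * partial k g x + of_real (\<xi> $ i) * of_real (\<xi> $ k) * partial j g x
  + of_real (\<xi> $ j) * of_real (\<xi> $ k) * partial i g x
  + of_real (\<xi> $ i) * of_real (\<xi> $ j) * of_real (\<xi> $ k) * g x"
proof -
 have pk: "smooth_on U (partial k g)" by (intro smooth_on_partial assms)
 have *: "shifted \<xi> j (shifted \<xi> k g) y = shifted \<xi> j (partial k g) y + of_real (\<xi> $ k) * shifted \<xi> j g y" if "y \<in> U" for y
  using shifted2[OF assms(1,2) that, of \<xi> j k] by (simp add: shifted_def algebra_simps)
 have "partial i (shifted \<xi> j (shifted \<xi> k g)) x = partial i (%y. shifted \<xi> j (partial k g) y + of_real (\<xi> $ k) * shifted \<xi> j g y) x"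
  by (rule partial_cong[OF assms(1,3)]) (rule *)
 also have "\<dots> = partial i (shifted \<xi> j (partial k g)) x + of_real (\<xi> $ k) * partial i (shifted \<xi> j g) x"
  by (subst partial_add, intro smooth_on_differentiable[of U] smooth_on_shifted pk assms,
   intro smooth_on_differentiable[of U] smooth_on_cmult smooth_on_shifted assms, subst partial_cmult)
  (auto intro: smooth_on_differentiable smooth_on_shifted assms)
 finally show ?thesis
  using partial_shifted[OF assms(1) pk assms(3), of i \<xi> j] partial_shifted[OF assms, of i \<xi> j] *[OF assms(3)]
  by (simp add: shifted_def[of \<xi> i] shifted_def[of \<xi> j] algebra_simps)
qed

lemma laplacian_mult_exp:
 assumes "open U" "smooth_on U g" "x \<in> U"
 shows "laplacian (%y. g y * exp (of_real (\<xi> \<bullet> y))) x =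
  (laplacian g x + 2 * (\<Sum>k\<in>UNIV. of_real (\<xi> $ k) * partial k g x) + (\<Sum>k\<in>UNIV. (of_real (\<xi> $ k))\<^sup>2) * g x) * exp (of_real (\<xi> \<bullet> x))"
proof -
 have "laplacian (%y. g y * exp (of_real (\<xi> \<bullet> y))) x = (\<Sum>i\<in>UNIV. shifted \<xi> i (shifted \<xi> i g) x) * exp (of_real (\<xi> \<bullet> x))"
  unfolding laplacian_def partial2_mult_exp[OF assms] by (simp add: sum_distrib_right)
 also have "(\<Sum>i\<in>UNIV. shifted \<xi> i (shifted \<xi> i g) x) =
   (\<Sum>i\<in>UNIV. partial i (partial i g) x + 2 * (of_real (\<xi> $ i) * partial i g x) + (of_real (\<xi> $ i))\<^sup>2 * g x)"
  by (intro sum.cong) (simp_all add: shifted2[OF assms] power2_eq_square)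
 finally show ?thesis by (simp add: sum.distrib laplacian_def sum_distrib_left sum_distrib_right)
qed

abbreviation triples :: "('n::linorder \<times> 'n \<times> 'n) set" where
 "triples \<equiv> {(i, j, k). i < j \<and> j < k}"

lemma sum_triples_eq:
 fixes f :: "'n::{finite,linorder} => 'n => 'n => complex"
 shows "(\<Sum>(i,j,k)\<in>triples. f i j k) = (\<Sum>i\<in>UNIV. \<Sum>j\<in>UNIV. \<Sum>k\<in>UNIV. if i < j \<and> j < k then f i j k else 0)"
proof -
 have "(\<Sum>(i,j,k)\<in>triples. f i j k) = (\<Sum>(i,j,k)\<in>UNIV. if i < j \<and> j < k then f i j k else 0)"
  by (rule sum.mono_neutral_cong_left) (auto split: if_splits)
 also have "\<dots> = (\<Sum>i\<in>UNIV. \<Sum>j\<in>UNIV. \<Sum>k\<in>UNIV. if i < j \<and> j < k then f i j k else 0)"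
  by (simp only: sum.cartesian_product UNIV_Times_UNIV split_def fst_conv snd_conv)
 finally show ?thesis .
qed

text \<open>Every ordered triple of distinct indices is exactly one of the six permutations of an
  increasing triple. In the symmetrised form the coefficients of a polynomial in \<xi> can be read
  off.\<close>

lemma sum_triples_symmetrize:
 fixes h :: "'n::{finite,linorder} => 'n => 'n => complex"
 shows "(\<Sum>(i,j,k)\<in>triples. h i j k + h i k j + h j i k + h j k i + h k i j + h k j i) =
  (\<Sum>i\<in>UNIV. \<Sum>j\<in>UNIV - {i}. \<Sum>k\<in>UNIV - {i,j}. h i j k)"
proof -
 define T where "T = (%f :: 'n => 'n => 'n => complex. \<Sum>i\<in>UNIV. \<Sum>j\<in>UNIV. \<Sum>k\<in>UNIV. f i j k)"
 have sw1: "T f = T (%i j k. f j i k)" for f unfolding T_def by (rule sum.swap)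
 have sw2: "T f = T (%i j k. f i k j)" for f unfolding T_def by (intro sum.cong refl sum.swap)
 have add: "T (%i j k. f i j k + g i j k) = T f + T g" for f g unfolding T_def by (simp add: sum.distrib)
 let ?c = "%P x. if P then x else (0::complex)"
 have "(\<Sum>(i,j,k)\<in>triples. h i j k + h i k j + h j i k + h j k i + h k i j + h k j i) =
  T (%i j k. ?c (i < j \<and> j < k) (h i j k + h i k j + h j i k + h j k i + h k i j + h k j i))"
  unfolding sum_triples_eq T_def ..
 also have "\<dots> = T (%i j k. ?c (i < j \<and> j < k) (h i j k) + ?c (i < j \<and> j < k) (h i k j) + ?c (i < j \<and> j < k) (h j i k)
   + ?c (i < j \<and> j < k) (h j k i) + ?c (i < j \<and> j < k) (h k i j) + ?c (i < j \<and> j < k) (h k j i))"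
  unfolding T_def by (intro sum.cong refl) auto
 also have "\<dots> = T (%i j k. ?c (i < j \<and> j < k) (h i j k)) + T (%i j k. ?c (i < j \<and> j < k) (h i k j)) + T (%i j k. ?c (i < j \<and> j < k) (h j i k))
   + T (%i j k. ?c (i < j \<and> j < k) (h j k i)) + T (%i j k. ?c (i < j \<and> j < k) (h k i j)) + T (%i j k. ?c (i < j \<and> j < k) (h k j i))"
  by (simp only: add)
 also have "T (%i j k. ?c (i < j \<and> j < k) (h i k j)) = T (%i j k. ?c (i < k \<and> k < j) (h i j k))" by (subst sw2) (rule refl)
 also have "T (%i j k. ?c (i < j \<and> j < k) (h j i k)) = T (%i j k. ?c (j < i \<and> i < k) (h i j k))" by (subst sw1) (rule refl)
 also have "T (%i j k. ?c (i < j \<and> j < k) (h j k i)) = T (%i j k. ?c (k < i \<and> i < j) (h i j k))"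
  by (subst sw1, subst sw2) (rule refl)
 also have "T (%i j k. ?c (i < j \<and> j < k) (h k i j)) = T (%i j k. ?c (j < k \<and> k < i) (h i j k))"
  by (subst sw2, subst sw1) (rule refl)
 also have "T (%i j k. ?c (i < j \<and> j < k) (h k j i)) = T (%i j k. ?c (k < j \<and> j < i) (h i j k))"
  by (subst sw2, subst sw1, subst sw2) (rule refl)
 also have "T (%i j k. ?c (i < j \<and> j < k) (h i j k)) + T (%i j k. ?c (i < k \<and> k < j) (h i j k)) + T (%i j k. ?c (j < i \<and> i < k) (h i j k))
   + T (%i j k. ?c (k < i \<and> i < j) (h i j k)) + T (%i j k. ?c (j < k \<and> k < i) (h i j k)) + T (%i j k. ?c (k < j \<and> j < i) (h i j k))
   = T (%i j k. ?c (i < j \<and> j < k) (h i j k) + ?c (i < k \<and> k < j) (h i j k) + ?c (j < i \<and> i < k) (h i j k)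
   + ?c (k < i \<and> i < j) (h i j k) + ?c (j < k \<and> k < i) (h i j k) + ?c (k < j \<and> j < i) (h i j k))"
  by (simp only: add)
 also have "\<dots> = T (%i j k. ?c (j \<noteq> i) (?c (k \<noteq> i \<and> k \<noteq> j) (h i j k)))"
  unfolding T_def
 proof (intro sum.cong refl)
  fix i j k :: 'n
  consider "i < j" "j < k" | "i < k" "k < j" | "j < i" "i < k" | "j < k" "k < i" | "k < i" "i < j" | "k < j" "j < i"
   | "i = j" | "i = k" | "j = k" by (metis linorder_neqE)
  then show "?c (i < j \<and> j < k) (h i j k) + ?c (i < k \<and> k < j) (h i j k) + ?c (j < i \<and> i < k) (h i j k)
   + ?c (k < i \<and> i < j) (h i j k) + ?c (j < k \<and> k < i) (h i j k) + ?c (k < j \<and> j < i) (h i j k) = ?c (j \<noteq> i) (?c (k \<noteq> i \<and> k \<noteq> j) (h i j k))"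
   by cases auto
 qed
 also have "\<dots> = (\<Sum>i\<in>UNIV. \<Sum>j\<in>UNIV - {i}. \<Sum>k\<in>UNIV - {i,j}. h i j k)"
  unfolding T_def
 proof (rule sum.cong[OF refl])
  fix i
  have "(\<Sum>j\<in>UNIV. \<Sum>k\<in>UNIV. ?c (j \<noteq> i) (?c (k \<noteq> i \<and> k \<noteq> j) (h i j k))) = (\<Sum>j\<in>UNIV - {i}. \<Sum>k\<in>UNIV. ?c (k \<noteq> i \<and> k \<noteq> j) (h i j k))"
   by (rule sum.mono_neutral_cong_right) auto
  also have "\<dots> = (\<Sum>j\<in>UNIV - {i}. \<Sum>k\<in>UNIV - {i,j}. h i j k)"
   by (intro sum.cong refl sum.mono_neutral_cong_right) auto
  finally show "(\<Sum>j\<in>UNIV. \<Sum>k\<in>UNIV. ?c (j \<noteq> i) (?c (k \<noteq> i \<and> k \<noteq> j) (h i j k))) = (\<Sum>j\<in>UNIV - {i}. \<Sum>k\<in>UNIV - {i,j}. h i j k)" .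
 qed
 finally show ?thesis .
qed

lemma partial_cmult_exp:
 "partial i (%x. c * exp (of_real (\<xi> \<bullet> x))) = (%x. (c * of_real (\<xi> $ i)) * exp (of_real (\<xi> \<bullet> x)))"
proof
 fix x
 have "(%x. exp (of_real (\<xi> \<bullet> x)) :: complex) differentiable (at x)"
  by (rule smooth_on_differentiable[OF smooth_on_exp UNIV_I])
 then show "partial i (%x. c * exp (of_real (\<xi> \<bullet> x))) x = (c * of_real (\<xi> $ i)) * exp (of_real (\<xi> \<bullet> x))"
  by (simp add: partial_cmult partial_exp mult.assoc)
qed

lemma cubic_operator_cmult_exp:
 "cubic_operator a1 a0 (%y. c * exp (of_real (\<xi> \<bullet> y))) x =
  c * ((\<Sum>(i,j,k)\<in>triples. of_real (\<xi> $ i) * of_real (\<xi> $ j) * of_real (\<xi> $ k)) + (\<Sum>i\<in>UNIV. of_real (\<xi> $ i) * a1 i x) + a0 x)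
  * exp (of_real (\<xi> \<bullet> x))"
proof -
 have "cubic_operator a1 a0 (%y. c * exp (of_real (\<xi> \<bullet> y))) x =
   (\<Sum>(i,j,k)\<in>triples. c * ((of_real (\<xi> $ i) * of_real (\<xi> $ j) * of_real (\<xi> $ k)) * exp (of_real (\<xi> \<bullet> x))))
   + (\<Sum>i\<in>UNIV. c * ((of_real (\<xi> $ i) * a1 i x) * exp (of_real (\<xi> \<bullet> x)))) + c * (a0 x * exp (of_real (\<xi> \<bullet> x)))"
  unfolding cubic_operator_def partial_cmult_exp by (simp add: mult_ac)
 then show ?thesis by (simp add: split_def sum_distrib_left sum_distrib_right distrib_right distrib_left mult_ac)
qed

lemma cubic_operator_exp:
 "cubic_operator a1 a0 (%y. exp (of_real (\<xi> \<bullet> y))) x =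
  ((\<Sum>(i,j,k)\<in>triples. of_real (\<xi> $ i) * of_real (\<xi> $ j) * of_real (\<xi> $ k)) + (\<Sum>i\<in>UNIV. of_real (\<xi> $ i) * a1 i x) + a0 x)
  * exp (of_real (\<xi> \<bullet> x))"
 using cubic_operator_cmult_exp[of a1 a0 1 \<xi> x] by simp

lemma schroedinger_exp:
 "schroedinger R (%y. exp (of_real (\<xi> \<bullet> y))) x = (R x - (\<Sum>k\<in>UNIV. (of_real (\<xi> $ k))\<^sup>2)) * exp (of_real (\<xi> \<bullet> x))"
proof -
 have "laplacian (%y. 1 * exp (of_real (\<xi> \<bullet> y))) x = (\<Sum>k\<in>UNIV. (of_real (\<xi> $ k))\<^sup>2) * exp (of_real (\<xi> \<bullet> x))"
  by (subst laplacian_mult_exp[of UNIV]) (auto simp: smooth_on_const laplacian_def)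
 then show ?thesis by (simp add: schroedinger_def algebra_simps)
qed

text \<open>The commutator is applied to the exponential of \<xi> . x and divided by it. The
  exponential is sent by the cubic operator to b times itself and by \<open>schroedinger R\<close>
  to g times itself, where b and g depend on x, so only derivatives of b and g survive.\<close>

lemma commutator_symbol:
 fixes R a0 :: "real^'n::{finite,linorder} => complex"
 assumes U: "open U" and R: "smooth_on U R" and a1: "\<And>i. smooth_on U (a1 i)" and a0: "smooth_on U a0"
  and comm: "commute_on U (schroedinger R) (cubic_operator a1 a0)" and x: "x \<in> U"
 shows "laplacian a0 x + (\<Sum>i\<in>UNIV. of_real (\<xi> $ i) * laplacian (a1 i) x)
  + 2 * (\<Sum>k\<in>UNIV. of_real (\<xi> $ k) * (partial k a0 x + (\<Sum>i\<in>UNIV. of_real (\<xi> $ i) * partial k (a1 i) x)))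
  + (\<Sum>(i,j,k)\<in>triples. partial i (partial j (partial k R)) x)
  + (\<Sum>(i,j,k)\<in>triples. of_real (\<xi> $ k) * partial i (partial j R) x + of_real (\<xi> $ j) * partial i (partial k R) x
   + of_real (\<xi> $ i) * partial j (partial k R) x)
  + (\<Sum>(i,j,k)\<in>triples. of_real (\<xi> $ i) * of_real (\<xi> $ j) * partial k R x + of_real (\<xi> $ i) * of_real (\<xi> $ k) * partial j R x
   + of_real (\<xi> $ j) * of_real (\<xi> $ k) * partial i R x)
  + (\<Sum>i\<in>UNIV. a1 i x * partial i R x) = 0"
proof -
 define T where "T = (%y. exp (of_real (\<xi> \<bullet> y)) :: complex)"
 define q where "q = (\<Sum>k\<in>UNIV. (of_real (\<xi> $ k))\<^sup>2 :: complex)"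
 define s3 where "s3 = (\<Sum>(i,j,k)\<in>triples. of_real (\<xi> $ i) * of_real (\<xi> $ j) * of_real (\<xi> $ k) :: complex)"
 define b where "b = (%y. s3 + (\<Sum>i\<in>UNIV. of_real (\<xi> $ i) * a1 i y) + a0 y)"
 define g where "g = (%y. R y - q)"
 have bs: "smooth_on U b" unfolding b_def by (intro smooth_on_add smooth_on_const smooth_on_sum smooth_on_cmult U a1 a0)
 have gs: "smooth_on U g" unfolding g_def by (intro smooth_on_diff U R smooth_on_const)
 have dif: "h differentiable (at y)" if "smooth_on U h" "y \<in> U" for h y using that by (rule smooth_on_differentiable)
 have pg: "partial i g y = partial i R y" if "y \<in> U" for i y
  unfolding g_def by (subst partial_diff) (auto intro: dif R that)
 have pg2: "partial i (partial j g) y = partial i (partial j R) y" if "y \<in> U" for i j y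
  using partial_cong[OF U that pg] .
 have pg3: "partial i (partial j (partial k g)) y = partial i (partial j (partial k R)) y" if "y \<in> U" for i j k y
  using partial_cong[OF U that pg2] .
 have pb: "partial k b y = (\<Sum>i\<in>UNIV. of_real (\<xi> $ i) * partial k (a1 i) y) + partial k a0 y" if y: "y \<in> U" for k y
 proof -
  have "partial k b y = partial k (%y. s3 + (\<Sum>i\<in>UNIV. of_real (\<xi> $ i) * a1 i y)) y + partial k a0 y"
   unfolding b_def by (rule partial_add) (intro dif[OF _ y] smooth_on_add smooth_on_const smooth_on_sum smooth_on_cmult U a1 a0)+
  also have "partial k (%y. s3 + (\<Sum>i\<in>UNIV. of_real (\<xi> $ i) * a1 i y)) y = partial k (%y. \<Sum>i\<in>UNIV. of_real (\<xi> $ i) * a1 i y) y"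
   by (subst partial_add) (auto intro!: dif[OF _ y] smooth_on_const smooth_on_sum smooth_on_cmult U a1)
  also have "\<dots> = (\<Sum>i\<in>UNIV. partial k (%y. of_real (\<xi> $ i) * a1 i y) y)"
   by (rule partial_sum) (intro dif[OF _ y] smooth_on_cmult U a1)
  also have "\<dots> = (\<Sum>i\<in>UNIV. of_real (\<xi> $ i) * partial k (a1 i) y)"
   by (intro sum.cong refl partial_cmult dif[OF _ y] a1)
  finally show ?thesis .
 qed
 have pb2: "partial k (partial k b) x = (\<Sum>i\<in>UNIV. of_real (\<xi> $ i) * partial k (partial k (a1 i)) x) + partial k (partial k a0) x" for k
 proof -
  have "partial k (partial k b) x = partial k (%y. (\<Sum>i\<in>UNIV. of_real (\<xi> $ i) * partial k (a1 i) y) + partial k a0 y) x"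
   using partial_cong[OF U x pb] .
  also have "\<dots> = partial k (%y. \<Sum>i\<in>UNIV. of_real (\<xi> $ i) * partial k (a1 i) y) x + partial k (partial k a0) x"
   by (rule partial_add) (intro dif[OF _ x] smooth_on_sum smooth_on_cmult smooth_on_partial U a1 a0)+
  also have "partial k (%y. \<Sum>i\<in>UNIV. of_real (\<xi> $ i) * partial k (a1 i) y) x = (\<Sum>i\<in>UNIV. partial k (%y. of_real (\<xi> $ i) * partial k (a1 i) y) x)"
   by (rule partial_sum) (intro dif[OF _ x] smooth_on_cmult smooth_on_partial U a1)
  also have "\<dots> = (\<Sum>i\<in>UNIV. of_real (\<xi> $ i) * partial k (partial k (a1 i)) x)"
   by (intro sum.cong refl partial_cmult dif[OF _ x] smooth_on_partial a1)
  finally show ?thesis .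
 qed
 have lb: "laplacian b x = (\<Sum>i\<in>UNIV. of_real (\<xi> $ i) * laplacian (a1 i) x) + laplacian a0 x"
 proof -
  have "(\<Sum>k\<in>UNIV. \<Sum>i\<in>UNIV. of_real (\<xi> $ i) * partial k (partial k (a1 i)) x) = (\<Sum>i\<in>UNIV. \<Sum>k\<in>UNIV. of_real (\<xi> $ i) * partial k (partial k (a1 i)) x)"
   by (rule sum.swap)
  then show ?thesis by (simp add: laplacian_def pb2 sum.distrib sum_distrib_left)
 qed
 have cT: "cubic_operator a1 a0 T = (%y. b y * T y)"
  by (rule ext) (simp only: T_def cubic_operator_exp b_def s3_def)
 have sT: "schroedinger R T = (%y. g y * T y)"
  by (rule ext) (simp only: T_def schroedinger_exp g_def q_def)
 have "smooth_on U T" unfolding T_def by (rule smooth_on_exp)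
 then have eq: "schroedinger R (%y. b y * T y) x = cubic_operator a1 a0 (%y. g y * T y) x"
  using comm x unfolding commute_on_def cT[symmetric] sT[symmetric] by blast
 have lhs: "schroedinger R (%y. b y * T y) x = (R x * b x - laplacian b x - 2 * (\<Sum>k\<in>UNIV. of_real (\<xi> $ k) * partial k b x) - q * b x) * T x"
  unfolding schroedinger_def T_def laplacian_mult_exp[OF U bs x] q_def by (simp add: algebra_simps)
 define E0 where "E0 = (\<Sum>(i,j,k)\<in>triples. partial i (partial j (partial k R)) x)"
 define E1 where "E1 = (\<Sum>(i,j,k)\<in>triples. of_real (\<xi> $ k) * partial i (partial j R) x + of_real (\<xi> $ j) * partial i (partial k R) x
   + of_real (\<xi> $ i) * partial j (partial k R) x)"
 define E2 where "E2 = (\<Sum>(i,j,k)\<in>triples. of_real (\<xi> $ i) * of_real (\<xi> $ j) * partial k R x + of_real (\<xi> $ i) * of_real (\<xi> $ k) * partial j R x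
   + of_real (\<xi> $ j) * of_real (\<xi> $ k) * partial i R x)"
 have "(\<Sum>(i,j,k)\<in>triples. partial i (partial j (partial k (%y. g y * T y))) x) =
   (\<Sum>(i,j,k)\<in>triples. shifted \<xi> i (shifted \<xi> j (shifted \<xi> k g)) x) * T x"
  unfolding T_def partial3_mult_exp[OF U gs x] by (simp add: split_def sum_distrib_right)
 also have "(\<Sum>(i,j,k)\<in>triples. shifted \<xi> i (shifted \<xi> j (shifted \<xi> k g)) x) = E0 + E1 + E2 + s3 * g x"
  unfolding E0_def E1_def E2_def s3_def shifted3[OF U gs x] pg[OF x] pg2[OF x] pg3[OF x]
  by (simp add: split_def sum.distrib sum_distrib_right)
 finally have c3: "(\<Sum>(i,j,k)\<in>triples. partial i (partial j (partial k (%y. g y * T y))) x) = (E0 + E1 + E2 + s3 * g x) * T x" .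
 have c1: "(\<Sum>i\<in>UNIV. a1 i x * partial i (%y. g y * T y) x) = ((\<Sum>i\<in>UNIV. a1 i x * partial i R x) + (\<Sum>i\<in>UNIV. of_real (\<xi> $ i) * a1 i x) * g x) * T x"
  unfolding T_def partial_mult_exp[OF U gs x] shifted_def pg[OF x]
  by (simp add: sum_distrib_right sum_distrib_left sum.distrib algebra_simps)
 have rhs: "cubic_operator a1 a0 (%y. g y * T y) x = (E0 + E1 + E2 + (\<Sum>i\<in>UNIV. a1 i x * partial i R x) + b x * g x) * T x"
  unfolding cubic_operator_def c3 c1 by (simp add: b_def algebra_simps)
 have "T x \<noteq> 0" by (simp add: T_def)
 then have "R x * b x - laplacian b x - 2 * (\<Sum>k\<in>UNIV. of_real (\<xi> $ k) * partial k b x) - q * b x =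
  E0 + E1 + E2 + (\<Sum>i\<in>UNIV. a1 i x * partial i R x) + b x * g x"
  using eq unfolding lhs rhs by simp
 \<comment> \<open>The common product of b and g cancels, and with it all terms of degree above 2 in
   \<xi>.\<close>
 then have "laplacian b x + 2 * (\<Sum>k\<in>UNIV. of_real (\<xi> $ k) * partial k b x) + E0 + E1 + E2 + (\<Sum>i\<in>UNIV. a1 i x * partial i R x) = 0"
  unfolding g_def by algebra
 then show ?thesis
  unfolding lb pb[OF x] E0_def[symmetric] E1_def[symmetric] E2_def[symmetric] by (simp add: algebra_simps)
qed

lemma sum_axis_combination:
 fixes g :: "'n::finite => complex"
 shows "(\<Sum>k\<in>UNIV. of_real ((s *\<^sub>R axis i 1 + t *\<^sub>R axis j 1 :: real^'n) $ k) * g k) = of_real s * g i + of_real t * g j"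
proof -
 have "of_real ((s *\<^sub>R axis i 1 + t *\<^sub>R axis j 1 :: real^'n) $ k) * g k = (if k = i then of_real s * g k else 0) + (if k = j then of_real t * g k else 0)" for k
  by (simp add: axis_def distrib_right)
 then show ?thesis by (simp add: sum.distrib)
qed

text \<open>Evaluation on combinations of two axis vectors with coefficients 0, 1 and -1. A
  quadratic form determines only the symmetric part of its matrix, hence the sum in the last
  conclusion.\<close>

lemma quadratic_polynomial_eq_0:
 fixes c0 :: complex and c :: "'n::finite => complex" and B :: "'n => 'n => complex"
 assumes "\<And>\<xi>::real^'n. c0 + (\<Sum>i\<in>UNIV. of_real (\<xi> $ i) * c i) + (\<Sum>i\<in>UNIV. \<Sum>j\<in>UNIV. of_real (\<xi> $ i) * of_real (\<xi> $ j) * B i j) = 0"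
 shows "c0 = 0" "c i = 0" "B i j + B j i = 0"
proof -
 have *: "c0 + (of_real s * c i + of_real t * c j) + (of_real s * (of_real s * B i i + of_real t * B i j) + of_real t * (of_real s * B j i + of_real t * B j j)) = 0" for s t i j
 proof -
  let ?x = "s *\<^sub>R axis i 1 + t *\<^sub>R axis j 1 :: real^'n"
  have "(\<Sum>k\<in>UNIV. \<Sum>l\<in>UNIV. of_real (?x $ k) * of_real (?x $ l) * B k l) = (\<Sum>k\<in>UNIV. of_real (?x $ k) * (\<Sum>l\<in>UNIV. of_real (?x $ l) * B k l))"
   by (simp only: sum_distrib_left mult.assoc)
  also have "\<dots> = of_real s * (of_real s * B i i + of_real t * B i j) + of_real t * (of_real s * B j i + of_real t * B j j)"
   by (simp only: sum_axis_combination)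
  finally show ?thesis using assms[of ?x] by (simp only: sum_axis_combination)
 qed
 \<comment> \<open>Both coefficients are 0, so the choice of the two indices is immaterial.\<close>
 show c0: "c0 = 0" using *[of 0 undefined 0 undefined] by simp
 have ci: "c i = 0 \<and> B i i = 0" for i
 proof -
  have "c i + B i i = 0" "- c i + B i i = 0"
   using *[of 1 i 0 i] *[of "-1" i 0 i] c0 by simp_all
  then have "B i i = c i" "2 * c i = 0" by (simp_all add: add_eq_0_iff)
  then show ?thesis by simp
 qed
 then show "c i = 0" by simp
 show "B i j + B j i = 0" using *[of 1 i 1 j] c0 ci[of i] ci[of j] by simp
qed

section \<open>Differential relations forced by the commutation\<close>

locale commuting_pair =
 fixes U :: "(real^'n::{finite,linorder}) set" and R a0 :: "real^'n::{finite,linorder} => complex"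
  and a1 :: "'n => real^'n::{finite,linorder} => complex"
 assumes U: "open U" and R: "smooth_on U R" and a1: "\<And>i. smooth_on U (a1 i)" and a0: "smooth_on U a0"
  and comm_R: "commute_on U (schroedinger R) Delta1"
  and comm_P: "commute_on U (cubic_operator a1 a0) Delta1"
  and comm: "commute_on U (schroedinger R) (cubic_operator a1 a0)"
begin

lemma dif: "smooth_on U h ==> y \<in> U ==> h differentiable (at y)"
 by (rule smooth_on_differentiable)

lemma partial_eq_0: "(\<And>y. y \<in> U ==> f y = 0) ==> x \<in> U ==> partial i f x = 0"
 using partial_cong[OF U, of x f "%_. 0" i] by simp

lemma partial_swap: "smooth_on U f ==> x \<in> U ==> partial i (partial j f) x = partial j (partial i f) x"
 using partial_commute[OF U] by blast

text \<open>The test function is the constant 1: \<open>Delta1\<close> kills it and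
  \<open>schroedinger R\<close> sends it to R.\<close>

lemma sum_partial_R: "x \<in> U ==> (\<Sum>i\<in>UNIV. partial i R x) = 0"
proof -
 assume x: "x \<in> U"
 have 1: "Delta1 (%_. 1) = (%_. 0)" by (rule ext) (simp add: Delta1_def)
 have 2: "schroedinger R (%_. 1) = R" by (rule ext) (simp add: schroedinger_def laplacian_def)
 have 3: "schroedinger R (%_. 0) x = 0" by (simp add: schroedinger_def laplacian_def)
 have "schroedinger R (Delta1 (%_. 1)) x = Delta1 (schroedinger R (%_. 1)) x"
  using comm_R x smooth_on_const unfolding commute_on_def by blast
 then show ?thesis unfolding 1 2 3 by (simp add: Delta1_def)
qed

lemma partial_symbol:
 assumes y: "y \<in> U"
 shows "partial k (%y. c + (\<Sum>i\<in>UNIV. of_real (\<xi> $ i) * a1 i y) + a0 y) y = (\<Sum>i\<in>UNIV. of_real (\<xi> $ i) * partial k (a1 i) y) + partial k a0 y"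
proof -
 have "partial k (%y. c + (\<Sum>i\<in>UNIV. of_real (\<xi> $ i) * a1 i y) + a0 y) y = partial k (%y. c + (\<Sum>i\<in>UNIV. of_real (\<xi> $ i) * a1 i y)) y + partial k a0 y"
  by (rule partial_add) (intro dif[OF _ y] smooth_on_add smooth_on_const smooth_on_sum smooth_on_cmult U a1 a0)+
 also have "partial k (%y. c + (\<Sum>i\<in>UNIV. of_real (\<xi> $ i) * a1 i y)) y = partial k (%y. \<Sum>i\<in>UNIV. of_real (\<xi> $ i) * a1 i y) y"
  by (subst partial_add) (auto intro!: dif[OF _ y] smooth_on_const smooth_on_sum smooth_on_cmult U a1)
 also have "\<dots> = (\<Sum>i\<in>UNIV. partial k (%y. of_real (\<xi> $ i) * a1 i y) y)"
  by (rule partial_sum) (intro dif[OF _ y] smooth_on_cmult U a1)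
 also have "\<dots> = (\<Sum>i\<in>UNIV. of_real (\<xi> $ i) * partial k (a1 i) y)"
  by (intro sum.cong refl partial_cmult dif[OF _ y] a1)
 finally show ?thesis .
qed

text \<open>The exponential is an eigenfunction of \<open>Delta1\<close>, so on it the commutator
  is, up to sign, multiplication by the sum of the partial derivatives of the symbol b. This is
  affine in \<xi>, and its linear coefficients must vanish.\<close>

lemma sum_partial_a1:
 assumes x: "x \<in> U"
 shows "(\<Sum>i\<in>UNIV. partial i (a1 j) x) = 0"
proof -
 have *: "(\<Sum>k\<in>UNIV. partial k a0 x) + (\<Sum>i\<in>UNIV. of_real (\<xi> $ i) * (\<Sum>k\<in>UNIV. partial k (a1 i) x))
   + (\<Sum>i\<in>UNIV. \<Sum>j\<in>UNIV. of_real (\<xi> $ i) * of_real (\<xi> $ j) * 0) = 0" for \<xi>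
 proof -
  define T where "T = (%y. exp (of_real (\<xi> \<bullet> y)) :: complex)"
  define s3 where "s3 = (\<Sum>(i,j,k)\<in>triples. of_real (\<xi> $ i) * of_real (\<xi> $ j) * of_real (\<xi> $ k) :: complex)"
  define b where "b = (%y. s3 + (\<Sum>i\<in>UNIV. of_real (\<xi> $ i) * a1 i y) + a0 y)"
  define \<sigma> where "\<sigma> = (\<Sum>k\<in>UNIV. of_real (\<xi> $ k) :: complex)"
  have bs: "smooth_on U b" unfolding b_def by (intro smooth_on_add smooth_on_const smooth_on_sum smooth_on_cmult U a1 a0)
  have 1: "Delta1 T = (%y. \<sigma> * T y)" by (rule ext) (simp add: Delta1_def T_def partial_exp \<sigma>_def sum_distrib_right)
  have 2: "cubic_operator a1 a0 T = (%y. b y * T y)"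
   by (rule ext) (simp only: T_def cubic_operator_exp b_def s3_def)
  have 3: "cubic_operator a1 a0 (%y. \<sigma> * T y) x = \<sigma> * b x * T x"
   by (simp only: T_def cubic_operator_cmult_exp b_def s3_def)
  have 4: "Delta1 (%y. b y * T y) x = ((\<Sum>k\<in>UNIV. partial k b x) + \<sigma> * b x) * T x"
   unfolding Delta1_def T_def partial_mult_exp[OF U bs x] shifted_def
   by (simp add: sum.distrib sum_distrib_right \<sigma>_def distrib_right)
  have "smooth_on U T" unfolding T_def by (rule smooth_on_exp)
  then have "cubic_operator a1 a0 (Delta1 T) x = Delta1 (cubic_operator a1 a0 T) x"
   using comm_P x unfolding commute_on_def by blast
  then have "(\<Sum>k\<in>UNIV. partial k b x) = 0" unfolding 1 2 3 4 by (simp add: T_def)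
  moreover have "(\<Sum>k\<in>UNIV. \<Sum>i\<in>UNIV. of_real (\<xi> $ i) * partial k (a1 i) x) = (\<Sum>i\<in>UNIV. \<Sum>k\<in>UNIV. of_real (\<xi> $ i) * partial k (a1 i) x)"
   by (rule sum.swap)
  ultimately show ?thesis unfolding b_def partial_symbol[OF x] by (simp add: sum.distrib sum_distrib_left add.commute)
 qed
 show ?thesis by (rule quadratic_polynomial_eq_0(2)[OF *])
qed

text \<open>The coefficients of degree 0, 1 and 2 in \<xi> of \<open>commutator_symbol\<close>.
  Summing over all ordered triples counts each term twice, which explains the divisions by
  2.\<close>

lemma symbol_coefficients:
 assumes x: "x \<in> U"
 shows "laplacian a0 x + (\<Sum>(i,j,k)\<in>triples. partial i (partial j (partial k R)) x) + (\<Sum>i\<in>UNIV. a1 i x * partial i R x) = 0"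
  and "laplacian (a1 i) x + 2 * partial i a0 x + (\<Sum>j\<in>UNIV - {i}. \<Sum>k\<in>UNIV - {i,j}. partial j (partial k R) x) / 2 = 0"
  and "(2 * partial i (a1 j) x + (if i = j then 0 else (\<Sum>k\<in>UNIV - {i,j}. partial k R x) / 2))
    + (2 * partial j (a1 i) x + (if j = i then 0 else (\<Sum>k\<in>UNIV - {j,i}. partial k R x) / 2)) = 0"
proof -
 let ?z = "laplacian a0 x + (\<Sum>(i,j,k)\<in>triples. partial i (partial j (partial k R)) x) + (\<Sum>i\<in>UNIV. a1 i x * partial i R x)"
 let ?c = "%i. laplacian (a1 i) x + 2 * partial i a0 x + (\<Sum>j\<in>UNIV - {i}. \<Sum>k\<in>UNIV - {i,j}. partial j (partial k R) x) / 2"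
 let ?B = "%i j. 2 * partial i (a1 j) x + (if i = j then 0 else (\<Sum>k\<in>UNIV - {i,j}. partial k R x) / 2)"
 have *: "?z + (\<Sum>i\<in>UNIV. of_real (\<xi> $ i) * ?c i) + (\<Sum>i\<in>UNIV. \<Sum>j\<in>UNIV. of_real (\<xi> $ i) * of_real (\<xi> $ j) * ?B i j) = 0" for \<xi>
 proof -
  let ?x = "%i. of_real (\<xi> $ i) :: complex"
  have sw: "partial i (partial j R) x = partial j (partial i R) x" for i j by (rule partial_swap[OF R x])
  have "(\<Sum>(i,j,k)\<in>triples. ?x k * partial i (partial j R) x + ?x j * partial i (partial k R) x + ?x i * partial j (partial k R) x)
   = (\<Sum>(i,j,k)\<in>triples. ?x i * partial j (partial k R) x / 2 + ?x i * partial k (partial j R) x / 2 + ?x j * partial i (partial k R) x / 2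
     + ?x j * partial k (partial i R) x / 2 + ?x k * partial i (partial j R) x / 2 + ?x k * partial j (partial i R) x / 2)"
   by (intro sum.cong refl) (auto simp: sw[of _ "_"] field_simps)
  also have "\<dots> = (\<Sum>i\<in>UNIV. \<Sum>j\<in>UNIV - {i}. \<Sum>k\<in>UNIV - {i,j}. ?x i * partial j (partial k R) x / 2)"
   by (rule sum_triples_symmetrize)
  also have "\<dots> = (\<Sum>i\<in>UNIV. ?x i * ((\<Sum>j\<in>UNIV - {i}. \<Sum>k\<in>UNIV - {i,j}. partial j (partial k R) x) / 2))"
   by (simp add: sum_distrib_left sum_divide_distrib)
  finally have e1: "(\<Sum>(i,j,k)\<in>triples. ?x k * partial i (partial j R) x + ?x j * partial i (partial k R) x + ?x i * partial j (partial k R) x) = \<dots>" .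
  have "(\<Sum>(i,j,k)\<in>triples. ?x i * ?x j * partial k R x + ?x i * ?x k * partial j R x + ?x j * ?x k * partial i R x)
   = (\<Sum>(i,j,k)\<in>triples. ?x i * ?x j * partial k R x / 2 + ?x i * ?x k * partial j R x / 2 + ?x j * ?x i * partial k R x / 2
     + ?x j * ?x k * partial i R x / 2 + ?x k * ?x i * partial j R x / 2 + ?x k * ?x j * partial i R x / 2)"
   by (intro sum.cong refl) (auto simp: field_simps)
  also have "\<dots> = (\<Sum>i\<in>UNIV. \<Sum>j\<in>UNIV - {i}. \<Sum>k\<in>UNIV - {i,j}. ?x i * ?x j * partial k R x / 2)"
   by (rule sum_triples_symmetrize)
  also have "\<dots> = (\<Sum>i\<in>UNIV. \<Sum>j\<in>UNIV. ?x i * ?x j * (if i = j then 0 else (\<Sum>k\<in>UNIV - {i,j}. partial k R x) / 2))"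
  proof (rule sum.cong[OF refl], rule sum.mono_neutral_cong_left)
   fix i j :: 'n assume "j \<in> UNIV - {i}"
   then show "(\<Sum>k\<in>UNIV - {i,j}. ?x i * ?x j * partial k R x / 2) = ?x i * ?x j * (if i = j then 0 else (\<Sum>k\<in>UNIV - {i,j}. partial k R x) / 2)"
    by (auto simp: sum_distrib_left sum_divide_distrib)
  qed auto
  finally have e2: "(\<Sum>(i,j,k)\<in>triples. ?x i * ?x j * partial k R x + ?x i * ?x k * partial j R x + ?x j * ?x k * partial i R x) = \<dots>" .
  have "(\<Sum>k\<in>UNIV. ?x k * (\<Sum>i\<in>UNIV. ?x i * partial k (a1 i) x)) = (\<Sum>i\<in>UNIV. \<Sum>j\<in>UNIV. ?x i * ?x j * partial i (a1 j) x)"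
   by (simp add: sum_distrib_left mult.assoc)
  then show ?thesis
   using commutator_symbol[OF U R a1 a0 comm x, of \<xi>] unfolding e1 e2
   by (simp add: distrib_left sum.distrib sum_distrib_left mult.left_commute[of 2] add_ac)
 qed
 show "?z = 0" "?c i = 0" "?B i j + ?B j i = 0"
  by (rule quadratic_polynomial_eq_0[OF *])+
qed

lemma partial_a1_same:
 assumes "x \<in> U"
 shows "partial i (a1 i) x = 0"
 using symbol_coefficients(3)[OF assms, of i i] by simp

text \<open>By \<open>sum_partial_R\<close> the sum of the remaining derivatives of R equals minus
  those in directions i and j.\<close>

lemma partial_a1_sym:
 assumes x: "x \<in> U" and "i \<noteq> j"
 shows "partial i (a1 j) x + partial j (a1 i) x = (partial i R x + partial j R x) / 2"
proof -
 have "(\<Sum>k\<in>UNIV. partial k R x) = partial i R x + (\<Sum>k\<in>UNIV - {i}. partial k R x)"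
  by (rule sum.remove) auto
 also have "(\<Sum>k\<in>UNIV - {i}. partial k R x) = partial j R x + (\<Sum>k\<in>UNIV - {i} - {j}. partial k R x)"
  by (rule sum.remove) (use assms in auto)
 finally have s: "(\<Sum>k\<in>UNIV - {i,j}. partial k R x) = - partial i R x - partial j R x"
  using sum_partial_R[OF x] by (simp add: Diff_insert2[symmetric] insert_commute algebra_simps add_eq_0_iff)
 have ji: "UNIV - {j,i} = UNIV - {i,j}" by blast
 define p q a b where "p = partial i (a1 j) x" and "q = partial j (a1 i) x" and "a = partial i R x" and "b = partial j R x"
 have "2 * p + (- a - b) / 2 + (2 * q + (- a - b) / 2) = 0"
  using symbol_coefficients(3)[OF x, of i j] assms(2) unfolding ji s by (simp add: p_def q_def a_def b_def)
 moreover have "2 * p + (- a - b) / 2 + (2 * q + (- a - b) / 2) = 2 * (p + q) - (a + b)"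
  by (simp add: field_simps)
 ultimately have "2 * (p + q) = a + b" by simp
 then have "p + q = (a + b) / 2" by (metis nonzero_mult_div_cancel_left zero_neq_numeral)
 then show ?thesis unfolding p_def q_def a_def b_def .
qed

text \<open>Differentiating \<open>partial_a1_sym\<close> for each of the three pairs by the third
  index gives the values of A + B, D + B and D + A, which determine A. This is the elimination that
  yields the Christoffel symbols.\<close>

lemma partial2_a1:
 assumes x: "x \<in> U" and d: "j \<noteq> k" "j \<noteq> l" "k \<noteq> l"
 shows "partial l (partial k (a1 j)) x = partial l (partial k R) x / 2"
proof -
 have e: "partial n (partial i (a1 m)) x + partial n (partial m (a1 i)) x = (partial n (partial i R) x + partial n (partial m R) x) / 2"
  if im: "i \<noteq> m" for n i m
 proof -
  have "partial n (%y. partial i (a1 m) y + partial m (a1 i) y) x = partial n (%y. 1/2 * (partial i R y + partial m R y)) x"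
   by (rule partial_cong[OF U x]) (simp add: partial_a1_sym[OF _ im])
  moreover have "partial n (%y. partial i (a1 m) y + partial m (a1 i) y) x = partial n (partial i (a1 m)) x + partial n (partial m (a1 i)) x"
   by (rule partial_add) (intro dif[OF _ x] smooth_on_partial a1)+
  moreover have "partial n (%y. 1/2 * (partial i R y + partial m R y)) x = 1/2 * (partial n (partial i R) x + partial n (partial m R) x)"
   by (subst partial_cmult, intro dif[OF _ x] smooth_on_add smooth_on_partial R U, subst partial_add)
    (auto intro!: dif[OF _ x] smooth_on_partial R)
  ultimately show ?thesis by simp
 qed
 have sR: "partial i (partial m R) x = partial m (partial i R) x" for i m by (rule partial_swap[OF R x])
 have sa: "partial i (partial m (a1 n)) x = partial m (partial i (a1 n)) x" for i m n by (rule partial_swap[OF a1 x])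
 define A where "A = partial l (partial k (a1 j)) x"
 define B where "B = partial l (partial j (a1 k)) x"
 define D where "D = partial j (partial k (a1 l)) x"
 define P where "P = partial l (partial j R) x"
 define Q where "Q = partial l (partial k R) x"
 define S where "S = partial j (partial k R) x"
 have 1: "A + B = (Q + P) / 2" using e[of k j l] d unfolding A_def B_def P_def Q_def by simp
 have 2: "D + B = (S + P) / 2" using e[of k l j] d sa[of j l k] sR[of j l] unfolding D_def B_def S_def P_def by simp
 have 3: "D + A = (S + Q) / 2" using e[of j l k] d sa[of k j l] sa[of k l j] sR[of k j] sR[of k l]
  unfolding D_def A_def S_def Q_def by simp
 have "2 * A = (A + B) + (D + A) - (D + B)" by simp
 also have "\<dots> = Q" unfolding 1 2 3 by (simp add: field_simps)
 finally have "A = Q / 2" by (metis nonzero_mult_div_cancel_left zero_neq_numeral)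
 then show ?thesis unfolding A_def Q_def .
qed

text \<open>\<open>partial j\<close> is applied to \<open>partial2_a1\<close>; the left side then
  contains the derivative of a1 j in its own direction, which is 0.\<close>

lemma partial3_R:
 assumes x: "x \<in> U" and d: "j \<noteq> k" "j \<noteq> l" "k \<noteq> l"
 shows "partial j (partial k (partial l R)) x = 0"
proof -
 have "partial k (partial j (a1 j)) y = 0" if "y \<in> U" for y
  by (rule partial_eq_0[OF partial_a1_same that])
 then have "partial l (partial k (partial j (a1 j))) x = 0" by (rule partial_eq_0[OF _ x])
 moreover have "partial l (partial k (partial j (a1 j))) x = partial l (partial j (partial k (a1 j))) x"
  by (rule partial_cong[OF U x]) (rule partial_swap[OF a1])
 moreover have "\<dots> = partial j (partial l (partial k (a1 j))) x"
  by (rule partial_swap[OF smooth_on_partial[OF a1] x])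
 moreover have "\<dots> = partial j (%y. 1/2 * partial l (partial k R) y) x"
  by (rule partial_cong[OF U x]) (simp add: partial2_a1 d)
 moreover have "\<dots> = 1/2 * partial j (partial l (partial k R)) x"
  by (rule partial_cmult) (intro dif[OF _ x] smooth_on_partial R)
 moreover have "partial j (partial l (partial k R)) x = partial j (partial k (partial l R)) x"
  by (rule partial_cong[OF U x]) (rule partial_swap[OF R])
 ultimately show ?thesis by simp
qed

text \<open>Differentiating \<open>partial_a1_sym\<close> once by j and once by k removes both
  coefficient functions, since a1 j is constant in direction j and a1 k in direction k. Together
  with \<open>partial3_R\<close> this says that the mixed derivative of R in j and k depends locally
  on x_j - x_k only.\<close>

lemma partial3_R':
 assumes x: "x \<in> U" and d: "j \<noteq> k"
 shows "partial j (partial j (partial k R)) x + partial k (partial j (partial k R)) x = 0"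
proof -
 have v: "partial i (partial i (partial j (a1 j))) y = 0" "partial i (partial j (a1 j)) y = 0" if "y \<in> U" for y i j
 proof -
  show *: "partial i (partial j (a1 j)) y = 0" by (rule partial_eq_0[OF partial_a1_same that])
  show "partial i (partial i (partial j (a1 j))) y = 0"
   by (rule partial_eq_0[OF _ that], rule partial_eq_0[OF partial_a1_same])
 qed
 have w: "partial k (partial j (partial k (a1 j))) x = 0" for j k
 proof -
  have "partial k (partial j (partial k (a1 j))) x = partial k (partial k (partial j (a1 j))) x"
   by (rule partial_cong[OF U x]) (rule partial_swap[OF a1])
  then show ?thesis using v[OF x] by simp
 qed
 have "partial k (partial j (%y. partial k (a1 j) y + partial j (a1 k) y)) x = partial k (partial j (%y. 1/2 * (partial k R y + partial j R y))) x"
  by (rule partial_cong[OF U x], rule partial_cong[OF U], assumption) (use partial_a1_sym[of _ k j] d in simp)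
 moreover have "partial k (partial j (%y. f y + g y)) x = partial k (partial j f) x + partial k (partial j g) x"
  if fg: "smooth_on U f" "smooth_on U g" for f g
 proof -
  have "partial k (partial j (%y. f y + g y)) x = partial k (%y. partial j f y + partial j g y) x"
   by (rule partial_cong[OF U x], rule partial_add) (intro dif fg, assumption)+
  also have "\<dots> = partial k (partial j f) x + partial k (partial j g) x"
   by (rule partial_add) (intro dif[OF _ x] smooth_on_partial fg)+
  finally show ?thesis .
 qed
 note add = this
 moreover have "partial k (partial j (%y. 1/2 * f y)) x = 1/2 * partial k (partial j f) x" if f: "smooth_on U f" for f
 proof -
  have "partial k (partial j (%y. 1/2 * f y)) x = partial k (%y. 1/2 * partial j f y) x"
   by (rule partial_cong[OF U x], rule partial_cmult) (intro dif f, assumption)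
  also have "\<dots> = 1/2 * partial k (partial j f) x"
   by (rule partial_cmult) (intro dif[OF _ x] smooth_on_partial f)
  finally show ?thesis .
 qed
 ultimately have "partial k (partial j (partial k (a1 j))) x + partial k (partial j (partial j (a1 k))) x = 1/2 * (partial k (partial j (partial k R)) x + partial k (partial j (partial j R)) x)"
  using smooth_on_add[OF U smooth_on_partial[OF R] smooth_on_partial[OF R]] smooth_on_partial[OF a1] smooth_on_partial[OF R] by simp
 moreover have "partial k (partial j (partial j (a1 k))) x = partial j (partial k (partial j (a1 k))) x"
  by (rule partial_swap[OF smooth_on_partial[OF a1] x])
 moreover have "partial k (partial j (partial j R)) x = partial j (partial k (partial j R)) x"
  by (rule partial_swap[OF smooth_on_partial[OF R] x])
 moreover have "partial j (partial k (partial j R)) x = partial j (partial j (partial k R)) x"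
  by (rule partial_cong[OF U x]) (rule partial_swap[OF R])
 ultimately show ?thesis using w[of k j] w[of j k] by (simp add: add.commute)
qed

text \<open>In the coefficient of degree 1 the Laplacian of a1 i cancels the double sum. It is
  evaluated by differentiating the vanishing sum of the derivatives of a1 i and inserting
  \<open>partial2_a1\<close>.\<close>

lemma partial_a0:
 assumes x: "x \<in> U"
 shows "partial i a0 x = 0"
proof -
 have z: "(\<Sum>l\<in>UNIV. partial m (partial l (a1 i)) x) = 0" for m
 proof -
  have "partial m (%y. \<Sum>l\<in>UNIV. partial l (a1 i) y) x = 0"
   using sum_partial_a1 x by (rule partial_eq_0)
  moreover have "partial m (%y. \<Sum>l\<in>UNIV. partial l (a1 i) y) x = (\<Sum>l\<in>UNIV. partial m (partial l (a1 i)) x)"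
   by (rule partial_sum) (intro dif[OF _ x] smooth_on_partial a1)
  ultimately show ?thesis by simp
 qed
 have ii: "partial m (partial i (a1 i)) x = 0" for m by (rule partial_eq_0[OF partial_a1_same x])
 have mm: "partial m (partial m (a1 i)) x = - (\<Sum>l\<in>UNIV - {i,m}. partial m (partial l R) x) / 2" if "m \<noteq> i" for m
 proof -
  have "(\<Sum>l\<in>UNIV. partial m (partial l (a1 i)) x) = partial m (partial i (a1 i)) x + (\<Sum>l\<in>UNIV - {i}. partial m (partial l (a1 i)) x)"
   by (rule sum.remove) auto
  also have "(\<Sum>l\<in>UNIV - {i}. partial m (partial l (a1 i)) x) = partial m (partial m (a1 i)) x + (\<Sum>l\<in>UNIV - {i} - {m}. partial m (partial l (a1 i)) x)"
   by (rule sum.remove) (use that in auto)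
  also have "(\<Sum>l\<in>UNIV - {i} - {m}. partial m (partial l (a1 i)) x) = (\<Sum>l\<in>UNIV - {i,m}. partial m (partial l R) x / 2)"
   by (rule sum.cong) (use that partial2_a1[OF x, of i _ m] in auto)
  finally show ?thesis using z[of m] ii by (simp add: sum_divide_distrib[symmetric] add_eq_0_iff)
 qed
 have "laplacian (a1 i) x = partial i (partial i (a1 i)) x + (\<Sum>m\<in>UNIV - {i}. partial m (partial m (a1 i)) x)"
  unfolding laplacian_def by (rule sum.remove) auto
 also have "\<dots> = - (\<Sum>m\<in>UNIV - {i}. \<Sum>l\<in>UNIV - {i,m}. partial m (partial l R) x) / 2"
  using mm ii by (simp add: sum_negf sum_divide_distrib[symmetric])
 finally show ?thesis using symbol_coefficients(2)[OF x, of i] by simp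
qed

text \<open>What is left of the coefficient of degree 0. This relation is the source of the
  functional equation.\<close>

lemma sum_a1_partial_R:
 assumes x: "x \<in> U"
 shows "(\<Sum>i\<in>UNIV. a1 i x * partial i R x) = 0"
proof -
 have "laplacian a0 x = 0"
  unfolding laplacian_def by (intro sum.neutral ballI, rule partial_eq_0[OF partial_a0 x])
 moreover have "(\<Sum>(i,j,k)\<in>triples. partial i (partial j (partial k R)) x) = 0"
  by (rule sum.neutral) (auto intro!: partial3_R[OF x])
 ultimately show ?thesis using symbol_coefficients(1)[OF x] by simp
qed

end

subsection \<open>Lattice sums\<close>

text \<open>The exponent 3/2 exceeds 1, and a product of two such factors, one per grid coordinate,
  dominates the inverse cube in the plane.\<close>

lemma summable_on_int_powr: "(%m::int. (1 + \<bar>real_of_int m\<bar>) powr (-3/2)) summable_on UNIV"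
proof -
 let ?f = "%m::int. (1 + \<bar>real_of_int m\<bar>) powr (-3/2)"
 have s: "summable (%n. real n powr (-3/2))" by (simp add: summable_real_powr_iff)
 have s1: "summable (%n. real (Suc n) powr (-3/2))" using s by (subst summable_Suc_iff)
 have s2: "summable (%n. real (Suc (Suc n)) powr (-3/2))" using s1 summable_Suc_iff[of "%n. real (Suc n) powr (-3/2)"] by simp
 have "(?f \<circ> int) summable_on UNIV"
  using s1 by (subst summable_on_UNIV_nonneg_real_iff) (auto simp: o_def add.commute)
 then have 1: "?f summable_on (range int)" by (subst summable_on_reindex) auto
 have "(?f \<circ> (%n. - int n - 1)) summable_on UNIV"
  using s2 by (subst summable_on_UNIV_nonneg_real_iff) (auto simp: o_def add.commute abs_if)
 then have 2: "?f summable_on (range (%n. - int n - 1))" by (subst summable_on_reindex) (auto simp: inj_on_def)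
 have "UNIV = range int \<union> range (%n. - int n - 1)"
 proof -
  have "m \<in> range int \<union> range (%n. - int n - 1)" for m
  proof (cases "m \<ge> 0")
   case True
   then show ?thesis by (intro UnI1 image_eqI[of _ _ "nat m"]) auto
  next
   case False
   then show ?thesis by (intro UnI2 image_eqI[of _ _ "nat (- m - 1)"]) auto
  qed
  then show ?thesis by blast
 qed
 moreover have "?f summable_on (range int \<union> range (%n. - int n - 1))"
  by (rule summable_on_Un_disjoint[OF 1 2]) auto
 ultimately show ?thesis by simp
qed

lemma summable_on_int2_powr:
 "(%(m, n). (1 + \<bar>real_of_int m\<bar>) powr (-3/2) * (1 + \<bar>real_of_int n\<bar>) powr (-3/2)) summable_on (UNIV :: (int \<times> int) set)"
proof -
 let ?f = "%m::int. (1 + \<bar>real_of_int m\<bar>) powr (-3/2)"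
 have "((%y. case (x, y) of (m, n) => ?f m * ?f n) has_sum ?f x * infsum ?f UNIV) UNIV" for x
  using has_sum_cmult_right[OF has_sum_infsum[OF summable_on_int_powr], of "?f x"] by simp
 moreover have "(%x. ?f x * infsum ?f UNIV) summable_on UNIV"
  by (rule summable_on_cmult_left[OF summable_on_int_powr])
 ultimately have "(%(m, n). ?f m * ?f n) summable_on (SIGMA m:UNIV. UNIV)"
  by (intro summable_on_SigmaI[where g = "%x. ?f x * infsum ?f UNIV"]) auto
 then show ?thesis by simp
qed

text \<open>Each cell of a grid of width \<delta> / 2 holds at most one point of T, so the sum is
  compared with a fixed sum over the grid. The bound depends on \<delta> and \<epsilon> only, which
  makes it uniform over all translates of a lattice.\<close>

lemma separated_sum_cube_bounded:
 assumes "\<delta> > 0" "\<epsilon> > 0"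
 obtains K where "\<And>T :: complex set. (\<And>x y. x \<in> T ==> y \<in> T ==> x \<noteq> y ==> \<delta> \<le> norm (x - y)) ==> (\<And>s. s \<in> T ==> \<epsilon> \<le> norm s) ==>
  (%s. 1 / norm s ^ 3) summable_on T \<and> infsum (%s. 1 / norm s ^ 3) T \<le> K"
proof -
 define \<eta> where "\<eta> = \<delta> / 2"
 have \<eta>: "\<eta> > 0" using assms by (simp add: \<eta>_def)
 define g where "g = (%m::int. (1 + \<bar>real_of_int m\<bar>) powr (-3/2))"
 define G where "G = (%(m, n). g m * g n)"
 define cell where "cell = (%s::complex. (\<lfloor>Re s / \<eta>\<rfloor>, \<lfloor>Im s / \<eta>\<rfloor>))"
 \<comment> \<open>Chosen so that 1 + |floor (x / \<eta>)| <= 2 + |s| / \<eta> <= c |s|, the 2 being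
   absorbed by |s| >= \<epsilon>.\<close>
 define c where "c = 2 / \<epsilon> + 1 / \<eta>"
 have c: "c > 0" using assms \<eta> by (simp add: c_def add_pos_pos)
 have G: "G summable_on UNIV" using summable_on_int2_powr by (simp add: G_def g_def)
 have G0: "G p \<ge> 0" for p by (simp add: G_def g_def split_def)
 have key: "1 / norm s ^ 3 \<le> c ^ 3 * G (cell s)" if s: "\<epsilon> \<le> norm s" for s
 proof -
  have s0: "norm s > 0" using assms s by linarith
  have fl: "1 + \<bar>real_of_int \<lfloor>x / \<eta>\<rfloor>\<bar> \<le> c * norm s" if "\<bar>x\<bar> \<le> norm s" for x
  proof -
   have "\<bar>real_of_int \<lfloor>x / \<eta>\<rfloor>\<bar> \<le> \<bar>x / \<eta>\<bar> + 1" by linarith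
   also have "\<bar>x / \<eta>\<bar> \<le> norm s / \<eta>" using that \<eta> by (simp add: abs_divide divide_right_mono)
   finally have "1 + \<bar>real_of_int \<lfloor>x / \<eta>\<rfloor>\<bar> \<le> 2 + norm s / \<eta>" by simp
   moreover have "2 \<le> 2 / \<epsilon> * norm s" using s assms by (simp add: field_simps)
   ultimately show ?thesis by (simp add: c_def algebra_simps)
  qed
  have gl: "(c * norm s) powr (-3/2) \<le> g \<lfloor>x / \<eta>\<rfloor>" if "\<bar>x\<bar> \<le> norm s" for x
   unfolding g_def by (rule powr_mono2') (use fl[OF that] in auto)
  have "(c * norm s) powr (-3/2) * (c * norm s) powr (-3/2) \<le> g \<lfloor>Re s / \<eta>\<rfloor> * g \<lfloor>Im s / \<eta>\<rfloor>"
   by (intro mult_mono gl abs_Re_le_cmod abs_Im_le_cmod) (auto simp: g_def)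
  also have "(c * norm s) powr (-3/2) * (c * norm s) powr (-3/2) = (c * norm s) powr (-3)"
   by (simp add: powr_add[symmetric])
  also have "\<dots> = 1 / (c * norm s) ^ 3"
  proof -
   have "c * norm s > 0" using c s0 by simp
   then show ?thesis using powr_numeral[of "c * norm s" "num.Bit1 num.One"] by (simp only: powr_minus_divide)
  qed
  finally have "1 / (c ^ 3 * norm s ^ 3) \<le> G (cell s)"
   by (simp add: G_def cell_def power_mult_distrib)
  then have "c ^ 3 * (1 / (c ^ 3 * norm s ^ 3)) \<le> c ^ 3 * G (cell s)" using c by (intro mult_left_mono) auto
  then show ?thesis using c by simp
 qed
 show thesis
 proof (rule that[of "c ^ 3 * infsum G UNIV"])
  fix T :: "complex set"
  assume sep: "\<And>x y. x \<in> T ==> y \<in> T ==> x \<noteq> y ==> \<delta> \<le> norm (x - y)" and eps: "\<And>s. s \<in> T ==> \<epsilon> \<le> norm s"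
  have inj: "inj_on cell T"
  proof (rule inj_onI, rule ccontr)
   fix x y assume xy: "x \<in> T" "y \<in> T" "cell x = cell y" "x \<noteq> y"
   have *: "\<bar>a - b\<bar> < \<eta>" if "\<lfloor>a / \<eta>\<rfloor> = \<lfloor>b / \<eta>\<rfloor>" for a b
   proof -
    have "\<bar>a / \<eta> - b / \<eta>\<bar> < 1" using that by linarith
    then have "\<bar>a - b\<bar> / \<eta> < 1" using \<eta> by (simp add: diff_divide_distrib[symmetric] abs_divide)
    then show ?thesis using \<eta> by simp
   qed
   have "norm (x - y) \<le> \<bar>Re (x - y)\<bar> + \<bar>Im (x - y)\<bar>" by (rule cmod_le)
   also have "\<dots> < \<eta> + \<eta>" using *[of "Re x" "Re y"] *[of "Im x" "Im y"] xy(3) by (simp add: cell_def)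
   also have "\<dots> = \<delta>" by (simp add: \<eta>_def)
   finally show False using sep[OF xy(1,2,4)] by simp
  qed
  have "G summable_on cell ` T" using G by (rule summable_on_subset_banach) auto
  then have s1: "(%s. G (cell s)) summable_on T" using summable_on_reindex[OF inj, of G] by (simp add: o_def)
  then have s2: "(%s. c ^ 3 * G (cell s)) summable_on T" by (rule summable_on_cmult_right)
  have s3: "(%s. 1 / norm s ^ 3) summable_on T"
   by (rule summable_on_comparison_test[OF s2]) (use key eps in auto)
  moreover have "infsum (%s. 1 / norm s ^ 3) T \<le> infsum (%s. c ^ 3 * G (cell s)) T"
   by (rule infsum_mono[OF s3 s2]) (use key eps in auto)
  moreover have "infsum (%s. c ^ 3 * G (cell s)) T = c ^ 3 * infsum G (cell ` T)"
   unfolding infsum_reindex[OF inj] o_def by (rule infsum_cmult_right) (rule s1)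
  moreover have "infsum G (cell ` T) \<le> infsum G UNIV"
   by (rule infsum_mono_neutral[OF \<open>G summable_on cell ` T\<close> G]) (use G0 in auto)
  moreover have "c ^ 3 * infsum G (cell ` T) \<le> c ^ 3 * infsum G UNIV"
   by (rule mult_left_mono) (use c \<open>infsum G (cell ` T) \<le> infsum G UNIV\<close> in auto)
  ultimately have "infsum (%s. 1 / norm s ^ 3) T \<le> c ^ 3 * infsum G UNIV" by linarith
  with s3 show "(%s. 1 / norm s ^ 3) summable_on T \<and> infsum (%s. 1 / norm s ^ 3) T \<le> c ^ 3 * infsum G UNIV" ..
 qed
qed

text \<open>The Weierstrass series without its term 1 / t^2. Kept apart, it is holomorphic at 0 and
  therefore makes sense on the walls x_i = x_j.\<close>

definition lattice_sum :: "complex set => complex => complex" where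
 "lattice_sum A t = (\<Sum>\<^sub>\<infinity>w\<in>A - {0}. 1 / (t - w)\<^sup>2 - 1 / w\<^sup>2)"

lemma weierstrass_p_eq: "weierstrass_p \<omega>1 \<omega>2 t = 1 / t\<^sup>2 + lattice_sum (period_lattice \<omega>1 \<omega>2) t"
 by (simp add: weierstrass_p_def lattice_sum_def)

text \<open>Discreteness is given quantitatively by a least distance \<delta>; the rank may be 0, 1
  or 2.\<close>

locale discrete_subgroup =
 fixes \<Lambda> :: "complex set" and \<delta> :: real
 assumes zero: "0 \<in> \<Lambda>" and diff: "\<And>x y. x \<in> \<Lambda> ==> y \<in> \<Lambda> ==> x - y \<in> \<Lambda>"
  and pos: "\<delta> > 0" and min_norm: "\<And>x. x \<in> \<Lambda> ==> x \<noteq> 0 ==> \<delta> \<le> norm x"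
begin

lemma uminus: "x \<in> \<Lambda> ==> - x \<in> \<Lambda>"
 using diff[OF zero, of x] by simp

lemma sep: "x \<in> \<Lambda> ==> y \<in> \<Lambda> ==> x \<noteq> y ==> \<delta> \<le> norm (x - y)"
 using min_norm[OF diff, of x y] by simp

lemma closed_subset: "A \<subseteq> \<Lambda> ==> closed A"
 using sep by (intro discrete_imp_closed[OF pos]) (fastforce simp: dist_norm norm_minus_commute)

text \<open>The difference equals t (2 w - t) / ((t - w)^2 w^2), which decays like the inverse cube
  of |w| because |w| <= |t - w| (1 + R / r).\<close>

lemma term_bound:
 assumes w: "w \<in> \<Lambda> - {0}" and t: "norm t \<le> R" "r > 0" "r \<le> norm (t - w)"
 shows "norm (1 / (t - w)\<^sup>2 - 1 / w\<^sup>2) \<le> R * (2 + R / \<delta>) * (1 + R / r)\<^sup>2 * (1 / norm w ^ 3)"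
proof -
 have R: "R \<ge> 0" using t norm_ge_zero order_trans by blast
 have w0: "norm w > 0" "norm w \<ge> \<delta>" using w min_norm by auto
 have tw: "t - w \<noteq> 0" using t by auto
 have "norm w \<le> norm (t - w) + R"
  using norm_triangle_ineq4[of t "t - w"] t by simp
 also have "\<dots> \<le> norm (t - w) + norm (t - w) * (R / r)"
  using mult_right_mono[OF t(3), of "R / r"] R t by simp
 finally have 1: "norm w \<le> norm (t - w) * (1 + R / r)" by (simp add: algebra_simps)
 have "norm (2 * w - t) \<le> 2 * norm w + R" using norm_triangle_ineq4[of "2 * w" t] t by simp
 also have "\<dots> \<le> 2 * norm w + norm w * (R / \<delta>)"
  using mult_right_mono[OF w0(2), of "R / \<delta>"] R pos by simp
 finally have 2: "norm (2 * w - t) \<le> (2 + R / \<delta>) * norm w" by (simp add: algebra_simps)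
 have "1 / (t - w)\<^sup>2 - 1 / w\<^sup>2 = t * (2 * w - t) / ((t - w)\<^sup>2 * w\<^sup>2)"
  using tw w0 by (simp add: field_simps) (simp add: power2_eq_square algebra_simps)
 then have "norm (1 / (t - w)\<^sup>2 - 1 / w\<^sup>2) = norm t * norm (2 * w - t) / ((norm (t - w))\<^sup>2 * (norm w)\<^sup>2)"
  by (simp add: norm_mult norm_divide norm_power)
 also have "\<dots> \<le> R * ((2 + R / \<delta>) * norm w) / ((norm (t - w))\<^sup>2 * (norm w)\<^sup>2)"
  using t R 2 by (intro divide_right_mono mult_mono) auto
 also have "\<dots> = R * (2 + R / \<delta>) * (1 / (norm w * (norm (t - w))\<^sup>2))"
  using w0 by (simp add: power2_eq_square)
 also have "1 / (norm w * (norm (t - w))\<^sup>2) \<le> (1 + R / r)\<^sup>2 * (1 / norm w ^ 3)"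
 proof -
  have "(norm w)\<^sup>2 \<le> (norm (t - w))\<^sup>2 * (1 + R / r)\<^sup>2"
   using power_mono[OF 1, of 2] by (simp add: power_mult_distrib)
  then have "(norm w)\<^sup>2 / (norm w ^ 3 * (norm (t - w))\<^sup>2) \<le> ((norm (t - w))\<^sup>2 * (1 + R / r)\<^sup>2) / (norm w ^ 3 * (norm (t - w))\<^sup>2)"
   by (intro divide_right_mono) auto
  then show ?thesis using w0 tw by (simp add: power2_eq_square power3_eq_cube)
 qed
 finally show ?thesis using R pos by (simp add: mult_left_mono mult.assoc)
qed

lemma summable_cube: "A \<subseteq> \<Lambda> - {0} ==> (%w. 1 / norm w ^ 3) summable_on A"
proof -
 assume A: "A \<subseteq> \<Lambda> - {0}"
 obtain K where K: "\<And>T :: complex set. (\<And>x y. x \<in> T ==> y \<in> T ==> x \<noteq> y ==> \<delta> \<le> norm (x - y)) ==> (\<And>s. s \<in> T ==> \<delta> \<le> norm s) ==>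
  (%s. 1 / norm s ^ 3) summable_on T \<and> infsum (%s. 1 / norm s ^ 3) T \<le> K"
  using separated_sum_cube_bounded[OF pos pos] by blast
 show ?thesis
 proof (rule conjunct1[OF K])
  show "\<delta> \<le> norm (x - y)" if "x \<in> A" "y \<in> A" "x \<noteq> y" for x y
   by (rule sep) (use A that in auto)
  show "\<delta> \<le> norm x" if "x \<in> A" for x
   by (rule min_norm) (use A that in auto)
 qed
qed

text \<open>The index set A is arbitrary so that a single pole can be removed from the sum. A ball
  of radius 2 r about t that misses A keeps all points of the ball of radius r at distance at least
  r from A, as \<open>term_bound\<close> requires.\<close>

lemma partial_sum_local:
 assumes A: "A \<subseteq> \<Lambda> - {0}" and t: "t \<notin> A"
 obtains r where "r > 0"
  "(%t. \<Sum>\<^sub>\<infinity>w\<in>A. 1 / (t - w)\<^sup>2 - 1 / w\<^sup>2) holomorphic_on ball t r"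
  "((%w. - 2 / (t - w) ^ 3) has_sum deriv (%t. \<Sum>\<^sub>\<infinity>w\<in>A. 1 / (t - w)\<^sup>2 - 1 / w\<^sup>2) t) A"
  "(%w. 1 / (t - w)\<^sup>2 - 1 / w\<^sup>2) summable_on A"
proof -
 have "open (- A)" by (rule open_Compl[OF closed_subset]) (use A in blast)
 then obtain r where r: "r > 0" "ball t (2 * r) \<subseteq> - A"
 proof -
  obtain e where "e > 0" "ball t e \<subseteq> - A" using \<open>open (- A)\<close> t openE by blast
  then show thesis by (intro that[of "e / 2"]) auto
 qed
 define R where "R = norm t + r"
 define M where "M = (%w::complex. R * (2 + R / \<delta>) * (1 + R / r)\<^sup>2 * (1 / norm w ^ 3))"
 have M: "M summable_on A" unfolding M_def by (intro summable_on_cmult_right summable_cube A)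
 have far: "r \<le> norm (s - w)" if "s \<in> ball t r" "w \<in> A" for s w
 proof -
  have "w \<notin> ball t (2 * r)" using r that by blast
  then have "2 * r \<le> norm (t - w)" by (simp add: dist_norm)
  then show ?thesis using that(1) norm_triangle_ineq[of "t - s" "s - w"] by (simp add: dist_norm)
 qed
 have bd: "norm (1 / (s - w)\<^sup>2 - 1 / w\<^sup>2) \<le> M w" if "w \<in> A" "s \<in> ball t r" for w s
  unfolding M_def
 proof (rule term_bound)
  show "norm s \<le> R" using that norm_triangle_ineq[of t "s - t"] by (simp add: R_def dist_norm norm_minus_commute)
 qed (use A r far that in auto)
 have hol: "(%s. 1 / (s - w)\<^sup>2 - 1 / w\<^sup>2) holomorphic_on ball t r" if "w \<in> A" for w
 proof (intro holomorphic_intros)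
  show "(s - w)\<^sup>2 \<noteq> 0" if "s \<in> ball t r" for s using far[OF that \<open>w \<in> A\<close>] r by auto
 qed
 have tw: "t - w \<noteq> 0" if "w \<in> A" for w using that t by auto
 have der: "deriv (%s. 1 / (s - w)\<^sup>2 - 1 / w\<^sup>2) t = - 2 / (t - w) ^ 3" if "w \<in> A" for w
 proof (rule DERIV_imp_deriv)
  have "((%s. 1 / (s - w)\<^sup>2) has_field_derivative - 2 / (t - w) ^ 3) (at t)"
  proof -
   have "((%s. (s - w)\<^sup>2) has_field_derivative 2 * (t - w)) (at t)"
    by (auto intro!: derivative_eq_intros)
   then have 1: "((%s. inverse ((s - w)\<^sup>2)) has_field_derivative - (2 * (t - w) * inverse (((t - w)\<^sup>2)\<^sup>2))) (at t)"
    using DERIV_inverse_fun[of "%s. (s - w)\<^sup>2"] tw[OF that] by (simp add: numeral_2_eq_2)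
   have e: "2 * u * inverse ((u\<^sup>2)\<^sup>2) = 2 / u ^ 3" if "u \<noteq> 0" for u :: complex
    using that by (simp add: field_simps power2_eq_square power3_eq_cube)
   show ?thesis using 1[unfolded e[OF tw[OF that]]] unfolding inverse_eq_divide by simp
  qed
  then show "((%s. 1 / (s - w)\<^sup>2 - 1 / w\<^sup>2) has_field_derivative - 2 / (t - w) ^ 3) (at t)"
   using DERIV_diff[OF _ DERIV_const, of "%s. 1 / (s - w)\<^sup>2" "- 2 / (t - w) ^ 3" t UNIV "1 / w\<^sup>2"] by simp
 qed
 show thesis
 proof (rule that[OF r(1)])
  show "(%t. \<Sum>\<^sub>\<infinity>w\<in>A. 1 / (t - w)\<^sup>2 - 1 / w\<^sup>2) holomorphic_on ball t r"
   by (rule holomorphic_infsum(1)[OF open_ball hol bd M])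
  have "((%w. deriv (%s. 1 / (s - w)\<^sup>2 - 1 / w\<^sup>2) t) has_sum deriv (%t. \<Sum>\<^sub>\<infinity>w\<in>A. 1 / (t - w)\<^sup>2 - 1 / w\<^sup>2) t) A"
   by (rule holomorphic_infsum(2)[OF open_ball hol bd M]) (use r in auto)
  then show "((%w. - 2 / (t - w) ^ 3) has_sum deriv (%t. \<Sum>\<^sub>\<infinity>w\<in>A. 1 / (t - w)\<^sup>2 - 1 / w\<^sup>2) t) A"
   by (subst (asm) has_sum_cong[OF der])
  have "(%w. norm (1 / (t - w)\<^sup>2 - 1 / w\<^sup>2)) summable_on A"
   by (rule summable_on_comparison_test[OF M]) (use bd r in auto)
  then show "(%w. 1 / (t - w)\<^sup>2 - 1 / w\<^sup>2) summable_on A"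
   by (rule abs_summable_summable)
 qed
qed

lemma lattice_sum_holomorphic: "lattice_sum \<Lambda> holomorphic_on - (\<Lambda> - {0})"
proof (rule holomorphic_on_open[THEN iffD2])
 show "open (- (\<Lambda> - {0}))" by (rule open_Compl[OF closed_subset]) blast
 show "\<forall>t\<in>- (\<Lambda> - {0}). \<exists>f'. (lattice_sum \<Lambda> has_field_derivative f') (at t)"
 proof
  fix t assume "t \<in> - (\<Lambda> - {0})"
  then have t: "t \<notin> \<Lambda> - {0}" by blast
  obtain r where r: "r > 0" "(%t. \<Sum>\<^sub>\<infinity>w\<in>\<Lambda> - {0}. 1 / (t - w)\<^sup>2 - 1 / w\<^sup>2) holomorphic_on ball t r"
   using partial_sum_local[OF order_refl t] by blast
  then have "(%t. \<Sum>\<^sub>\<infinity>w\<in>\<Lambda> - {0}. 1 / (t - w)\<^sup>2 - 1 / w\<^sup>2) field_differentiable at t"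
   by (intro holomorphic_on_imp_differentiable_at[OF r(2)]) auto
  then show "\<exists>f'. (lattice_sum \<Lambda> has_field_derivative f') (at t)"
   unfolding lattice_sum_def[abs_def] field_differentiable_def .
 qed
qed

text \<open>The differentiated series is a sum of inverse cubes over the translate t - \<Lambda>,
  whose points are again \<delta>-separated and at least \<epsilon> away from 0. A global bound of
  this kind is available for the derivative and feeds Liouville's theorem.\<close>

lemma deriv_lattice_sum_bounded:
 assumes "\<epsilon> > 0"
 obtains K where "\<And>t. (\<And>w. w \<in> \<Lambda> ==> \<epsilon> \<le> norm (t - w)) ==> norm (deriv (lattice_sum \<Lambda>) t) \<le> K"
proof -
 obtain K where K: "\<And>T :: complex set. (\<And>x y. x \<in> T ==> y \<in> T ==> x \<noteq> y ==> \<delta> \<le> norm (x - y)) ==> (\<And>s. s \<in> T ==> \<epsilon> \<le> norm s) ==>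
  (%s. 1 / norm s ^ 3) summable_on T \<and> infsum (%s. 1 / norm s ^ 3) T \<le> K"
  using separated_sum_cube_bounded[OF pos assms] by blast
 show thesis
 proof (rule that[of "2 * K"])
  fix t assume far: "\<And>w. w \<in> \<Lambda> ==> \<epsilon> \<le> norm (t - w)"
  have t: "t \<notin> \<Lambda> - {0}" using far[of t] assms by auto
  have hs: "((%w. - 2 / (t - w) ^ 3) has_sum deriv (lattice_sum \<Lambda>) t) (\<Lambda> - {0})"
   unfolding lattice_sum_def[abs_def] using partial_sum_local[OF order_refl t] by blast
  let ?T = "(%w. t - w) ` (\<Lambda> - {0})"
  have inj: "inj_on (%w. t - w) (\<Lambda> - {0})" by (auto simp: inj_on_def)
  have KT: "(%s. 1 / norm s ^ 3) summable_on ?T \<and> infsum (%s. 1 / norm s ^ 3) ?T \<le> K"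
  proof (rule K)
   fix x y assume "x \<in> ?T" "y \<in> ?T" "x \<noteq> y"
   then obtain a b where ab: "x = t - a" "y = t - b" "a \<in> \<Lambda>" "b \<in> \<Lambda>" "a \<noteq> b" by blast
   then have "norm (x - y) = norm (b - a)" by simp
   then show "\<delta> \<le> norm (x - y)" using sep[of b a] ab by simp
  qed (use far in auto)
  then have "((%w. 1 / norm (t - w) ^ 3) has_sum infsum (%s. 1 / norm s ^ 3) ?T) (\<Lambda> - {0})"
   using has_sum_reindex[OF inj, of "%s. 1 / norm s ^ 3"] has_sum_infsum by (auto simp: o_def)
  then have "((%w. 2 * (1 / norm (t - w) ^ 3)) has_sum 2 * infsum (%s. 1 / norm s ^ 3) ?T) (\<Lambda> - {0})"
   by (rule has_sum_cmult_right)
  then have "norm (deriv (lattice_sum \<Lambda>) t) \<le> 2 * infsum (%s. 1 / norm s ^ 3) ?T"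
   by (rule norm_infsum_le[OF hs]) (simp add: norm_divide norm_power)
  then show "norm (deriv (lattice_sum \<Lambda>) t) \<le> 2 * K" using KT by linarith
 qed
qed

lemma lattice_sum_0: "lattice_sum \<Lambda> 0 = 0"
 by (simp add: lattice_sum_def)

lemma lattice_sum_uminus: "lattice_sum \<Lambda> (- t) = lattice_sum \<Lambda> t"
proof -
 have "uminus ` (\<Lambda> - {0}) = \<Lambda> - {0}"
 proof (intro equalityI subsetI)
  fix x assume "x \<in> \<Lambda> - {0}"
  then show "x \<in> uminus ` (\<Lambda> - {0})" using uminus[of x] by (intro image_eqI[of _ _ "- x"]) auto
 qed (use uminus in auto)
 then have "lattice_sum \<Lambda> (- t) = infsum (%w. 1 / (- t - w)\<^sup>2 - 1 / w\<^sup>2) (uminus ` (\<Lambda> - {0}))"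
  by (simp add: lattice_sum_def)
 also have "\<dots> = infsum ((%w. 1 / (- t - w)\<^sup>2 - 1 / w\<^sup>2) \<circ> uminus) (\<Lambda> - {0})"
  by (rule infsum_reindex) auto
 also have "\<dots> = lattice_sum \<Lambda> t"
  unfolding lattice_sum_def by (rule infsum_cong) (simp add: power2_eq_square algebra_simps)
 finally show ?thesis .
qed

text \<open>The term of w is split off; the remaining sum has no pole in the ball by
  separation.\<close>

lemma lattice_sum_pole:
 assumes w: "w \<in> \<Lambda>" "w \<noteq> 0"
 obtains g where "g holomorphic_on ball w \<delta>" "\<And>t. t \<in> ball w \<delta> - {w} ==> lattice_sum \<Lambda> t = 1 / (t - w)\<^sup>2 + g t"
proof -
 define A where "A = \<Lambda> - {0,w}"
 define g where "g = (%t. (\<Sum>\<^sub>\<infinity>w\<in>A. 1 / (t - w)\<^sup>2 - 1 / w\<^sup>2) - 1 / w\<^sup>2)"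
 have A: "A \<subseteq> \<Lambda> - {0}" by (auto simp: A_def)
 have tA: "t \<notin> A" if "t \<in> ball w \<delta>" for t using that sep[of w t] w by (auto simp: A_def dist_norm)
 have "(%t. \<Sum>\<^sub>\<infinity>w\<in>A. 1 / (t - w)\<^sup>2 - 1 / w\<^sup>2) holomorphic_on ball w \<delta>"
 proof (rule holomorphic_on_open[THEN iffD2, OF open_ball], intro ballI)
  fix t assume t: "t \<in> ball w \<delta>"
  obtain r where r: "r > 0" "(%t. \<Sum>\<^sub>\<infinity>w\<in>A. 1 / (t - w)\<^sup>2 - 1 / w\<^sup>2) holomorphic_on ball t r"
   using partial_sum_local[OF A tA[OF t]] by blast
  then have "(%t. \<Sum>\<^sub>\<infinity>w\<in>A. 1 / (t - w)\<^sup>2 - 1 / w\<^sup>2) field_differentiable at t"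
   by (intro holomorphic_on_imp_differentiable_at[OF r(2)]) auto
  then show "\<exists>f'. ((%t. \<Sum>\<^sub>\<infinity>w\<in>A. 1 / (t - w)\<^sup>2 - 1 / w\<^sup>2) has_field_derivative f') (at t)"
   unfolding field_differentiable_def .
 qed
 then have "g holomorphic_on ball w \<delta>" unfolding g_def by (intro holomorphic_intros)
 moreover have "lattice_sum \<Lambda> t = 1 / (t - w)\<^sup>2 + g t" if t: "t \<in> ball w \<delta> - {w}" for t
 proof -
  have tA': "t \<notin> A" using t by (intro tA) auto
  have s: "(%w. 1 / (t - w)\<^sup>2 - 1 / w\<^sup>2) summable_on A" using partial_sum_local[OF A tA'] by blast
  have "\<Lambda> - {0} = insert w A" "w \<notin> A" using w by (auto simp: A_def)
  then have "lattice_sum \<Lambda> t = (1 / (t - w)\<^sup>2 - 1 / w\<^sup>2) + (\<Sum>\<^sub>\<infinity>w\<in>A. 1 / (t - w)\<^sup>2 - 1 / w\<^sup>2)"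
   unfolding lattice_sum_def using infsum_insert[OF s, of w] by simp
  then show ?thesis by (simp add: g_def)
 qed
 ultimately show thesis by (rule that)
qed

end

subsection \<open>The duplication formula and entire continuation\<close>

lemma holomorphic_eq_on_punctured_ball:
 assumes "f holomorphic_on ball a r" "g holomorphic_on ball a r" "r > 0"
  and "\<And>z. z \<in> ball a r - {a} ==> f z = g z" and "z \<in> ball a r"
 shows "f z = g z"
proof (rule analytic_continuation_open[of "ball a r - {a}" "ball a r" f g])
 have "a + of_real (r / 2) \<in> ball a r - {a}" using assms(3) by (auto simp: dist_norm)
 then show "ball a r - {a} \<noteq> {}" by blast
qed (use assms in auto)

lemma holomorphic_deriv_eq_0_punctured_ball:
 assumes "\<And>z. z \<in> ball 0 r - {0} ==> (f has_field_derivative 0) (at z)" 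
 obtains c :: complex where "\<And>z. z \<in> ball 0 r - {0} ==> f z = c"
proof -
 have "connected (ball (0::complex) r - {0})" by (rule connected_punctured_ball) simp
 moreover have "continuous_on (ball 0 r - {0}) f"
  using assms by (intro continuous_at_imp_continuous_on ballI DERIV_isCont)
 moreover have "open (ball (0::complex) r - {0})" by (intro open_delete open_ball)
 ultimately obtain c where "\<And>z. z \<in> ball 0 r - {0} ==> f z = c"
  using DERIV_zero_connected_constant[of "ball 0 r - {0}" "{}" f] assms by (metis Diff_empty finite.emptyI)
 then show thesis by (rule that)
qed

text \<open>An indicial argument at the singular point 0. If d had a zero of order n there,
  comparing the lowest coefficients on both sides would give n \<alpha>(0) = \<beta>(0).\<close>

lemma euler_equation_zero:
 assumes r: "r > 0" and d: "d holomorphic_on ball 0 r" and \<alpha>: "\<alpha> holomorphic_on ball 0 r" and \<beta>: "\<beta> holomorphic_on ball 0 r"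
  and eq: "\<And>z. z \<in> ball 0 r - {0} ==> z * deriv d z * \<alpha> z = d z * \<beta> z"
  and ne: "\<And>n::nat. of_nat n * \<alpha> 0 \<noteq> \<beta> 0" and z: "z \<in> ball 0 r"
 shows "d z = 0"
proof -
 have eq': "z * deriv d z * \<alpha> z = d z * \<beta> z" if "z \<in> ball 0 r" for z
  by (rule holomorphic_eq_on_punctured_ball[OF _ _ r eq that]) (intro holomorphic_intros holomorphic_deriv d \<alpha> \<beta> open_ball)+
 have "d 0 * \<beta> 0 = 0" using eq'[of 0] r by simp
 then have d0: "d 0 = 0" using ne[of 0] by simp
 have "d constant_on ball 0 r"
 proof (rule ccontr)
  assume nc: "\<not> d constant_on ball 0 r"
  have r0: "0 \<in> ball 0 r" using r by simp
  have "\<exists>g e n. 0 < n \<and> 0 < e \<and> ball (0::complex) e \<subseteq> ball 0 r \<and> g holomorphic_on ball 0 e \<and>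
   (\<forall>w\<in>ball 0 e. d w = w ^ n * g w) \<and> (\<forall>w\<in>ball 0 e. g w \<noteq> 0)"
  proof (rule holomorphic_factor_zero_nonconstant[OF d open_ball connected_ball r0 d0 nc])
   fix g e and n :: nat
   assume "0 < n" "0 < e" "ball (0::complex) e \<subseteq> ball 0 r" "g holomorphic_on ball 0 e"
    "\<And>w. w \<in> ball 0 e ==> d w = (w - 0) ^ n * g w" "\<And>w. w \<in> ball 0 e ==> g w \<noteq> 0"
   then show ?thesis by (intro exI[of _ g] exI[of _ e] exI[of _ n]) simp
  qed
  then obtain g e and n :: nat where n: "0 < n" "0 < e" "ball (0::complex) e \<subseteq> ball 0 r" and g: "g holomorphic_on ball 0 e"
   and dg': "\<forall>w\<in>ball 0 e. d w = w ^ n * g w" and gz': "\<forall>w\<in>ball 0 e. g w \<noteq> 0"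
   by blast
  note dg = bspec[OF dg'] and gz = bspec[OF gz']
  \<comment> \<open>The difference of the two sides of the equation after division by w^n.\<close>
  define f where "f = (%w. (of_nat n * g w + w * deriv g w) * \<alpha> w - g w * \<beta> w)"
  have fz: "f w = 0" if w: "w \<in> ball 0 e - {0}" for w
  proof -
   have gd: "(g has_field_derivative deriv g w) (at w)" using holomorphic_derivI[OF g open_ball] w by blast
   have "((%w. w ^ n * g w) has_field_derivative of_nat n * w ^ (n - 1) * g w + w ^ n * deriv g w) (at w)"
    using gd by (auto intro!: derivative_eq_intros)
   then have "(d has_field_derivative of_nat n * w ^ (n - 1) * g w + w ^ n * deriv g w) (at w)"
    by (rule has_field_derivative_transform_within_open[OF _ open_ball[of 0 e]]) (use w dg' in auto)
   then have "w * deriv d w = w * (of_nat n * w ^ (n - 1) * g w + w ^ n * deriv g w)" by (simp add: DERIV_imp_deriv)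
   also have "\<dots> = w ^ n * (of_nat n * g w + w * deriv g w)"
    using n(1) by (cases n) (auto simp: algebra_simps)
   finally have e1: "w * deriv d w = w ^ n * (of_nat n * g w + w * deriv g w)" .
   have "w ^ n * (of_nat n * g w + w * deriv g w) * \<alpha> w = w ^ n * g w * \<beta> w"
   proof -
    have we: "w \<in> ball 0 e" using w by blast
    then have "w \<in> ball 0 r" by (rule subsetD[OF n(3)])
    from eq'[OF this] show ?thesis unfolding e1 dg[OF we] .
   qed
   moreover have "w ^ n * f w = w ^ n * (of_nat n * g w + w * deriv g w) * \<alpha> w - w ^ n * g w * \<beta> w"
    by (simp add: f_def algebra_simps)
   ultimately have "w ^ n * f w = 0" by simp
   then show ?thesis using w by simp
  qed
  have "f holomorphic_on ball 0 e"
   unfolding f_def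
   by (intro holomorphic_intros holomorphic_deriv g open_ball holomorphic_on_subset[OF \<alpha> n(3)] holomorphic_on_subset[OF \<beta> n(3)])
  note holf = this
  have f0: "f 0 = 0"
   by (rule holomorphic_eq_on_punctured_ball[OF holf holomorphic_on_const n(2) fz]) (use n(2) in auto)
  have "g 0 * (of_nat n * \<alpha> 0 - \<beta> 0) = f 0" by (simp add: f_def algebra_simps)
  then have "g 0 * (of_nat n * \<alpha> 0 - \<beta> 0) = 0" using f0 by (simp only:)
  then show False using ne[of n] gz[of 0] n by simp
 qed
 then obtain c where c: "\<forall>w\<in>ball 0 r. d w = c" unfolding constant_on_def by blast
 have "0 \<in> ball (0::complex) r" using r by simp
 from bspec[OF c z] bspec[OF c this] d0 show ?thesis by (simp only:)
qed

text \<open>\<open>Y\<close> is the right-hand side of the duplication formula, and q1, q2, q3 stand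
  for the derivatives of q. The quantity being squared is half the derivative of \<open>Y\<close>,
  because the formula will be used at half the argument. So the right-hand side obeys the same
  first-order equation as q.\<close>

lemma duplication_algebra:
 fixes q q1 q2 q3 \<kappa> \<kappa>2 :: complex
 assumes "q1 \<noteq> 0" "q1\<^sup>2 = 4 * q ^ 3 + 2 * \<kappa> * q + \<kappa>2" "q2 = 6 * q\<^sup>2 + \<kappa>" "q3 = 12 * q * q1"
 defines "Y \<equiv> - 2 * q + (q2 / q1)\<^sup>2 / 4"
 shows "((- 2 * q1 + (q2 / q1) * ((q3 * q1 - q2 * q2) / q1\<^sup>2) / 2) / 2)\<^sup>2 = 4 * Y ^ 3 + 2 * \<kappa> * Y + \<kappa>2"
proof -
 define p where "p = q1\<^sup>2"
 have p: "p \<noteq> 0" using assms(1) by (simp add: p_def)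
 have pq: "p = 4 * q ^ 3 + 2 * \<kappa> * q + \<kappa>2" using assms by (simp add: p_def)
 define A where "A = - 2 * p\<^sup>2 + 6 * q * p * q2 - q2 ^ 3 / 2"
 define B where "B = q2\<^sup>2 - 8 * q * p"
 have q31: "q3 * q1 = 12 * q * p" using assms by (simp add: p_def power2_eq_square)
 have Y: "Y = B / (4 * p)" using p unfolding Y_def B_def power_divide p_def[symmetric] by (simp add: field_simps)
 have "(- 2 * q1 + (q2 / q1) * ((q3 * q1 - q2 * q2) / q1\<^sup>2) / 2) / 2 = A / (2 * q1 * p)"
  using assms(1) p unfolding q31 A_def p_def[symmetric]
  by (simp add: field_simps power2_eq_square power3_eq_cube) (simp add: p_def power2_eq_square)
 then have s1: "((- 2 * q1 + (q2 / q1) * ((q3 * q1 - q2 * q2) / q1\<^sup>2) / 2) / 2)\<^sup>2 = A\<^sup>2 / (4 * p ^ 3)"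
  by (simp add: power_divide power_mult_distrib p_def power_mult[symmetric])
 have s2: "4 * Y ^ 3 + 2 * \<kappa> * Y + \<kappa>2 = (B ^ 3 + 8 * \<kappa> * B * p\<^sup>2 + 16 * \<kappa>2 * p ^ 3) / (16 * p ^ 3)"
  using p unfolding Y by (simp add: field_simps power2_eq_square power3_eq_cube)
 have s3: "4 * A\<^sup>2 = B ^ 3 + 8 * \<kappa> * B * p\<^sup>2 + 16 * \<kappa>2 * p ^ 3"
 proof -
  have A2: "2 * A = - 4 * p\<^sup>2 + 12 * q * p * q2 - q2 ^ 3" by (simp add: A_def algebra_simps)
  \<comment> \<open>The two brackets on the right vanish by the equations for q2 and p; their
    cofactors show that the difference lies in the ideal they generate.\<close>
  have "(2 * A)\<^sup>2 - (B ^ 3 + 8 * \<kappa> * B * p\<^sup>2 + 16 * \<kappa>2 * p ^ 3) =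
   p\<^sup>2 * (8 * q2\<^sup>2 * (q2 - 6 * q\<^sup>2 - \<kappa>) + 16 * p * (p - 6 * q * q2 + 32 * q ^ 3 + 4 * \<kappa> * q - \<kappa>2))"
   unfolding A2 B_def by (simp add: algebra_simps power2_eq_square power3_eq_cube)
  moreover have "q2 - 6 * q\<^sup>2 - \<kappa> = 0" "p - 6 * q * q2 + 32 * q ^ 3 + 4 * \<kappa> * q - \<kappa>2 = 0"
   unfolding pq assms(3) by (simp_all add: algebra_simps power2_eq_square power3_eq_cube)
  ultimately show ?thesis by (simp add: power_mult_distrib)
 qed
 show ?thesis unfolding s1 s2 s3[symmetric] using p by simp
qed

text \<open>This is f^4 (log f)''' with denominators cleared. For the Weierstrass sigma function it
  expresses \<sigma>(2z) = - \<wp>'(z) \<sigma>(z)^4, and being polynomial in f and its derivatives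
  it is holomorphic wherever f is.\<close>

definition Psi :: "(complex => complex) => complex => complex" where
 "Psi f z = f z * ((f z)\<^sup>2 * deriv (deriv (deriv f)) z - 3 * f z * deriv f z * deriv (deriv f) z + 2 * (deriv f z) ^ 3)"

lemma deriv_eq_on_open:
 assumes "open A" "z \<in> A" "\<And>w. w \<in> A ==> f w = g w"
 shows "deriv f z = deriv g z"
proof (rule deriv_cong_ev)
 show "\<forall>\<^sub>F x in nhds z. f x = g x"
  using assms by (auto simp: eventually_nhds)
qed simp

lemma Psi_eq_on_open:
 assumes "open A" "z \<in> A" "\<And>w. w \<in> A ==> f w = g w"
 shows "Psi f z = Psi g z"
proof -
 have 1: "deriv f w = deriv g w" if "w \<in> A" for w by (rule deriv_eq_on_open[OF assms(1) that assms(3)])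
 have 2: "deriv (deriv f) w = deriv (deriv g) w" if "w \<in> A" for w by (rule deriv_eq_on_open[OF assms(1) that 1])
 have 3: "deriv (deriv (deriv f)) w = deriv (deriv (deriv g)) w" if "w \<in> A" for w by (rule deriv_eq_on_open[OF assms(1) that 2])
 show ?thesis unfolding Psi_def 1[OF assms(2)] 2[OF assms(2)] 3[OF assms(2)] assms(3)[OF assms(2)] ..
qed

lemma Psi_holomorphic: "open A ==> f holomorphic_on A ==> Psi f holomorphic_on A"
 unfolding Psi_def[abs_def] by (intro holomorphic_intros holomorphic_deriv)

text \<open>If a germ at 0 satisfies the doubling rule \<open>f (2 z) = Psi f z\<close>, then applying the rule
 repeatedly doubles the radius of its disc of definition.\<close>

lemma entire_extension:
 assumes \<rho>: "\<rho> > 0" "s holomorphic_on ball 0 \<rho>" and e0: "e0 > 0" "\<And>z. z \<in> ball 0 e0 ==> s (2 * z) = Psi s z"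
 obtains F e where "F holomorphic_on UNIV" "e > 0" "\<And>z. z \<in> ball 0 e ==> F z = s z"
proof -
 define P where "P = (%r f. f holomorphic_on ball 0 r \<and> (\<exists>e>0. \<forall>z\<in>ball 0 e. f z = s z))"
 have double: "\<exists>g. P (2 * r) g" if Pf: "P r f" for r f
 proof -
  obtain e where e: "e > 0" "\<forall>z\<in>ball 0 e. f z = s z" using Pf by (auto simp: P_def)
  define g where "g = (%z. Psi f (z / 2))"
  have "Psi f holomorphic_on ball 0 r" using Pf by (intro Psi_holomorphic) (auto simp: P_def)
  then have "(Psi f \<circ> (%z. z / 2)) holomorphic_on ball 0 (2 * r)"
   by (rule holomorphic_on_compose_gen[rotated]) (auto intro!: holomorphic_intros)
  then have "g holomorphic_on ball 0 (2 * r)" by (simp add: g_def o_def)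
  moreover have "g z = s z" if z: "z \<in> ball 0 (min e e0)" for z
  proof -
   have z2: "z / 2 \<in> ball 0 e" "z / 2 \<in> ball 0 e0" using z e(1) e0(1) by auto
   have "g z = Psi s (z / 2)" unfolding g_def by (rule Psi_eq_on_open[OF open_ball z2(1)]) (use e in auto)
   also have "\<dots> = s z" using e0(2)[OF z2(2)] by simp
   finally show ?thesis .
  qed
  ultimately have "P (2 * r) g" unfolding P_def using e e0 by (intro conjI exI[of _ "min e e0"]) auto
  then show ?thesis by blast
 qed
 have pow: "\<exists>f. P (2 ^ n * \<rho>) f" for n
 proof (induction n)
  case 0
  then show ?case using \<rho> by (intro exI[of _ s]) (auto simp: P_def)
 next
  case (Suc n)
  then show ?case using double by (auto simp: mult.assoc)
 qed
 have "\<exists>f. P (real (Suc n)) f" for n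
 proof -
  obtain m where m: "real (Suc n) / \<rho> < 2 ^ m" using real_arch_pow[of 2] by auto
  then have "real (Suc n) \<le> 2 ^ m * \<rho>" using \<rho> by (simp add: field_simps)
  moreover obtain f where "P (2 ^ m * \<rho>) f" using pow by blast
  ultimately have "P (real (Suc n)) f" unfolding P_def
   by (meson holomorphic_on_subset subset_ball)
  then show ?thesis by blast
 qed
 then obtain f where f: "\<And>n. P (real (Suc n)) (f n)" by metis
 have agree: "f n z = f m z" if nm: "n \<le> m" and z: "z \<in> ball 0 (real (Suc n))" for n m z
 proof -
  obtain e1 where e1: "e1 > 0" "\<forall>z\<in>ball 0 e1. f n z = s z" using f[of n] by (auto simp: P_def)
  obtain e2 where e2: "e2 > 0" "\<forall>z\<in>ball 0 e2. f m z = s z" using f[of m] by (auto simp: P_def)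
  define e where "e = min (min e1 e2) (real (Suc n))"
  have h1: "f n holomorphic_on ball 0 (real (Suc n))" using f by (simp add: P_def)
  have h2: "f m holomorphic_on ball 0 (real (Suc n))"
   using f[of m] nm by (auto simp: P_def intro: holomorphic_on_subset[OF _ subset_ball])
  show ?thesis
  proof (rule analytic_continuation_open[OF open_ball[of 0 e] open_ball _ connected_ball _ h1 h2 _ z])
   show "ball 0 e \<noteq> ({}::complex set)" using e1 e2 by (auto simp: e_def)
   show "ball 0 e \<subseteq> ball (0::complex) (real (Suc n))" by (auto simp: e_def)
   show "f n w = f m w" if "w \<in> ball 0 e" for w
   proof -
    have "w \<in> ball 0 e1" "w \<in> ball 0 e2" using that by (auto simp: e_def)
    then show ?thesis using e1(2) e2(2) by simp
   qed
  qed
 qed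
 define N where "N = (%z::complex. nat \<lceil>norm z\<rceil>)"
 define F where "F = (%z. f (N z) z)"
 have FN: "F z = f n z" if "z \<in> ball 0 (real (Suc n))" for n z
 proof -
  have "norm z \<le> real (N z)" unfolding N_def by linarith
  then have zN: "z \<in> ball 0 (real (Suc (N z)))" by simp
  show ?thesis unfolding F_def using agree[OF _ that, of "N z"] agree[OF _ zN, of n] by (metis nat_le_linear)
 qed
 have "F holomorphic_on UNIV"
 proof (rule holomorphic_on_open[THEN iffD2, OF open_UNIV], intro ballI)
  fix z :: complex
  have "norm z \<le> real (N z)" unfolding N_def by linarith
  then have z: "z \<in> ball 0 (real (Suc (N z)))" by simp
  have "f (N z) holomorphic_on ball 0 (real (Suc (N z)))" using f by (simp add: P_def)
  then have "(f (N z) has_field_derivative deriv (f (N z)) z) (at z)"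
   by (rule holomorphic_derivI[OF _ open_ball z])
  then have "(F has_field_derivative deriv (f (N z)) z) (at z)"
   by (rule has_field_derivative_transform_within_open[OF _ open_ball z]) (rule FN[symmetric])
  then show "\<exists>f'. (F has_field_derivative f') (at z)" by blast
 qed
 moreover obtain e where e: "e > 0" "\<forall>z\<in>ball 0 e. f 0 z = s z" using f[of 0] by (auto simp: P_def)
 moreover have "F z = s z" if "z \<in> ball 0 (min e 1)" for z
  using FN[of z 0] e(2) that by auto
 ultimately show thesis using that[of F "min e 1"] by simp
qed

section \<open>From a germ of the Weierstrass equation to an entire sigma function\<close>

text \<open>In classical notation \<kappa> = -g2 / 2 and \<kappa>2 = -g3. The equation is assumed
  only near 0, and the cubic may have multiple roots.\<close>

locale weierstrass_germ =
 fixes h :: "complex => complex" and \<rho> :: real and \<kappa> \<kappa>2 :: complex and q :: "complex => complex"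
 assumes rho: "\<rho> > 0" and hol_h: "h holomorphic_on ball 0 \<rho>"
  and even: "\<And>z. z \<in> ball 0 \<rho> ==> h (- z) = h z" and h_0: "h 0 = 0"
  and q: "\<And>z. q z = 1 / z\<^sup>2 + h z"
  and ode1: "\<And>z. z \<in> ball 0 \<rho> - {0} ==> (deriv q z)\<^sup>2 = 4 * q z ^ 3 + 2 * \<kappa> * q z + \<kappa>2"
  and ode2: "\<And>z. z \<in> ball 0 \<rho> - {0} ==> deriv (deriv q) z = 6 * (q z)\<^sup>2 + \<kappa>"
begin

abbreviation D :: "complex set" where "D \<equiv> ball 0 \<rho> - {0}"

lemma open_D: "open D" by (intro open_delete open_ball)

lemma hol_deriv_h: "deriv h holomorphic_on ball 0 \<rho>" "deriv (deriv h) holomorphic_on ball 0 \<rho>"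
 by (intro holomorphic_deriv hol_h open_ball)+

lemma hol_q: "q holomorphic_on D"
proof -
 have "(%z. 1 / z\<^sup>2 + h z) holomorphic_on D"
  by (intro holomorphic_intros holomorphic_on_subset[OF hol_h]) auto
 then show ?thesis by (simp add: q[abs_def])
qed

lemma deriv_q: assumes "z \<in> D" shows "(q has_field_derivative - 2 / z ^ 3 + deriv h z) (at z)" "deriv q z = - 2 / z ^ 3 + deriv h z"
proof -
 have z: "z \<noteq> 0" using assms by auto
 have "(h has_field_derivative deriv h z) (at z)" using holomorphic_derivI[OF hol_h open_ball] assms by blast
 then have "((%z. 1 / z\<^sup>2 + h z) has_field_derivative (0 * z\<^sup>2 - 1 * (2 * z)) / (z\<^sup>2 * z\<^sup>2) + deriv h z) (at z)"
  using z by (intro DERIV_add DERIV_divide) (auto intro!: derivative_eq_intros)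
 moreover have "(0 * z\<^sup>2 - 1 * (2 * z)) / (z\<^sup>2 * z\<^sup>2) = - 2 / z ^ 3"
  using z by (simp add: power2_eq_square power3_eq_cube)
 ultimately show "(q has_field_derivative - 2 / z ^ 3 + deriv h z) (at z)" by (simp add: q[abs_def])
 then show "deriv q z = - 2 / z ^ 3 + deriv h z" by (rule DERIV_imp_deriv)
qed

lemma deriv2_q: assumes "z \<in> D" shows "deriv (deriv q) z = 6 / z ^ 4 + deriv (deriv h) z"
proof -
 have z: "z \<noteq> 0" using assms by auto
 have "(deriv h has_field_derivative deriv (deriv h) z) (at z)" using holomorphic_derivI[OF hol_deriv_h(1) open_ball] assms by blast
 then have "((%z. - 2 / z ^ 3 + deriv h z) has_field_derivative (0 * z ^ 3 - (- 2) * (of_nat 3 * z\<^sup>2)) / (z ^ 3 * z ^ 3) + deriv (deriv h) z) (at z)"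
  using z by (intro DERIV_add DERIV_divide) (auto intro!: derivative_eq_intros)
 then have "(deriv q has_field_derivative (0 * z ^ 3 - (- 2) * (of_nat 3 * z\<^sup>2)) / (z ^ 3 * z ^ 3) + deriv (deriv h) z) (at z)"
  by (rule has_field_derivative_transform_within_open[OF _ open_D assms]) (simp add: deriv_q(2))
 moreover have "(0 * z ^ 3 - (- 2) * (of_nat 3 * z\<^sup>2)) / (z ^ 3 * z ^ 3) = 6 / z ^ 4"
  using z by (simp add: field_simps power2_eq_square power3_eq_cube power4_eq_xxxx)
 ultimately show ?thesis by (simp add: DERIV_imp_deriv)
qed

lemma derivs_q:
 assumes "z \<in> D"
 shows "(q has_field_derivative deriv q z) (at z)" "(deriv q has_field_derivative deriv (deriv q) z) (at z)"
  "(deriv (deriv q) has_field_derivative 12 * q z * deriv q z) (at z)"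
proof -
 show 1: "(q has_field_derivative deriv q z) (at z)" by (rule holomorphic_derivI[OF hol_q open_D assms])
 show "(deriv q has_field_derivative deriv (deriv q) z) (at z)"
  by (rule holomorphic_derivI[OF holomorphic_deriv[OF hol_q open_D] open_D assms])
 have "((%z. 6 * (q z)\<^sup>2 + \<kappa>) has_field_derivative 12 * q z * deriv q z) (at z)"
  using 1 by (auto intro!: derivative_eq_intros)
 then show "(deriv (deriv q) has_field_derivative 12 * q z * deriv q z) (at z)"
  by (rule has_field_derivative_transform_within_open[OF _ open_D assms]) (simp add: ode2)
qed

text \<open>The derivative of q freed of its pole by z^3. Its value -2 at 0 shows that the
  derivative of q has no zeros near 0, so that one may divide by it.\<close>

definition w :: "complex => complex" where "w z = - 2 + z ^ 3 * deriv h z"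

lemma hol_w: "w holomorphic_on ball 0 \<rho>"
 unfolding w_def[abs_def] by (intro holomorphic_intros hol_deriv_h)

lemma w_eq: "z \<in> D ==> w z = z ^ 3 * deriv q z"
 by (simp add: w_def deriv_q(2) algebra_simps)

text \<open>The right-hand side, taken at half the argument, satisfies the same first-order equation
  as q and has the same pole 1 / z^2. The difference of the two is holomorphic and solves an
  equation of the type of \<open>euler_equation_zero\<close>, hence is 0.\<close>

lemma duplication:
 obtains r where "r > 0" "r \<le> \<rho>" "\<And>z. z \<in> ball 0 r ==> w z \<noteq> 0"
  "\<And>z. z \<in> ball 0 (r / 2) - {0} ==> q (2 * z) = - 2 * q z + (deriv (deriv q) z / deriv q z)\<^sup>2 / 4"
proof -
 have "continuous (at 0) w"
  using hol_w rho by (intro continuous_on_interior[OF holomorphic_on_imp_continuous_on]) auto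
 moreover have "w 0 \<noteq> 0" by (simp add: w_def)
 ultimately obtain e where e: "e > 0" "\<And>z. dist 0 z < e ==> w z \<noteq> 0"
  using continuous_at_avoid by blast
 define r where "r = min e \<rho>"
 have r: "r > 0" "r \<le> \<rho>" using e rho by (auto simp: r_def)
 have wnz: "w z \<noteq> 0" if "z \<in> ball 0 r" for z using e(2)[of z] that by (simp add: r_def)
 have sub: "ball 0 r \<subseteq> ball (0::complex) \<rho>" using r by auto
 have subD: "z \<in> D" if "z \<in> ball 0 r - {0}" for z using that sub by auto
 note hol = holomorphic_on_subset[OF hol_h sub] holomorphic_on_subset[OF hol_deriv_h(1) sub]
  holomorphic_on_subset[OF hol_deriv_h(2) sub] holomorphic_on_subset[OF hol_w sub]
 \<comment> \<open>Chosen so that q'' / q' = (-3 + z^3 \<psi>) / z with \<psi> holomorphic; squaring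
   this isolates the polar part of Y.\<close>
 define \<psi> where "\<psi> = (%z. (z * deriv (deriv h) z + 3 * deriv h z) / w z)"
 define K where "K = (%z. - (3/2) * z * \<psi> z + z ^ 4 * (\<psi> z)\<^sup>2 / 4 - 2 * h z)"
 define Y where "Y = (%z. - 2 * q z + (deriv (deriv q) z / deriv q z)\<^sup>2 / 4)"
 have holK: "K holomorphic_on ball 0 r"
  unfolding K_def \<psi>_def using wnz by (intro holomorphic_intros hol) auto
 have q1nz: "deriv q z \<noteq> 0" if "z \<in> ball 0 r - {0}" for z
  using w_eq[OF subD[OF that]] wnz[of z] that by auto
 have YK: "Y z = 1 / (4 * z\<^sup>2) + K z" if z: "z \<in> ball 0 r - {0}" for z
 proof -
  have z0: "z \<noteq> 0" and wz: "w z \<noteq> 0" using z wnz[of z] by auto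
  have "deriv (deriv q) z / deriv q z = (6 / z ^ 4 + deriv (deriv h) z) / (w z / z ^ 3)"
   using w_eq[OF subD[OF z]] deriv2_q[OF subD[OF z]] z0 by simp
  also have "\<dots> = (6 + z ^ 4 * deriv (deriv h) z) / (z * w z)"
   using z0 wz by (simp add: field_simps power3_eq_cube power4_eq_xxxx)
  also have "6 + z ^ 4 * deriv (deriv h) z = - 3 * w z + z ^ 3 * (z * deriv (deriv h) z + 3 * deriv h z)"
   by (simp add: w_def algebra_simps power3_eq_cube power4_eq_xxxx)
  also have "\<dots> / (z * w z) = (- 3 + z ^ 3 * \<psi> z) / z"
   using z0 wz by (simp add: \<psi>_def field_simps)
  finally have ratio: "deriv (deriv q) z / deriv q z = (- 3 + z ^ 3 * \<psi> z) / z" .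
  show ?thesis using z0 unfolding Y_def K_def ratio q[of z]
   by (simp add: field_simps power2_eq_square power3_eq_cube power4_eq_xxxx)
 qed
 have holY: "(Y has_field_derivative - 2 * deriv q z + (deriv (deriv q) z / deriv q z) * ((12 * q z * deriv q z * deriv q z - deriv (deriv q) z * deriv (deriv q) z) / (deriv q z)\<^sup>2) / 2) (at z)"
  if z: "z \<in> ball 0 r - {0}" for z
 proof -
  have "((%z. deriv (deriv q) z / deriv q z) has_field_derivative ((12 * q z * deriv q z) * deriv q z - deriv (deriv q) z * deriv (deriv q) z) / (deriv q z * deriv q z)) (at z)"
   by (rule DERIV_divide[OF derivs_q(3)[OF subD[OF z]] derivs_q(2)[OF subD[OF z]] q1nz[OF z]])
  note DERIV_add[OF DERIV_cmult[OF derivs_q(1)[OF subD[OF z]], of "- 2"] DERIV_cdivide[OF DERIV_power[OF this, of 2], of 4]]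
  moreover have "c * a + of_nat 2 * (E / (b * b) * Q ^ (2 - Suc 0)) / 4 = c * a + Q * (E / b\<^sup>2) / 2" for a b c E Q :: complex
   by (simp add: power2_eq_square mult_ac)
  ultimately show ?thesis unfolding Y_def by (simp only:)
 qed
 define k where "k = (%z. K (z / 2))"
 define X where "X = (%z. Y (z / 2))"
 have holk: "k holomorphic_on ball 0 r"
 proof -
  have "(K \<circ> (%z. z / 2)) holomorphic_on ball 0 r"
   by (rule holomorphic_on_compose_gen[OF _ holK]) (use r in \<open>auto intro!: holomorphic_intros\<close>)
  then show ?thesis by (simp add: k_def o_def)
 qed
 have half: "z / 2 \<in> ball 0 r - {0}" if "z \<in> ball 0 r - {0}" for z :: complex using that r by auto
 have Xk: "X z = 1 / z\<^sup>2 + k z" if "z \<in> ball 0 r - {0}" for z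
  using YK[OF half[OF that]] by (simp add: X_def k_def power_divide)
 have X1: "(- 2 / z ^ 3 + deriv k z)\<^sup>2 = 4 * X z ^ 3 + 2 * \<kappa> * X z + \<kappa>2" if z: "z \<in> ball 0 r - {0}" for z
 proof -
  let ?y = "z / 2"
  have yD: "?y \<in> D" by (rule subD[OF half[OF z]])
  let ?Y1 = "- 2 * deriv q ?y + (deriv (deriv q) ?y / deriv q ?y) * ((12 * q ?y * deriv q ?y * deriv q ?y - deriv (deriv q) ?y * deriv (deriv q) ?y) / (deriv q ?y)\<^sup>2) / 2"
  have "((%z. z / 2) has_field_derivative 1 / 2) (at z)" by (auto intro!: derivative_eq_intros)
  then have "(X has_field_derivative ?Y1 * (1 / 2)) (at z)"
   unfolding X_def by (rule DERIV_chain2[where f = Y and g = "%z. z / 2", OF holY[OF half[OF z]]])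
  then have dX: "deriv X z = ?Y1 / 2" by (simp add: DERIV_imp_deriv)
  have z0: "z \<noteq> 0" using z by auto
  have "(k has_field_derivative deriv k z) (at z)" using holomorphic_derivI[OF holk open_ball] z by blast
  then have "((%z. 1 / z\<^sup>2 + k z) has_field_derivative (0 * z\<^sup>2 - 1 * (2 * z)) / (z\<^sup>2 * z\<^sup>2) + deriv k z) (at z)"
   using z0 by (intro DERIV_add DERIV_divide) (auto intro!: derivative_eq_intros)
  moreover have "(0 * z\<^sup>2 - 1 * (2 * z)) / (z\<^sup>2 * z\<^sup>2) = - 2 / z ^ 3"
   using z0 by (simp add: power2_eq_square power3_eq_cube)
  ultimately have "((%z. 1 / z\<^sup>2 + k z) has_field_derivative - 2 / z ^ 3 + deriv k z) (at z)" by simp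
  then have "(X has_field_derivative - 2 / z ^ 3 + deriv k z) (at z)"
   by (rule has_field_derivative_transform_within_open[OF _ open_delete[OF open_ball] z]) (simp add: Xk)
  then have "- 2 / z ^ 3 + deriv k z = ?Y1 / 2" using dX by (simp add: DERIV_imp_deriv)
  moreover have "(?Y1 / 2)\<^sup>2 = 4 * X z ^ 3 + 2 * \<kappa> * X z + \<kappa>2"
   unfolding X_def Y_def
   by (rule duplication_algebra[OF q1nz[OF half[OF z]] ode1[OF yD] ode2[OF yD] refl])
  ultimately show ?thesis by (simp only:)
 qed
 define d where "d = (%z. k z - h z)"
 \<comment> \<open>Subtracting the equations of X and q and factoring gives (X' - q') (X' + q') = (X
   - q) (4 (X^2 + X q + q^2) + 2 \<kappa>). The second factors, freed of poles by z^3 and z^4, are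
   \<alpha> and \<beta>.\<close>
 define \<alpha> where "\<alpha> = (%z. - 4 + z ^ 3 * (deriv k z + deriv h z))"
 define \<beta> where "\<beta> = (%z. 4 * ((1 + z\<^sup>2 * k z)\<^sup>2 + (1 + z\<^sup>2 * k z) * (1 + z\<^sup>2 * h z) + (1 + z\<^sup>2 * h z)\<^sup>2) + 2 * \<kappa> * z ^ 4)"
 have hold: "d holomorphic_on ball 0 r" "\<alpha> holomorphic_on ball 0 r" "\<beta> holomorphic_on ball 0 r"
  unfolding d_def \<alpha>_def \<beta>_def by (intro holomorphic_intros hol holk holomorphic_deriv open_ball)+
 have "d z = 0" if "z \<in> ball 0 r" for z
 proof (rule euler_equation_zero[OF r(1) hold _ _ that])
  fix z :: complex assume z: "z \<in> ball 0 r - {0}"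
  have z0: "z \<noteq> 0" using z by auto
  have "(d has_field_derivative deriv k z - deriv h z) (at z)"
   unfolding d_def by (intro DERIV_diff holomorphic_derivI[OF holk open_ball] holomorphic_derivI[OF hol(1) open_ball]) (use z in auto)
  then have dd: "deriv d z = deriv k z - deriv h z" by (rule DERIV_imp_deriv)
  define x1 q1 x y where "x1 = - 2 / z ^ 3 + deriv k z" and "q1 = - 2 / z ^ 3 + deriv h z" and "x = X z" and "y = q z"
  have e1: "x1\<^sup>2 = 4 * x ^ 3 + 2 * \<kappa> * x + \<kappa>2" using X1[OF z] by (simp add: x1_def x_def)
  have e2: "q1\<^sup>2 = 4 * y ^ 3 + 2 * \<kappa> * y + \<kappa>2" using ode1[OF subD[OF z]] deriv_q(2)[OF subD[OF z]] by (simp add: q1_def y_def)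
  have "(x1 - q1) * (x1 + q1) = x1\<^sup>2 - q1\<^sup>2" by (simp add: power2_eq_square algebra_simps)
  also have "\<dots> = (x - y) * (4 * (x\<^sup>2 + x * y + y\<^sup>2) + 2 * \<kappa>)"
   unfolding e1 e2 by (simp add: power2_eq_square power3_eq_cube algebra_simps)
  finally have main: "(x1 - q1) * (x1 + q1) = (x - y) * (4 * (x\<^sup>2 + x * y + y\<^sup>2) + 2 * \<kappa>)" .
  have f1: "x1 - q1 = deriv d z" by (simp add: x1_def q1_def dd)
  have f2: "x - y = d z" by (simp add: x_def y_def d_def Xk[OF z] q[of z])
  have f3: "z ^ 3 * (x1 + q1) = \<alpha> z" using z0 by (simp add: x1_def q1_def \<alpha>_def field_simps)
  have fx: "z\<^sup>2 * x = 1 + z\<^sup>2 * k z" "z\<^sup>2 * y = 1 + z\<^sup>2 * h z" using z0 by (simp_all add: x_def y_def Xk[OF z] q[of z] field_simps)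
  have f4: "z ^ 4 * (4 * (x\<^sup>2 + x * y + y\<^sup>2) + 2 * \<kappa>) = \<beta> z"
   unfolding \<beta>_def fx[symmetric] by (simp add: algebra_simps power2_eq_square power4_eq_xxxx)
  have "z * deriv d z * \<alpha> z = z ^ 4 * ((x1 - q1) * (x1 + q1))"
   unfolding f1[symmetric] f3[symmetric] by (simp add: algebra_simps power3_eq_cube power4_eq_xxxx)
  also have "\<dots> = d z * \<beta> z" unfolding main f2 f4[symmetric] by (simp add: algebra_simps)
  finally show "z * deriv d z * \<alpha> z = d z * \<beta> z" .
 next
  fix n :: nat
  \<comment> \<open>Here \<alpha> 0 = -4 and \<beta> 0 = 12, so the left side is never
    positive.\<close>
  have "Re (of_nat n * \<alpha> 0) \<noteq> Re (\<beta> 0)" by (simp add: \<alpha>_def \<beta>_def)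
  then show "of_nat n * \<alpha> 0 \<noteq> \<beta> 0" by metis
 qed
 then have kh: "k z = h z" if "z \<in> ball 0 r" for z using that by (simp add: d_def)
 have "q (2 * z) = Y z" if "z \<in> ball 0 (r / 2) - {0}" for z
 proof -
  have z2: "2 * z \<in> ball 0 r - {0}" using that by (auto simp: norm_mult)
  show ?thesis using Xk[OF z2] kh[of "2 * z"] z2 by (simp add: X_def q[of "2 * z"])
 qed
 then show thesis using that[OF r wnz] by (simp add: Y_def)
qed

text \<open>H is a double primitive of -h, so that the logarithm of z exp H has second derivative
  -(1 / z^2 + h) = -q.\<close>

lemma exists_H:
 obtains H H1 where "\<And>z. z \<in> ball 0 \<rho> ==> (H has_field_derivative H1 z) (at z)"
  "\<And>z. z \<in> ball 0 \<rho> ==> (H1 has_field_derivative - h z) (at z)"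
  "H 0 = 0" "H1 0 = 0" "\<And>z. z \<in> ball 0 \<rho> ==> H (- z) = H z"
proof -
 have prim: "\<exists>F. (\<forall>z\<in>ball 0 \<rho>. (F has_field_derivative f z) (at z)) \<and> F 0 = 0" if hf: "f holomorphic_on ball 0 \<rho>" for f :: "complex => complex"
 proof -
  obtain G where G: "\<And>x. x \<in> ball 0 \<rho> ==> (G has_field_derivative f x) (at x within ball 0 \<rho>)"
   using holomorphic_convex_primitive'[OF convex_ball open_ball hf] by metis
  have "((%z. G z - G 0) has_field_derivative f z) (at z)" if "z \<in> ball 0 \<rho>" for z
   using DERIV_diff[OF G[OF that] DERIV_const[of "G 0"]] that by (simp add: at_within_open[OF that open_ball])
  then show ?thesis by (intro exI[of _ "%z. G z - G 0"]) auto
 qed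
 obtain H1 where H1: "\<forall>z\<in>ball 0 \<rho>. (H1 has_field_derivative - h z) (at z)" "H1 0 = 0"
  using prim[OF holomorphic_on_minus[OF hol_h]] by blast
 have "H1 holomorphic_on ball 0 \<rho>"
  using H1(1) by (auto simp: holomorphic_on_open)
 then obtain H where H: "\<forall>z\<in>ball 0 \<rho>. (H has_field_derivative H1 z) (at z)" "H 0 = 0"
  using prim by blast
 have const: "f z = f 0" if "\<And>z. z \<in> ball 0 \<rho> ==> (f has_field_derivative 0) (at z)" "z \<in> ball 0 \<rho>" for f :: "complex => complex" and z
 proof -
  have "(f has_field_derivative 0) (at x within ball 0 \<rho>)" if "x \<in> ball 0 \<rho>" for x
   using has_field_derivative_at_within that(1) \<open>\<And>z. z \<in> ball 0 \<rho> ==> (f has_field_derivative 0) (at z)\<close> by blast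
  then have "\<exists>c. \<forall>x\<in>ball 0 \<rho>. f x = c" by (intro has_field_derivative_zero_constant[OF convex_ball]) auto
  then show ?thesis using that(2) rho by force
 qed
 have neg: "((%z. f (- z)) has_field_derivative - f') (at z)" if "(f has_field_derivative f') (at (- z))" for f f' and z :: complex
  using DERIV_chain2[OF that DERIV_minus[OF DERIV_ident]] by simp
 have m: "- z \<in> ball 0 \<rho>" if "z \<in> ball 0 \<rho>" for z :: complex using that by simp
 have odd: "H1 z + H1 (- z) = 0" if z: "z \<in> ball 0 \<rho>" for z
 proof -
  have "H1 z + H1 (- z) = H1 0 + H1 (- 0)"
  proof (rule const[OF _ z])
   fix z :: complex assume z: "z \<in> ball 0 \<rho>"
   show "((%z. H1 z + H1 (- z)) has_field_derivative 0) (at z)"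
    using DERIV_add[OF bspec[OF H1(1) z] neg[OF bspec[OF H1(1) m[OF z]]]] even[OF z] by simp
  qed
  then show ?thesis using H1(2) by simp
 qed
 have evenH: "H (- z) = H z" if z: "z \<in> ball 0 \<rho>" for z
 proof -
  have "H z - H (- z) = H 0 - H (- 0)"
  proof (rule const[OF _ z])
   fix z :: complex assume z: "z \<in> ball 0 \<rho>"
   show "((%z. H z - H (- z)) has_field_derivative 0) (at z)"
    using DERIV_diff[OF bspec[OF H(1) z] neg[OF bspec[OF H(1) m[OF z]]]] odd[OF z] by (simp add: add.commute)
  qed
  then show ?thesis by simp
 qed
 show thesis
  by (rule that[of H H1]) (use H H1 evenH in auto)
qed

text \<open>The duplication formula of q, integrated twice, becomes the doubling rule for the germ s
  = z exp H. The two integration constants are settled by oddness and by normalisation at 0, after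
  which \<open>entire_extension\<close> applies.\<close>

lemma entire_sigma:
 obtains \<sigma> r where "\<sigma> holomorphic_on UNIV" "0 < r" "r \<le> \<rho>" "\<sigma> 0 = 0" "\<And>z. z \<in> ball 0 r - {0} ==> \<sigma> z \<noteq> 0"
  "\<And>z. \<sigma> (- z) = - \<sigma> z"
  "\<And>z. z \<in> ball 0 r - {0} ==> ((deriv \<sigma> z)\<^sup>2 - \<sigma> z * deriv (deriv \<sigma>) z) / (\<sigma> z)\<^sup>2 = q z"
proof -
 obtain H H1 where H: "\<And>z. z \<in> ball 0 \<rho> ==> (H has_field_derivative H1 z) (at z)"
  and H1: "\<And>z. z \<in> ball 0 \<rho> ==> (H1 has_field_derivative - h z) (at z)"
  and H0: "H 0 = 0" "H1 0 = 0" and evenH: "\<And>z. z \<in> ball 0 \<rho> ==> H (- z) = H z"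
  by (rule exists_H) blast
 obtain r where r: "r > 0" "r \<le> \<rho>" and wnz: "\<And>z. z \<in> ball 0 r ==> w z \<noteq> 0"
  and dup: "\<And>z. z \<in> ball 0 (r / 2) - {0} ==> q (2 * z) = - 2 * q z + (deriv (deriv q) z / deriv q z)\<^sup>2 / 4"
  by (rule duplication) blast
 have holH: "H holomorphic_on ball 0 \<rho>" "H1 holomorphic_on ball 0 \<rho>"
  unfolding holomorphic_on_open[OF open_ball] using H H1 by blast+
 \<comment> \<open>The germ of sigma; its logarithmic derivative \<zeta> satisfies \<zeta>' =
   -q.\<close>
 define s where "s = (%z. z * exp (H z))"
 define \<zeta> where "\<zeta> = (%z. 1 / z + H1 z)"
 have hols: "s holomorphic_on ball 0 \<rho>" unfolding s_def by (intro holomorphic_intros holH)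
 have ds: "(s has_field_derivative s z * \<zeta> z) (at z)" if z: "z \<in> D" for z
 proof -
  have "(s has_field_derivative 1 * exp (H z) + exp (H z) * H1 z * z) (at z)"
   unfolding s_def using z by (intro DERIV_mult DERIV_ident DERIV_chain2[OF DERIV_exp] H) auto
  moreover have "1 * exp (H z) + exp (H z) * H1 z * z = s z * \<zeta> z" using z by (simp add: s_def \<zeta>_def field_simps)
  ultimately show ?thesis by simp
 qed
 have d\<zeta>: "(\<zeta> has_field_derivative - q z) (at z)" if z: "z \<in> D" for z
 proof -
  have "(\<zeta> has_field_derivative (0 * z - 1 * 1) / (z * z) + - h z) (at z)"
   unfolding \<zeta>_def using z by (intro DERIV_add DERIV_divide DERIV_const DERIV_ident H1) auto
  moreover have "(0 * z - 1 * 1) / (z * z) + - h z = - q z" by (simp add: q[of z] power2_eq_square)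
  ultimately show ?thesis by simp
 qed
 have ds1: "deriv s z = s z * \<zeta> z" if "z \<in> D" for z using ds[OF that] by (rule DERIV_imp_deriv)
 have dds: "(deriv s has_field_derivative s z * ((\<zeta> z)\<^sup>2 - q z)) (at z)" if z: "z \<in> D" for z
 proof -
  have "((%z. s z * \<zeta> z) has_field_derivative s z * \<zeta> z * \<zeta> z + - q z * s z) (at z)"
   by (intro DERIV_mult ds d\<zeta> z)
  then have "(deriv s has_field_derivative s z * \<zeta> z * \<zeta> z + - q z * s z) (at z)"
   by (rule has_field_derivative_transform_within_open[OF _ open_D z]) (simp add: ds1)
  then show ?thesis by (simp add: algebra_simps power2_eq_square)
 qed
 have ds2: "deriv (deriv s) z = s z * ((\<zeta> z)\<^sup>2 - q z)" if "z \<in> D" for z using dds[OF that] by (rule DERIV_imp_deriv)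
 have ds3: "deriv (deriv (deriv s)) z = s z * (\<zeta> z ^ 3 - 3 * \<zeta> z * q z - deriv q z)" if z: "z \<in> D" for z
 proof -
  have "((%z. s z * (\<zeta> z * \<zeta> z - q z)) has_field_derivative
    s z * \<zeta> z * (\<zeta> z * \<zeta> z - q z) + (- q z * \<zeta> z + - q z * \<zeta> z - deriv q z) * s z) (at z)"
   by (intro DERIV_mult DERIV_diff ds d\<zeta> derivs_q(1) z)
  then have "(deriv (deriv s) has_field_derivative
    s z * \<zeta> z * (\<zeta> z * \<zeta> z - q z) + (- q z * \<zeta> z + - q z * \<zeta> z - deriv q z) * s z) (at z)"
   by (rule has_field_derivative_transform_within_open[OF _ open_D z]) (simp add: ds2 power2_eq_square)
  then show ?thesis by (simp add: DERIV_imp_deriv algebra_simps power3_eq_cube)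
 qed
 have Psi_s: "Psi s z = - deriv q z * s z ^ 4" if z: "z \<in> D" for z
  unfolding Psi_def ds1[OF z] ds2[OF z] ds3[OF z]
  by (simp add: algebra_simps power2_eq_square power3_eq_cube power4_eq_xxxx)
 define R where "R = r / 2"
 have R: "R > 0" "R \<le> \<rho>" "R < r" using r by (auto simp: R_def)
 have inD: "z \<in> D" "2 * z \<in> D" "z \<in> ball 0 r" if "z \<in> ball 0 R - {0}" for z
  using that r by (auto simp: R_def norm_mult)
 have inB: "z \<in> ball 0 \<rho>" "2 * z \<in> ball 0 \<rho>" "z \<in> ball 0 r" if "z \<in> ball 0 R" for z :: complex
  using that r by (auto simp: R_def norm_mult)
 have q1nz: "deriv q z \<noteq> 0" if z: "z \<in> ball 0 R - {0}" for z
  using wnz[OF inD(3)[OF z]] w_eq[OF inD(1)[OF z]] by auto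
 have d2: "((%z. 2 * z) has_field_derivative 2) (at z)" for z :: complex
  by (auto intro!: derivative_eq_intros)
 \<comment> \<open>The logarithmic derivative of the quotient of \<open>Psi s z\<close> by s (2 z),
   written with w so that the pole at 0 is gone. Its derivative vanishes exactly by the duplication
   formula.\<close>
 define \<nu> where "\<nu> = (%z. deriv w z / w z + 4 * H1 z - 2 * H1 (2 * z))"
 have holw: "(w has_field_derivative deriv w z) (at z)" if "z \<in> ball 0 \<rho>" for z
  by (rule holomorphic_derivI[OF hol_w open_ball that])
 have subR: "ball 0 R \<subseteq> ball (0::complex) \<rho>" using R by auto
 have hol\<nu>: "\<nu> holomorphic_on ball 0 R"
 proof -
  have "(H1 \<circ> (%z. 2 * z)) holomorphic_on ball 0 R"
   by (rule holomorphic_on_compose_gen[OF _ holH(2)]) (use inB in \<open>auto intro!: holomorphic_intros\<close>)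
  then have "(%z. H1 (2 * z)) holomorphic_on ball 0 R" by (simp add: o_def)
  moreover have "deriv w holomorphic_on ball 0 R" "w holomorphic_on ball 0 R" "H1 holomorphic_on ball 0 R"
   using holomorphic_deriv[OF hol_w open_ball] hol_w holH(2) subR by (auto intro: holomorphic_on_subset)
  ultimately show ?thesis unfolding \<nu>_def
   using wnz[OF inB(3)] by (intro holomorphic_intros) auto
 qed
 have \<nu>_eq: "\<nu> z = 3 / z + deriv (deriv q) z / deriv q z + 4 * H1 z - 2 * H1 (2 * z)" if z: "z \<in> ball 0 R - {0}" for z
 proof -
  have z0: "z \<noteq> 0" using z by auto
  have "((%z. z ^ 3 * deriv q z) has_field_derivative of_nat 3 * z ^ 2 * deriv q z + deriv (deriv q) z * z ^ 3) (at z)"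
   using DERIV_mult[OF DERIV_power[OF DERIV_ident, of 3] derivs_q(2)[OF inD(1)[OF z]]] by simp
  then have "(w has_field_derivative of_nat 3 * z ^ 2 * deriv q z + deriv (deriv q) z * z ^ 3) (at z)"
   by (rule has_field_derivative_transform_within_open[OF _ open_D inD(1)[OF z]]) (simp add: w_eq)
  then have "deriv w z = of_nat 3 * z ^ 2 * deriv q z + deriv (deriv q) z * z ^ 3" by (rule DERIV_imp_deriv)
  then have "deriv w z / w z = 3 / z + deriv (deriv q) z / deriv q z"
   using z0 q1nz[OF z] by (simp add: w_eq[OF inD(1)[OF z]] field_simps power2_eq_square power3_eq_cube)
  then show ?thesis by (simp add: \<nu>_def)
 qed
 have "((%z. \<nu> z) has_field_derivative 0) (at z)" if z: "z \<in> ball 0 R - {0}" for z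
 proof -
  have z0: "z \<noteq> 0" using z by auto
  have zD: "z \<in> D" by (rule inD(1)[OF z])
  define Q where "Q = deriv (deriv q) z / deriv q z"
  have 1: "((%z. 3 / z) has_field_derivative (0 * z - 3 * 1) / (z * z)) (at z)"
   using z0 by (intro DERIV_divide DERIV_const DERIV_ident)
  have 2: "((%z. deriv (deriv q) z / deriv q z) has_field_derivative ((12 * q z * deriv q z) * deriv q z - deriv (deriv q) z * deriv (deriv q) z) / (deriv q z * deriv q z)) (at z)"
   by (rule DERIV_divide[OF derivs_q(3)[OF zD] derivs_q(2)[OF zD] q1nz[OF z]])
  have 3: "((%z. 4 * H1 z) has_field_derivative 4 * - h z) (at z)"
   using zD by (intro DERIV_cmult H1) auto
  have 4: "((%z. 2 * H1 (2 * z)) has_field_derivative 2 * (- h (2 * z) * 2)) (at z)"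
   by (intro DERIV_cmult DERIV_chain2[OF H1 d2]) (use inD(2)[OF z] in auto)
  have "((%z. 3 / z + deriv (deriv q) z / deriv q z + 4 * H1 z - 2 * H1 (2 * z)) has_field_derivative
   (0 * z - 3 * 1) / (z * z) + ((12 * q z * deriv q z) * deriv q z - deriv (deriv q) z * deriv (deriv q) z) / (deriv q z * deriv q z) + 4 * - h z - 2 * (- h (2 * z) * 2)) (at z)"
   by (rule DERIV_diff[OF DERIV_add[OF DERIV_add[OF 1 2] 3] 4])
  moreover have "(0 * z - 3 * 1) / (z * z) + ((12 * q z * deriv q z) * deriv q z - deriv (deriv q) z * deriv (deriv q) z) / (deriv q z * deriv q z) + 4 * - h z - 2 * (- h (2 * z) * 2) = 0"
  proof -
   have s1: "((12 * q z * deriv q z) * deriv q z - deriv (deriv q) z * deriv (deriv q) z) / (deriv q z * deriv q z) = 12 * q z - Q\<^sup>2"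
    using q1nz[OF z] by (simp add: Q_def field_simps power2_eq_square)
   have s2: "Q\<^sup>2 = 4 * q (2 * z) + 8 * q z"
   proof -
    have "q (2 * z) = - 2 * q z + Q\<^sup>2 / 4" unfolding Q_def by (rule dup) (use z in \<open>simp add: R_def\<close>)
    then show ?thesis by (simp add: field_simps)
   qed
   have s3: "q z = 1 / (z * z) + h z" "q (2 * z) = 1 / (4 * (z * z)) + h (2 * z)"
    by (simp_all add: q[of z] q[of "2 * z"] power2_eq_square)
   show ?thesis unfolding s1 unfolding s2 unfolding s3 using z0 by (simp add: field_simps)
  qed
  ultimately have "((%z. 3 / z + deriv (deriv q) z / deriv q z + 4 * H1 z - 2 * H1 (2 * z)) has_field_derivative 0) (at z)" by simp
  then show ?thesis
   by (rule has_field_derivative_transform_within_open[OF _ open_delete[OF open_ball] z]) (simp add: \<nu>_eq)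
 qed
 then obtain c where c: "\<And>z. z \<in> ball 0 R - {0} ==> \<nu> z = c"
  using holomorphic_deriv_eq_0_punctured_ball[of R \<nu>] by metis
 have \<nu>c: "\<nu> z = c" if "z \<in> ball 0 R" for z
  by (rule holomorphic_eq_on_punctured_ball[OF hol\<nu> holomorphic_on_const R(1) c that])
 have dw0: "deriv w 0 = 0"
 proof (rule DERIV_imp_deriv)
  have "(deriv h has_field_derivative deriv (deriv h) 0) (at 0)"
   using holomorphic_derivI[OF hol_deriv_h(1) open_ball] rho by auto
  from DERIV_add[OF DERIV_const[of "- 2"] DERIV_mult[OF DERIV_power[OF DERIV_ident, of 3] this]]
  show "(w has_field_derivative 0) (at 0)" by (simp add: w_def[abs_def])
 qed
 have "\<nu> 0 = 0" using dw0 H0 by (simp add: \<nu>_def)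
 then have \<nu>0: "\<nu> z = 0" if "z \<in> ball 0 R" for z using \<nu>c[OF that] \<nu>c[of 0] R by simp
 \<comment> \<open>The quotient of \<open>Psi s z\<close> by s (2 z) itself, equal to 1 at 0 because
   w 0 = -2.\<close>
 define N where "N = (%z. - w z / 2 * exp (4 * H z - H (2 * z)))"
 have dN: "(N has_field_derivative 0) (at z)" if z: "z \<in> ball 0 R" for z
 proof -
  have "((%z. 4 * H z - H (2 * z)) has_field_derivative 4 * H1 z - H1 (2 * z) * 2) (at z)"
   using inB[OF z] by (intro DERIV_diff DERIV_cmult H DERIV_chain2[OF H d2]) auto
  then have "((%z. exp (4 * H z - H (2 * z))) has_field_derivative exp (4 * H z - H (2 * z)) * (4 * H1 z - H1 (2 * z) * 2)) (at z)"
   by (rule DERIV_chain2[OF DERIV_exp])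
  moreover have "((%z. - w z / 2) has_field_derivative - deriv w z / 2) (at z)"
   by (intro DERIV_cdivide DERIV_minus holw inB(1)[OF z])
  ultimately have "(N has_field_derivative - deriv w z / 2 * exp (4 * H z - H (2 * z)) + exp (4 * H z - H (2 * z)) * (4 * H1 z - H1 (2 * z) * 2) * (- w z / 2)) (at z)"
   unfolding N_def by (rule DERIV_mult[rotated])
  moreover have "- deriv w z / 2 * exp (4 * H z - H (2 * z)) + exp (4 * H z - H (2 * z)) * (4 * H1 z - H1 (2 * z) * 2) * (- w z / 2) = N z * \<nu> z"
   using wnz[OF inB(3)[OF z]] by (simp add: N_def \<nu>_def field_simps)
  ultimately show ?thesis by (simp only: \<nu>0[OF z] mult_zero_right)
 qed
 have N1: "N z = 1" if z: "z \<in> ball 0 R" for z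
 proof -
  have "\<exists>c. \<forall>x\<in>ball 0 R. N x = c"
   by (rule has_field_derivative_zero_constant[OF convex_ball]) (rule has_field_derivative_at_within[OF dN])
  then obtain c where c: "\<forall>x\<in>ball 0 R. N x = c" by blast
  have "0 \<in> ball (0::complex) R" using R by simp
  then have "N z = N 0" using bspec[OF c z] bspec[OF c] by simp
  also have "N 0 = 1" using H0 by (simp add: N_def w_def)
  finally show ?thesis .
 qed
 have double: "s (2 * z) = Psi s z" if z: "z \<in> ball 0 R" for z
 proof (cases "z = 0")
  case True
  then show ?thesis by (simp add: s_def Psi_def)
 next
  case False
  then have z': "z \<in> ball 0 R - {0}" using z by simp
  have "Psi s z = - deriv q z * s z ^ 4" by (rule Psi_s[OF inD(1)[OF z']])
  also have "deriv q z = w z / z ^ 3" using w_eq[OF inD(1)[OF z']] False by simp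
  also have "- (w z / z ^ 3) * s z ^ 4 = - w z * z * exp (4 * H z)"
   using False by (simp add: s_def power_mult_distrib exp_of_nat_mult[symmetric] power3_eq_cube power4_eq_xxxx exp_double field_simps flip: exp_add)
  also have "\<dots> = 2 * z * exp (H (2 * z)) * N z"
   by (simp add: N_def exp_diff)
  also have "\<dots> = s (2 * z)" by (simp add: N1[OF z] s_def)
  finally show ?thesis ..
 qed
 obtain \<sigma> e where \<sigma>: "\<sigma> holomorphic_on UNIV" and e: "e > 0" and \<sigma>s: "\<And>z. z \<in> ball 0 e ==> \<sigma> z = s z"
 proof (rule entire_extension[OF rho hols R(1)])
  show "s (2 * z) = Psi s z" if "z \<in> ball 0 R" for z using that by (rule double)
  fix F e assume "F holomorphic_on UNIV" "0 < e" "\<And>z. z \<in> ball 0 e ==> F z = s z"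
  then show thesis by (rule that)
 qed
 define t where "t = min e \<rho>"
 have t: "t > 0" "t \<le> e" "t \<le> \<rho>" using e rho by (auto simp: t_def)
 show thesis
 proof (rule that[OF \<sigma> t(1,3)])
  show "\<sigma> 0 = 0" using \<sigma>s[of 0] e by (simp add: s_def)
  show "\<sigma> z \<noteq> 0" if "z \<in> ball 0 t - {0}" for z using \<sigma>s[of z] t that by (simp add: s_def)
  show "\<sigma> (- z) = - \<sigma> z" for z
  proof -
   have m: "(%z. \<sigma> (- z)) holomorphic_on UNIV"
    using holomorphic_on_compose_gen[OF holomorphic_on_minus[OF holomorphic_on_id, of UNIV] \<sigma>] by (simp add: o_def)
   have "- \<sigma> (- z) = \<sigma> z"
   proof (rule analytic_continuation_open[OF open_ball[of 0 t] open_UNIV _ connected_UNIV subset_UNIV holomorphic_on_minus[OF m] \<sigma>])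
    show "ball 0 t \<noteq> ({}::complex set)" using t by simp
    show "- \<sigma> (- z) = \<sigma> z" if "z \<in> ball 0 t" for z
     using \<sigma>s[of z] \<sigma>s[of "- z"] evenH[of z] that t by (simp add: s_def)
   qed simp
   then show ?thesis by (metis minus_minus)
  qed
  show "((deriv \<sigma> z)\<^sup>2 - \<sigma> z * deriv (deriv \<sigma>) z) / (\<sigma> z)\<^sup>2 = q z" if z: "z \<in> ball 0 t - {0}" for z
  proof -
   have z': "z \<in> ball 0 e" "z \<in> D" using z t by auto
   have 1: "deriv \<sigma> z = deriv s z" if "z \<in> ball 0 e" for z by (rule deriv_eq_on_open[OF open_ball that \<sigma>s])
   have 2: "deriv (deriv \<sigma>) z = deriv (deriv s) z" by (rule deriv_eq_on_open[OF open_ball z'(1) 1])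
   have s0: "s z \<noteq> 0" using z by (simp add: s_def)
   show ?thesis unfolding 1[OF z'(1)] 2 \<sigma>s[OF z'(1)] ds1[OF z'(2)] ds2[OF z'(2)]
    using s0 by (simp add: field_simps power2_eq_square)
  qed
 qed
qed

end

text \<open>By the Leibniz rule the equation expresses each higher derivative at 0 through lower
  ones, so all of them vanish.\<close>

lemma second_order_linear_ode_zero:
 assumes e: "e > 0" and d: "d holomorphic_on ball 0 e" and c: "c holomorphic_on ball 0 e"
  and ode: "\<And>s. s \<in> ball 0 e ==> deriv (deriv d) s = c s * d s"
  and d0: "d 0 = 0" "deriv d 0 = 0" and s: "s \<in> ball 0 e"
 shows "d s = 0"
proof -
 have e0: "0 \<in> ball (0::complex) e" using e by simp
 have "(deriv ^^ n) d 0 = 0" for n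
 proof (induction n rule: less_induct)
  case (less n)
  show ?case
  proof (cases "n < 2")
   case True
   then consider "n = 0" | "n = 1" by linarith
   then show ?thesis using d0 by cases auto
  next
   case False
   then obtain m where m: "n = m + 2" by (metis add.commute le_Suc_ex linorder_not_less)
   have "(deriv ^^ n) d 0 = (deriv ^^ m) (deriv (deriv d)) 0"
    by (simp add: m funpow_add o_def numeral_2_eq_2 funpow_swap1)
   also have "\<dots> = (deriv ^^ m) (%s. c s * d s) 0"
    by (rule higher_deriv_transform_within_open[OF _ _ open_ball e0 ode])
     (intro holomorphic_intros holomorphic_deriv c d open_ball)+
   also have "\<dots> = (\<Sum>i = 0..m. of_nat (m choose i) * (deriv ^^ i) c 0 * (deriv ^^ (m - i)) d 0)"
    by (rule higher_deriv_mult[OF c d open_ball e0])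
   also have "\<dots> = 0"
    by (rule sum.neutral) (use less m in auto)
   finally show ?thesis .
  qed
 qed
 then show ?thesis by (rule holomorphic_fun_eq_0_on_connected[OF d open_ball connected_ball _ e0 s])
qed

section \<open>The global meromorphic function and its periods\<close>

text \<open>Q is -(log \<sigma>)'' with its poles in Z, the zero set of \<sigma>. Everything about Q
  is assumed near 0 and spreads to V, which is connected as the complement of a countable
  set.\<close>

locale meromorphic_wp =
 fixes \<sigma> :: "complex => complex" and r :: real and h :: "complex => complex" and \<kappa> \<kappa>2 :: complex and Z V :: "complex set"
  and Q :: "complex => complex"
 assumes hol_\<sigma>: "\<sigma> holomorphic_on UNIV" and r: "r > 0" and \<sigma>0: "\<sigma> 0 = 0"
  and nz: "\<And>z. z \<in> ball 0 r - {0} ==> \<sigma> z \<noteq> 0" and odd: "\<And>z. \<sigma> (- z) = - \<sigma> z"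
  and Z: "Z = {z. \<sigma> z = 0}" and V: "V = - Z"
  and Q: "\<And>z. Q z = ((deriv \<sigma> z)\<^sup>2 - \<sigma> z * deriv (deriv \<sigma>) z) / (\<sigma> z)\<^sup>2"
  and hol_h: "h holomorphic_on ball 0 r" and h0: "h 0 = 0" and h_even: "\<And>z. z \<in> ball 0 r ==> h (- z) = h z"
  and Q_near: "\<And>z. z \<in> ball 0 r - {0} ==> Q z = 1 / z\<^sup>2 + h z"
  and near1: "\<And>z. z \<in> ball 0 r - {0} ==> (deriv Q z)\<^sup>2 = 4 * Q z ^ 3 + 2 * \<kappa> * Q z + \<kappa>2"
  and near2: "\<And>z. z \<in> ball 0 r - {0} ==> deriv (deriv Q) z = 6 * (Q z)\<^sup>2 + \<kappa>"
begin

lemma zero_Z: "0 \<in> Z" using \<sigma>0 by (simp add: Z)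

lemma nonconst: "\<not> \<sigma> constant_on UNIV"
proof
 assume "\<sigma> constant_on UNIV"
 then obtain c where "\<forall>z. \<sigma> z = c" by (auto simp: constant_on_def)
 moreover have "\<sigma> (of_real (r / 2)) \<noteq> 0" using r by (intro nz) auto
 ultimately show False using \<sigma>0 by metis
qed

lemma countable_Z: "countable Z"
 using holomorphic_countable_zeros[OF hol_\<sigma> open_UNIV connected_UNIV fsigma_UNIV nonconst] by (simp add: Z)

lemma open_V: "open V"
proof -
 have "continuous_on UNIV \<sigma>" using hol_\<sigma> by (rule holomorphic_on_imp_continuous_on)
 then have "open (\<sigma> -` (- {0}))" by (intro open_vimage) auto
 moreover have "\<sigma> -` (- {0}) = V" by (auto simp: V Z)
 ultimately show ?thesis by simp
qed

lemma hol_Q: "Q holomorphic_on V"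
proof -
 have "\<sigma> holomorphic_on V" "deriv \<sigma> holomorphic_on V" "deriv (deriv \<sigma>) holomorphic_on V"
  using hol_\<sigma> holomorphic_deriv[OF hol_\<sigma> open_UNIV] holomorphic_deriv[OF holomorphic_deriv[OF hol_\<sigma> open_UNIV] open_UNIV]
  by (blast intro: holomorphic_on_subset)+
 then have "(%z. ((deriv \<sigma> z)\<^sup>2 - \<sigma> z * deriv (deriv \<sigma>) z) / (\<sigma> z)\<^sup>2) holomorphic_on V"
  by (intro holomorphic_on_divide holomorphic_on_diff holomorphic_on_mult holomorphic_on_power) (auto simp: V Z)
 moreover have "Q = (%z. ((deriv \<sigma> z)\<^sup>2 - \<sigma> z * deriv (deriv \<sigma>) z) / (\<sigma> z)\<^sup>2)" by (rule ext) (rule Q)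
 ultimately show ?thesis by simp
qed

lemma connected_V: "connected V"
 using connected_open_diff_countable[OF _ open_UNIV connected_UNIV countable_Z] by (simp add: V Compl_eq_Diff_UNIV)

lemma near_V: "ball 0 r - {0} \<subseteq> V" using nz by (auto simp: V Z)

lemma near_nonempty: "ball (0::complex) r - {0} \<noteq> {}"
proof -
 have "of_real (r / 2) \<in> ball (0::complex) r - {0}" using r by auto
 then show ?thesis by blast
qed

lemma identity_V:
 assumes "f holomorphic_on V" "g holomorphic_on V" "\<And>z. z \<in> ball 0 r - {0} ==> f z = g z" "z \<in> V"
 shows "f z = g z"
 by (rule analytic_continuation_open[OF open_delete[OF open_ball] open_V near_nonempty connected_V near_V assms])

lemma ode1: "z \<in> V ==> (deriv Q z)\<^sup>2 = 4 * Q z ^ 3 + 2 * \<kappa> * Q z + \<kappa>2"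
 by (rule identity_V[OF _ _ near1]) (intro holomorphic_intros holomorphic_deriv hol_Q open_V)+

lemma ode2: "z \<in> V ==> deriv (deriv Q) z = 6 * (Q z)\<^sup>2 + \<kappa>"
 by (rule identity_V[OF _ _ near2]) (intro holomorphic_intros holomorphic_deriv hol_Q open_V)+

lemma uminus_V: "- z \<in> V \<longleftrightarrow> z \<in> V" using odd by (simp add: V Z)

lemma Q_even: assumes z: "z \<in> V" shows "Q (- z) = Q z"
proof (rule identity_V[OF _ hol_Q _ z])
 have "(Q \<circ> uminus) holomorphic_on V"
  by (rule holomorphic_on_compose_gen[OF _ hol_Q]) (auto simp: uminus_V intro!: holomorphic_intros)
 then show "(%z. Q (- z)) holomorphic_on V" by (simp add: o_def)
 fix z :: complex assume "z \<in> ball 0 r - {0}"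
 then show "Q (- z) = Q z" using Q_near[of z] Q_near[of "- z"] h_even[of z] by simp
qed

lemma deriv_Q_uminus: assumes z: "z \<in> V" shows "deriv Q (- z) = - deriv Q z"
proof -
 have "(Q has_field_derivative deriv Q (- z)) (at (- z))" using z by (intro holomorphic_derivI[OF hol_Q open_V]) (simp add: uminus_V)
 from DERIV_chain2[OF this DERIV_minus[OF DERIV_ident]] have "((%z. Q (- z)) has_field_derivative - deriv Q (- z)) (at z)" by simp
 then have "(Q has_field_derivative - deriv Q (- z)) (at z)"
  by (rule has_field_derivative_transform_within_open[OF _ open_V z]) (rule Q_even)
 then have "deriv Q z = - deriv Q (- z)" by (rule DERIV_imp_deriv)
 then show ?thesis by simp
qed

text \<open>At a zero of order n the function -(log \<sigma>)'' has principal part n / (z - w)^2, so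
  Q is unbounded near every zero of \<sigma>.\<close>

lemma zero_structure:
 assumes w: "w \<in> Z"
 obtains e where "e > 0" "\<And>z. z \<in> ball w e - {w} ==> z \<in> V"
  "\<And>B e'. e' > 0 ==> \<exists>z. z \<in> ball w e' - {w} \<and> z \<in> V \<and> norm (Q z) > B"
proof -
 have \<sigma>w: "\<sigma> w = 0" using w by (simp add: Z)
 have "\<exists>g e n. 0 < n \<and> 0 < e \<and> g holomorphic_on ball w e \<and>
   (\<forall>z\<in>ball w e. \<sigma> z = (z - w) ^ n * g z) \<and> (\<forall>z\<in>ball w e. g z \<noteq> 0)"
 proof (rule holomorphic_factor_zero_nonconstant[OF hol_\<sigma> open_UNIV connected_UNIV UNIV_I \<sigma>w nonconst])
  fix g e and n :: nat
  assume "0 < n" "0 < e" "g holomorphic_on ball w e"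
   "\<And>z. z \<in> ball w e ==> \<sigma> z = (z - w) ^ n * g z" "\<And>z. z \<in> ball w e ==> g z \<noteq> 0"
  then show ?thesis by (intro exI[of _ g] exI[of _ e] exI[of _ n]) simp
 qed
 then obtain g e and n :: nat where n: "0 < n" "0 < e" and g: "g holomorphic_on ball w e"
  and \<sigma>g: "\<forall>z\<in>ball w e. \<sigma> z = (z - w) ^ n * g z" and gz: "\<forall>z\<in>ball w e. g z \<noteq> 0"
  by blast
 have inV: "z \<in> V" if "z \<in> ball w e - {w}" for z
  using bspec[OF \<sigma>g, of z] bspec[OF gz, of z] that by (simp add: V Z)
 define l where "l = (%z. deriv g z / g z)"
 have hl: "l holomorphic_on ball w e" unfolding l_def using gz by (intro holomorphic_intros holomorphic_deriv g open_ball) auto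
 have Ql: "Q z = of_nat n / (z - w)\<^sup>2 - deriv l z" if z: "z \<in> ball w e - {w}" for z
 proof -
  have zw: "z - w \<noteq> 0" and zb: "z \<in> ball w e" using z by auto
  have ld: "deriv \<sigma> y / \<sigma> y = of_nat n / (y - w) + l y" if y: "y \<in> ball w e - {w}" for y
  proof -
   have yw: "y - w \<noteq> 0" and yb: "y \<in> ball w e" using y by auto
   have "((%z. (z - w) ^ n) has_field_derivative of_nat n * (y - w) ^ (n - 1)) (at y)"
    by (auto intro!: derivative_eq_intros)
   then have "((%z. (z - w) ^ n * g z) has_field_derivative of_nat n * (y - w) ^ (n - 1) * g y + deriv g y * (y - w) ^ n) (at y)"
    by (rule DERIV_mult[OF _ holomorphic_derivI[OF g open_ball yb]])
   then have "(\<sigma> has_field_derivative of_nat n * (y - w) ^ (n - 1) * g y + deriv g y * (y - w) ^ n) (at y)"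
    by (rule has_field_derivative_transform_within_open[OF _ open_ball yb]) (simp add: bspec[OF \<sigma>g])
   then have "deriv \<sigma> y = of_nat n * (y - w) ^ (n - 1) * g y + deriv g y * (y - w) ^ n" by (rule DERIV_imp_deriv)
   moreover have pw: "(y - w) ^ n = (y - w) * (y - w) ^ (n - 1)" using n(1) by (cases n) auto
   moreover have "(a * P * c + c' * (u * P)) / (u * P * c) = a / u + c' / c"
    if "u \<noteq> 0" "P \<noteq> 0" "c \<noteq> 0" for a P c c' u :: complex
    using that by (simp add: field_simps)
   note this[of "y - w" "(y - w) ^ (n - 1)" "g y" "of_nat n" "deriv g y"]
   ultimately show ?thesis
    unfolding bspec[OF \<sigma>g yb] l_def using yw bspec[OF gz yb] by simp
  qed
  have \<sigma>z: "\<sigma> z \<noteq> 0" using inV[OF z] by (simp add: V Z)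
  have d\<sigma>: "(\<sigma> has_field_derivative deriv \<sigma> z) (at z)" "(deriv \<sigma> has_field_derivative deriv (deriv \<sigma>) z) (at z)"
   by (rule holomorphic_derivI[OF hol_\<sigma> open_UNIV UNIV_I] holomorphic_derivI[OF holomorphic_deriv[OF hol_\<sigma> open_UNIV] open_UNIV UNIV_I])+
  have "((%y. of_nat n / (y - w) + l y) has_field_derivative (0 * (z - w) - of_nat n * 1) / ((z - w) * (z - w)) + deriv l z) (at z)"
  proof (intro DERIV_add DERIV_divide DERIV_const)
   show "((%y. y - w) has_field_derivative 1) (at z)" by (auto intro!: derivative_eq_intros)
   show "(l has_field_derivative deriv l z) (at z)" by (rule holomorphic_derivI[OF hl open_ball zb])
  qed (use zw in auto)
  then have "((%y. deriv \<sigma> y / \<sigma> y) has_field_derivative (0 * (z - w) - of_nat n * 1) / ((z - w) * (z - w)) + deriv l z) (at z)"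
   by (rule has_field_derivative_transform_within_open[OF _ open_delete[OF open_ball] z]) (simp add: ld)
  moreover have "((%y. deriv \<sigma> y / \<sigma> y) has_field_derivative (deriv (deriv \<sigma>) z * \<sigma> z - deriv \<sigma> z * deriv \<sigma> z) / (\<sigma> z * \<sigma> z)) (at z)"
   by (rule DERIV_divide[OF d\<sigma>(2,1) \<sigma>z])
  ultimately have "(0 * (z - w) - of_nat n * 1) / ((z - w) * (z - w)) + deriv l z = (deriv (deriv \<sigma>) z * \<sigma> z - deriv \<sigma> z * deriv \<sigma> z) / (\<sigma> z * \<sigma> z)"
   by (rule DERIV_unique)
  moreover have "Q z = - ((deriv (deriv \<sigma>) z * \<sigma> z - deriv \<sigma> z * deriv \<sigma> z) / (\<sigma> z * \<sigma> z))"
   unfolding Q power2_eq_square minus_divide_left by (simp add: mult.commute)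
  ultimately have "Q z = - ((0 * (z - w) - of_nat n * 1) / ((z - w) * (z - w)) + deriv l z)" by (simp only:)
  then show ?thesis by (simp add: power2_eq_square)
 qed
 have big: "\<exists>z. z \<in> ball w e' - {w} \<and> z \<in> V \<and> norm (Q z) > B" if e': "e' > 0" for B e'
 proof -
  have wb: "w \<in> ball w e" using n(2) by simp
  have "isCont (deriv l) w"
   using holomorphic_on_imp_continuous_on[OF holomorphic_deriv[OF hl open_ball]] wb
   by (simp add: continuous_on_eq_continuous_at)
  then obtain e1 where e1: "e1 > 0" "\<And>z. dist z w < e1 ==> dist (deriv l z) (deriv l w) < 1"
   unfolding continuous_at_eps_delta by (metis zero_less_one)
  define M where "M = norm (deriv l w) + 1 + \<bar>B\<bar> + 1"
  have M: "M > 0" using norm_ge_zero[of "deriv l w"] abs_ge_zero[of B] unfolding M_def by linarith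
  define t where "t = min (min (e1 / 2) (e / 2)) (min (e' / 2) (1 / M))"
  have t: "t > 0" "t < e1" "t < e" "t < e'" "t \<le> 1 / M" using e1 n e' M by (auto simp: t_def)
  define t' where "t' = min t (1/M)"
  have tt: "t' = t" using t by (simp add: t'_def)
  define s where "s = min t 1 / 1"
  have s: "s > 0" "s \<le> 1" "s \<le> t" using t by (auto simp: s_def)
  define z where "z = w + of_real s"
  have dz: "dist z w = s" using s by (simp add: z_def dist_norm)
  have zb: "z \<in> ball w e - {w}" "z \<in> ball w e' - {w}" using dz s t by (auto simp: dist_commute)
  have "M \<le> 1 / s"
  proof -
   have "s \<le> 1 / M" using s t by linarith
   then show ?thesis using s M by (simp add: field_simps)
  qed
  also have "1 / s \<le> 1 / s\<^sup>2" using s by (simp add: field_simps power2_eq_square)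
  also have "\<dots> \<le> real n / s\<^sup>2" using n(1) s by (intro divide_right_mono) auto
  also have "\<dots> = norm (of_nat n / (z - w)\<^sup>2)" using s by (simp add: z_def norm_divide norm_power)
  finally have 1: "M \<le> norm (of_nat n / (z - w)\<^sup>2)" .
  have "norm (deriv l z - deriv l w) < 1" using e1(2)[of z] dz s t by (simp add: dist_norm)
  then have "norm (deriv l z) < norm (deriv l w) + 1" using norm_triangle_ineq2[of "deriv l z" "deriv l w"] by linarith
  then have "norm (Q z) > \<bar>B\<bar>"
   unfolding Ql[OF zb(1)] using 1 norm_triangle_ineq2[of "of_nat n / (z - w)\<^sup>2" "deriv l z"] unfolding M_def by linarith
  then have "norm (Q z) > B" by linarith
  then show ?thesis using zb inV[OF zb(1)] by blast
 qed
 show thesis by (rule that[OF n(2) inV big])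
qed

text \<open>1 / Q extends to a nonconstant holomorphic map E near 0 and is therefore open, so every
  large value of Q is attained near 0. The first-order equation then fixes the derivative up to
  sign, and replacing t by -t adjusts the sign.\<close>

lemma large_value:
 assumes \<epsilon>: "\<epsilon> > 0"
 obtains B where "B > 0" "\<And>z. z \<in> V ==> norm (Q z) > B ==> \<exists>t\<in>V. norm t < \<epsilon> \<and> Q t = Q z \<and> deriv Q t = deriv Q z"
proof -
 define u where "u = (%z. 1 + z\<^sup>2 * h z)"
 have hu: "u holomorphic_on ball 0 r" unfolding u_def by (intro holomorphic_intros hol_h)
 have "0 \<in> ball (0::complex) r" using r by simp
 then have "continuous (at 0) u"
  using holomorphic_on_imp_continuous_on[OF hu] by (simp add: continuous_on_eq_continuous_at)
 moreover have "u 0 \<noteq> 0" by (simp add: u_def)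
 ultimately obtain e where e: "e > 0" "\<And>z. dist 0 z < e ==> u z \<noteq> 0"
  using continuous_at_avoid by blast
 define R where "R = min (min e \<epsilon>) r"
 have R: "R > 0" "R \<le> e" "R \<le> \<epsilon>" "R \<le> r" using e \<epsilon> r by (auto simp: R_def)
 define E where "E = (%z. z\<^sup>2 / u z)"
 have unz: "u z \<noteq> 0" if "z \<in> ball 0 R" for z using e(2)[of z] that R by simp
 have hE: "E holomorphic_on ball 0 R"
  unfolding E_def using unz R by (intro holomorphic_intros holomorphic_on_subset[OF hu]) auto
 have "\<not> E constant_on ball 0 R"
 proof
  assume "E constant_on ball 0 R"
  then obtain c where c: "\<forall>z\<in>ball 0 R. E z = c" by (auto simp: constant_on_def)
  have b: "0 \<in> ball (0::complex) R" "of_real (R / 2) \<in> ball (0::complex) R" using R by auto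
  have "E 0 = 0" by (simp add: E_def)
  moreover have "E (of_real (R / 2)) \<noteq> 0" using unz[OF b(2)] R by (simp add: E_def)
  ultimately show False using bspec[OF c b(1)] bspec[OF c b(2)] by simp
 qed
 then have "open (E ` ball 0 R)" by (rule open_mapping_thm[OF hE open_ball connected_ball open_ball order_refl])
 moreover have "0 \<in> E ` ball 0 R" using R by (intro image_eqI[of _ _ 0]) (auto simp: E_def)
 ultimately obtain \<eta> where \<eta>: "\<eta> > 0" "ball 0 \<eta> \<subseteq> E ` ball 0 R" by (meson openE)
 show thesis
 proof (rule that[of "1 / \<eta>"])
  show "1 / \<eta> > 0" using \<eta> by simp
  fix z assume z: "z \<in> V" "norm (Q z) > 1 / \<eta>"
  have Qz: "Q z \<noteq> 0" using z(2) \<eta> by auto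
  have "1 / Q z \<in> ball 0 \<eta>" using z(2) \<eta> Qz by (simp add: norm_divide field_simps)
  then obtain t where t: "t \<in> ball 0 R" "E t = 1 / Q z" using \<eta>(2) by (metis imageE subsetD)
  have t0: "t \<noteq> 0" using t(2) Qz by (auto simp: E_def)
  have tr: "t \<in> ball 0 r - {0}" using t R t0 by auto
  then have tV: "t \<in> V" using near_V by blast
  have "Q t = u t / t\<^sup>2" using t0 by (simp add: Q_near[OF tr] u_def field_simps)
  also have "\<dots> = 1 / E t" by (simp add: E_def)
  finally have Qt: "Q t = Q z" using t(2) by simp
  have "(deriv Q t)\<^sup>2 = (deriv Q z)\<^sup>2" using ode1[OF tV] ode1[OF z(1)] Qt by simp
  then consider "deriv Q t = deriv Q z" | "deriv Q (- t) = deriv Q z"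
   using deriv_Q_uminus[OF tV] by (metis minus_minus power2_eq_iff)
  then show "\<exists>t\<in>V. norm t < \<epsilon> \<and> Q t = Q z \<and> deriv Q t = deriv Q z"
  proof cases
   case 1
   then show ?thesis using tV t R Qt by (intro bexI[of _ t]) auto
  next
   case 2
   then show ?thesis using tV t R Qt Q_even[OF tV] uminus_V[of t] by (intro bexI[of _ "- t"]) auto
  qed
 qed
qed

text \<open>The condition is restricted to points where both values are honest, since Q at a point
  of Z is only a default value of division.\<close>

definition period :: "complex => bool" where
 "period \<tau> \<longleftrightarrow> (\<forall>z\<in>V. z + \<tau> \<in> V --> Q (z + \<tau>) = Q z)"

lemma period_uminus: "period \<tau> ==> period (- \<tau>)"
 unfolding period_def by (metis add_uminus_conv_diff diff_add_cancel)

text \<open>The equation Q'' = 6 Q^2 + \<kappa> is autonomous, so value and derivative determine the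
  solution: the difference of two translates satisfies a linear second-order equation with zero
  initial data. The local identity then spreads over the complement of two countable sets, which is
  connected.\<close>

lemma period_of_equal_values:
 assumes a: "a \<in> V" and t: "t \<in> V" and eq: "Q a = Q t" "deriv Q a = deriv Q t"
 shows "period (a - t)"
proof -
 obtain e1 where e1: "e1 > 0" "ball a e1 \<subseteq> V" using open_V a by (meson openE)
 obtain e2 where e2: "e2 > 0" "ball t e2 \<subseteq> V" using open_V t by (meson openE)
 define e where "e = min e1 e2"
 have e: "e > 0" using e1 e2 by (simp add: e_def)
 have sh: "a + s \<in> V" "t + s \<in> V" if "s \<in> ball 0 e" for s
  using that e1 e2 by (auto simp: e_def dist_norm subset_iff)
 have der: "((%s. f (b + s)) has_field_derivative deriv f (b + s)) (at s)" if "f holomorphic_on V" "b + s \<in> V" for f b s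
 proof -
  have "(f has_field_derivative deriv f (b + s)) (at (b + s))" by (rule holomorphic_derivI[OF that(1) open_V that(2)])
  moreover have "((%s. b + s) has_field_derivative 1) (at s)" by (auto intro!: derivative_eq_intros)
  ultimately show ?thesis using DERIV_chain2[where f = f and g = "%s. b + s"] by fastforce
 qed
 note hQ1 = holomorphic_deriv[OF hol_Q open_V]
 define d where "d = (%s. Q (a + s) - Q (t + s))"
 define c where "c = (%s. 6 * (Q (a + s) + Q (t + s)))"
 have hsh: "(%s. Q (a + s)) holomorphic_on ball 0 e" "(%s. Q (t + s)) holomorphic_on ball 0 e"
  unfolding holomorphic_on_open[OF open_ball] using der[OF hol_Q] sh by blast+
 have d1: "(d has_field_derivative deriv Q (a + s) - deriv Q (t + s)) (at s)" if "s \<in> ball 0 e" for s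
  unfolding d_def by (intro DERIV_diff der hol_Q sh that)
 have dd: "deriv d s = deriv Q (a + s) - deriv Q (t + s)" if "s \<in> ball 0 e" for s using d1[OF that] by (rule DERIV_imp_deriv)
 have d2: "deriv (deriv d) s = c s * d s" if s: "s \<in> ball 0 e" for s
 proof -
  have "((%s. deriv Q (a + s) - deriv Q (t + s)) has_field_derivative deriv (deriv Q) (a + s) - deriv (deriv Q) (t + s)) (at s)"
   by (intro DERIV_diff der hQ1 sh s)
  then have "(deriv d has_field_derivative deriv (deriv Q) (a + s) - deriv (deriv Q) (t + s)) (at s)"
   by (rule has_field_derivative_transform_within_open[OF _ open_ball s]) (simp add: dd)
  then have "deriv (deriv d) s = deriv (deriv Q) (a + s) - deriv (deriv Q) (t + s)" by (rule DERIV_imp_deriv)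
  also have "\<dots> = c s * d s" unfolding ode2[OF sh(1)[OF s]] ode2[OF sh(2)[OF s]] c_def d_def
   by (simp add: power2_eq_square algebra_simps)
  finally show ?thesis .
 qed
 have d0: "d s = 0" if s: "s \<in> ball 0 e" for s
 proof (rule second_order_linear_ode_zero[OF e _ _ d2 _ _ s])
  show "d holomorphic_on ball 0 e" "c holomorphic_on ball 0 e"
   unfolding d_def c_def by (intro holomorphic_intros hsh)+
  show "d 0 = 0" using eq by (simp add: d_def)
  show "deriv d 0 = 0" using dd[of 0] e eq by simp
 qed
 define \<tau> where "\<tau> = a - t"
 have "countable ((%z. z - \<tau>) ` Z)" using countable_Z by (rule countable_image)
 then have "countable (Z \<union> (%z. z - \<tau>) ` Z)" using countable_Z by simp
 then have conn: "connected (UNIV - (Z \<union> (%z. z - \<tau>) ` Z))"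
  by (intro connected_open_diff_countable) auto
 have W: "UNIV - (Z \<union> (%z. z - \<tau>) ` Z) = V \<inter> (%z. z + \<tau>) -` V"
 proof -
  have "z \<in> (%z. z - \<tau>) ` Z \<longleftrightarrow> z + \<tau> \<in> Z" for z by (auto intro!: image_eqI[of _ _ "z + \<tau>"])
  then show ?thesis by (auto simp: V)
 qed
 have openW: "open (V \<inter> (%z. z + \<tau>) -` V)"
  by (intro open_Int open_V open_vimage continuous_intros)
 have "Q (z + \<tau>) = Q z" if z: "z \<in> V" "z + \<tau> \<in> V" for z
 proof (rule analytic_continuation_open[where f = "%z. Q (z + \<tau>)" and g = Q, OF open_ball[of t e] openW])
  show "ball t e \<noteq> {}" using e by simp
  show "connected (V \<inter> (%z. z + \<tau>) -` V)" using conn unfolding W .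
  have sh': "y \<in> V \<and> y + \<tau> \<in> V \<and> Q (y + \<tau>) = Q y" if y: "y \<in> ball t e" for y
  proof -
   have s: "y - t \<in> ball 0 e" using y by (simp add: dist_norm norm_minus_commute)
   show ?thesis using sh[OF s] d0[OF s] by (simp add: d_def \<tau>_def algebra_simps)
  qed
  show "ball t e \<subseteq> V \<inter> (%z. z + \<tau>) -` V" using sh' by auto
  show "Q (y + \<tau>) = Q y" if "y \<in> ball t e" for y using sh'[OF that] by blast
  have "(Q \<circ> (%z. z + \<tau>)) holomorphic_on V \<inter> (%z. z + \<tau>) -` V"
   by (rule holomorphic_on_compose_gen[OF _ hol_Q]) (auto intro!: holomorphic_intros)
  then show "(%z. Q (z + \<tau>)) holomorphic_on V \<inter> (%z. z + \<tau>) -` V" by (simp add: o_def)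
  show "Q holomorphic_on V \<inter> (%z. z + \<tau>) -` V" by (rule holomorphic_on_subset[OF hol_Q]) blast
  show "z \<in> V \<inter> (%z. z + \<tau>) -` V" using z by simp
 qed
 then show ?thesis by (auto simp: period_def \<tau>_def)
qed

text \<open>Q is unbounded near a pole, so it cannot be continuous at the translate.\<close>

lemma period_shift_Z:
 assumes p: "period \<tau>" and z: "z \<in> Z"
 shows "z + \<tau> \<in> Z"
proof (rule ccontr)
 assume "z + \<tau> \<notin> Z"
 then have zV: "z + \<tau> \<in> V" by (simp add: V)
 have "isCont Q (z + \<tau>)"
  using holomorphic_on_imp_continuous_on[OF hol_Q] zV open_V by (simp add: continuous_on_eq_continuous_at)
 then obtain e1 where e1: "e1 > 0" "\<And>y. dist y (z + \<tau>) < e1 ==> dist (Q y) (Q (z + \<tau>)) < 1"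
  unfolding continuous_at_eps_delta by (metis zero_less_one)
 obtain e2 where e2: "e2 > 0" "ball (z + \<tau>) e2 \<subseteq> V" using open_V zV by (meson openE)
 have "min e1 e2 > 0" using e1 e2 by simp
 then obtain y where y: "y \<in> ball z (min e1 e2) - {z}" "y \<in> V" "norm (Q y) > norm (Q (z + \<tau>)) + 1"
  using zero_structure[OF z] by metis
 have yd: "dist (y + \<tau>) (z + \<tau>) < min e1 e2" using y(1) by (simp add: dist_commute dist_norm)
 then have "y + \<tau> \<in> V" using e2(2) by (auto simp: dist_commute subset_iff)
 then have "Q (y + \<tau>) = Q y" using p y(2) by (simp add: period_def)
 moreover have "dist (Q (y + \<tau>)) (Q (z + \<tau>)) < 1" using e1(2) yd by simp
 ultimately show False using y(3) norm_triangle_ineq2[of "Q y" "Q (z + \<tau>)"] by (simp add: dist_norm)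
qed

text \<open>A period moves the pole 0 to a pole. Conversely, near a pole \<tau> choose a with |Q a|
  so large that some t near 0 has the same value and derivative. Then a - t is a period, hence
  itself a pole, and lies so close to \<tau> that isolation of the poles gives a - t =
  \<tau>.\<close>

lemma period_iff: "period \<tau> \<longleftrightarrow> \<tau> \<in> Z"
proof
 assume "period \<tau>"
 then show "\<tau> \<in> Z" using period_shift_Z[OF _ zero_Z, of \<tau>] by simp
next
 assume w: "\<tau> \<in> Z"
 obtain e where e: "e > 0" "\<And>z. z \<in> ball \<tau> e - {\<tau>} ==> z \<in> V"
  and big: "\<And>B e'. e' > 0 ==> \<exists>z. z \<in> ball \<tau> e' - {\<tau>} \<and> z \<in> V \<and> norm (Q z) > B"
  using zero_structure[OF w] by metis
 have e2: "e / 2 > 0" using e by simp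
 obtain B where B: "\<And>z. z \<in> V ==> norm (Q z) > B ==> \<exists>t\<in>V. norm t < e / 2 \<and> Q t = Q z \<and> deriv Q t = deriv Q z"
  using large_value[OF e2] by metis
 obtain a where a: "a \<in> ball \<tau> (e / 2) - {\<tau>}" "a \<in> V" "norm (Q a) > B" using big[OF e2] by metis
 obtain t where t: "t \<in> V" "norm t < e / 2" "Q t = Q a" "deriv Q t = deriv Q a" using B[OF a(2,3)] by metis
 have p: "period (a - t)" by (rule period_of_equal_values[OF a(2) t(1) t(3)[symmetric] t(4)[symmetric]])
 then have "a - t \<in> Z" using period_shift_Z[OF _ zero_Z, of "a - t"] by simp
 moreover have "dist \<tau> (a - t) < e"
  using norm_triangle_ineq[of "\<tau> - a" t] a(1) t(2) by (simp add: dist_norm algebra_simps)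
 ultimately have "a - t = \<tau>" using e(2)[of "a - t"] by (auto simp: V)
 then show "period \<tau>" using p by simp
qed

lemma discrete: "discrete_subgroup Z r"
proof
 show "0 \<in> Z" by (rule zero_Z)
 show "r > 0" by (rule r)
 show "r \<le> norm x" if "x \<in> Z" "x \<noteq> 0" for x using nz[of x] that by (force simp: Z)
 show "x - y \<in> Z" if "x \<in> Z" "y \<in> Z" for x y
  using period_shift_Z[OF period_uminus that(1), of y] that(2) period_iff by simp
qed

lemma Q_shift: "w \<in> Z ==> z \<in> V ==> z + w \<in> V ==> Q (z + w) = Q z"
 using period_iff[of w] by (simp add: period_def)

text \<open>If Q z were too large, some t with |t| < \<epsilon> would have the same value and
  derivative, so z - t would be a point of Z closer to z than \<epsilon>. The bound on Q passes to
  its derivative through the first-order equation.\<close>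

lemma bounded_away:
 assumes "\<epsilon> > 0"
 obtains K where "\<And>z. (\<And>w. w \<in> Z ==> \<epsilon> \<le> norm (z - w)) ==> norm (deriv Q z) \<le> K"
proof -
 obtain B where B0: "B > 0" and B: "\<And>z. z \<in> V ==> norm (Q z) > B ==> \<exists>t\<in>V. norm t < \<epsilon> \<and> Q t = Q z \<and> deriv Q t = deriv Q z"
  using large_value[OF assms] by metis
 define M where "M = 4 * B ^ 3 + 2 * norm \<kappa> * B + norm \<kappa>2"
 have M0: "M \<ge> 0" using B0 by (simp add: M_def)
 show thesis
 proof (rule that[of "1 + M"])
  fix z assume far: "\<And>w. w \<in> Z ==> \<epsilon> \<le> norm (z - w)"
  have zV: "z \<in> V" using far[of z] assms by (auto simp: V)
  have "norm (Q z) \<le> B"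
  proof (rule ccontr)
   assume "\<not> norm (Q z) \<le> B"
   then obtain t where t: "t \<in> V" "norm t < \<epsilon>" "Q t = Q z" "deriv Q t = deriv Q z" using B[OF zV] by fastforce
   have "period (z - t)" by (rule period_of_equal_values[OF zV t(1) t(3)[symmetric] t(4)[symmetric]])
   then have "\<epsilon> \<le> norm (z - (z - t))" using period_iff by (intro far) blast
   then show False using t(2) by simp
  qed
  then have "norm ((deriv Q z)\<^sup>2) \<le> M"
   unfolding ode1[OF zV] M_def
   by (intro order.trans[OF norm_triangle_ineq] add_mono)
    (auto simp: norm_mult norm_power intro!: mult_left_mono power_mono)
  then have 1: "(norm (deriv Q z))\<^sup>2 \<le> M" by (simp add: norm_power)
  show "norm (deriv Q z) \<le> 1 + M"
  proof (cases "norm (deriv Q z) \<le> 1")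
   case False
   then have "norm (deriv Q z) * 1 \<le> norm (deriv Q z) * norm (deriv Q z)" by (intro mult_left_mono) auto
   then show ?thesis using 1 by (simp add: power2_eq_square)
  qed (use M0 in simp)
 qed
qed

text \<open>Q - 1 / z^2 minus the lattice sum has only removable singularities and so extends to an
  entire function E. The derivative of E is bounded, hence constant; evenness makes that constant 0,
  and both h and the lattice sum vanish at 0. The derivative is used because periodicity of the
  series is not known beforehand.\<close>

lemma h_eq_lattice_sum:
 assumes z: "z \<in> ball 0 r"
 shows "h z = lattice_sum Z z"
proof -
 interpret L: discrete_subgroup Z r by (rule discrete)
 define S where "S = lattice_sum Z"
 define D where "D = (%z. Q z - 1 / z\<^sup>2 - S z)"
 have V_sub: "V \<subseteq> - (Z - {0})" by (auto simp: V)
 have nz0: "z \<noteq> 0" if "z \<in> V" for z using that zero_Z by (auto simp: V)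
 have holS: "S holomorphic_on - (Z - {0})" unfolding S_def by (rule L.lattice_sum_holomorphic)
 have holD: "D holomorphic_on V"
  unfolding D_def using nz0 by (intro holomorphic_on_diff holomorphic_on_divide hol_Q holomorphic_on_subset[OF holS V_sub] holomorphic_intros) auto
 have ball_Z: "z \<in> V" if "z \<in> ball w r - {w}" "w \<in> Z" for w z
  using L.sep[of w z] that by (auto simp: V dist_norm)
 have D_near0: "D z = h z - S z" if "z \<in> ball 0 r - {0}" for z
  unfolding D_def Q_near[OF that] by simp
 have b0S: "ball 0 r \<subseteq> - (Z - {0})" using near_V by (auto simp: V)
 have hol_hS: "(%z. h z - S z) holomorphic_on ball 0 r"
  by (intro holomorphic_on_diff hol_h holomorphic_on_subset[OF holS b0S])
 have "\<exists>G. G holomorphic_on ball w r \<and> (\<forall>z\<in>ball w r - {w}. D z = G z)" if w: "w \<in> Z" for w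
 proof (cases "w = 0")
  case True
  then show ?thesis using hol_hS D_near0 by (intro exI[of _ "%z. h z - S z"]) auto
 next
  case False
  have "\<exists>g. g holomorphic_on ball w r \<and> (\<forall>t\<in>ball w r - {w}. S t = 1 / (t - w)\<^sup>2 + g t)"
   unfolding S_def by (rule L.lattice_sum_pole[OF w False]) blast
  then obtain g where g: "g holomorphic_on ball w r" "\<forall>t\<in>ball w r - {w}. S t = 1 / (t - w)\<^sup>2 + g t" by blast
  have n0: "z \<noteq> 0" if "z \<in> ball w r" for z using L.min_norm[OF w False] that by (auto simp: dist_norm)
  \<comment> \<open>By periodicity Q has at w the same expansion as at 0, so its pole 1 / (z - w)^2
    cancels against that of the lattice sum.\<close>
  define G where "G = (%z. h (z - w) - 1 / z\<^sup>2 - g z)"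
  have "(h \<circ> (%z. z - w)) holomorphic_on ball w r"
   by (rule holomorphic_on_compose_gen[OF _ hol_h]) (auto intro!: holomorphic_intros simp: dist_norm norm_minus_commute)
  then have "G holomorphic_on ball w r"
   unfolding G_def using n0 by (intro holomorphic_on_diff holomorphic_on_divide g holomorphic_intros) (auto simp: o_def)
  moreover have "D z = G z" if z: "z \<in> ball w r - {w}" for z
  proof -
   have zw: "z - w \<in> ball 0 r - {0}" using z by (auto simp: dist_norm norm_minus_commute)
   then have "z - w \<in> V" using near_V by blast
   then have "Q z = Q (z - w)" using Q_shift[OF w, of "z - w"] ball_Z[OF z w] by simp
   then show ?thesis unfolding D_def G_def using Q_near[OF zw] bspec[OF g(2) z] by simp
  qed
  ultimately show ?thesis by blast
 qed
 then obtain G where G: "\<And>w. w \<in> Z ==> G w holomorphic_on ball w r" "\<And>w z. w \<in> Z ==> z \<in> ball w r - {w} ==> D z = G w z"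
  by metis
 define E where "E = (%z. if z \<in> Z then G z z else D z)"
 have EV: "E z = D z" if "z \<in> V" for z using that by (simp add: E_def V)
 have EG: "E z = G w z" if "w \<in> Z" "z \<in> ball w r" for w z
  using that G(2)[of w z] ball_Z[of z w] by (cases "z = w") (auto simp: E_def V)
 have holE: "E holomorphic_on UNIV"
 proof (rule holomorphic_on_open[THEN iffD2, OF open_UNIV], intro ballI)
  fix z :: complex
  show "\<exists>f'. (E has_field_derivative f') (at z)"
  proof (cases "z \<in> Z")
   case True
   have zb: "z \<in> ball z r" using r by simp
   have "(E has_field_derivative deriv (G z) z) (at z)"
    by (rule has_field_derivative_transform_within_open[OF holomorphic_derivI[OF G(1)[OF True] open_ball zb] open_ball zb])
     (simp add: EG[OF True])
   then show ?thesis by blast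
  next
   case False
   then have zV: "z \<in> V" by (simp add: V)
   have "(E has_field_derivative deriv D z) (at z)"
    by (rule has_field_derivative_transform_within_open[OF holomorphic_derivI[OF holD open_V zV] open_V zV]) (simp add: EV)
   then show ?thesis by blast
  qed
 qed
 have r2: "r / 2 > 0" using r by simp
 obtain K1 where K1: "\<And>z. (\<And>w. w \<in> Z ==> r / 2 \<le> norm (z - w)) ==> norm (deriv Q z) \<le> K1"
  using bounded_away[OF r2] by metis
 obtain K2 where K2: "\<And>z. (\<And>w. w \<in> Z ==> r / 2 \<le> norm (z - w)) ==> norm (deriv S z) \<le> K2"
  unfolding S_def using L.deriv_lattice_sum_bounded[OF r2] by metis
 define K where "K = K1 + 2 / (r / 2) ^ 3 + K2"
 have far: "norm (deriv E z) \<le> K" if f: "\<And>w. w \<in> Z ==> r / 2 \<le> norm (z - w)" for z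
 proof -
  have zV: "z \<in> V" using f[of z] r by (auto simp: V)
  have z0: "z \<noteq> 0" "r / 2 \<le> norm z" using nz0[OF zV] f[OF zero_Z] by auto
  have "((%z. 1 / z\<^sup>2) has_field_derivative (0 * z\<^sup>2 - 1 * (2 * z)) / (z\<^sup>2 * z\<^sup>2)) (at z)"
   using z0 by (intro DERIV_divide) (auto intro!: derivative_eq_intros)
  moreover have "(0 * z\<^sup>2 - 1 * (2 * z)) / (z\<^sup>2 * z\<^sup>2) = - 2 / z ^ 3"
   using z0 by (simp add: power2_eq_square power3_eq_cube)
  moreover have "open (- (Z - {0}))" by (rule open_Compl[OF L.closed_subset]) blast
  then have "(S has_field_derivative deriv S z) (at z)"
   by (rule holomorphic_derivI[OF holS]) (use zV V_sub in blast)
  ultimately have "(D has_field_derivative deriv Q z - (- 2 / z ^ 3) - deriv S z) (at z)"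
   unfolding D_def by (intro DERIV_diff holomorphic_derivI[OF hol_Q open_V zV]) auto
  then have "(E has_field_derivative deriv Q z - (- 2 / z ^ 3) - deriv S z) (at z)"
   by (rule has_field_derivative_transform_within_open[OF _ open_V zV]) (simp add: EV)
  then have "deriv E z = deriv Q z - (- 2 / z ^ 3) - deriv S z" by (rule DERIV_imp_deriv)
  also have "norm \<dots> \<le> norm (deriv Q z) + norm (- 2 / z ^ 3) + norm (deriv S z)"
   by (meson add_mono norm_triangle_ineq4 order.refl order.trans)
  also have "\<dots> \<le> K"
   unfolding K_def
  proof (intro add_mono K1 K2 f)
   have "(r / 2) ^ 3 \<le> norm z ^ 3" using z0 r by (intro power_mono) auto
   then show "norm (- 2 / z ^ 3) \<le> 2 / (r / 2) ^ 3"
    using r z0 by (simp only: norm_divide norm_power norm_minus_cancel norm_numeral) (intro divide_left_mono mult_pos_pos, auto)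
  qed
  finally show ?thesis .
 qed
 have holE1: "deriv E holomorphic_on UNIV" by (rule holomorphic_deriv[OF holE open_UNIV])
 \<comment> \<open>Inside a disc of radius r / 2 about a lattice point the maximum principle
   applies: the boundary circle is at distance at least r / 2 from every lattice point.\<close>
 have "norm (deriv E z) \<le> K" for z
 proof (cases "\<forall>w\<in>Z. r / 2 \<le> norm (z - w)")
  case True
  then show ?thesis by (intro far) blast
 next
  case False
  then obtain w where w: "w \<in> Z" "norm (z - w) < r / 2" by force
  show ?thesis
  proof (rule maximum_modulus_frontier[of "deriv E" "ball w (r / 2)"])
   show "deriv E holomorphic_on interior (ball w (r / 2))" by (rule holomorphic_on_subset[OF holE1]) simp
   show "continuous_on (closure (ball w (r / 2))) (deriv E)"
    by (rule continuous_on_subset[OF holomorphic_on_imp_continuous_on[OF holE1]]) simp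
   show "z \<in> ball w (r / 2)" using w by (simp add: dist_norm norm_minus_commute)
   fix y assume "y \<in> frontier (ball w (r / 2))"
   then have yw: "norm (y - w) = r / 2" using r by (simp add: dist_norm norm_minus_commute)
   show "norm (deriv E y) \<le> K"
   proof (rule far)
    fix v assume v: "v \<in> Z"
    show "r / 2 \<le> norm (y - v)"
    proof (cases "v = w")
     case False
     then have "r \<le> norm (v - w)" using L.sep v w by blast
     then show ?thesis using yw norm_triangle_ineq4[of "y - w" "y - v"] by simp
    qed (use yw in simp)
   qed
  qed simp
 qed
 then have "bounded (range (deriv E))" by (auto simp: bounded_iff)
 then have "deriv E constant_on UNIV" by (rule Liouville_theorem[OF holE1])
 then obtain c where c: "\<And>z. deriv E z = c" by (auto simp: constant_on_def)
 have "((%z. E z - c * z) has_field_derivative 0) (at z within UNIV)" for z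
  using DERIV_diff[OF holomorphic_derivI[OF holE open_UNIV UNIV_I] DERIV_cmult[OF DERIV_ident, of c]] c by simp
 then have "\<exists>e0. \<forall>z\<in>UNIV. E z - c * z = e0"
  by (intro has_field_derivative_zero_constant[OF convex_UNIV])
 then obtain e0 where e0: "\<And>z. E z - c * z = e0" by blast
 \<comment> \<open>E has constant derivative c and agrees at a and -a, which forces c = 0.\<close>
 define a where "a = complex_of_real (r / 2)"
 have a: "a \<in> ball 0 r - {0}" "a \<in> V" "- a \<in> V" using r near_V uminus_V[of a] by (auto simp: a_def)
 have "D (- a) = D a" using Q_even[OF a(2)] by (simp add: D_def S_def L.lattice_sum_uminus)
 then have "E (- a) = E a" using EV a by simp
 then have "2 * (c * a) = (E (- a) - c * (- a)) - (E a - c * a)" by simp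
 also have "\<dots> = 0" by (simp only: e0 diff_self)
 finally have c0: "c = 0" using a(1) by auto
 have hS: "h z - S z = e0" if "z \<in> ball 0 r" for z
 proof (rule holomorphic_eq_on_punctured_ball[OF hol_hS holomorphic_on_const r _ that])
  fix z :: complex assume z: "z \<in> ball 0 r - {0}"
  then have "E z = h z - S z" using EV D_near0[OF z] near_V by auto
  then show "h z - S z = e0" using e0[of z] c0 by simp
 qed
 have "0 \<in> ball (0::complex) r" using r by simp
 from hS[OF this] have "e0 = 0" by (simp add: h0 S_def L.lattice_sum_0)
 then show ?thesis using hS[OF z] by (simp add: S_def)
qed

end

subsection \<open>Discrete subgroups of the plane\<close>

lemma closed_attains_minimal_norm:
 fixes S :: "complex set"
 assumes "closed S" "S \<noteq> {}"
 obtains w where "w \<in> S" "\<And>z. z \<in> S ==> norm w \<le> norm z"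
 using distance_attains_inf[OF assms, of 0] by auto

text \<open>The generators are a shortest nonzero vector w1 and a shortest vector w2 off the real
  line through w1. Halves appear because \<open>period_lattice\<close> takes half-periods.\<close>

lemma discrete_subgroup_eq_period_lattice:
 fixes \<Lambda> :: "complex set"
 assumes zero: "0 \<in> \<Lambda>" and diff: "\<And>x y. x \<in> \<Lambda> ==> y \<in> \<Lambda> ==> x - y \<in> \<Lambda>"
  and sep: "\<delta> > 0" "\<And>x. x \<in> \<Lambda> ==> x \<noteq> 0 ==> \<delta> \<le> norm x"
 shows "\<exists>\<omega>1 \<omega>2. primitive_half_periods \<omega>1 \<omega>2 \<and> \<Lambda> = period_lattice \<omega>1 \<omega>2"
proof -
 have uminus: "- x \<in> \<Lambda>" if "x \<in> \<Lambda>" for x using diff[OF zero that] by simp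
 have add: "x + y \<in> \<Lambda>" if "x \<in> \<Lambda>" "y \<in> \<Lambda>" for x y using diff[OF that(1) uminus[OF that(2)]] by simp
 have nat_mult: "of_nat n * x \<in> \<Lambda>" if "x \<in> \<Lambda>" for n x
  by (induction n) (use zero add that in \<open>auto simp: distrib_right\<close>)
 have int_mult: "of_int m * x \<in> \<Lambda>" if "x \<in> \<Lambda>" for m x
 proof (cases "m \<ge> 0")
  case True
  then show ?thesis using nat_mult[OF that, of "nat m"] by simp
 next
  case False
  then show ?thesis using uminus[OF nat_mult[OF that, of "nat (-m)"]] by simp
 qed
 have closed: "closed S" if "S \<subseteq> \<Lambda>" for S
 proof (rule discrete_imp_closed[OF sep(1)], intro ballI impI)
  fix x y assume xy: "x \<in> S" "y \<in> S" "dist y x < \<delta>"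
  then have "y - x \<in> \<Lambda>" using that diff by blast
  then show "y = x" using sep(2)[of "y - x"] xy(3) by (auto simp: dist_norm)
 qed
 consider "\<Lambda> = {0}" | w where "w \<in> \<Lambda>" "w \<noteq> 0" using zero by blast
 then show ?thesis
 proof cases
  case 1
  then have "\<Lambda> = period_lattice None None" by (simp add: period_lattice_def)
  then show ?thesis by (intro exI[of _ None]) simp
 next
  case 2
  then have "\<Lambda> - {0} \<noteq> {}" by blast
  then obtain w1 where w1: "w1 \<in> \<Lambda> - {0}" and w1_min: "\<And>z. z \<in> \<Lambda> - {0} ==> norm w1 \<le> norm z"
   using closed_attains_minimal_norm[of "\<Lambda> - {0}"] closed by blast
  have w10: "w1 \<noteq> 0" "w1 \<in> \<Lambda>" using w1 by auto
  \<comment> \<open>The fractional part of t would otherwise give a nonzero vector shorter than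
    w1.\<close>
  have real_mult: "t \<in> \<int>" if "of_real t * w1 \<in> \<Lambda>" for t
  proof (rule ccontr)
   assume t: "t \<notin> \<int>"
   have "of_real t * w1 - of_int \<lfloor>t\<rfloor> * w1 \<in> \<Lambda>" using diff[OF that int_mult[OF w10(2)]] .
   moreover have "of_real t * w1 - of_int \<lfloor>t\<rfloor> * w1 = of_real (frac t) * w1"
    by (simp add: frac_def algebra_simps)
   moreover have "frac t > 0" using t by (simp add: frac_gt_0_iff)
   ultimately have "norm w1 \<le> norm (of_real (frac t) * w1)" using w10 by (intro w1_min) auto
   moreover have "\<dots> < norm w1" using \<open>frac t > 0\<close> frac_lt_1[of t] w10 by (simp add: norm_mult)
   ultimately show False by simp
  qed
  show ?thesis
  proof (cases "\<forall>z\<in>\<Lambda>. z / w1 \<in> \<real>")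
   case True
   have "\<Lambda> = period_lattice (Some (w1/2)) None"
   proof (intro equalityI subsetI)
    fix z assume z: "z \<in> \<Lambda>"
    then obtain t where t: "z / w1 = of_real t" using True by (auto elim: Reals_cases)
    then have zt: "z = of_real t * w1" using w10 by (simp add: field_simps)
    then obtain m where "t = of_int m" using real_mult z by (auto elim: Ints_cases)
    then show "z \<in> period_lattice (Some (w1/2)) None" using zt by (auto simp: period_lattice_def)
   qed (use int_mult w10 in \<open>auto simp: period_lattice_def\<close>)
   then show ?thesis using w10 by (intro exI[of _ "Some (w1/2)"] exI[of _ None]) simp
  next
   case False
   define S where "S = {z \<in> \<Lambda>. z / w1 \<notin> \<real>}"
   have "S \<noteq> {}" "S \<subseteq> \<Lambda>" using False by (auto simp: S_def)
   then obtain w2 where w2: "w2 \<in> S" and w2_min: "\<And>z. z \<in> S ==> norm w2 \<le> norm z"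
    using closed_attains_minimal_norm[of S] closed by blast
   define \<tau> where "\<tau> = w2 / w1"
   have \<tau>: "Im \<tau> \<noteq> 0" using w2 by (simp add: S_def \<tau>_def complex_is_Real_iff)
   have w2\<tau>: "w2 = \<tau> * w1" using w10 by (simp add: \<tau>_def)
   have w20: "w2 \<in> \<Lambda>" "w2 \<noteq> 0" using w2 by (auto simp: S_def)
   have w12: "norm w1 \<le> norm w2" using w20 by (intro w1_min) auto
   have "\<Lambda> = period_lattice (Some (w1/2)) (Some (w2/2))"
   proof (intro equalityI subsetI)
    fix z assume z: "z \<in> \<Lambda>"
    define t where "t = Im (z / w1) / Im \<tau>"
    define s where "s = Re (z / w1) - t * Re \<tau>"
    have "z / w1 = of_real s + of_real t * \<tau>"
     using \<tau> by (simp add: complex_eq_iff s_def t_def)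
    then have zst: "z = of_real s * w1 + of_real t * w2"
     using w10 by (simp add: w2\<tau> field_simps)
    \<comment> \<open>Rounding to nearest integers leaves coefficients of size at most 1/2, so the
      remainder z' has norm at most that of w2.\<close>
    define m n where "m = round s" and "n = round t"
    define s' t' where "s' = s - of_int m" and "t' = t - of_int n"
    have small: "\<bar>s'\<bar> \<le> 1/2" "\<bar>t'\<bar> \<le> 1/2"
     using of_int_round_abs_le[of s] of_int_round_abs_le[of t] by (auto simp: s'_def t'_def m_def n_def abs_minus_commute)
    define z' where "z' = z - of_int m * w1 - of_int n * w2"
    have z'\<Lambda>: "z' \<in> \<Lambda>" unfolding z'_def by (intro diff z int_mult w10 w20)
    have z'eq: "z' = of_real s' * w1 + of_real t' * w2"
     by (simp add: z'_def zst s'_def t'_def algebra_simps)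
    \<comment> \<open>If t' were nonzero, minimality of w2 would force equality in the triangle
      inequality, so the two summands would be parallel, although w1 and w2 are not.\<close>
    have t'0: "t' = 0"
    proof (rule ccontr)
     assume t': "t' \<noteq> 0"
     have "z' / w1 = of_real s' + of_real t' * \<tau>" using w10 by (simp add: z'eq w2\<tau> field_simps)
     then have "Im (z' / w1) \<noteq> 0" using t' \<tau> by simp
     then have "z' \<in> S" using z'\<Lambda> by (simp add: S_def complex_is_Real_iff)
     then have ge: "norm w2 \<le> norm z'" by (rule w2_min)
     have n1: "norm (of_real s' * w1) \<le> norm w2 / 2" "norm (of_real t' * w2) \<le> norm w2 / 2"
      using mult_mono[OF small(1) w12] mult_right_mono[OF small(2), of "norm w2"] by (auto simp: norm_mult)
     then have eq: "norm z' = norm (of_real s' * w1) + norm (of_real t' * w2)"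
      "norm (of_real s' * w1) = norm w2 / 2" "norm (of_real t' * w2) = norm w2 / 2"
      using ge norm_triangle_ineq[of "of_real s' * w1" "of_real t' * w2"] unfolding z'eq by linarith+
     then have "norm (of_real s' * w1) *\<^sub>R (of_real t' * w2) = norm (of_real t' * w2) *\<^sub>R (of_real s' * w1)"
      using norm_triangle_eq[of "of_real s' * w1" "of_real t' * w2"] unfolding z'eq by simp
     then have "of_real t' * w2 = of_real s' * w1" using eq w20 by simp
     then have "of_real t' * \<tau> = of_real s'" using w10 by (simp add: w2\<tau>)
     then have "Im (of_real t' * \<tau>) = 0" by simp
     then show False using t' \<tau> by simp
    qed
    then have "s' \<in> \<int>" using real_mult[of s'] z'\<Lambda> z'eq by simp
    then obtain k where "s' = of_int k" by (auto elim: Ints_cases)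
    then have "s' = 0" using small by auto
    then have "z' = 0" using t'0 z'eq by simp
    then have "z = of_int m * w1 + of_int n * w2" by (simp add: z'_def algebra_simps)
    then show "z \<in> period_lattice (Some (w1/2)) (Some (w2/2))" by (auto simp: period_lattice_def)
   qed (use int_mult w10 w20 add in \<open>auto simp: period_lattice_def\<close>)
   moreover have "primitive_half_periods (Some (w1/2)) (Some (w2/2))"
    using w10 w2 by (simp add: S_def)
   ultimately show ?thesis by blast
  qed
 qed
qed

text \<open>Two integrations of q''' = 12 q q' produce the constants \<kappa> and \<kappa>2; a
  punctured disc is connected, so each is a single constant.\<close>

lemma third_order_ode_lattice_sum:
 fixes h :: "complex => complex"
 assumes rho: "\<rho> > 0" and hol_h: "h holomorphic_on ball 0 \<rho>"
  and even: "\<And>z. z \<in> ball 0 \<rho> ==> h (- z) = h z" and h_0: "h 0 = 0"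
  and q: "\<And>z. q z = 1 / z\<^sup>2 + h z"
  and ode: "\<And>z. z \<in> ball 0 \<rho> - {0} ==> deriv (deriv (deriv q)) z = 12 * q z * deriv q z"
 obtains \<omega>1 \<omega>2 \<delta> r where "primitive_half_periods \<omega>1 \<omega>2" "discrete_subgroup (period_lattice \<omega>1 \<omega>2) \<delta>" "r > 0"
  "\<And>z. z \<in> ball 0 r ==> h z = lattice_sum (period_lattice \<omega>1 \<omega>2) z"
proof -
 let ?D = "ball 0 \<rho> - {0} :: complex set"
 have open_D: "open ?D" by (intro open_delete open_ball)
 have hol_q: "q holomorphic_on ?D"
 proof -
  have "(%z. 1 / z\<^sup>2 + h z) holomorphic_on ?D"
   by (intro holomorphic_intros holomorphic_on_subset[OF hol_h]) auto
  then show ?thesis by (simp add: q[abs_def])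
 qed
 note hd1 = holomorphic_deriv[OF hol_q open_D]
 note hd2 = holomorphic_deriv[OF hd1 open_D]
 have d: "(q has_field_derivative deriv q z) (at z)" "(deriv q has_field_derivative deriv (deriv q) z) (at z)"
  "(deriv (deriv q) has_field_derivative deriv (deriv (deriv q)) z) (at z)" if "z \<in> ?D" for z
  using holomorphic_derivI[OF hol_q open_D that] holomorphic_derivI[OF hd1 open_D that] holomorphic_derivI[OF hd2 open_D that] .
 define F1 where "F1 = (%z. deriv (deriv q) z - 6 * (q z)\<^sup>2)"
 have "(F1 has_field_derivative 0) (at z)" if z: "z \<in> ?D" for z
 proof -
  have "(F1 has_field_derivative deriv (deriv (deriv q)) z - 6 * (of_nat 2 * (deriv q z * q z ^ (2 - Suc 0)))) (at z)"
   unfolding F1_def by (rule DERIV_diff[OF d(3)[OF z] DERIV_cmult[OF DERIV_power[OF d(1)[OF z]]]])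
  moreover have "deriv (deriv (deriv q)) z - 6 * (of_nat 2 * (deriv q z * q z ^ (2 - Suc 0))) = 0"
   unfolding ode[OF z] by simp
  ultimately show ?thesis by (simp only:)
 qed
 then obtain \<kappa> where \<kappa>: "\<And>z. z \<in> ?D ==> F1 z = \<kappa>"
  using holomorphic_deriv_eq_0_punctured_ball[of \<rho> F1] by metis
 have k1: "deriv (deriv q) z = 6 * (q z)\<^sup>2 + \<kappa>" if "z \<in> ?D" for z using \<kappa>[OF that] by (simp add: F1_def algebra_simps)
 define F2 where "F2 = (%z. (deriv q z)\<^sup>2 - (4 * q z ^ 3 + 2 * \<kappa> * q z))"
 have "(F2 has_field_derivative 0) (at z)" if z: "z \<in> ?D" for z
 proof -
  have "(F2 has_field_derivative
    of_nat 2 * (deriv (deriv q) z * deriv q z ^ (2 - Suc 0)) - (4 * (of_nat 3 * (deriv q z * q z ^ (3 - Suc 0))) + 2 * \<kappa> * deriv q z)) (at z)"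
   unfolding F2_def
   by (rule DERIV_diff[OF DERIV_power[OF d(2)[OF z]] DERIV_add[OF DERIV_cmult[OF DERIV_power[OF d(1)[OF z]]] DERIV_cmult[OF d(1)[OF z]]]])
  moreover have "of_nat 2 * (deriv (deriv q) z * deriv q z ^ (2 - Suc 0)) - (4 * (of_nat 3 * (deriv q z * q z ^ (3 - Suc 0))) + 2 * \<kappa> * deriv q z) = 0"
   by (simp add: k1[OF z] algebra_simps)
  ultimately show ?thesis by (simp only:)
 qed
 then obtain \<kappa>2 where \<kappa>2: "\<And>z. z \<in> ?D ==> F2 z = \<kappa>2"
  using holomorphic_deriv_eq_0_punctured_ball[of \<rho> F2] by metis
 interpret weierstrass_germ h \<rho> \<kappa> \<kappa>2 q
 proof
  show "(deriv q z)\<^sup>2 = 4 * q z ^ 3 + 2 * \<kappa> * q z + \<kappa>2" if "z \<in> ?D" for z using \<kappa>2[OF that] by (simp add: F2_def algebra_simps)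
 qed (use rho hol_h even h_0 q k1 in auto)
 obtain \<sigma> r where \<sigma>: "\<sigma> holomorphic_on UNIV" "0 < r" "r \<le> \<rho>" "\<sigma> 0 = 0" and nz: "\<And>z. z \<in> ball 0 r - {0} ==> \<sigma> z \<noteq> 0"
  and odd: "\<And>z. \<sigma> (- z) = - \<sigma> z"
  and \<sigma>q: "\<And>z. z \<in> ball 0 r - {0} ==> ((deriv \<sigma> z)\<^sup>2 - \<sigma> z * deriv (deriv \<sigma>) z) / (\<sigma> z)\<^sup>2 = q z"
  by (rule entire_sigma) blast
 define Q where "Q = (%z. ((deriv \<sigma> z)\<^sup>2 - \<sigma> z * deriv (deriv \<sigma>) z) / (\<sigma> z)\<^sup>2)"
 define Z where "Z = {z. \<sigma> z = 0}"
 have B: "open (ball (0::complex) r - {0})" by (intro open_delete open_ball)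
 have zD: "z \<in> ?D" if "z \<in> ball 0 r - {0}" for z using that \<sigma>(3) by auto
 have Qq: "Q z = q z" if "z \<in> ball 0 r - {0}" for z using \<sigma>q[OF that] by (simp add: Q_def)
 have Qq1: "deriv Q z = deriv q z" if "z \<in> ball 0 r - {0}" for z by (rule deriv_eq_on_open[OF B that Qq])
 have Qq2: "deriv (deriv Q) z = deriv (deriv q) z" if "z \<in> ball 0 r - {0}" for z by (rule deriv_eq_on_open[OF B that Qq1])
 interpret M: meromorphic_wp \<sigma> r h \<kappa> \<kappa>2 Z "- Z" Q
 proof
  show "h holomorphic_on ball 0 r" by (rule holomorphic_on_subset[OF hol_h]) (use \<sigma>(3) in auto)
  show "h (- z) = h z" if "z \<in> ball 0 r" for z using even[of z] that \<sigma>(3) by auto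
  fix z :: complex assume z: "z \<in> ball 0 r - {0}"
  show "Q z = 1 / z\<^sup>2 + h z" using Qq[OF z] q[of z] by simp
  show "(deriv Q z)\<^sup>2 = 4 * Q z ^ 3 + 2 * \<kappa> * Q z + \<kappa>2" unfolding Qq[OF z] Qq1[OF z] by (rule ode1[OF zD[OF z]])
  show "deriv (deriv Q) z = 6 * (Q z)\<^sup>2 + \<kappa>" unfolding Qq[OF z] Qq2[OF z] by (rule ode2[OF zD[OF z]])
  show "\<sigma> z \<noteq> 0" using z by (rule nz)
 qed (use \<sigma> odd h_0 in \<open>auto simp: Q_def Z_def\<close>)
 interpret L: discrete_subgroup Z r by (rule M.discrete)
 obtain \<omega>1 \<omega>2 where \<omega>: "primitive_half_periods \<omega>1 \<omega>2" "Z = period_lattice \<omega>1 \<omega>2"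
  using discrete_subgroup_eq_period_lattice[OF L.zero L.diff L.pos L.min_norm] by blast
 show thesis
  by (rule that[OF \<omega>(1) _ \<sigma>(2)]) (use M.discrete M.h_eq_lattice_sum in \<open>auto simp: \<omega>(2)[symmetric]\<close>)
qed

subsection \<open>Sums of functions of coordinate differences\<close>

text \<open>Summing over all ordered pairs and halving avoids case distinctions on the order of
  indices; for symmetric families with zero diagonal it is the sum over i < j.\<close>

definition pair_sum :: "('n::finite => 'n => complex => complex) => real^'n => complex" where
 "pair_sum f x = (\<Sum>i\<in>UNIV. \<Sum>j\<in>UNIV. f i j (of_real (x $ i - x $ j))) / 2"

text \<open>Serves both for regular families, with S a disc, and for families with poles, with S a
  punctured disc and W the complement of the walls. The reflection rule \<open>sym\<close> makes the
  summand depend on the unordered pair only.\<close>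

locale pair_functions =
 fixes f :: "'n::finite => 'n => complex => complex" and S :: "complex set" and W :: "(real^'n) set"
 assumes S: "open S" and W: "open W" and WS: "\<And>x i j. x \<in> W ==> i \<noteq> j ==> of_real (x $ i - x $ j) \<in> S"
  and hol: "\<And>i j. f i j holomorphic_on S" and diag: "\<And>i z. f i i z = 0"
  and sym: "\<And>i j z. z \<in> S ==> f j i (- z) = f i j z" and S_uminus: "\<And>z. z \<in> S ==> - z \<in> S"
begin

lemma diag_fun: "f i i = (%_. 0)" using diag by blast

lemma smooth_pair: "smooth_on W (%x. f i j (of_real (x $ i - x $ j)))"
proof (cases "i = j")
 case True
 then show ?thesis by (simp add: diag smooth_on_const)
next
 case False
 then show ?thesis using WS by (intro smooth_on_holomorphic_difference[OF S W _ hol]) auto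
qed

lemma smooth_pair': "smooth_on W (%x. deriv (f i j) (of_real (x $ i - x $ j)))"
proof (cases "i = j")
 case True
 then show ?thesis by (simp add: diag_fun smooth_on_const)
next
 case False
 then show ?thesis using WS by (intro smooth_on_holomorphic_difference[OF S W _ holomorphic_deriv[OF hol S]]) auto
qed

lemma smooth_pair_sum: "smooth_on W (pair_sum f)"
proof -
 have "smooth_on W (%x. 1/2 * (\<Sum>i\<in>UNIV. \<Sum>j\<in>UNIV. f i j (of_real (x $ i - x $ j))))"
  by (intro smooth_on_cmult smooth_on_sum W smooth_pair)
 then show ?thesis by (simp add: pair_sum_def[abs_def])
qed

lemma partial_pair:
 assumes x: "x \<in> W"
 shows "partial k (%x. f i j (of_real (x $ i - x $ j))) x = (of_bool (k = i) - of_bool (k = j)) * deriv (f i j) (of_real (x $ i - x $ j))"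
proof (cases "i = j")
 case True
 then show ?thesis by (simp add: diag_fun)
next
 case False
 show ?thesis by (rule partial_holomorphic_difference[OF hol S WS[OF x False]])
qed

lemma partial_pair':
 assumes x: "x \<in> W"
 shows "partial k (%x. deriv (f i j) (of_real (x $ i - x $ j))) x = (of_bool (k = i) - of_bool (k = j)) * deriv (deriv (f i j)) (of_real (x $ i - x $ j))"
proof (cases "i = j")
 case True
 then show ?thesis by (simp add: diag_fun)
next
 case False
 show ?thesis by (rule partial_holomorphic_difference[OF holomorphic_deriv[OF hol S] S WS[OF x False]])
qed

lemma deriv_sym:
 assumes z: "z \<in> S"
 shows "deriv (f j i) (- z) = - deriv (f i j) z"
proof -
 have "(f j i has_field_derivative deriv (f j i) (- z)) (at (- z))"
  by (rule holomorphic_derivI[OF hol S S_uminus[OF z]])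
 from DERIV_chain2[where g = uminus, OF this DERIV_minus[OF DERIV_ident]]
 have "((%z. f j i (- z)) has_field_derivative - deriv (f j i) (- z)) (at z)" by simp
 then have "(f i j has_field_derivative - deriv (f j i) (- z)) (at z)"
  by (rule has_field_derivative_transform_within_open[OF _ S z]) (rule sym)
 then have "deriv (f i j) z = - deriv (f j i) (- z)" by (rule DERIV_imp_deriv)
 then show ?thesis by simp
qed

lemma deriv_sym_x:
 assumes x: "x \<in> W"
 shows "deriv (f j i) (of_real (x $ j - x $ i)) = - deriv (f i j) (of_real (x $ i - x $ j))"
proof (cases "i = j")
 case True
 then show ?thesis by (simp add: diag_fun)
next
 case False
 then show ?thesis using deriv_sym[OF WS[OF x False], of j i] by simp
qed

lemma partial_pair_sum:
 assumes x: "x \<in> W"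
 shows "partial k (pair_sum f) x = (\<Sum>l\<in>UNIV. deriv (f k l) (of_real (x $ k - x $ l)))"
proof -
 let ?D = "%i j. deriv (f i j) (of_real (x $ i - x $ j))"
 have "partial k (pair_sum f) x = partial k (%x. 1/2 * (\<Sum>i\<in>UNIV. \<Sum>j\<in>UNIV. f i j (of_real (x $ i - x $ j)))) x"
  by (simp add: pair_sum_def[abs_def])
 also have "\<dots> = 1/2 * partial k (%x. \<Sum>i\<in>UNIV. \<Sum>j\<in>UNIV. f i j (of_real (x $ i - x $ j))) x"
  by (rule partial_cmult) (intro smooth_on_differentiable[OF _ x] smooth_on_sum W smooth_pair)
 also have "partial k (%x. \<Sum>i\<in>UNIV. \<Sum>j\<in>UNIV. f i j (of_real (x $ i - x $ j))) x
   = (\<Sum>i\<in>UNIV. partial k (%x. \<Sum>j\<in>UNIV. f i j (of_real (x $ i - x $ j))) x)"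
  by (rule partial_sum) (intro smooth_on_differentiable[OF _ x] smooth_on_sum W smooth_pair)
 also have "\<dots> = (\<Sum>i\<in>UNIV. \<Sum>j\<in>UNIV. partial k (%x. f i j (of_real (x $ i - x $ j))) x)"
  by (intro sum.cong refl partial_sum) (intro smooth_on_differentiable[OF _ x] smooth_pair)
 also have "\<dots> = (\<Sum>i\<in>UNIV. \<Sum>j\<in>UNIV. (if i = k then ?D i j else 0) - (if j = k then ?D i j else 0))"
  unfolding partial_pair[OF x] by (intro sum.cong refl) auto
 also have "\<dots> = (\<Sum>i\<in>UNIV. \<Sum>j\<in>UNIV. if i = k then ?D i j else 0) - (\<Sum>i\<in>UNIV. \<Sum>j\<in>UNIV. if j = k then ?D i j else 0)"
  by (simp only: sum_subtractf)
 also have "(\<Sum>i\<in>UNIV. \<Sum>j\<in>UNIV. if i = k then ?D i j else 0) = (\<Sum>i\<in>UNIV. if i = k then (\<Sum>j\<in>UNIV. ?D i j) else 0)"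
  by (intro sum.cong refl) auto
 also have "\<dots> = (\<Sum>j\<in>UNIV. ?D k j)" by simp
 also have "(\<Sum>i\<in>UNIV. \<Sum>j\<in>UNIV. if j = k then ?D i j else 0) = (\<Sum>i\<in>UNIV. ?D i k)" by simp
 also have "(\<Sum>i\<in>UNIV. ?D i k) = (\<Sum>i\<in>UNIV. - ?D k i)" by (intro sum.cong refl deriv_sym_x x)
 finally show ?thesis by (simp add: sum_negf)
qed

lemma sum_partial_pair_sum:
 assumes x: "x \<in> W"
 shows "(\<Sum>k\<in>UNIV. partial k (pair_sum f) x) = 0"
proof -
 let ?D = "%i j. deriv (f i j) (of_real (x $ i - x $ j))"
 define s where "s = (\<Sum>k\<in>UNIV. \<Sum>l\<in>UNIV. ?D k l)"
 have "s = (\<Sum>l\<in>UNIV. \<Sum>k\<in>UNIV. ?D k l)" unfolding s_def by (rule sum.swap)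
 also have "\<dots> = (\<Sum>l\<in>UNIV. \<Sum>k\<in>UNIV. - ?D l k)" by (intro sum.cong refl deriv_sym_x x)
 also have "\<dots> = - s" by (simp add: s_def sum_negf)
 finally have "s = 0" by simp
 then show ?thesis unfolding partial_pair_sum[OF x] s_def .
qed

text \<open>A mixed derivative isolates a single pair, which is what makes the pair functions
  recoverable from the sum.\<close>

lemma partial2_pair_sum:
 assumes x: "x \<in> W" and kl: "k \<noteq> l"
 shows "partial l (partial k (pair_sum f)) x = - deriv (deriv (f k l)) (of_real (x $ k - x $ l))"
proof -
 have "partial l (partial k (pair_sum f)) x = partial l (%x. \<Sum>m\<in>UNIV. deriv (f k m) (of_real (x $ k - x $ m))) x"
  using W x by (rule partial_cong) (rule partial_pair_sum)
 also have "\<dots> = (\<Sum>m\<in>UNIV. partial l (%x. deriv (f k m) (of_real (x $ k - x $ m))) x)"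
  by (rule partial_sum) (intro smooth_on_differentiable[OF _ x] smooth_pair')
 also have "\<dots> = (\<Sum>m\<in>UNIV. if m = l then - deriv (deriv (f k m)) (of_real (x $ k - x $ m)) else 0)"
  unfolding partial_pair'[OF x] using kl by (intro sum.cong refl) auto
 finally show ?thesis by simp
qed

lemma partial3_pair_sum:
 assumes x: "x \<in> W" and kl: "k \<noteq> l"
 shows "partial m (partial l (partial k (pair_sum f))) x = - ((of_bool (m = k) - of_bool (m = l)) * deriv (deriv (deriv (f k l))) (of_real (x $ k - x $ l)))"
proof -
 have h2: "deriv (deriv (f k l)) holomorphic_on S" by (intro holomorphic_deriv hol S)
 have sm: "smooth_on W (%x. deriv (deriv (f k l)) (of_real (x $ k - x $ l)))"
  using WS kl by (intro smooth_on_holomorphic_difference[OF S W _ h2]) auto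
 have "partial m (partial l (partial k (pair_sum f))) x = partial m (%x. (- 1) * deriv (deriv (f k l)) (of_real (x $ k - x $ l))) x"
  using W x by (rule partial_cong) (simp add: partial2_pair_sum kl)
 also have "\<dots> = (- 1) * partial m (%x. deriv (deriv (f k l)) (of_real (x $ k - x $ l))) x"
  by (rule partial_cmult) (intro smooth_on_differentiable[OF sm x])
 finally show ?thesis using partial_holomorphic_difference[OF h2 S WS[OF x kl]] by simp
qed

end

lemma inj_vec_exists: "\<exists>y::real^'n::finite. \<forall>i j. i \<noteq> j --> y $ i \<noteq> y $ j"
proof -
 obtain g :: "'n => nat" where g: "inj g" using finite_imp_inj_to_nat_seg[of "UNIV :: 'n set"] by (auto simp: inj_on_def)
 show ?thesis by (rule exI[of _ "\<chi> i. real (g i)"]) (use g in \<open>auto simp: inj_eq\<close>)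
qed

lemma eventually_distinct:
 fixes x y :: "real^'n::finite"
 assumes y: "\<forall>i j. i \<noteq> j --> y $ i \<noteq> y $ j"
 shows "eventually (%t. \<forall>i j. i \<noteq> j --> (x + t *\<^sub>R y) $ i \<noteq> (x + t *\<^sub>R y) $ j) (at_right 0)"
proof -
 have "eventually (%t. i \<noteq> j --> (x + t *\<^sub>R y) $ i \<noteq> (x + t *\<^sub>R y) $ j) (at_right 0)" for i j
 proof (cases "i = j")
  case False
  show ?thesis
  proof (cases "x $ i = x $ j")
   case True
   have "eventually (%t::real. t > 0) (at_right 0)" by (rule eventually_at_right_less)
   then show ?thesis by eventually_elim (use True False y in auto)
  next
   case ne: False
   have "((%t. (x + t *\<^sub>R y) $ i - (x + t *\<^sub>R y) $ j) \<longlongrightarrow> x $ i - x $ j) (at_right 0)"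
    by (auto intro!: tendsto_eq_intros)
   then have "eventually (%t. (x + t *\<^sub>R y) $ i - (x + t *\<^sub>R y) $ j \<noteq> 0) (at_right 0)"
    by (rule tendsto_imp_eventually_ne) (use ne in simp)
   then show ?thesis by eventually_elim auto
  qed
 qed simp
 then show ?thesis by (simp add: eventually_all_finite)
qed

text \<open>A ray whose direction has distinct coordinates leaves all walls at once, so identities
  proved off the walls hold on them by continuity.\<close>

lemma zero_on_dense:
 fixes F :: "real^'n::finite => complex"
 assumes B: "open B" "x \<in> B" and F: "F differentiable (at x)"
  and 0: "\<And>z. z \<in> B ==> (\<And>i j. i \<noteq> j ==> z $ i \<noteq> z $ j) ==> F z = 0"
 shows "F x = 0"
proof -
 obtain y :: "real^'n" where y: "\<forall>i j. i \<noteq> j --> y $ i \<noteq> y $ j" using inj_vec_exists by blast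
 have l: "((%t. x + t *\<^sub>R y) \<longlongrightarrow> x) (at_right 0)" by (auto intro!: tendsto_eq_intros)
 have "isCont F x" using F by (rule differentiable_imp_continuous_within)
 then have "((%t. F (x + t *\<^sub>R y)) \<longlongrightarrow> F x) (at_right 0)" using l by (rule isCont_tendsto_compose)
 moreover have "eventually (%t. x + t *\<^sub>R y \<in> B) (at_right 0)" using l B by (rule topological_tendstoD)
 then have "eventually (%t. F (x + t *\<^sub>R y) = 0) (at_right 0)"
  using eventually_distinct[OF y, of x] by eventually_elim (rule 0, auto)
 then have "((%t. F (x + t *\<^sub>R y)) \<longlongrightarrow> 0) (at_right 0)" by (rule tendsto_eventually)
 ultimately show ?thesis using tendsto_unique trivial_limit_at_right_real by blast
qed

lemma directional_constant:
 fixes f :: "real^'n::finite => complex"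
 assumes W: "convex W" and f: "\<And>z. z \<in> W ==> f differentiable (at z)"
  and d: "\<And>z. z \<in> W ==> (\<Sum>i\<in>UNIV. (y - x) $ i *\<^sub>R partial i f z) = 0" and xy: "x \<in> W" "y \<in> W"
 shows "f y = f x"
proof -
 define g where "g = (%t. f (x + t *\<^sub>R (y - x)))"
 have inW: "x + t *\<^sub>R (y - x) \<in> W" if "t \<in> {0..1}" for t
  using convexD_alt[OF W xy, of t] that by (simp add: algebra_simps)
 have "(g has_vector_derivative 0) (at t within {0..1})" if t: "t \<in> {0..1}" for t
 proof -
  have 1: "((%t. x + t *\<^sub>R (y - x)) has_derivative (%s. s *\<^sub>R (y - x))) (at t)"
   by (auto intro!: derivative_eq_intros)
  have "(g has_derivative (%s. \<Sum>i\<in>UNIV. (s *\<^sub>R (y - x)) $ i *\<^sub>R partial i f (x + t *\<^sub>R (y - x)))) (at t)"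
   unfolding g_def by (rule has_derivative_compose[OF 1 directional_derivative[OF f[OF inW[OF t]]]])
  moreover have "(\<Sum>i\<in>UNIV. (s *\<^sub>R (y - x)) $ i *\<^sub>R partial i f (x + t *\<^sub>R (y - x))) = 0" for s
  proof -
   have "(\<Sum>i\<in>UNIV. (s *\<^sub>R (y - x)) $ i *\<^sub>R partial i f (x + t *\<^sub>R (y - x))) = s *\<^sub>R (\<Sum>i\<in>UNIV. (y - x) $ i *\<^sub>R partial i f (x + t *\<^sub>R (y - x)))"
    by (simp add: scaleR_sum_right)
   then show ?thesis using d[OF inW[OF t]] by simp
  qed
  ultimately have "(g has_vector_derivative 0) (at t)" by (simp add: has_vector_derivative_def)
  then show ?thesis by (rule has_vector_derivative_at_within)
 qed
 then obtain c where "\<And>t. t \<in> {0..1} ==> g t = c"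
  using has_vector_derivative_zero_constant[of "{0..1::real}" g] by auto
 from this[of 0] this[of 1] show ?thesis by (simp add: g_def)
qed

lemma constant_of_zero_partials:
 fixes f :: "real^'n::finite => complex"
 assumes "convex W" "\<And>z. z \<in> W ==> f differentiable (at z)" "\<And>z i. z \<in> W ==> partial i f z = 0" "x \<in> W" "y \<in> W"
 shows "f y = f x"
 by (rule directional_constant[OF assms(1,2) _ assms(4,5)]) (simp_all add: assms(3))

lemma partial_coordinate: "partial i (%x. of_real (x $ j)) x = of_bool (i = j)"
 "(%x::real^'n::finite. of_real (x $ j) :: complex) differentiable (at x)"
proof -
 have d: "((%x::real^'n. of_real (x $ j) :: complex) has_derivative (%y. of_real (y $ j))) (at x)"
  by (intro bounded_linear.has_derivative[OF bounded_linear_of_real] bounded_linear.has_derivative[OF bounded_linear_vec_nth] has_derivative_ident)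
 then show "(%x::real^'n. of_real (x $ j) :: complex) differentiable (at x)" by (rule differentiableI)
 show "partial i (%x. of_real (x $ j)) x = of_bool (i = j)"
  using partial_eq_derivative(2)[OF d, of i] by (simp add: axis_def)
qed

lemma partial_linear:
 "partial i (%x. \<Sum>j\<in>UNIV. l j * of_real (x $ j)) x = l i"
 "(%x::real^'n::finite. \<Sum>j\<in>UNIV. l j * of_real (x $ j) :: complex) differentiable (at x)"
proof -
 have dj: "(%x::real^'n. l j * of_real (x $ j)) differentiable (at x)" for j
  by (intro differentiable_mult differentiable_const partial_coordinate)
 show "(%x::real^'n. \<Sum>j\<in>UNIV. l j * of_real (x $ j) :: complex) differentiable (at x)"
  by (rule differentiable_sum) (use dj in auto)
 have "partial i (%x. \<Sum>j\<in>UNIV. l j * of_real (x $ j)) x = (\<Sum>j\<in>UNIV. l j * of_bool (i = j))"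
  using dj by (subst partial_sum) (auto simp: partial_cmult partial_coordinate)
 also have "\<dots> = l i" by (simp add: of_bool_def if_distrib cong: if_cong)
 finally show "partial i (%x. \<Sum>j\<in>UNIV. l j * of_real (x $ j)) x = l i" .
qed

lemma affine_of_zero_second_partials:
 fixes g :: "real^'n::finite => complex"
 assumes W: "convex W" "open W" and g: "smooth_on W g" and x0: "x0 \<in> W"
  and 0: "\<And>z i j. z \<in> W ==> partial i (partial j g) z = 0"
 obtains l m where "\<And>x i. x \<in> W ==> partial i g x = l i" "\<And>x. x \<in> W ==> g x = m + (\<Sum>j\<in>UNIV. l j * of_real (x $ j))"
proof -
 define l where "l = (%i. partial i g x0)"
 have pl: "partial i g x = l i" if "x \<in> W" for x i
  unfolding l_def by (rule constant_of_zero_partials[OF W(1) _ 0 x0 that]) (rule smooth_on_differentiable[OF smooth_on_partial[OF g]])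
 define k where "k = (%x. g x - (\<Sum>j\<in>UNIV. l j * of_real (x $ j)))"
 have dg: "g differentiable (at x)" if "x \<in> W" for x by (rule smooth_on_differentiable[OF g that])
 have "k x = k x0" if x: "x \<in> W" for x
 proof (rule constant_of_zero_partials[OF W(1) _ _ x0 x])
  fix z assume z: "z \<in> W"
  show "k differentiable (at z)" unfolding k_def by (intro differentiable_diff dg z partial_linear(2))
  show "partial i k z = 0" for i unfolding k_def
   using partial_diff[OF dg[OF z] partial_linear(2)] by (simp add: partial_linear(1) pl[OF z])
 qed
 then have "g x = k x0 + (\<Sum>j\<in>UNIV. l j * of_real (x $ j))" if "x \<in> W" for x
  using that by (simp add: k_def algebra_simps)
 then show thesis using pl that by blast
qed

lemma primitive_on_ball:
 fixes f :: "complex => complex"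
 assumes hf: "f holomorphic_on ball 0 \<rho>"
 shows "\<exists>F. (\<forall>z\<in>ball 0 \<rho>. (F has_field_derivative f z) (at z)) \<and> F 0 = 0"
proof -
 obtain G where G: "\<And>x. x \<in> ball 0 \<rho> ==> (G has_field_derivative f x) (at x within ball 0 \<rho>)"
  using holomorphic_convex_primitive'[OF convex_ball open_ball hf] by metis
 have "((%z. G z - G 0) has_field_derivative f z) (at z)" if "z \<in> ball 0 \<rho>" for z
  using DERIV_diff[OF G[OF that] DERIV_const[of "G 0"]] that by (simp add: at_within_open[OF that open_ball])
 then show ?thesis by (intro exI[of _ "%z. G z - G 0"]) auto
qed

lemma holomorphic_zero_of_zero_on_reals:
 assumes f: "f holomorphic_on S" and S: "open S" "connected S" and \<xi>: "\<xi> \<in> S" and \<eta>: "\<eta> > 0"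
  and 0: "\<And>t::real. 0 < t ==> t < \<eta> ==> f (\<xi> + of_real t) = 0" and w: "w \<in> S"
 shows "f w = 0"
proof -
 obtain e where e: "e > 0" "ball \<xi> e \<subseteq> S" using S(1) \<xi> by (meson openE)
 define \<eta>' where "\<eta>' = min \<eta> e"
 have \<eta>': "\<eta>' > 0" using \<eta> e by (simp add: \<eta>'_def)
 define U where "U = (%t. \<xi> + of_real t) ` {0<..<\<eta>'}"
 have "U \<subseteq> S"
 proof
  fix z assume "z \<in> U"
  then obtain t where t: "0 < t" "t < \<eta>'" "z = \<xi> + of_real t" by (auto simp: U_def)
  then have "z \<in> ball \<xi> e" by (simp add: dist_norm \<eta>'_def)
  then show "z \<in> S" using e by blast
 qed
 moreover have "\<xi> islimpt U"
  unfolding islimpt_approachable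
 proof (intro allI impI)
  fix \<epsilon> :: real assume "\<epsilon> > 0"
  then have "\<xi> + of_real (min (\<epsilon> / 2) (\<eta>' / 2)) \<in> U" "dist (\<xi> + of_real (min (\<epsilon> / 2) (\<eta>' / 2))) \<xi> < \<epsilon>"
   using \<eta>' by (auto simp: U_def dist_norm)
  moreover have "\<xi> + of_real (min (\<epsilon> / 2) (\<eta>' / 2)) \<noteq> \<xi>" using \<eta>' \<open>\<epsilon> > 0\<close> by (simp add: min_def)
  ultimately show "\<exists>x'\<in>U. x' \<noteq> \<xi> \<and> dist x' \<xi> < \<epsilon>" by blast
 qed
 moreover have "f z = 0" if "z \<in> U" for z using that 0 by (auto simp: U_def \<eta>'_def)
 ultimately show ?thesis using analytic_continuation[OF f S _ \<xi> _ _ w] by blast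
qed

lemma abs_component_difference_le: "\<bar>x $ i - x $ j\<bar> \<le> 2 * norm (x :: real^'n::finite)"
 using component_le_norm_cart[of x i] component_le_norm_cart[of x j] by linarith

text \<open>By p2 and p3 a mixed derivative of F is constant along every direction that preserves
  x_j - x_k, hence is a function of that difference. Two integrations give pair functions; after
  subtracting them only an affine function is left, and its linear part, with coefficients of sum 0
  by p1, is again a pair sum.\<close>

lemma pair_representation:
 fixes F :: "real^'n::{finite,linorder} => complex"
 assumes \<rho>: "\<rho> > 0" and F: "real_analytic_on (ball 0 \<rho>) F"
  and p1: "\<And>x. x \<in> ball 0 \<rho> ==> (\<Sum>i\<in>UNIV. partial i F x) = 0"
  and p2: "\<And>x j k l. x \<in> ball 0 \<rho> ==> j \<noteq> k ==> j \<noteq> l ==> k \<noteq> l ==> partial j (partial k (partial l F)) x = 0"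
  and p3: "\<And>x j k. x \<in> ball 0 \<rho> ==> j \<noteq> k ==> partial j (partial j (partial k F)) x + partial k (partial j (partial k F)) x = 0"
 obtains \<epsilon> r d where "0 < \<epsilon>" "\<epsilon> \<le> \<rho>" "\<And>i j. r i j holomorphic_on ball 0 (2 * \<epsilon>)" "\<And>i z. r i i z = 0" "\<And>i j. r i j 0 = 0"
  "\<And>i j z. z \<in> ball 0 (2 * \<epsilon>) ==> r j i (- z) = r i j z" "\<And>x. x \<in> ball 0 \<epsilon> ==> F x = pair_sum r x + d"
proof -
 have sm: "smooth_on (ball 0 \<rho>) F" by (rule real_analytic_on_imp_smooth_on[OF F])
 \<comment> \<open>The reference point has the same difference x_j - x_k and all other coordinates
   0. Its norm is at most 2 |x|, hence the ball of half the radius.\<close>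
 have dep: "partial j (partial k F) x = partial j (partial k F) ((x $ j - x $ k) *\<^sub>R axis j 1)"
  if x: "x \<in> ball 0 (\<rho> / 2)" and jk: "j \<noteq> k" for x j k
 proof (rule directional_constant[of "ball 0 \<rho>"])
  show "convex (ball (0 :: real^'n::{finite,linorder}) \<rho>)" by simp
  show "partial j (partial k F) differentiable (at z)" if "z \<in> ball 0 \<rho>" for z
   by (intro smooth_on_differentiable[OF _ that] smooth_on_partial sm)
  show "x \<in> ball 0 \<rho>" using x \<rho> by simp
  show "(x $ j - x $ k) *\<^sub>R axis j (1::real) \<in> ball 0 \<rho>"
   using x abs_component_difference_le[of x j k] by (simp add: dist_norm norm_axis_1)
  fix z :: "real^'n::{finite,linorder}" assume z: "z \<in> ball 0 \<rho>"
  let ?w = "partial j (partial k F)"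
  let ?t = "%i. (x - (x $ j - x $ k) *\<^sub>R axis j 1) $ i *\<^sub>R partial i ?w z"
  have "(\<Sum>i\<in>UNIV. ?t i) = ?t j + (?t k + (\<Sum>i\<in>UNIV - {j} - {k}. ?t i))"
   using jk by (subst sum.remove[of _ j], simp, simp, subst sum.remove[of _ k]) auto
  also have "(\<Sum>i\<in>UNIV - {j} - {k}. ?t i) = 0"
   by (rule sum.neutral) (use p2[OF z] jk in auto)
  also have "?t j + (?t k + 0) = x $ k *\<^sub>R (partial j ?w z + partial k ?w z)"
   using jk by (simp add: axis_def scaleR_add_right)
  also have "\<dots> = 0" using p3[OF z jk] by simp
  finally show "(\<Sum>i\<in>UNIV. ?t i) = 0" .
 qed
 have "\<exists>e G. e > 0 \<and> G holomorphic_on ball 0 e \<and> (\<forall>t. \<bar>t\<bar> < e --> partial j (partial k F) (t *\<^sub>R axis j 1) = G (of_real t))" for j k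
 proof -
  have "real_analytic_on (ball 0 \<rho>) (partial j (partial k F))" by (intro real_analytic_on_partial F)
  then have "real_analytic_at (partial j (partial k F)) 0" using \<rho> by (simp add: real_analytic_on_def)
  from real_analytic_at_line[OF this, of "axis j 1"] show ?thesis by auto
 qed
 then obtain e G where e: "\<And>j k. e j k > 0" and G: "\<And>j k. G j k holomorphic_on ball 0 (e j k)"
  and FG: "\<And>j k t. \<bar>t\<bar> < e j k ==> partial j (partial k F) (t *\<^sub>R axis j 1) = G j k (of_real t)"
  by metis
 define \<epsilon> where "\<epsilon> = Min (insert (\<rho> / 2) ((%(j,k). e j k / 2) ` UNIV))"
 have "\<epsilon> \<in> insert (\<rho> / 2) ((%(j,k). e j k / 2) ` UNIV)" unfolding \<epsilon>_def by (rule Min_in) auto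
 then have \<epsilon>0: "\<epsilon> > 0" using \<rho> e by auto
 have \<epsilon>\<rho>: "\<epsilon> \<le> \<rho> / 2" unfolding \<epsilon>_def by (rule Min_le) auto
 have \<epsilon>e: "2 * \<epsilon> \<le> e j k" for j k
 proof -
  have "e j k / 2 \<in> (%(j,k). e j k / 2) ` UNIV" by (rule image_eqI[of _ _ "(j,k)"]) auto
  then have "\<epsilon> \<le> e j k / 2" unfolding \<epsilon>_def by (intro Min_le) auto
  then show ?thesis by simp
 qed
 let ?B = "ball (0::complex) (2 * \<epsilon>)"
 have "\<exists>w0 w1. (\<forall>z\<in>?B. (w1 has_field_derivative - G j k z) (at z)) \<and> (\<forall>z\<in>?B. (w0 has_field_derivative w1 z) (at z)) \<and> w0 0 = 0" for j k
 proof -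
  have "G j k holomorphic_on ?B" by (rule holomorphic_on_subset[OF G subset_ball[OF \<epsilon>e]])
  then obtain w1 where w1: "\<forall>z\<in>?B. (w1 has_field_derivative - G j k z) (at z)"
   using primitive_on_ball[of "%z. - G j k z"] holomorphic_on_minus by blast
  then have "w1 holomorphic_on ?B" unfolding holomorphic_on_open[OF open_ball] by blast
  then show ?thesis using w1 primitive_on_ball[of w1] by blast
 qed
 then obtain w0 w1 where w1: "\<And>j k z. z \<in> ?B ==> (w1 j k has_field_derivative - G j k z) (at z)"
  and w0: "\<And>j k z. z \<in> ?B ==> (w0 j k has_field_derivative w1 j k z) (at z)" and w00: "\<And>j k. w0 j k 0 = 0"
  by metis
 have hol_w0: "w0 j k holomorphic_on ?B" for j k unfolding holomorphic_on_open[OF open_ball] using w0 by blast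
 \<comment> \<open>Primitives are chosen for i < j only and carried to j < i by reflection, so that
   the symmetry holds by construction.\<close>
 define W where "W = (%i j z. if i < j then w0 i j z else if j < i then w0 j i (- z) else 0)"
 have holW: "W i j holomorphic_on ?B" for i j
 proof -
  have "(w0 j i \<circ> uminus) holomorphic_on ?B"
   by (rule holomorphic_on_compose_gen[OF _ hol_w0]) (auto intro!: holomorphic_intros)
  then have "(%z. w0 j i (- z)) holomorphic_on ?B" by (simp add: o_def)
  then show ?thesis using hol_w0[of i j] unfolding W_def by (cases "i < j"; cases "j < i") (auto intro: holomorphic_on_const)
 qed
 have diffB: "of_real (x $ i - x $ j) \<in> ?B" if "x \<in> ball 0 \<epsilon>" for x :: "real^'n::{finite,linorder}" and i j
 proof -
  have "\<bar>x $ i - x $ j\<bar> < 2 * \<epsilon>" using abs_component_difference_le[of x i j] that by simp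
  then show ?thesis by (simp del: of_real_diff)
 qed
 interpret W: pair_functions W ?B "ball 0 \<epsilon>"
 proof
  show "W j i (- z) = W i j z" for i j z by (auto simp: W_def)
  show "of_real (x $ i - x $ j) \<in> ?B" if "x \<in> ball 0 \<epsilon>" for x :: "real^'n::{finite,linorder}" and i j by (rule diffB[OF that])
 qed (use holW in \<open>auto simp: W_def\<close>)
 have W2: "partial j (partial i (pair_sum W)) x = partial j (partial i F) x" if x: "x \<in> ball 0 \<epsilon>" and ij: "i < j" for x i j
 proof -
  let ?z = "complex_of_real (x $ i - x $ j)"
  have Wij: "W i j = w0 i j" using ij by (simp add: W_def)
  have zB: "?z \<in> ?B" by (rule diffB[OF x])
  have "deriv (w0 i j) z = w1 i j z" if "z \<in> ?B" for z using w0[OF that] by (rule DERIV_imp_deriv)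
  then have "deriv (deriv (w0 i j)) ?z = deriv (w1 i j) ?z" by (rule deriv_eq_on_open[OF open_ball zB])
  also have "\<dots> = - G i j ?z" using w1[OF zB] by (rule DERIV_imp_deriv)
  finally have "partial j (partial i (pair_sum W)) x = G i j ?z"
   using W.partial2_pair_sum[OF x, of i j] ij Wij by simp
  also have "\<dots> = partial i (partial j F) ((x $ i - x $ j) *\<^sub>R axis i 1)"
   using zB \<epsilon>e[of i j] by (intro FG[symmetric]) (simp del: of_real_diff)
  also have "\<dots> = partial i (partial j F) x" by (rule dep[symmetric]) (use x \<epsilon>\<rho> ij in auto)
  also have "\<dots> = partial j (partial i F) x" by (rule partial_commute[OF open_ball sm]) (use x \<epsilon>\<rho> \<rho> in auto)
  finally show ?thesis .
 qed
 have smF: "smooth_on (ball 0 \<epsilon>) F" by (rule smooth_on_subset[OF sm]) (use \<epsilon>\<rho> \<rho> in auto)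
 define g where "g = (%x. F x - pair_sum W x)"
 have smg: "smooth_on (ball 0 \<epsilon>) g" unfolding g_def by (intro smooth_on_diff open_ball smF W.smooth_pair_sum)
 have g1: "partial i g x = partial i F x - partial i (pair_sum W) x" if "x \<in> ball 0 \<epsilon>" for x i
  unfolding g_def by (intro partial_diff smooth_on_differentiable[OF _ that] smF W.smooth_pair_sum)
 have g2: "partial j (partial i g) x = partial j (partial i F) x - partial j (partial i (pair_sum W)) x" if x: "x \<in> ball 0 \<epsilon>" for x i j
 proof -
  have "partial j (partial i g) x = partial j (%x. partial i F x - partial i (pair_sum W) x) x"
   by (rule partial_cong[OF open_ball x g1])
  also have "\<dots> = partial j (partial i F) x - partial j (partial i (pair_sum W)) x"
   by (intro partial_diff smooth_on_differentiable[OF _ x] smooth_on_partial smF W.smooth_pair_sum)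
  finally show ?thesis .
 qed
 have sumg: "(\<Sum>i\<in>UNIV. partial i g x) = 0" if x: "x \<in> ball 0 \<epsilon>" for x
  using p1[of x] W.sum_partial_pair_sum[OF x] x \<epsilon>\<rho> \<rho> by (simp add: g1[OF x] sum_subtractf)
 have off: "partial j (partial i g) x = 0" if x: "x \<in> ball 0 \<epsilon>" and ij: "i \<noteq> j" for x i j
 proof (cases "i < j")
  case True
  then show ?thesis using g2[OF x] W2[OF x True] by simp
 next
  case False
  then have "j < i" using ij by simp
  then have "partial i (partial j g) x = 0" using g2[OF x] W2[OF x] by simp
  then show ?thesis using partial_commute[OF open_ball smg x] by simp
 qed
 \<comment> \<open>A pure second derivative follows from the mixed ones by differentiating the
   vanishing sum of all first derivatives.\<close>
 have all0: "partial i (partial j g) x = 0" if x: "x \<in> ball 0 \<epsilon>" for x i j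
 proof (cases "i = j")
  case True
  have "partial i (%x. \<Sum>l\<in>UNIV. partial l g x) x = 0"
   using partial_cong[where i = i, OF open_ball x sumg] by simp
  also have "partial i (%x. \<Sum>l\<in>UNIV. partial l g x) x = (\<Sum>l\<in>UNIV. partial i (partial l g) x)"
   by (intro partial_sum smooth_on_differentiable[OF _ x] smooth_on_partial smg)
  also have "\<dots> = partial i (partial i g) x + (\<Sum>l\<in>UNIV - {i}. partial i (partial l g) x)"
   by (rule sum.remove) auto
  also have "(\<Sum>l\<in>UNIV - {i}. partial i (partial l g) x) = 0" by (rule sum.neutral) (use off[OF x] in auto)
  finally show ?thesis using True by simp
 qed (use off[OF x] in auto)
 have z0: "0 \<in> ball (0::real^'n::{finite,linorder}) \<epsilon>" using \<epsilon>0 by simp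
 obtain l m where l: "\<And>x i. x \<in> ball 0 \<epsilon> ==> partial i g x = l i"
  and gl: "\<And>x. x \<in> ball 0 \<epsilon> ==> g x = m + (\<Sum>j\<in>UNIV. l j * of_real (x $ j))"
  using affine_of_zero_second_partials[OF convex_ball open_ball smg z0 all0] by metis
 have l0: "(\<Sum>i\<in>UNIV. l i) = 0" using sumg[OF z0] l[OF z0] by simp
 define N where "N = (of_nat CARD('n) :: complex)"
 have N: "N \<noteq> 0" by (simp add: N_def)
 \<comment> \<open>Since the l i sum to 0, half the sum over all ordered pairs of (l i - l j) (x_i -
   x_j) / N is the sum of l i x_i.\<close>
 define r where "r = (%i j z. W i j z + (l i - l j) / N * z)"
 show thesis
 proof (rule that[of \<epsilon> r m])
  show "\<epsilon> > 0" "\<epsilon> \<le> \<rho>" using \<epsilon>0 \<epsilon>\<rho> \<rho> by auto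
  show "r i j holomorphic_on ?B" for i j unfolding r_def by (intro holomorphic_intros holW)
  show "r i i z = 0" "r i j 0 = 0" for i j z by (auto simp: r_def W_def w00)
  show "r j i (- z) = r i j z" for i j z
  proof -
   have "W j i (- z) = W i j z" by (auto simp: W_def)
   moreover have "(l j - l i) / N * (- z) = (l i - l j) / N * z" by (simp add: field_simps)
   ultimately show ?thesis by (simp add: r_def)
  qed
  fix x :: "real^'n::{finite,linorder}" assume x: "x \<in> ball 0 \<epsilon>"
  define X where "X = (%i. complex_of_real (x $ i))"
  have "(\<Sum>i\<in>(UNIV::'n set). \<Sum>j\<in>(UNIV::'n set). (l i - l j) * (X i - X j)) =
    (\<Sum>i\<in>(UNIV::'n set). \<Sum>j\<in>(UNIV::'n set). l i * X i) - (\<Sum>i\<in>(UNIV::'n set). \<Sum>j\<in>(UNIV::'n set). l i * X j) - (\<Sum>i\<in>(UNIV::'n set). \<Sum>j\<in>(UNIV::'n set). l j * X i) + (\<Sum>i\<in>(UNIV::'n set). \<Sum>j\<in>(UNIV::'n set). l j * X j)"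
   unfolding sum_subtractf[symmetric] sum.distrib[symmetric] by (intro sum.cong refl) (simp add: algebra_simps)
  also have "(\<Sum>i\<in>(UNIV::'n set). \<Sum>j\<in>(UNIV::'n set). l i * X j) = 0"
   using l0 by (simp add: sum_distrib_left[symmetric] sum_distrib_right[symmetric])
  also have "(\<Sum>i\<in>(UNIV::'n set). \<Sum>j\<in>(UNIV::'n set). l j * X i) = 0"
   using l0 by (simp add: sum_distrib_left[symmetric] sum_distrib_right[symmetric])
  also have "(\<Sum>i\<in>(UNIV::'n set). \<Sum>j\<in>(UNIV::'n set). l i * X i) - 0 - 0 + (\<Sum>i\<in>(UNIV::'n set). \<Sum>j\<in>(UNIV::'n set). l j * X j) = 2 * N * (\<Sum>i\<in>UNIV. l i * X i)"
   by (simp add: N_def sum_distrib_left[symmetric])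
  finally have lin: "(\<Sum>i\<in>UNIV. \<Sum>j\<in>UNIV. (l i - l j) * (X i - X j)) = 2 * N * (\<Sum>i\<in>UNIV. l i * X i)" .
  have "pair_sum r x = pair_sum W x + (\<Sum>i\<in>UNIV. \<Sum>j\<in>UNIV. (l i - l j) / N * (X i - X j)) / 2"
   by (simp add: pair_sum_def r_def X_def sum.distrib add_divide_distrib)
  also have "(\<Sum>i\<in>UNIV. \<Sum>j\<in>UNIV. (l i - l j) / N * (X i - X j)) = (\<Sum>i\<in>UNIV. \<Sum>j\<in>UNIV. (l i - l j) * (X i - X j)) / N"
   by (simp add: sum_divide_distrib)
  also have "\<dots> / 2 = (\<Sum>i\<in>UNIV. l i * X i)" unfolding lin using N by simp
  finally show "F x = pair_sum r x + m" using gl[OF x] by (simp add: g_def X_def algebra_simps)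
 qed
qed

subsection \<open>The first-order coefficients near the origin\<close>

text \<open>For a symmetric family this is the part of \<open>pair_sum f\<close> that involves the
  coordinate i.\<close>

definition row_sum :: "('n::finite => 'n => complex => complex) => 'n => real^'n => complex" where
 "row_sum f i x = (\<Sum>k\<in>UNIV. f i k (of_real (x $ i - x $ k)))"

text \<open>The first derivative of a family with two indices, not a second derivative.\<close>

abbreviation deriv2 :: "('n => 'n => complex => complex) => 'n => 'n => complex => complex" where
 "deriv2 f \<equiv> (%i j. deriv (f i j))"

text \<open>The relations for a1 have the particular solution (P - T i) / 2, where P is the pair sum
  and T i its row. The deviation from it has vanishing second derivatives and is affine on the
  convex set K. In the relation of \<open>sum_a1_partial_R\<close> the contribution of P drops out,
  since the derivatives of P sum to 0.\<close>

lemma affine_coefficients: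
 fixes R a0 :: "real^'n::{finite,linorder} => complex"
 assumes cp: "commuting_pair U R a0 a1" and pf: "pair_functions u S D" and DU: "D \<subseteq> U"
  and K: "K \<subseteq> D" "open K" "convex K" "x0 \<in> K" and Rd: "\<And>x. x \<in> D ==> R x = pair_sum u x + d"
 obtains lam mu where "\<And>i. lam i i = 0" "\<And>i. (\<Sum>j\<in>UNIV. lam i j) = 0" "\<And>i j. lam i j + lam j i = 0"
  "\<And>x. x \<in> K ==> (\<Sum>i\<in>UNIV. (row_sum u i x - 2 * (mu i + (\<Sum>j\<in>UNIV. lam i j * of_real (x $ j)))) * row_sum (deriv2 u) i x) = 0"
proof -
 interpret C: commuting_pair U R a0 a1 by (rule cp)
 interpret P: pair_functions u S D by (rule pf)
 let ?D = "%i j x. deriv (u i j) (complex_of_real (x $ i - x $ j))"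
 let ?V = "%i x. \<Sum>l\<in>UNIV. ?D i l x"
 define P where "P = pair_sum u"
 define T where "T = row_sum u"
 have smP: "smooth_on D P" unfolding P_def by (rule P.smooth_pair_sum)
 have smT: "smooth_on D (T i)" for i
  unfolding T_def row_sum_def[abs_def] by (intro smooth_on_sum P.W P.smooth_pair)
 have sma: "smooth_on D (a1 i)" for i by (rule smooth_on_subset[OF C.a1 DU])
 have D0: "?D i i x = 0" for i x by (simp add: P.diag_fun)
 have pT: "partial k (T i) x = of_bool (k = i) * ?V i x - ?D i k x" if x: "x \<in> D" for k i x
 proof -
  have "partial k (T i) x = (\<Sum>l\<in>UNIV. partial k (%x. u i l (of_real (x $ i - x $ l))) x)"
   unfolding T_def row_sum_def[abs_def]
   by (rule partial_sum) (intro smooth_on_differentiable[OF _ x] P.smooth_pair)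
  also have "\<dots> = (\<Sum>l\<in>UNIV. of_bool (k = i) * ?D i l x - (if l = k then ?D i l x else 0))"
   unfolding P.partial_pair[OF x] by (intro sum.cong refl) (auto simp: algebra_simps)
  also have "\<dots> = of_bool (k = i) * ?V i x - ?D i k x"
   by (simp only: sum_subtractf sum_distrib_left[symmetric] sum.delta finite UNIV_I if_True)
  finally show ?thesis .
 qed
 have pP: "partial k P x = ?V k x" if "x \<in> D" for k x
  unfolding P_def by (rule P.partial_pair_sum[OF that])
 have pR: "partial k R x = partial k P x" if x: "x \<in> D" for k x
 proof -
  have "partial k R x = partial k (%x. P x + d) x"
   by (rule partial_cong[OF P.W x]) (simp add: Rd P_def)
  also have "\<dots> = partial k P x"
   using partial_add[OF smooth_on_differentiable[OF smP x] differentiable_const[of d]] by simp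
  finally show ?thesis .
 qed
 have pR2: "partial l (partial k R) x = partial l (partial k P) x" if x: "x \<in> D" for k l x
  by (rule partial_cong[OF P.W x pR])
 \<comment> \<open>The deviation from the particular solution; its affine form is given by mu and
   lam.\<close>
 define g where "g = (%i x. a1 i x - 1/2 * (P x - T i x))"
 have smPT: "smooth_on D (%x. P x - T i x)" for i by (intro smooth_on_diff P.W smP smT)
 have smg: "smooth_on D (g i)" for i
  unfolding g_def by (intro smooth_on_diff smooth_on_cmult P.W sma smP smT)
 have pg: "partial k (g i) x = partial k (a1 i) x - 1/2 * (partial k P x - partial k (T i) x)" if x: "x \<in> D" for k i x
 proof -
  have "partial k (g i) x = partial k (a1 i) x - partial k (%x. 1/2 * (P x - T i x)) x"
   unfolding g_def by (intro partial_diff smooth_on_differentiable[OF _ x] sma smooth_on_cmult P.W smPT)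
  also have "partial k (%x. 1/2 * (P x - T i x)) x = 1/2 * partial k (%x. P x - T i x) x"
   by (intro partial_cmult smooth_on_differentiable[OF _ x] smPT)
  also have "partial k (%x. P x - T i x) x = partial k P x - partial k (T i) x"
   by (intro partial_diff smooth_on_differentiable[OF _ x] smP smT)
  finally show ?thesis .
 qed
 have inU: "x \<in> U" if "x \<in> D" for x using that DU by blast
 have pg_same: "partial i (g i) x = 0" if x: "x \<in> D" for i x
  using pg[OF x, of i i] C.partial_a1_same[OF inU[OF x], of i] pP[OF x, of i] pT[OF x, of i i] D0[of i x] by simp
 have pg_sum: "(\<Sum>k\<in>UNIV. partial k (g i) x) = 0" if x: "x \<in> D" for i x
 proof -
  have "(\<Sum>k\<in>UNIV. partial k (T i) x) = (\<Sum>k\<in>UNIV. (if k = i then ?V i x else 0) - ?D i k x)"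
   by (intro sum.cong refl) (simp add: pT[OF x])
  then have "(\<Sum>k\<in>UNIV. partial k (T i) x) = 0" by (simp add: sum_subtractf)
  moreover have "(\<Sum>k\<in>UNIV. partial k P x) = 0" unfolding P_def by (rule P.sum_partial_pair_sum[OF x])
  ultimately show ?thesis
   using C.sum_partial_a1[OF inU[OF x], of i]
   by (simp add: pg[OF x] sum_subtractf sum_divide_distrib[symmetric])
 qed
 have pg2: "partial l (partial k (g i)) x = 0" if x: "x \<in> D" and d: "i \<noteq> k" "i \<noteq> l" "k \<noteq> l" for k l i x
 proof -
  have smD: "smooth_on D (%x. ?D i k x)" by (rule P.smooth_pair')
  have "partial l (partial k (T i)) x = partial l (%x. (-1) * ?D i k x) x"
   by (rule partial_cong[OF P.W x]) (use d in \<open>simp add: pT\<close>)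
  also have "\<dots> = (-1) * partial l (%x. ?D i k x) x"
   by (rule partial_cmult[OF smooth_on_differentiable[OF smD x]])
  also have "\<dots> = 0" using P.partial_pair'[OF x, of l i k] d by simp
  finally have T2: "partial l (partial k (T i)) x = 0" .
  have smPTk: "smooth_on D (%x. partial k P x - partial k (T i) x)"
   by (intro smooth_on_diff smooth_on_partial P.W smP smT)
  have "partial l (partial k (g i)) x = partial l (%x. partial k (a1 i) x - 1/2 * (partial k P x - partial k (T i) x)) x"
   by (rule partial_cong[OF P.W x pg])
  also have "\<dots> = partial l (partial k (a1 i)) x - partial l (%x. 1/2 * (partial k P x - partial k (T i) x)) x"
   by (intro partial_diff smooth_on_differentiable[OF _ x] smooth_on_partial sma smooth_on_cmult P.W smPTk)
  also have "partial l (%x. 1/2 * (partial k P x - partial k (T i) x)) x = 1/2 * partial l (%x. partial k P x - partial k (T i) x) x"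
   by (intro partial_cmult smooth_on_differentiable[OF _ x] smPTk)
  also have "partial l (%x. partial k P x - partial k (T i) x) x = partial l (partial k P) x - partial l (partial k (T i)) x"
   by (intro partial_diff smooth_on_differentiable[OF _ x] smooth_on_partial smP smT)
  finally show ?thesis using C.partial2_a1[OF inU[OF x] d] pR2[OF x, of l k] T2 by simp
 qed
 have pgi: "partial l (partial i (g i)) x = 0" if x: "x \<in> D" for i l x
  using partial_cong[where i = l, OF P.W x pg_same] by simp
 have pgi': "partial i (partial l (g i)) x = 0" if x: "x \<in> D" for i l x
  using partial_commute[OF P.W smg x, of i l i] pgi[OF x] by simp
 have all0: "partial l (partial k (g i)) x = 0" if x: "x \<in> D" for i k l x
 proof (cases "k = i \<or> l = i \<or> k \<noteq> l")
  case True
  then show ?thesis using pgi[OF x] pgi'[OF x] pg2[OF x, of i k l] by metis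
 next
  case False
  then have kl: "k = l" "k \<noteq> i" by auto
  have "0 = partial k (%x. \<Sum>m\<in>UNIV. partial m (g i) x) x"
   using partial_cong[where i = k, OF P.W x pg_sum] by simp
  also have "\<dots> = (\<Sum>m\<in>UNIV. partial k (partial m (g i)) x)"
   by (intro partial_sum smooth_on_differentiable[OF _ x] smooth_on_partial smg)
  also have "\<dots> = partial k (partial k (g i)) x + (\<Sum>m\<in>UNIV - {k}. partial k (partial m (g i)) x)"
   by (rule sum.remove) auto
  also have "(\<Sum>m\<in>UNIV - {k}. partial k (partial m (g i)) x) = 0"
  proof (rule sum.neutral, rule ballI)
   fix m assume "m \<in> UNIV - {k}"
   then show "partial k (partial m (g i)) x = 0"
    using pgi[OF x, of k i] pg2[OF x, of i m k] kl by (cases "m = i") auto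
  qed
  finally show ?thesis using kl by simp
 qed
 have "\<exists>l m. (\<forall>x\<in>K. \<forall>j. partial j (g i) x = l j) \<and> (\<forall>x\<in>K. g i x = m + (\<Sum>j\<in>UNIV. l j * of_real (x $ j)))" for i
 proof -
  have "partial j (partial k (g i)) x = 0" if "x \<in> K" for x j k using that K all0 by blast
  from affine_of_zero_second_partials[OF K(3,2) smooth_on_subset[OF smg K(1)] K(4) this]
  show ?thesis by metis
 qed
 then obtain lam mu where lam: "\<And>i x j. x \<in> K ==> partial j (g i) x = lam i j"
  and gK: "\<And>i x. x \<in> K ==> g i x = mu i + (\<Sum>j\<in>UNIV. lam i j * of_real (x $ j))" by metis
 have x0: "x0 \<in> D" using K by blast
 show thesis
 proof (rule that[of lam mu])
  show "lam i i = 0" for i using lam[OF K(4)] pg_same[OF x0] by metis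
  show "(\<Sum>j\<in>UNIV. lam i j) = 0" for i using pg_sum[OF x0, of i] lam[OF K(4)] by simp
  show "lam i j + lam j i = 0" for i j
  proof (cases "i = j")
   case True
   then show ?thesis using lam[OF K(4), of i i] pg_same[OF x0] by simp
  next
   case False
   have "partial j (g i) x0 = partial j (a1 i) x0 - 1/2 * (partial j P x0 + ?D i j x0)"
    using False unfolding pg[OF x0] pT[OF x0] by simp
   moreover have "partial i (g j) x0 = partial i (a1 j) x0 - 1/2 * (partial i P x0 - ?D i j x0)"
    using False unfolding pg[OF x0] pT[OF x0] P.deriv_sym_x[OF x0, of i j] by simp
   moreover have "partial i (a1 j) x0 + partial j (a1 i) x0 = (partial i P x0 + partial j P x0) / 2"
    using C.partial_a1_sym[OF inU[OF x0] False] pR[OF x0] by simp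
   moreover have "a - 1/2 * (b + e) + (a' - 1/2 * (b' - e)) = (a' + a) - (b' + b) / 2" for a b e a' b' :: complex
    by (simp add: field_simps)
   ultimately have "partial j (g i) x0 + partial i (g j) x0 = 0" by (simp only: diff_self)
   then show ?thesis by (simp add: lam[OF K(4)])
  qed
  fix x assume xK: "x \<in> K"
  then have x: "x \<in> D" using K by blast
  have rs: "row_sum (deriv2 u) i x = partial i P x" for i using pP[OF x, of i] by (simp add: row_sum_def)
  have "(row_sum u i x - 2 * (mu i + (\<Sum>j\<in>UNIV. lam i j * of_real (x $ j)))) * partial i P x
    = P x * partial i P x - 2 * (a1 i x * partial i R x)" for i
  proof -
   have "row_sum u i x - 2 * (mu i + (\<Sum>j\<in>UNIV. lam i j * of_real (x $ j))) = P x - 2 * a1 i x"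
    unfolding gK[OF xK, symmetric] by (simp add: g_def T_def field_simps)
   then show ?thesis using pR[OF x, of i] by (simp only: left_diff_distrib mult.assoc)
  qed
  then have "(\<Sum>i\<in>UNIV. (row_sum u i x - 2 * (mu i + (\<Sum>j\<in>UNIV. lam i j * of_real (x $ j)))) * row_sum (deriv2 u) i x)
    = P x * (\<Sum>i\<in>UNIV. partial i P x) - 2 * (\<Sum>i\<in>UNIV. a1 i x * partial i R x)"
   by (simp add: rs sum_subtractf sum_distrib_left)
  then show "(\<Sum>i\<in>UNIV. (row_sum u i x - 2 * (mu i + (\<Sum>j\<in>UNIV. lam i j * of_real (x $ j)))) * row_sum (deriv2 u) i x) = 0"
   using C.sum_a1_partial_R[OF inU[OF x]] P.sum_partial_pair_sum[OF x] by (simp add: P_def)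
 qed
qed

text \<open>Real walls separate the chambers, so mu and lam found on one chamber could differ on
  another. On the complexified line from x0 to x the walls are finitely many points and the rest is
  connected, so the identity with the same constants holds everywhere.\<close>

lemma pair_identity_continuation:
 fixes u :: "'n::finite => 'n => complex => complex" and x x0 :: "real^'n" and K :: "(real^'n) set"
 assumes hol: "\<And>i j. u i j holomorphic_on ball 0 (2 * \<epsilon>) - {0}" and diag: "\<And>i. u i i = (%_. 0)"
  and K: "open K" "K \<subseteq> {x::real^'n. x \<in> ball 0 \<epsilon> \<and> ( \<forall>i j. i \<noteq> j --> x $ i \<noteq> x $ j)}" "x0 \<in> K"
  and 0: "\<And>x. x \<in> K ==> (\<Sum>i\<in>UNIV. (row_sum u i x - 2 * (mu i + (\<Sum>j\<in>UNIV. lam i j * of_real (x $ j)))) * row_sum (deriv2 u) i x) = 0"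
  and x: "x \<in> ball 0 \<epsilon>" "\<And>i j. i \<noteq> j ==> x $ i \<noteq> x $ j"
 shows "(\<Sum>i\<in>UNIV. (row_sum u i x - 2 * (mu i + (\<Sum>j\<in>UNIV. lam i j * of_real (x $ j)))) * row_sum (deriv2 u) i x) = 0"
proof -
 define \<delta> where "\<delta> = (%i j t. complex_of_real (x0 $ i - x0 $ j) + t * of_real ((x - x0) $ i - (x - x0) $ j))"
 define X where "X = (%t::real. x0 + t *\<^sub>R (x - x0))"
 have \<delta>X: "\<delta> i j (of_real t) = of_real (X t $ i - X t $ j)" for i j t
  by (simp add: \<delta>_def X_def algebra_simps)
 \<comment> \<open>The complex parameters keeping all differences inside the disc form a convex set;
   Z is finite because no difference vanishes at t = 0.\<close>
 define A where "A = {t. \<forall>i j. i \<noteq> j --> norm (\<delta> i j t) < 2 * \<epsilon>}"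
 define Z where "Z = {t. \<exists>i j. i \<noteq> j \<and> \<delta> i j t = 0}"
 have x0: "x0 \<in> ball 0 \<epsilon>" "\<And>i j. i \<noteq> j ==> x0 $ i \<noteq> x0 $ j" using K by auto
 have "Z \<subseteq> (\<Union>i j. {- complex_of_real (x0 $ i - x0 $ j) / of_real ((x - x0) $ i - (x - x0) $ j)})"
 proof
  fix t assume "t \<in> Z"
  then obtain i j where ij: "i \<noteq> j" "\<delta> i j t = 0" by (auto simp: Z_def)
  define a b where "a = complex_of_real (x0 $ i - x0 $ j)" and "b = complex_of_real ((x - x0) $ i - (x - x0) $ j)"
  have "a \<noteq> 0" using x0(2)[OF ij(1)] by (simp add: a_def)
  moreover have "a + t * b = 0" using ij(2) by (simp add: \<delta>_def a_def b_def)
  ultimately have b: "b \<noteq> 0" and "t * b = - a" by (auto simp: eq_neg_iff_add_eq_0 add.commute)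
  then have "t = - a / b" using nonzero_eq_divide_eq[OF b] by blast
  then show "t \<in> (\<Union>i j. {- complex_of_real (x0 $ i - x0 $ j) / of_real ((x - x0) $ i - (x - x0) $ j)})"
   unfolding a_def b_def by blast
 qed
 moreover have "finite (\<Union>i j. {- complex_of_real (x0 $ i - x0 $ j) / of_real ((x - x0) $ i - (x - x0) $ j)})"
  by (intro finite_UN_I finite) auto
 ultimately have finZ: "finite Z" by (rule finite_subset)
 have "convex A"
 proof (rule convexI)
  fix s t :: complex and a b :: real assume st: "s \<in> A" "t \<in> A" and ab: "0 \<le> a" "0 \<le> b" "a + b = 1"
  have "\<delta> i j (a *\<^sub>R s + b *\<^sub>R t) = a *\<^sub>R \<delta> i j s + b *\<^sub>R \<delta> i j t" for i j
  proof -
   have b: "b = 1 - a" using ab by simp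
   show ?thesis unfolding b by (simp add: \<delta>_def scaleR_conv_of_real algebra_simps)
  qed
  moreover have "a *\<^sub>R \<delta> i j s + b *\<^sub>R \<delta> i j t \<in> ball 0 (2 * \<epsilon>)" if ij: "i \<noteq> j" for i j
   by (rule convexD[OF convex_ball _ _ ab]) (use st ij in \<open>auto simp: A_def\<close>)
  ultimately show "a *\<^sub>R s + b *\<^sub>R t \<in> A" by (simp add: A_def)
 qed
 have A: "A = (\<Inter>p\<in>{p. fst p \<noteq> snd p}. {t. norm (\<delta> (fst p) (snd p) t) < 2 * \<epsilon>})"
  by (auto simp: A_def)
 have opA: "open A"
  unfolding A unfolding \<delta>_def by (intro open_INT ballI finite open_Collect_less continuous_intros)
 define S where "S = A - Z"
 have S: "open S" "connected S"
  unfolding S_def using opA finZ connected_open_diff_countable[OF _ opA convex_connected[OF \<open>convex A\<close>] countable_finite[OF finZ]]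
  by (auto intro: open_Diff finite_imp_closed)
 have X01: "complex_of_real t \<in> S" if t: "t = 0 \<or> t = 1" for t
 proof -
  have "X t \<in> ball 0 \<epsilon> \<and> (\<forall>i j. i \<noteq> j --> X t $ i \<noteq> X t $ j)" using t x x0 by (auto simp: X_def)
  moreover have "\<bar>X t $ i - X t $ j\<bar> \<le> 2 * norm (X t)" for i j by (rule abs_component_difference_le)
  ultimately have "\<bar>X t $ i - X t $ j\<bar> < 2 * \<epsilon> \<and> X t $ i \<noteq> X t $ j" if "i \<noteq> j" for i j
   using that by (smt (verit) mem_ball_0)
  then show ?thesis by (auto simp: S_def A_def Z_def \<delta>X simp del: of_real_diff)
 qed
 have hu: "(%t. f (\<delta> i j t)) holomorphic_on S" if f: "f holomorphic_on ball 0 (2 * \<epsilon>) - {0}" and ij: "i \<noteq> j" for f i j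
 proof -
  have "(f \<circ> \<delta> i j) holomorphic_on S"
  proof (rule holomorphic_on_compose_gen[OF _ f])
   show "\<delta> i j holomorphic_on S" unfolding \<delta>_def by (intro holomorphic_intros)
   show "\<delta> i j ` S \<subseteq> ball 0 (2 * \<epsilon>) - {0}" using ij by (auto simp: S_def A_def Z_def)
  qed
  then show ?thesis by (simp add: o_def)
 qed
 have h1: "(%t. u i j (\<delta> i j t)) holomorphic_on S" for i j
  by (cases "i = j") (use hu[OF hol] in \<open>auto simp: diag intro: holomorphic_on_const\<close>)
 have h2: "(%t. deriv (u i j) (\<delta> i j t)) holomorphic_on S" for i j
  by (cases "i = j") (use hu[OF holomorphic_deriv[OF hol]] in \<open>auto simp: diag open_delete intro: holomorphic_on_const\<close>)
 define f where "f = (%t. \<Sum>i\<in>UNIV. ((\<Sum>k\<in>UNIV. u i k (\<delta> i k t)) - 2 * (mu i + (\<Sum>j\<in>UNIV. lam i j * (of_real (x0 $ j) + t * of_real ((x - x0) $ j)))))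
   * (\<Sum>k\<in>UNIV. deriv (u i k) (\<delta> i k t)))"
 have hf: "f holomorphic_on S" unfolding f_def by (intro holomorphic_intros h1 h2)
 have fX: "f (of_real t) = (\<Sum>i\<in>UNIV. (row_sum u i (X t) - 2 * (mu i + (\<Sum>j\<in>UNIV. lam i j * of_real (X t $ j)))) * row_sum (deriv2 u) i (X t))" for t
  unfolding f_def row_sum_def \<delta>X by (simp add: X_def)
 have "eventually (%t. X t \<in> K) (nhds 0)"
 proof (rule topological_tendstoD[OF _ K(1)])
  show "(X \<longlongrightarrow> x0) (nhds 0)" unfolding X_def by (rule tendsto_eq_intros filterlim_ident refl | simp)+
 qed (rule K)
 then obtain \<eta> where \<eta>: "\<eta> > 0" "\<And>t. \<bar>t\<bar> < \<eta> ==> X t \<in> K"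
  unfolding eventually_nhds_metric by (auto simp: dist_norm)
 have "f (complex_of_real 1) = 0"
 proof (rule holomorphic_zero_of_zero_on_reals[OF hf S X01[of 0] \<eta>(1) _ X01[of 1]])
  show "f (of_real 0 + of_real t) = 0" if t: "0 < t" "t < \<eta>" for t :: real
   using fX[of t] 0[OF \<eta>(2)[of t]] t by simp
 qed auto
 then show ?thesis unfolding fX by (simp add: X_def)
qed

lemma deriv_double_pole:
 assumes r: "r holomorphic_on S" "open S" "z \<in> S" and z: "z \<noteq> 0"
 shows "deriv (%z. c / z\<^sup>2 + r z) z = - 2 * c / z ^ 3 + deriv r z"
proof (rule DERIV_imp_deriv)
 have "((%z. c / z\<^sup>2) has_field_derivative - 2 * c / z ^ 3) (at z)"
  using z by (auto intro!: derivative_eq_intros simp: field_simps power2_eq_square power3_eq_cube)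
 then show "((%z. c / z\<^sup>2 + r z) has_field_derivative - 2 * c / z ^ 3 + deriv r z) (at z)"
  by (rule DERIV_add[OF _ holomorphic_derivI[OF r]])
qed

lemma holomorphic_double_pole:
 assumes "r holomorphic_on S"
 shows "(%z. c / z\<^sup>2 + r z) holomorphic_on S - {0}"
proof -
 have "r holomorphic_on S - {0}" using assms by (rule holomorphic_on_subset) auto
 then show ?thesis by (intro holomorphic_intros) auto
qed

lemma pair_functions_punctured_ball:
 fixes f :: "'n::finite => 'n => complex => complex"
 assumes "\<And>i j. f i j holomorphic_on ball 0 (2 * \<epsilon>) - {0}" "\<And>i z. f i i z = 0"
  and "\<And>i j z. z \<in> ball 0 (2 * \<epsilon>) - {0} ==> f j i (- z) = f i j z"
 shows "pair_functions f (ball 0 (2 * \<epsilon>) - {0}) {x::real^'n. x \<in> ball 0 \<epsilon> \<and> (\<forall>i j. i \<noteq> j --> x $ i \<noteq> x $ j)}"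
proof
 have "{x::real^'n. x \<in> ball 0 \<epsilon> \<and> (\<forall>i j. i \<noteq> j --> x $ i \<noteq> x $ j)} = ball 0 \<epsilon> \<inter> (\<Inter>p\<in>{p. fst p \<noteq> snd p}. {x. x $ fst p \<noteq> x $ snd p})"
  by auto
 moreover have "open \<dots>"
  by (intro open_Int open_ball open_INT finite ballI open_Collect_neq continuous_intros)
 ultimately show "open {x::real^'n. x \<in> ball 0 \<epsilon> \<and> (\<forall>i j. i \<noteq> j --> x $ i \<noteq> x $ j)}" by simp
 show "of_real (x $ i - x $ j) \<in> ball 0 (2 * \<epsilon>) - {0::complex}"
  if x: "x \<in> {x::real^'n. x \<in> ball 0 \<epsilon> \<and> (\<forall>i j. i \<noteq> j --> x $ i \<noteq> x $ j)}" and "i \<noteq> j" for x :: "real^'n" and i j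
 proof -
  have "\<bar>x $ i - x $ j\<bar> < 2 * \<epsilon>" using abs_component_difference_le[of x i j] x by simp
  moreover have "x $ i - x $ j \<noteq> 0" using that by simp
  ultimately show ?thesis by (simp del: of_real_diff)
 qed
qed (use assms in auto)

section \<open>Collisions of two coordinates at a wall\<close>

text \<open>The poles of order 5 cancel by opposite signs. The conclusion is the equation multiplied
  by \<tau>^3, with the former pole of order 3 on the left.\<close>

lemma wall_algebra:
 fixes \<tau> c a a' b b' \<rho> :: complex
 assumes "\<tau> \<noteq> 0" and "(c / \<tau>\<^sup>2 + a) * (- 2 * c / \<tau> ^ 3 + b) + ((c / \<tau>\<^sup>2 + a') * (2 * c / \<tau> ^ 3 + b') + \<rho>) = 0"
 shows "2 * c * (a - a') = c * \<tau> * (b + b') + \<tau> ^ 3 * (a * b + a' * b' + \<rho>)"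
proof -
 define w where "w = inverse \<tau>"
 have "\<tau> * w = 1" using assms(1) by (simp add: w_def)
 moreover have "(c * w\<^sup>2 + a) * (- 2 * c * w ^ 3 + b) + ((c * w\<^sup>2 + a') * (2 * c * w ^ 3 + b') + \<rho>) = 0"
  using assms(2) by (simp add: w_def divide_inverse power_inverse)
 ultimately show ?thesis by algebra
qed

lemma positive_distinct_vec_exists: "\<exists>y::real^'n::finite. (\<forall>i. y $ i > 0) \<and> (\<forall>i j. i \<noteq> j --> y $ i \<noteq> y $ j)"
proof -
 obtain g :: "'n => nat" where g: "inj g" using finite_imp_inj_to_nat_seg[of "UNIV :: 'n set"] by (auto simp: inj_on_def)
 show ?thesis by (rule exI[of _ "\<chi> i. real (Suc (g i))"]) (use g in \<open>auto simp: inj_eq\<close>)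
qed

definition off_diagonal :: "(complex => complex) => 'n => 'n => complex => complex" where
 "off_diagonal v i j = (if i = j then (%_. 0) else v)"

text \<open>\<open>Cs\<close> holds the coefficients of the double poles, \<open>r\<close> the
  regular parts normalised at 0, and \<open>A\<close> is twice the affine deviation of the
  first-order coefficients.\<close>

locale wall_setup =
 fixes \<epsilon> :: real and Cs :: "'n::finite => 'n => complex" and r :: "'n => 'n => complex => complex"
  and lam :: "'n => 'n => complex" and mu :: "'n => complex"
  and u :: "'n => 'n => complex => complex" and A :: "'n => real^'n => complex"
 defines "u \<equiv> %i j z. Cs i j / z\<^sup>2 + r i j z"
  and "A \<equiv> %i x. 2 * (mu i + (\<Sum>j\<in>UNIV. lam i j * of_real (x $ j)))"
 assumes eps: "\<epsilon> > 0" and Cs_sym: "\<And>i j. Cs j i = Cs i j" and Cs_diag: "\<And>i. Cs i i = 0"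
  and hol: "\<And>i j. r i j holomorphic_on ball 0 (2 * \<epsilon>)" and r_diag: "\<And>i z. r i i z = 0" and r_0: "\<And>i j. r i j 0 = 0"
  and r_sym: "\<And>i j z. z \<in> ball 0 (2 * \<epsilon>) ==> r j i (- z) = r i j z"
  and lam_diag: "\<And>i. lam i i = 0" and lam_sum: "\<And>i. (\<Sum>j\<in>UNIV. lam i j) = 0" and lam_sym: "\<And>i j. lam i j + lam j i = 0"
  and identity: "\<And>x. x \<in> ball 0 \<epsilon> ==> (\<And>i j. i \<noteq> j ==> x $ i \<noteq> x $ j) ==>
   (\<Sum>i\<in>UNIV. (row_sum u i x - A i x) * row_sum (deriv2 u) i x) = 0"
begin

lemma u_diag: "u i i = (%_. 0)" by (simp add: u_def Cs_diag r_diag)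

lemma hol_u: "u i j holomorphic_on ball 0 (2 * \<epsilon>) - {0}"
 unfolding u_def by (rule holomorphic_double_pole[OF hol])

lemma deriv_u:
 assumes "z \<in> ball 0 (2 * \<epsilon>)" "z \<noteq> 0"
 shows "deriv (u i j) z = - 2 * Cs i j / z ^ 3 + deriv (r i j) z"
 unfolding u_def by (rule deriv_double_pole[OF hol open_ball assms])

text \<open>Near a point of this single wall only rows i and j are singular, with poles c / t^2 and,
  for the derivatives, -2 c / t^3 and 2 c / t^3. By \<open>wall_algebra\<close> the regular parts of
  these two rows, corrected by A, become equal in the limit; c nonzero permits the division.\<close>

lemma wall:
 fixes p :: "real^'n"
 assumes ij: "i \<noteq> j" "Cs i j \<noteq> 0" and p: "p \<in> ball 0 \<epsilon>" "p $ i = p $ j"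
  and dis: "\<And>k l. k \<noteq> l ==> {k,l} \<noteq> {i,j} ==> p $ k \<noteq> p $ l"
 shows "(\<Sum>k\<in>UNIV - {i,j}. u i k (of_real (p $ i - p $ k)) - u j k (of_real (p $ j - p $ k))) = A i p - A j p"
proof -
 define c where "c = Cs i j"
 \<comment> \<open>The family with the one singular pair replaced by its regular part, so that all
   its members are continuous at p.\<close>
 define v where "v = (%k l. if {k,l} = {i,j} then r k l else u k l)"
 define X where "X = (%t::real. p + t *\<^sub>R axis i 1)"
 have Xp: "(X \<longlongrightarrow> p) (at_right 0)" unfolding X_def by (rule tendsto_eq_intros refl | simp)+
 have Xc: "((%t. complex_of_real (X t $ k - X t $ l)) \<longlongrightarrow> of_real (p $ k - p $ l)) (at_right 0)" for k l
  by (intro tendsto_intros Xp)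
 have pB: "complex_of_real (p $ k - p $ l) \<in> ball 0 (2 * \<epsilon>)" for k l
  using abs_component_difference_le[of p k l] p by (simp del: of_real_diff)
 have evD: "eventually (%t. \<forall>k l. k \<noteq> l --> X t $ k \<noteq> X t $ l) (at_right 0)"
 proof -
  have "eventually (%t. k \<noteq> l --> X t $ k \<noteq> X t $ l) (at_right 0)" for k l
  proof (cases "k = l \<or> {k,l} \<noteq> {i,j}")
   case True
   show ?thesis
   proof (cases "k = l")
    case False
    then have ne: "p $ k - p $ l \<noteq> 0" using dis True by auto
    have "((%t. X t $ k - X t $ l) \<longlongrightarrow> p $ k - p $ l) (at_right 0)" by (intro tendsto_intros Xp)
    then have "eventually (%t. X t $ k - X t $ l \<noteq> 0) (at_right 0)" using ne by (rule tendsto_imp_eventually_ne)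
    then show ?thesis by eventually_elim auto
   qed simp
  next
   case False
   have "eventually (%t::real. t > 0) (at_right 0)" by (rule eventually_at_right_less)
   then show ?thesis
   proof eventually_elim
    case (elim t)
    have "k = i \<and> l = j \<or> k = j \<and> l = i" using False by (auto simp: doubleton_eq_iff)
    then show ?case using ij p elim by (auto simp: X_def axis_def)
   qed
  qed
  then show ?thesis by (simp add: eventually_all_finite)
 qed
 have evB: "eventually (%t. X t \<in> ball 0 \<epsilon>) (at_right 0)" by (rule topological_tendstoD[OF Xp open_ball p(1)])
 have cont: "((%t. f (of_real (X t $ k - X t $ l))) \<longlongrightarrow> f (of_real (p $ k - p $ l))) (at_right 0)"
  if "f holomorphic_on M" "open M" "of_real (p $ k - p $ l) \<in> M" for f M k l
 proof -
  have "isCont f (of_real (p $ k - p $ l))"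
   using holomorphic_on_imp_continuous_on[OF that(1)] that(2,3) by (simp add: continuous_on_eq_continuous_at)
  then show ?thesis using Xc by (rule isCont_tendsto_compose)
 qed
 have hv: "\<exists>M. open M \<and> v k l holomorphic_on M \<and> of_real (p $ k - p $ l) \<in> M" for k l
 proof (cases "k = l \<or> {k,l} = {i,j}")
  case True
  then show ?thesis
  proof
   assume "k = l"
   then have "v k l = (%_. 0)" using ij by (auto simp: v_def u_diag)
   then show ?thesis by (intro exI[of _ UNIV]) auto
  next
   assume "{k,l} = {i,j}"
   then show ?thesis using hol pB by (intro exI[of _ "ball 0 (2 * \<epsilon>)"]) (auto simp: v_def)
  qed
 next
  case False
  then have "p $ k - p $ l \<noteq> 0" using dis by auto
  then have "of_real (p $ k - p $ l) \<noteq> (0::complex)" by (simp del: of_real_diff)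
  then show ?thesis using hol_u pB False by (intro exI[of _ "ball 0 (2 * \<epsilon>) - {0}"]) (auto simp: v_def open_delete simp del: of_real_diff)
 qed
 have lv: "((%t. v k l (of_real (X t $ k - X t $ l))) \<longlongrightarrow> v k l (of_real (p $ k - p $ l))) (at_right 0)"
  and lv': "((%t. deriv (v k l) (of_real (X t $ k - X t $ l))) \<longlongrightarrow> deriv (v k l) (of_real (p $ k - p $ l))) (at_right 0)" for k l
 proof -
  obtain M where M: "open M" "v k l holomorphic_on M" "of_real (p $ k - p $ l) \<in> M" using hv[of k l] by blast
  show "((%t. v k l (of_real (X t $ k - X t $ l))) \<longlongrightarrow> v k l (of_real (p $ k - p $ l))) (at_right 0)"
   by (rule cont[OF M(2,1,3)])
  show "((%t. deriv (v k l) (of_real (X t $ k - X t $ l))) \<longlongrightarrow> deriv (v k l) (of_real (p $ k - p $ l))) (at_right 0)"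
   by (rule cont[OF holomorphic_deriv[OF M(2,1)] M(1,3)])
 qed
 have lT: "((%t. row_sum v k (X t)) \<longlongrightarrow> row_sum v k p) (at_right 0)" for k
  unfolding row_sum_def by (intro tendsto_sum lv)
 have lV: "((%t. row_sum (deriv2 v) k (X t)) \<longlongrightarrow> row_sum (deriv2 v) k p) (at_right 0)" for k
  unfolding row_sum_def by (intro tendsto_sum lv')
 have lA: "((%t. A k (X t)) \<longlongrightarrow> A k p) (at_right 0)" for k unfolding A_def by (intro tendsto_intros Xp)
 have pick: "(\<Sum>l\<in>UNIV. if {k,l} = {i,j} then h l else 0) = (if k = i then h j else if k = j then h i else 0)" for k and h :: "'n => complex"
 proof -
  have iff: "{k,l} = {i,j} \<longleftrightarrow> (k = i \<and> l = j \<or> k = j \<and> l = i)" for l by (auto simp: doubleton_eq_iff)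
  have "(\<Sum>l\<in>UNIV. if {k,l} = {i,j} then h l else 0) = (\<Sum>l\<in>UNIV. if l = (if k = i then j else i) then (if k = i \<or> k = j then h l else 0) else 0)"
   by (intro sum.cong refl) (use ij in \<open>auto simp: iff\<close>)
  also have "\<dots> = (if k = i then h j else if k = j then h i else 0)" by (simp only: sum.delta finite UNIV_I if_True) auto
  finally show ?thesis .
 qed
 define \<alpha> where "\<alpha> = (%k t. row_sum v k (X t) - A k (X t))"
 define \<beta> where "\<beta> = (%k t. row_sum (deriv2 v) k (X t))"
 define \<rho> where "\<rho> = (%t. \<Sum>k\<in>UNIV - {i} - {j}. \<alpha> k t * \<beta> k t)"
 define E where "E = (%t::real. c * of_real t * (\<beta> i t + \<beta> j t) + of_real t ^ 3 * (\<alpha> i t * \<beta> i t + \<alpha> j t * \<beta> j t + \<rho> t))"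
 have ev: "eventually (%t. 2 * c * (\<alpha> i t - \<alpha> j t) = E t) (at_right 0)"
  using evD evB eventually_at_right_less[of 0]
 proof eventually_elim
  case (elim t)
  let ?z = "%k l. complex_of_real (X t $ k - X t $ l)"
  have zij: "?z i j = of_real t" "?z j i = - of_real t" using p ij by (auto simp: X_def axis_def)
  have zB: "?z k l \<in> ball 0 (2 * \<epsilon>)" for k l
   using abs_component_difference_le[of "X t" k l] elim(2) by (simp del: of_real_diff)
  have z0: "?z k l \<noteq> 0" if "k \<noteq> l" for k l using elim(1) that by (simp del: of_real_diff)
  have "row_sum u k (X t) = (\<Sum>l\<in>UNIV. (if {k,l} = {i,j} then Cs k l / (?z k l)\<^sup>2 else 0) + v k l (?z k l))" for k
   unfolding row_sum_def by (intro sum.cong refl) (simp add: v_def u_def)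
  then have Tk: "row_sum u k (X t) = (if k = i then Cs k j / (?z k j)\<^sup>2 else if k = j then Cs k i / (?z k i)\<^sup>2 else 0) + row_sum v k (X t)" for k
   unfolding sum.distrib pick row_sum_def .
  have "row_sum (deriv2 u) k (X t) = (\<Sum>l\<in>UNIV. (if {k,l} = {i,j} then - 2 * Cs k l / (?z k l) ^ 3 else 0) + deriv (v k l) (?z k l))" for k
   unfolding row_sum_def
  proof (intro sum.cong refl)
   fix l
   show "deriv (u k l) (?z k l) = (if {k,l} = {i,j} then - 2 * Cs k l / (?z k l) ^ 3 else 0) + deriv (v k l) (?z k l)"
   proof (cases "{k,l} = {i,j}")
    case True
    then have "k \<noteq> l" using ij by auto
    then show ?thesis using deriv_u[OF zB z0] True by (simp add: v_def)
   qed (simp add: v_def)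
  qed
  then have Vk: "row_sum (deriv2 u) k (X t) = (if k = i then - 2 * Cs k j / (?z k j) ^ 3 else if k = j then - 2 * Cs k i / (?z k i) ^ 3 else 0) + row_sum (deriv2 v) k (X t)" for k
   unfolding sum.distrib pick row_sum_def .
  have Ti: "row_sum u i (X t) - A i (X t) = c / (of_real t)\<^sup>2 + \<alpha> i t" using Tk[of i] zij by (simp add: \<alpha>_def c_def)
  have Tj: "row_sum u j (X t) - A j (X t) = c / (of_real t)\<^sup>2 + \<alpha> j t" using Tk[of j] zij ij Cs_sym[of i j] by (simp add: \<alpha>_def c_def)
  have Vi: "row_sum (deriv2 u) i (X t) = - 2 * c / (of_real t) ^ 3 + \<beta> i t" using Vk[of i] zij by (simp add: \<beta>_def c_def)
  have Vj: "row_sum (deriv2 u) j (X t) = 2 * c / (of_real t) ^ 3 + \<beta> j t" using Vk[of j] zij ij Cs_sym[of i j] by (simp add: \<beta>_def c_def)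
  have rest: "(\<Sum>k\<in>UNIV - {i} - {j}. (row_sum u k (X t) - A k (X t)) * row_sum (deriv2 u) k (X t)) = \<rho> t"
   unfolding \<rho>_def by (intro sum.cong refl) (auto simp: Tk Vk \<alpha>_def \<beta>_def)
  have "0 = (\<Sum>k\<in>UNIV. (row_sum u k (X t) - A k (X t)) * row_sum (deriv2 u) k (X t))"
   by (rule identity[symmetric]) (use elim in auto)
  also have "\<dots> = (row_sum u i (X t) - A i (X t)) * row_sum (deriv2 u) i (X t) + (\<Sum>k\<in>UNIV - {i}. (row_sum u k (X t) - A k (X t)) * row_sum (deriv2 u) k (X t))"
   by (rule sum.remove) auto
  also have "(\<Sum>k\<in>UNIV - {i}. (row_sum u k (X t) - A k (X t)) * row_sum (deriv2 u) k (X t))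
    = (row_sum u j (X t) - A j (X t)) * row_sum (deriv2 u) j (X t) + (\<Sum>k\<in>UNIV - {i} - {j}. (row_sum u k (X t) - A k (X t)) * row_sum (deriv2 u) k (X t))"
   by (rule sum.remove) (use ij in auto)
  finally have eq: "(c / (of_real t)\<^sup>2 + \<alpha> i t) * (- 2 * c / of_real t ^ 3 + \<beta> i t) + ((c / (of_real t)\<^sup>2 + \<alpha> j t) * (2 * c / of_real t ^ 3 + \<beta> j t) + \<rho> t) = 0"
   unfolding Ti Tj Vi Vj rest by (rule sym)
  show ?case unfolding E_def by (rule wall_algebra[OF _ eq]) (use elim in simp)
 qed
 have l\<alpha>: "(\<alpha> k \<longlongrightarrow> row_sum v k p - A k p) (at_right 0)" for k unfolding \<alpha>_def by (intro tendsto_diff lT lA)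
 have l\<beta>: "(\<beta> k \<longlongrightarrow> row_sum (deriv2 v) k p) (at_right 0)" for k unfolding \<beta>_def by (rule lV)
 have l\<rho>: "(\<rho> \<longlongrightarrow> (\<Sum>k\<in>UNIV - {i} - {j}. (row_sum v k p - A k p) * row_sum (deriv2 v) k p)) (at_right 0)"
  unfolding \<rho>_def by (intro tendsto_intros l\<alpha> l\<beta>)
 have lt: "((%t. complex_of_real t) \<longlongrightarrow> 0) (at_right 0)" by (rule tendsto_eq_intros refl | simp)+
 have "(E \<longlongrightarrow> c * 0 * (row_sum (deriv2 v) i p + row_sum (deriv2 v) j p) + 0 ^ 3 * ((row_sum v i p - A i p) * row_sum (deriv2 v) i p
   + (row_sum v j p - A j p) * row_sum (deriv2 v) j p + (\<Sum>k\<in>UNIV - {i} - {j}. (row_sum v k p - A k p) * row_sum (deriv2 v) k p))) (at_right 0)"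
  unfolding E_def by (intro tendsto_add tendsto_mult tendsto_const tendsto_power lt l\<alpha> l\<beta> l\<rho>)
 then have E0: "(E \<longlongrightarrow> 0) (at_right 0)" by simp
 have "((%t. 2 * c * (\<alpha> i t - \<alpha> j t)) \<longlongrightarrow> 2 * c * ((row_sum v i p - A i p) - (row_sum v j p - A j p))) (at_right 0)"
  by (intro tendsto_mult tendsto_const tendsto_diff l\<alpha>)
 then have EL: "(E \<longlongrightarrow> 2 * c * ((row_sum v i p - A i p) - (row_sum v j p - A j p))) (at_right 0)"
  using ev by (rule Lim_transform_eventually)
 have "2 * c * ((row_sum v i p - A i p) - (row_sum v j p - A j p)) = 0"
  by (rule tendsto_unique[OF trivial_limit_at_right_real EL E0])
 then have main: "row_sum v i p - A i p = row_sum v j p - A j p" using ij by (simp add: c_def)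
 have v0: "v i i = (%_. 0)" "v j j = (%_. 0)" "v i j 0 = 0" "v j i 0 = 0"
  using ij by (auto simp: v_def u_diag r_0 doubleton_eq_iff)
 have "row_sum v i p = v i i (of_real (p $ i - p $ i)) + (v i j (of_real (p $ i - p $ j)) + (\<Sum>k\<in>UNIV - {i} - {j}. v i k (of_real (p $ i - p $ k))))"
  using ij unfolding row_sum_def by (subst sum.remove[of _ i], simp, simp, subst sum.remove[of _ j]) auto
 also have "(\<Sum>k\<in>UNIV - {i} - {j}. v i k (of_real (p $ i - p $ k))) = (\<Sum>k\<in>UNIV - {i,j}. u i k (of_real (p $ i - p $ k)))"
  by (rule sum.cong) (auto simp: v_def doubleton_eq_iff)
 finally have 1: "row_sum v i p = (\<Sum>k\<in>UNIV - {i,j}. u i k (of_real (p $ i - p $ k)))" using p(2) v0 by simp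
 have "row_sum v j p = v j j (of_real (p $ j - p $ j)) + (v j i (of_real (p $ j - p $ i)) + (\<Sum>k\<in>UNIV - {j} - {i}. v j k (of_real (p $ j - p $ k))))"
  using ij unfolding row_sum_def by (subst sum.remove[of _ j], simp, simp, subst sum.remove[of _ i]) auto
 also have "(\<Sum>k\<in>UNIV - {j} - {i}. v j k (of_real (p $ j - p $ k))) = (\<Sum>k\<in>UNIV - {i,j}. u j k (of_real (p $ j - p $ k)))"
  by (rule sum.cong) (auto simp: v_def doubleton_eq_iff)
 finally have 2: "row_sum v j p = (\<Sum>k\<in>UNIV - {i,j}. u j k (of_real (p $ j - p $ k)))" using p(2) v0 by simp
 show ?thesis using main unfolding 1 2 sum_subtractf by (simp add: algebra_simps)
qed

text \<open>If only x_k moves, just the terms with index k and the affine part of the wall relation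
  vary. So u i k - u j k is affine on a small interval: its double pole is absent, its constant is 0
  by the normalisation of r, and its slope comes from lam. The identity theorem carries this to the
  disc.\<close>

lemma wall_consequence:
 assumes ij: "i \<noteq> j" "Cs i j \<noteq> 0" and k: "k \<noteq> i" "k \<noteq> j"
 shows "Cs i k = Cs j k" and "z \<in> ball 0 (2 * \<epsilon>) ==> r i k z - r j k z = - 2 * (lam i k - lam j k) * z"
proof -
 obtain y :: "real^'n" where y: "\<And>i. y $ i > 0" "\<And>i j. i \<noteq> j ==> y $ i \<noteq> y $ j"
  using positive_distinct_vec_exists by blast
 define N where "N = norm y + 1"
 have ny: "N > 0" "norm y < N" unfolding N_def by (smt (verit) norm_ge_zero)+
 define \<delta> where "\<delta> = \<epsilon> / (2 * N)"
 have \<delta>: "\<delta> > 0" using eps ny by (simp add: \<delta>_def)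
 have "\<delta> * norm y < \<delta> * N" using \<delta> ny by simp
 also have "\<dots> = \<epsilon> / 2" using ny by (simp add: \<delta>_def)
 finally have \<delta>y: "\<delta> * norm y < \<epsilon> / 2" .
 define q :: "real^'n" where "q = (\<chi> l. if l \<in> {i,j,k} then 0 else \<delta> * y $ l)"
 have "norm q \<le> norm (\<delta> *\<^sub>R y)"
  by (rule norm_le_componentwise_cart) (use \<delta> y(1) in \<open>auto simp: q_def\<close>)
 then have q: "norm q < \<epsilon> / 2" using \<delta>y \<delta> by simp
 \<comment> \<open>Coordinates i and j sit at 0, coordinate k at -s < 0, and the others at distinct
   positive places, so p lies on exactly one wall.\<close>
 define p where "p = (%s::real. q - s *\<^sub>R axis k 1)"
 have pc: "p s $ l = (if l = k then - s else q $ l)" for s l by (auto simp: p_def q_def axis_def)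
 have qc: "q $ l = (if l \<in> {i,j,k} then 0 else \<delta> * y $ l)" for l by (simp add: q_def)
 define Y where "Y = (%l. \<delta> * y $ l)"
 have Y: "Y l > 0" "l \<noteq> m ==> Y l \<noteq> Y m" for l m using \<delta> y by (auto simp: Y_def)
 have pc': "p s $ l = (if l = i \<or> l = j then 0 else if l = k then - s else Y l)" for s l
  using k by (auto simp: pc qc Y_def)
 define w where "w = (%s::real. u i k (of_real s) - u j k (of_real s))"
 define B where "B = (\<Sum>m\<in>UNIV - {i,j} - {k}. u i m (- of_real (q $ m)) - u j m (- of_real (q $ m)))"
 define K where "K = A i q - A j q - B"
 have w: "w s = K - 2 * (lam i k - lam j k) * of_real s" if s: "0 < s" "s < \<epsilon> / 2" for s
 proof -
  have "(\<Sum>m\<in>UNIV - {i,j}. u i m (of_real (p s $ i - p s $ m)) - u j m (of_real (p s $ j - p s $ m))) = A i (p s) - A j (p s)"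
  proof (rule wall[OF ij])
   have "norm (p s) \<le> norm q + norm (s *\<^sub>R axis k (1::real) :: real^'n)" unfolding p_def by (rule norm_triangle_ineq4)
   also have "norm (s *\<^sub>R axis k (1::real) :: real^'n) = s" using s by (simp add: norm_axis_1)
   finally show "p s \<in> ball 0 \<epsilon>" using q s by simp
   show "p s $ i = p s $ j" using k by (simp add: pc qc)
   show "p s $ a \<noteq> p s $ b" if ab: "a \<noteq> b" "{a,b} \<noteq> {i,j}" for a b
   proof -
    have "\<not> (a = i \<or> a = j) \<or> \<not> (b = i \<or> b = j)" using ab by auto
    moreover have "Y a \<noteq> 0" "Y b \<noteq> 0" "Y a \<noteq> - s" "Y b \<noteq> - s" "s \<noteq> 0" using Y(1)[of a] Y(1)[of b] s by auto
    ultimately show ?thesis using Y(2)[OF ab(1)] ab(1) unfolding pc' by auto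
   qed
  qed
  also have "(\<Sum>m\<in>UNIV - {i,j}. u i m (of_real (p s $ i - p s $ m)) - u j m (of_real (p s $ j - p s $ m))) =
    (u i k (of_real (p s $ i - p s $ k)) - u j k (of_real (p s $ j - p s $ k)))
    + (\<Sum>m\<in>UNIV - {i,j} - {k}. u i m (of_real (p s $ i - p s $ m)) - u j m (of_real (p s $ j - p s $ m)))"
   by (rule sum.remove) (use k in auto)
  also have "(\<Sum>m\<in>UNIV - {i,j} - {k}. u i m (of_real (p s $ i - p s $ m)) - u j m (of_real (p s $ j - p s $ m))) = B"
   unfolding B_def by (intro sum.cong refl) (use k in \<open>auto simp: pc qc\<close>)
  also have "u i k (of_real (p s $ i - p s $ k)) - u j k (of_real (p s $ j - p s $ k)) = w s"
   using k by (simp add: pc qc w_def)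
  finally have "w s + B = A i (p s) - A j (p s)" .
  moreover have "A m (p s) = A m q - 2 * lam m k * of_real s" for m
  proof -
   have "(\<Sum>l\<in>UNIV. lam m l * of_real (p s $ l)) = (\<Sum>l\<in>UNIV. lam m l * of_real (q $ l) - (if l = k then lam m l * of_real s else 0))"
    by (intro sum.cong refl) (auto simp: pc qc)
   then have e: "(\<Sum>l\<in>UNIV. lam m l * of_real (p s $ l)) = (\<Sum>l\<in>UNIV. lam m l * of_real (q $ l)) - lam m k * of_real s"
    by (simp add: sum_subtractf)
   show ?thesis unfolding A_def e by (simp add: algebra_simps)
  qed
  ultimately show ?thesis by (simp add: K_def algebra_simps)
 qed
 define f where "f = (%z. r i k z - r j k z + 2 * (lam i k - lam j k) * z)"
 have hf: "f holomorphic_on ball 0 (2 * \<epsilon>)" unfolding f_def by (intro holomorphic_intros hol)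
 have f0: "f 0 = 0" by (simp add: f_def r_0)
 have cf: "isCont f 0" using holomorphic_on_imp_continuous_on[OF hf] eps by (simp add: continuous_on_eq_continuous_at)
 have l0: "((%s. complex_of_real s) \<longlongrightarrow> 0) (at_right 0)" by (rule tendsto_eq_intros refl | simp)+
 have lf: "((%s. f (of_real s)) \<longlongrightarrow> 0) (at_right 0)" using isCont_tendsto_compose[OF cf l0] unfolding f0 .
 have ev: "eventually (%s::real. 0 < s \<and> s < \<epsilon> / 2) (at_right 0)"
  using eps by (intro eventually_conj eventually_at_right_less eventually_at_rightI[of 0 "\<epsilon> / 2"]) auto
 have wf: "(Cs i k - Cs j k) / (of_real s)\<^sup>2 + f (of_real s) = K" if "0 < s" "s < \<epsilon> / 2" for s :: real
  using w[OF that] by (simp add: w_def u_def f_def diff_divide_distrib algebra_simps)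
 have lim: "((%s. (of_real s)\<^sup>2 * (K - f (of_real s))) \<longlongrightarrow> 0\<^sup>2 * (K - 0)) (at_right 0)"
  by (intro tendsto_mult tendsto_power tendsto_diff tendsto_const l0 lf)
 have "eventually (%s. (of_real s)\<^sup>2 * (K - f (of_real s)) = Cs i k - Cs j k) (at_right 0)"
  using ev
 proof eventually_elim
  case (elim s)
  then have "complex_of_real s \<noteq> 0" by simp
  then show ?case unfolding wf[symmetric, of s, OF elim[THEN conjunct1] elim[THEN conjunct2]] by simp
 qed
 with lim have "((%s::real. Cs i k - Cs j k) \<longlongrightarrow> 0\<^sup>2 * (K - 0)) (at_right 0)" by (rule Lim_transform_eventually)
 then show Ck: "Cs i k = Cs j k" by (simp add: tendsto_const_iff)
 have fK: "f (of_real s) = K" if "0 < s" "s < \<epsilon> / 2" for s :: real using wf[OF that] Ck by simp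
 have "eventually (%s. f (of_real s) = K) (at_right 0)" using ev by eventually_elim (use fK in blast)
 with lf have "((%s::real. K) \<longlongrightarrow> 0) (at_right 0)" by (rule Lim_transform_eventually)
 then have K0: "K = 0" by (simp add: tendsto_const_iff)
 assume z: "z \<in> ball 0 (2 * \<epsilon>)"
 have "f z = 0"
 proof (rule holomorphic_zero_of_zero_on_reals[OF hf open_ball connected_ball _ _ _ z])
  show "(0::complex) \<in> ball 0 (2 * \<epsilon>)" "\<epsilon> / 2 > 0" using eps by auto
  show "f (0 + of_real t) = 0" if "0 < t" "t < \<epsilon> / 2" for t :: real using fK[OF that] K0 by simp
 qed
 then have "r i k z - r j k z = - (2 * (lam i k - lam j k) * z)" unfolding f_def by (simp only: eq_neg_iff_add_eq_0)
 then show "r i k z - r j k z = - 2 * (lam i k - lam j k) * z" by (simp only: mult_minus_left)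
qed

end

text \<open>\<open>connected_walls\<close> says that the graph of the nonzero coefficients is
  connected: a nonempty set of indices closed along its edges is everything.\<close>

locale equal_walls = wall_setup \<epsilon> Cs r lam mu u A
 for \<epsilon> and Cs :: "'n::finite => 'n => complex" and r lam mu u A +
 assumes connected_walls: "\<And>M. M \<noteq> {} ==> (\<And>a b. Cs a b \<noteq> 0 ==> a \<in> M \<longleftrightarrow> b \<in> M) ==> M = UNIV"
  and three: "CARD('n) \<ge> 3"
begin

text \<open>Along an edge a b the coefficients Cs i a and Cs i b agree, so being a neighbour of i
  propagates along edges. A connected graph with this property is complete.\<close>

lemma Cs_nonzero:
 assumes "i \<noteq> j"
 shows "Cs i j \<noteq> 0"
proof -
 have "{j. j = i \<or> Cs i j \<noteq> 0} = UNIV"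
 proof (rule connected_walls)
  fix a b assume ab: "Cs a b \<noteq> 0"
  then have ne: "a \<noteq> b" using Cs_diag by metis
  have "Cs i a = Cs i b" if "a \<noteq> i" "b \<noteq> i"
   using wall_consequence(1)[OF ne ab, of i] that Cs_sym by metis
  then show "a \<in> {j. j = i \<or> Cs i j \<noteq> 0} \<longleftrightarrow> b \<in> {j. j = i \<or> Cs i j \<noteq> 0}"
   using ab Cs_sym[of a b] by (cases "a = i"; cases "b = i") auto
 qed auto
 then show ?thesis using assms by auto
qed

lemma Cs_column: "i \<noteq> j ==> k \<noteq> j ==> Cs i j = Cs k j"
 using wall_consequence(1)[OF _ Cs_nonzero, of i k j] by metis

lemma Cs_equal:
 assumes "i \<noteq> j" "k \<noteq> l"
 shows "Cs i j = Cs k l"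
proof (cases "k = j")
 case True
 have "Cs j i = Cs l i" if "l \<noteq> i" using Cs_column[of j i l] that assms by metis
 moreover have "Cs i l = Cs j l" if "l \<noteq> i" using Cs_column[of i l j] that assms True by metis
 ultimately show ?thesis using True Cs_sym by metis
next
 case False
 then have "Cs i j = Cs k j" using Cs_column[of i j k] assms by metis
 moreover have "Cs j k = Cs l k" using Cs_column[of j k l] assms False by metis
 ultimately show ?thesis using Cs_sym by metis
qed

text \<open>Adding 2 * lam i j * z removes the slopes, and then the function depends on the column
  index alone. Exchanging the indices reflects z, so column moves and exchanges together identify
  all pairs.\<close>

lemma r_equal:
 "\<exists>\<rho>. \<rho> holomorphic_on ball 0 (2 * \<epsilon>) \<and> \<rho> 0 = 0 \<and> (\<forall>z\<in>ball 0 (2 * \<epsilon>). \<rho> (- z) = \<rho> z) \<and>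
  (\<forall>i j. \<forall>z\<in>ball 0 (2 * \<epsilon>). i \<noteq> j --> r i j z = \<rho> z - 2 * lam i j * z)"
proof -
 define s where "s = (%i j z. r i j z + 2 * lam i j * z)"
 have col: "s i j z = s k j z" if "i \<noteq> j" "k \<noteq> j" "z \<in> ball 0 (2 * \<epsilon>)" for i j k z
 proof (cases "i = k")
  case False
  have "r i j z - r k j z = - 2 * (lam i j - lam k j) * z"
   by (rule wall_consequence(2)[OF False Cs_nonzero[OF False]]) (use that in auto)
  then show ?thesis by (simp add: s_def algebra_simps)
 qed simp
 have tr: "s j i (- z) = s i j z" if "z \<in> ball 0 (2 * \<epsilon>)" for i j z
 proof -
  have "lam j i = - lam i j" using lam_sym[of i j] by (simp add: eq_neg_iff_add_eq_0 add.commute)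
  then show ?thesis using r_sym[OF that, of j i] by (simp add: s_def)
 qed
 obtain T :: "'n set" where "card T = 3" using obtain_subset_with_card_n[OF three] by metis
 then obtain a b c :: 'n where abc: "a \<noteq> b" "a \<noteq> c" "b \<noteq> c" by (auto simp: card_3_iff)
 have uz: "- z \<in> ball 0 (2 * \<epsilon>)" if "z \<in> ball 0 (2 * \<epsilon>)" for z :: complex using that by simp
 \<comment> \<open>Three column moves alternating with three exchanges lead around the triple a, b,
   c back to the start with z reflected.\<close>
 have even: "s a b (- z) = s a b z" if z: "z \<in> ball 0 (2 * \<epsilon>)" for z
 proof -
  have "s a b z = s c b z" by (rule col[OF _ _ z]) (use abc in auto)
  also have "\<dots> = s b c (- z)" by (rule tr[OF z, symmetric])
  also have "\<dots> = s a c (- z)" by (rule col[OF _ _ uz[OF z]]) (use abc in auto)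
  also have "\<dots> = s c a z" by (rule tr[OF z])
  also have "\<dots> = s b a z" by (rule col[OF _ _ z]) (use abc in auto)
  also have "\<dots> = s a b (- z)" by (rule tr[OF z, symmetric])
  finally show ?thesis by simp
 qed
 have all: "s i j z = s a b z" if ij: "i \<noteq> j" and z: "z \<in> ball 0 (2 * \<epsilon>)" for i j z
 proof (cases "j = a")
  case True
  have "s i a z = s b a z" by (rule col[OF _ _ z]) (use abc ij True in auto)
  also have "\<dots> = s a b (- z)" by (rule tr[OF z, symmetric])
  finally show ?thesis using even[OF z] True by simp
 next
  case False
  have 1: "s i j z = s a j z" by (rule col[OF _ _ z]) (use ij False in auto)
  show ?thesis
  proof (cases "j = b")
   case ne: False
   have "s a j z = s b j z" by (rule col[OF _ _ z]) (use ne False in auto)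
   also have "\<dots> = s j b (- z)" by (rule tr[OF z, symmetric])
   also have "\<dots> = s a b (- z)" by (rule col[OF _ _ uz[OF z]]) (use abc ne in auto)
   finally show ?thesis using even[OF z] 1 by simp
  qed (use 1 in simp)
 qed
 show ?thesis
 proof (intro exI[of _ "s a b"] conjI allI ballI impI)
  show "s a b holomorphic_on ball 0 (2 * \<epsilon>)" unfolding s_def by (intro holomorphic_intros hol)
  show "s a b 0 = 0" by (simp add: s_def r_0)
  show "r i j z = s a b z - 2 * lam i j * z" if z: "z \<in> ball 0 (2 * \<epsilon>)" and "i \<noteq> j" for i j z
   using all[OF \<open>i \<noteq> j\<close> z] by (simp add: s_def algebra_simps)
 qed (rule even)
qed

text \<open>In the wall relation the functions with common shape cancel and the linear terms match
  those of A, leaving only the difference of the two constants.\<close>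

lemma mu_equal: "mu i = mu j"
proof (cases "i = j")
 case False
 obtain \<rho> where \<rho>_all: "\<rho> holomorphic_on ball 0 (2 * \<epsilon>) \<and> \<rho> 0 = 0 \<and> (\<forall>z\<in>ball 0 (2 * \<epsilon>). \<rho> (- z) = \<rho> z) \<and>
  (\<forall>i j. \<forall>z\<in>ball 0 (2 * \<epsilon>). i \<noteq> j --> r i j z = \<rho> z - 2 * lam i j * z)"
  using r_equal ..
 have \<rho>: "r i j z = \<rho> z - 2 * lam i j * z" if "i \<noteq> j" "z \<in> ball 0 (2 * \<epsilon>)" for i j z
  by (rule \<rho>_all[THEN conjunct2, THEN conjunct2, THEN conjunct2, rule_format, OF that(2,1)])
 obtain y :: "real^'n" where y: "\<And>i. y $ i > 0" "\<And>i j. i \<noteq> j ==> y $ i \<noteq> y $ j"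
  using positive_distinct_vec_exists by blast
 define N where "N = norm y + 1"
 have ny: "N > 0" "norm y < N" unfolding N_def by (smt (verit) norm_ge_zero)+
 define \<delta> where "\<delta> = \<epsilon> / N"
 have \<delta>: "\<delta> > 0" using eps ny by (simp add: \<delta>_def)
 have "\<delta> * norm y < \<delta> * N" using \<delta> ny by simp
 also have "\<dots> = \<epsilon>" using ny by (simp add: \<delta>_def)
 finally have \<delta>y: "\<delta> * norm y < \<epsilon>" .
 define p :: "real^'n" where "p = (\<chi> l. if l = i \<or> l = j then 0 else \<delta> * y $ l)"
 have pc: "p $ l = (if l = i \<or> l = j then 0 else \<delta> * y $ l)" for l by (simp add: p_def)
 define Y where "Y = (%l. \<delta> * y $ l)"
 have Y: "Y l > 0" "l \<noteq> m ==> Y l \<noteq> Y m" for l m using \<delta> y by (auto simp: Y_def)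
 have pcY: "p $ l = (if l = i \<or> l = j then 0 else Y l)" for l by (simp add: pc Y_def)
 have "norm p \<le> norm (\<delta> *\<^sub>R y)"
  by (rule norm_le_componentwise_cart) (use \<delta> y(1) in \<open>auto simp: p_def\<close>)
 then have p: "p \<in> ball 0 \<epsilon>" using \<delta>y \<delta> by simp
 have "(\<Sum>m\<in>UNIV - {i,j}. u i m (of_real (p $ i - p $ m)) - u j m (of_real (p $ j - p $ m))) = A i p - A j p"
 proof (rule wall[OF False Cs_nonzero[OF False] p])
  show "p $ i = p $ j" by (simp add: pc)
  show "p $ a \<noteq> p $ b" if ab: "a \<noteq> b" "{a,b} \<noteq> {i,j}" for a b
  proof -
   have "\<not> (a = i \<or> a = j) \<or> \<not> (b = i \<or> b = j)" using ab by auto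
   moreover have "Y a \<noteq> 0" "Y b \<noteq> 0" using Y(1)[of a] Y(1)[of b] by auto
   ultimately show ?thesis using Y(2)[OF ab(1)] ab(1) unfolding pcY by auto
  qed
 qed
 moreover have "u i m (of_real (p $ i - p $ m)) - u j m (of_real (p $ j - p $ m)) = 2 * (lam i m - lam j m) * of_real (p $ m)"
  if m: "m \<in> UNIV - {i,j}" for m
 proof -
  have pB: "complex_of_real (p $ i - p $ m) \<in> ball 0 (2 * \<epsilon>)"
   using abs_component_difference_le[of p i m] p by (simp del: of_real_diff)
  have im: "i \<noteq> m" "j \<noteq> m" using m by auto
  have ij: "p $ j = p $ i" by (simp add: pc)
  have pi: "p $ i = 0" by (simp add: pc)
  show ?thesis unfolding u_def ij \<rho>[OF im(1) pB] \<rho>[OF im(2) pB] Cs_equal[OF im]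
   using pi by (simp add: algebra_simps)
 qed
 then have "(\<Sum>m\<in>UNIV - {i,j}. u i m (of_real (p $ i - p $ m)) - u j m (of_real (p $ j - p $ m))) = (\<Sum>m\<in>UNIV - {i,j}. 2 * (lam i m - lam j m) * of_real (p $ m))"
  by (intro sum.cong refl)
 moreover have "\<dots> = (\<Sum>m\<in>UNIV. 2 * (lam i m - lam j m) * of_real (p $ m))"
  by (rule sum.mono_neutral_left) (auto simp: pc)
 moreover have "\<dots> = (\<Sum>m\<in>UNIV. 2 * (lam i m * of_real (p $ m)) - 2 * (lam j m * of_real (p $ m)))"
  by (intro sum.cong refl) (simp add: algebra_simps)
 moreover have "\<dots> = A i p - A j p - 2 * (mu i - mu j)"
  unfolding sum_subtractf sum_distrib_left[symmetric] A_def by (simp add: algebra_simps)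
 ultimately show ?thesis by simp
qed simp

text \<open>All affine data disappear. The slopes in the row sums cancel against the linear part of
  A, in the derivatives they sum to 0, and the common constant mu multiplies the sum of all
  derivative rows, which is 0 by symmetry.\<close>

lemma reduced_identity:
 "\<exists>c \<rho>. c \<noteq> 0 \<and> (\<forall>i j. i \<noteq> j --> Cs i j = c) \<and> \<rho> holomorphic_on ball 0 (2 * \<epsilon>) \<and> \<rho> 0 = 0 \<and>
  (\<forall>z\<in>ball 0 (2 * \<epsilon>). \<rho> (- z) = \<rho> z) \<and> (\<forall>x\<in>ball 0 \<epsilon>. pair_sum r x = pair_sum (off_diagonal \<rho>) x) \<and>
  (\<forall>x\<in>(ball 0 \<epsilon> :: (real^'n) set). (\<forall>i j. i \<noteq> j --> x $ i \<noteq> x $ j) -->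
   (\<Sum>i\<in>UNIV. row_sum (off_diagonal (%z. c / z\<^sup>2 + \<rho> z)) i x * row_sum (off_diagonal (deriv (%z. c / z\<^sup>2 + \<rho> z))) i x) = 0)"
proof -
 obtain \<rho> where \<rho>_all: "\<rho> holomorphic_on ball 0 (2 * \<epsilon>) \<and> \<rho> 0 = 0 \<and> (\<forall>z\<in>ball 0 (2 * \<epsilon>). \<rho> (- z) = \<rho> z) \<and>
  (\<forall>i j. \<forall>z\<in>ball 0 (2 * \<epsilon>). i \<noteq> j --> r i j z = \<rho> z - 2 * lam i j * z)"
  using r_equal ..
 note h\<rho> = \<rho>_all[THEN conjunct1] and \<rho>0 = \<rho>_all[THEN conjunct2, THEN conjunct1]
 have even: "\<rho> (- z) = \<rho> z" if "z \<in> ball 0 (2 * \<epsilon>)" for z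
  by (rule \<rho>_all[THEN conjunct2, THEN conjunct2, THEN conjunct1, rule_format, OF that])
 have r: "r i j z = \<rho> z - 2 * lam i j * z" if "i \<noteq> j" "z \<in> ball 0 (2 * \<epsilon>)" for i j z
  by (rule \<rho>_all[THEN conjunct2, THEN conjunct2, THEN conjunct2, rule_format, OF that(2,1)])
 obtain T :: "'n set" where "card T = 3" using obtain_subset_with_card_n[OF three] by metis
 then obtain a b :: 'n where ab: "a \<noteq> b" by (auto simp: card_3_iff)
 define c where "c = Cs a b"
 have Cc: "Cs i j = c" if "i \<noteq> j" for i j unfolding c_def by (rule Cs_equal[OF that ab])
 have c: "c \<noteq> 0" unfolding c_def by (rule Cs_nonzero[OF ab])
 have xB: "complex_of_real (x $ i - x $ j) \<in> ball 0 (2 * \<epsilon>)" if "x \<in> ball 0 \<epsilon>" for i j and x :: "real^'n"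
  using abs_component_difference_le[of x i j] that by (simp del: of_real_diff)
 have linear: "(\<Sum>k\<in>UNIV. lam i k * of_real (x $ i - x $ k)) = - (\<Sum>k\<in>UNIV. lam i k * of_real (x $ k))" for i and x :: "real^'n"
  using lam_sum[of i] by (simp add: right_diff_distrib sum_subtractf sum_distrib_right[symmetric])
 have lam_sum': "(\<Sum>i\<in>UNIV. lam i k) = 0" for k
 proof -
  have "(\<Sum>i\<in>UNIV. lam i k) = (\<Sum>i\<in>UNIV. - lam k i)"
   by (intro sum.cong refl) (use lam_sym in \<open>simp add: eq_neg_iff_add_eq_0\<close>)
  then show ?thesis by (simp add: sum_negf lam_sum)
 qed
 show ?thesis
 proof (rule exI[of _ c], rule exI[of _ \<rho>], intro conjI allI ballI impI)
  show "c \<noteq> 0" "\<rho> holomorphic_on ball 0 (2 * \<epsilon>)" "\<rho> 0 = 0" by (rule c h\<rho> \<rho>0)+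
  show "Cs i j = c" if "i \<noteq> j" for i j by (rule Cc[OF that])
  show "\<rho> (- z) = \<rho> z" if "z \<in> ball 0 (2 * \<epsilon>)" for z by (rule even[OF that])
  fix x :: "real^'n" assume x: "x \<in> ball 0 \<epsilon>"
  have "r i j (of_real (x $ i - x $ j)) = off_diagonal \<rho> i j (of_real (x $ i - x $ j)) - 2 * (lam i j * of_real (x $ i - x $ j))" for i j
   using r[OF _ xB[OF x], of i j] by (cases "i = j") (simp_all add: off_diagonal_def r_diag lam_diag)
  then have "pair_sum r x = pair_sum (off_diagonal \<rho>) x - (\<Sum>i\<in>UNIV. \<Sum>j\<in>UNIV. lam i j * of_real (x $ i - x $ j))"
   by (simp add: pair_sum_def sum_subtractf diff_divide_distrib sum_distrib_left[symmetric])
  also have "(\<Sum>i\<in>UNIV. \<Sum>j\<in>UNIV. lam i j * of_real (x $ i - x $ j)) = - (\<Sum>i\<in>UNIV. \<Sum>j\<in>UNIV. lam i j * of_real (x $ j))"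
   by (simp only: linear sum_negf)
  also have "(\<Sum>i\<in>UNIV. \<Sum>j\<in>UNIV. lam i j * of_real (x $ j)) = (\<Sum>j\<in>UNIV. \<Sum>i\<in>UNIV. lam i j * of_real (x $ j))"
   by (rule sum.swap)
  also have "\<dots> = 0" by (simp add: sum_distrib_right[symmetric] lam_sum')
  finally show "pair_sum r x = pair_sum (off_diagonal \<rho>) x" by simp
  assume "\<forall>i j. i \<noteq> j --> x $ i \<noteq> x $ j"
  then have dis: "x $ i \<noteq> x $ j" if "i \<noteq> j" for i j using that by blast
  define v where v: "v = (%z. c / z\<^sup>2 + \<rho> z)"
  have dv: "deriv2 (off_diagonal v) = off_diagonal (deriv v)" by (intro ext) (simp add: off_diagonal_def)
  let ?z = "%i j. complex_of_real (x $ i - x $ j)"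
  have z0: "?z i j \<noteq> 0" if "i \<noteq> j" for i j using dis[OF that] by (simp del: of_real_diff)
  have uv: "u i j (?z i j) = off_diagonal v i j (?z i j) - 2 * (lam i j * ?z i j)" for i j
   using r[OF _ xB[OF x], of i j] Cc[of i j] by (cases "i = j") (simp_all add: off_diagonal_def u_def lam_diag Cs_diag r_diag v)
  have T: "row_sum u i x = row_sum (off_diagonal v) i x + 2 * (\<Sum>k\<in>UNIV. lam i k * of_real (x $ k))" for i
   unfolding row_sum_def uv sum_subtractf sum_distrib_left[symmetric] linear by simp
  have du: "deriv (u i j) (?z i j) = deriv (off_diagonal v i j) (?z i j) - 2 * lam i j" for i j
  proof (cases "i = j")
   case False
   have "deriv (r i j) (?z i j) = deriv (%z. \<rho> z - 2 * lam i j * z) (?z i j)"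
    by (rule deriv_eq_on_open[OF open_ball xB[OF x] r[OF False]])
   also have "\<dots> = deriv \<rho> (?z i j) - 2 * lam i j"
    by (rule DERIV_imp_deriv) (rule DERIV_diff[OF holomorphic_derivI[OF h\<rho> open_ball xB[OF x]] DERIV_cmult_Id[of "2 * lam i j"]])
   finally show ?thesis
    using deriv_u[OF xB[OF x] z0[OF False], of i j] deriv_double_pole[OF h\<rho> open_ball xB[OF x] z0[OF False], of c] False
    by (simp add: off_diagonal_def v Cc)
  qed (simp add: off_diagonal_def u_diag lam_diag)
  have V: "row_sum (deriv2 u) i x = row_sum (deriv2 (off_diagonal v)) i x" for i
   unfolding row_sum_def du sum_subtractf sum_distrib_left[symmetric] lam_sum by simp
  interpret P: pair_functions "off_diagonal v" "ball 0 (2 * \<epsilon>) - {0}" "{x::real^'n. x \<in> ball 0 \<epsilon> \<and> (\<forall>i j. i \<noteq> j --> x $ i \<noteq> x $ j)}"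
  proof (rule pair_functions_punctured_ball)
   show "off_diagonal v i j holomorphic_on ball 0 (2 * \<epsilon>) - {0}" for i j :: 'n
    using holomorphic_double_pole[OF h\<rho>, of c] by (simp add: off_diagonal_def v holomorphic_on_const)
  qed (use even in \<open>auto simp: off_diagonal_def v\<close>)
  have xD: "x \<in> {x::real^'n. x \<in> ball 0 \<epsilon> \<and> (\<forall>i j. i \<noteq> j --> x $ i \<noteq> x $ j)}" using x dis by blast
  have V0: "(\<Sum>i\<in>UNIV. row_sum (deriv2 (off_diagonal v)) i x) = 0"
   using P.sum_partial_pair_sum[OF xD] unfolding P.partial_pair_sum[OF xD] row_sum_def .
  have "0 = (\<Sum>i\<in>UNIV. (row_sum u i x - A i x) * row_sum (deriv2 u) i x)"
   by (rule identity[symmetric]) (use x dis in auto)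
  also have "\<dots> = (\<Sum>i\<in>UNIV. row_sum (off_diagonal v) i x * row_sum (deriv2 (off_diagonal v)) i x - 2 * mu a * row_sum (deriv2 (off_diagonal v)) i x)"
  proof (intro sum.cong refl)
   fix i
   show "(row_sum u i x - A i x) * row_sum (deriv2 u) i x = row_sum (off_diagonal v) i x * row_sum (deriv2 (off_diagonal v)) i x - 2 * mu a * row_sum (deriv2 (off_diagonal v)) i x"
    unfolding T V A_def mu_equal[of i a] by (simp add: algebra_simps)
  qed
  also have "\<dots> = (\<Sum>i\<in>UNIV. row_sum (off_diagonal v) i x * row_sum (deriv2 (off_diagonal v)) i x)"
   by (simp add: sum_subtractf sum_distrib_left[symmetric] V0)
  finally have F: "(\<Sum>i\<in>UNIV. row_sum (off_diagonal v) i x * row_sum (deriv2 (off_diagonal v)) i x) = 0" by simp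
  show "(\<Sum>i\<in>UNIV. row_sum (off_diagonal (%z. c / z\<^sup>2 + \<rho> z)) i x * row_sum (off_diagonal (deriv (%z. c / z\<^sup>2 + \<rho> z))) i x) = 0"
   using F unfolding dv unfolding v .
 qed
qed

end

subsection \<open>The differential equation of the potential\<close>

text \<open>The products v (x_i - x_k) * w (x_i - x_l) of the functional equation in which i, k, l
  are exactly the three chosen coordinates.\<close>

definition three_form :: "(complex => complex) => (complex => complex) => real => real => real => complex" where
 "three_form v w a b z = v (of_real (a - b)) * w (of_real (a - z)) + v (of_real (a - z)) * w (of_real (a - b))
   + v (of_real (b - a)) * w (of_real (b - z)) + v (of_real (b - z)) * w (of_real (b - a))
   + v (of_real (z - a)) * w (of_real (z - b)) + v (of_real (z - b)) * w (of_real (z - a))"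

lemma three_form_commute: "three_form v w a b z = three_form v w b a z" "three_form v w a b z = three_form v w z a b"
 by (simp_all add: three_form_def)

definition set_coordinates :: "'n => 'n => 'n => real^'n::finite => real => real => real => real^'n" where
 "set_coordinates i j k y a b z = (\<chi> m. if m = i then a else if m = j then b else if m = k then z else y $ m)"

text \<open>Terms of the triple sum that do not involve all three chosen coordinates cancel.\<close>

lemma three_form_alternation:
 fixes y :: "real^'n::finite" and i1 i2 i3 :: 'n
 assumes ne: "i1 \<noteq> i2" "i1 \<noteq> i3" "i2 \<noteq> i3"
  and 0: "\<And>a b z. a \<in> {a0,a1} ==> b \<in> {b0,b1} ==> z \<in> {z0,z1} ==>
   (\<Sum>i\<in>UNIV. row_sum (off_diagonal v) i (set_coordinates i1 i2 i3 y a b z) * row_sum (off_diagonal w) i (set_coordinates i1 i2 i3 y a b z)) = 0"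
 shows "three_form v w a0 b0 z0 - three_form v w a1 b0 z0 - three_form v w a0 b1 z0 + three_form v w a1 b1 z0
  = three_form v w a0 b0 z1 - three_form v w a1 b0 z1 - three_form v w a0 b1 z1 + three_form v w a1 b1 z1"
proof -
 define X where "X = set_coordinates i1 i2 i3 y"
 have Xc: "X a b z $ m = (if m = i1 then a else if m = i2 then b else if m = i3 then z else y $ m)" for a b z m
  by (simp add: X_def set_coordinates_def)
 define alt where "alt = (%G::real => real => real => complex. G a0 b0 z0 - G a1 b0 z0 - G a0 b1 z0 + G a1 b1 z0
   - (G a0 b0 z1 - G a1 b0 z1 - G a0 b1 z1 + G a1 b1 z1))"
 define T where "T = (%i k l (x::real^'n). off_diagonal v i k (of_real (x $ i - x $ k)) * off_diagonal w i l (of_real (x $ i - x $ l)))"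
 define g where "g = (%t a b z. T (fst t) (fst (snd t)) (snd (snd t)) (X a b z))"
 define F where "F = (%a b z. \<Sum>i\<in>UNIV. row_sum (off_diagonal v) i (X a b z) * row_sum (off_diagonal w) i (X a b z))"
 have Fg: "F a b z = (\<Sum>t\<in>UNIV. g t a b z)" for a b z
 proof -
  have "F a b z = (\<Sum>i\<in>UNIV. \<Sum>k\<in>UNIV. \<Sum>l\<in>UNIV. g (i,k,l) a b z)"
   by (simp add: F_def row_sum_def sum_product g_def T_def)
  also have "\<dots> = (\<Sum>t\<in>UNIV \<times> (UNIV \<times> UNIV). g t a b z)" by (simp only: sum.cartesian_product')
  finally show ?thesis by (simp only: UNIV_Times_UNIV)
 qed
 have alt_sum: "alt (%a b z. \<Sum>t\<in>A. g t a b z) = (\<Sum>t\<in>A. alt (g t))" for A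
  by (simp add: alt_def sum_subtractf sum.distrib)
 define P where "P = {(i1,i2,i3), (i1,i3,i2), (i2,i1,i3), (i2,i3,i1), (i3,i1,i2), (i3,i2,i1)}"
 have zero: "alt (g t) = 0" if t: "t \<in> UNIV - P" for t
 proof -
  obtain i k l where ikl: "t = (i,k,l)" by (cases t) auto
  have "(i1 \<noteq> i \<and> i1 \<noteq> k \<and> i1 \<noteq> l) \<or> (i2 \<noteq> i \<and> i2 \<noteq> k \<and> i2 \<noteq> l) \<or> (i3 \<noteq> i \<and> i3 \<noteq> k \<and> i3 \<noteq> l)"
   using t ne unfolding P_def ikl by auto
  then show ?thesis
  proof (elim disjE)
   assume h: "i1 \<noteq> i \<and> i1 \<noteq> k \<and> i1 \<noteq> l"
   have "g t a b z = g t a1 b z" for a b z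
   proof -
    have "X a b z $ m = X a1 b z $ m" if "i1 \<noteq> m" for m using that by (auto simp: Xc)
    then show ?thesis using h by (simp add: g_def T_def ikl)
   qed
   from this[of a0] show ?thesis by (simp add: alt_def)
  next
   assume h: "i2 \<noteq> i \<and> i2 \<noteq> k \<and> i2 \<noteq> l"
   have "g t a b z = g t a b1 z" for a b z
   proof -
    have "X a b z $ m = X a b1 z $ m" if "i2 \<noteq> m" for m using that by (auto simp: Xc)
    then show ?thesis using h by (simp add: g_def T_def ikl)
   qed
   from this[of _ b0] show ?thesis by (simp add: alt_def)
  next
   assume h: "i3 \<noteq> i \<and> i3 \<noteq> k \<and> i3 \<noteq> l"
   have "g t a b z = g t a b z1" for a b z
   proof -
    have "X a b z $ m = X a b z1 $ m" if "i3 \<noteq> m" for m using that by (auto simp: Xc)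
    then show ?thesis using h by (simp add: g_def T_def ikl)
   qed
   from this[of _ _ z0] show ?thesis by (simp add: alt_def)
  qed
 qed
 have P3: "(\<Sum>t\<in>P. g t a b z) = three_form v w a b z" for a b z
  using ne ne[symmetric] unfolding P_def by (simp add: g_def T_def Xc off_diagonal_def three_form_def add.assoc)
 have "alt (three_form v w) = alt (%a b z. \<Sum>t\<in>P. g t a b z)" by (simp add: P3 alt_def)
 also have "\<dots> = (\<Sum>t\<in>P. alt (g t))" by (rule alt_sum)
 also have "\<dots> = (\<Sum>t\<in>UNIV. alt (g t))" by (rule sum.mono_neutral_left) (use zero in auto)
 also have "\<dots> = alt (%a b z. \<Sum>t\<in>UNIV. g t a b z)" by (rule alt_sum[symmetric])
 also have "\<dots> = alt F" by (simp add: Fg alt_def)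
 also have "\<dots> = 0" using 0 by (simp add: alt_def F_def X_def)
 finally show ?thesis by (simp add: alt_def)
qed

text \<open>The first coordinate alternates between t and q, the second between 0 and -q, the third
  between z and -z. These values are chosen for the collisions t -> 0 and z -> q; the remaining
  coordinates stay fixed away from them.\<close>

lemma three_form_alternation_eventually:
 fixes v w :: "complex => complex"
 assumes \<epsilon>: "\<epsilon> > 0" and three: "CARD('n::finite) \<ge> 3"
  and 0: "\<And>x::real^'n. x \<in> ball 0 \<epsilon> ==> (\<And>i j. i \<noteq> j ==> x $ i \<noteq> x $ j) ==>
   (\<Sum>i\<in>UNIV. row_sum (off_diagonal v) i x * row_sum (off_diagonal w) i x) = 0"
 obtains \<eta> where "0 < \<eta>" "\<eta> \<le> \<epsilon>" "\<And>t q z. t \<in> {0<..<\<eta>} ==> q \<in> {0<..<\<eta>} ==> z \<in> {0<..<\<eta>} ==> t \<noteq> q ==> t \<noteq> z ==> q \<noteq> z ==>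
  three_form v w t 0 z - three_form v w q 0 z - three_form v w t (- q) z + three_form v w q (- q) z
  = three_form v w t 0 (- z) - three_form v w q 0 (- z) - three_form v w t (- q) (- z) + three_form v w q (- q) (- z)"
proof -
 obtain T :: "'n set" where "card T = 3" using obtain_subset_with_card_n[OF three] by metis
 then obtain i1 i2 i3 :: 'n where ne: "i1 \<noteq> i2" "i1 \<noteq> i3" "i2 \<noteq> i3" by (auto simp: card_3_iff)
 obtain y :: "real^'n" where y: "\<And>i. y $ i > 0" "\<And>i j. i \<noteq> j ==> y $ i \<noteq> y $ j"
  using positive_distinct_vec_exists by blast
 define N where "N = norm y + 1"
 have ny: "N > 0" "norm y < N" unfolding N_def by (smt (verit) norm_ge_zero)+
 define \<delta> where "\<delta> = \<epsilon> / (2 * N)"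
 have \<delta>: "\<delta> > 0" using \<epsilon> ny by (simp add: \<delta>_def)
 have "\<delta> * norm y < \<delta> * N" using \<delta> ny by simp
 also have "\<dots> = \<epsilon> / 2" using ny by (simp add: \<delta>_def)
 finally have \<delta>y: "\<delta> * norm y < \<epsilon> / 2" .
 define Y where "Y = (%l. \<delta> * y $ l)"
 have Y: "Y l > 0" "l \<noteq> m ==> Y l \<noteq> Y m" for l m using \<delta> y by (auto simp: Y_def)
 \<comment> \<open>Three coordinates below \<epsilon> / 6 add at most \<epsilon> / 2 to the norm,
   and the bound by \<open>Y l\<close> keeps them apart from the other coordinates.\<close>
 define \<eta> where "\<eta> = Min (insert (\<epsilon> / 6) (range Y))"
 have "\<eta> \<in> insert (\<epsilon> / 6) (range Y)" unfolding \<eta>_def by (rule Min_in) auto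
 then have \<eta>0: "\<eta> > 0" using Y(1) \<epsilon> by auto
 have \<eta>6: "\<eta> \<le> \<epsilon> / 6" unfolding \<eta>_def by (rule Min_le) auto
 have \<eta>Y: "\<eta> \<le> Y l" for l unfolding \<eta>_def by (rule Min_le) auto
 define Q :: "real^'n" where "Q = (\<chi> l. if l \<in> {i1,i2,i3} then 0 else Y l)"
 have "norm Q \<le> norm (\<delta> *\<^sub>R y)"
  by (rule norm_le_componentwise_cart) (use \<delta> y(1) in \<open>auto simp: Q_def Y_def\<close>)
 then have Q: "norm Q < \<epsilon> / 2" using \<delta>y \<delta> by simp
 define X where "X = set_coordinates i1 i2 i3 Q"
 have Xc: "X a b z $ m = (if m = i1 then a else if m = i2 then b else if m = i3 then z else Y m)" for a b z m
  by (simp add: X_def set_coordinates_def Q_def)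
 have XB: "X a b z \<in> ball 0 \<epsilon>" if "\<bar>a\<bar> < \<eta>" "\<bar>b\<bar> < \<eta>" "\<bar>z\<bar> < \<eta>" for a b z
 proof -
  have "X a b z = Q + a *\<^sub>R axis i1 1 + b *\<^sub>R axis i2 1 + z *\<^sub>R axis i3 1"
   unfolding vec_eq_iff using ne by (auto simp: Xc Q_def axis_def)
  then have "norm (X a b z) \<le> norm Q + \<bar>a\<bar> + \<bar>b\<bar> + \<bar>z\<bar>"
   by (auto intro!: norm_triangle_le simp: norm_axis_1)
  then show ?thesis using Q that \<eta>6 by simp
 qed
 have X0: "(\<Sum>i\<in>UNIV. row_sum (off_diagonal v) i (X a b z) * row_sum (off_diagonal w) i (X a b z)) = 0"
  if "\<bar>a\<bar> < \<eta>" "\<bar>b\<bar> < \<eta>" "\<bar>z\<bar> < \<eta>" and d: "a \<noteq> b" "a \<noteq> z" "b \<noteq> z" for a b z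
 proof (rule 0[OF XB[OF that(1-3)]])
  have "a \<noteq> Y m" "b \<noteq> Y m" "z \<noteq> Y m" for m using \<eta>Y[of m] that by auto
  then show "X a b z $ i \<noteq> X a b z $ j" if "i \<noteq> j" for i j
   using d d[symmetric] Y(2)[OF that] that unfolding Xc by auto
 qed
 show thesis
 proof (rule that[OF \<eta>0])
  show "\<eta> \<le> \<epsilon>" using \<eta>6 \<epsilon> by simp
  fix t q z assume h: "t \<in> {0<..<\<eta>}" "q \<in> {0<..<\<eta>}" "z \<in> {0<..<\<eta>}" "t \<noteq> q" "t \<noteq> z" "q \<noteq> z"
  show "three_form v w t 0 z - three_form v w q 0 z - three_form v w t (- q) z + three_form v w q (- q) z
   = three_form v w t 0 (- z) - three_form v w q 0 (- z) - three_form v w t (- q) (- z) + three_form v w q (- q) (- z)"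
  proof (rule three_form_alternation[OF ne, of t q 0 "- q" z "- z" v Q w])
   show "(\<Sum>i\<in>UNIV. row_sum (off_diagonal v) i (set_coordinates i1 i2 i3 Q a b z') * row_sum (off_diagonal w) i (set_coordinates i1 i2 i3 Q a b z')) = 0"
    if "a \<in> {t,q}" "b \<in> {0,- q}" "z' \<in> {z,- z}" for a b z'
    unfolding X_def[symmetric] by (rule X0) (use that h in auto)
  qed
 qed
qed

text \<open>The numerator is twice the error of the trapezoidal rule for the integral of f' from s
  to s + t, whence the constant 1/6.\<close>

lemma third_derivative_limit:
 fixes f :: "complex => complex"
 assumes f: "f holomorphic_on S" and S: "open S" "s \<in> S"
 shows "((%t. (t * (deriv f (t + s) + deriv f s) - 2 * (f (t + s) - f s)) / t ^ 3) \<longlongrightarrow> deriv (deriv (deriv f)) s / 6) (at 0)"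
proof -
 define D where "D = (%k. (deriv ^^ k) f)"
 have D: "D k holomorphic_on S" for k unfolding D_def by (rule holomorphic_higher_deriv[OF f S(1)])
 have D_Suc: "deriv (D k) = D (Suc k)" for k by (simp add: D_def)
 obtain e where e: "e > 0" "cball s e \<subseteq> S" using S by (meson open_contains_cball)
 have inS: "t + s \<in> S" if "t \<in> cball 0 e" for t
 proof -
  have "t + s \<in> cball s e" using that by (simp add: dist_norm norm_minus_commute)
  then show ?thesis using e by blast
 qed
 have d: "((%t. D k (t + s)) has_field_derivative D (Suc k) (t + s)) (at t within cball 0 e)" if "t \<in> cball 0 e" for k t
  using DERIV_shift[THEN iffD1, OF holomorphic_derivI[OF D[of k] S(1) inS[OF that]]] unfolding D_Suc
  by (rule has_field_derivative_at_within)
 \<comment> \<open>\<open>F i\<close> is the i-th derivative of the numerator, in the format of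
   \<open>complex_Taylor\<close>. Of the terms up to degree 3 at t = 0 only \<open>F 3\<close>, with
   value \<open>D 3 s\<close>, contributes.\<close>
 define F where "F = (%i::nat. if i = 0 then (%t. t * (D 1 (t + s) + D 1 s) - 2 * (D 0 (t + s) - D 0 s))
   else if i = 1 then (%t. D 1 s - D 1 (t + s) + t * D 2 (t + s))
   else if i = 2 then (%t. t * D 3 (t + s))
   else if i = 3 then (%t. D 3 (t + s) + t * D 4 (t + s))
   else (%t. 2 * D 4 (t + s) + t * D 5 (t + s)))"
 have FF: "F 0 = (%t. t * (D 1 (t + s) + D 1 s) - 2 * (D 0 (t + s) - D 0 s))"
  "F 1 = (%t. D 1 s - D 1 (t + s) + t * D 2 (t + s))" "F 2 = (%t. t * D 3 (t + s))"
  "F 3 = (%t. D 3 (t + s) + t * D 4 (t + s))" "F 4 = (%t. 2 * D 4 (t + s) + t * D 5 (t + s))"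
  by (simp_all add: F_def)
 have dF: "(F i has_field_derivative F (Suc i) t) (at t within cball 0 e)" if t: "t \<in> cball 0 e" and i: "i \<le> 3" for i t
 proof -
  have dn: "((%t. D 0 (t + s)) has_field_derivative D 1 (t + s)) (at t within cball 0 e)"
   "((%t. D 1 (t + s)) has_field_derivative D 2 (t + s)) (at t within cball 0 e)"
   "((%t. D 2 (t + s)) has_field_derivative D 3 (t + s)) (at t within cball 0 e)"
   "((%t. D 3 (t + s)) has_field_derivative D 4 (t + s)) (at t within cball 0 e)"
   "((%t. D 4 (t + s)) has_field_derivative D 5 (t + s)) (at t within cball 0 e)"
   using d[OF t, of 0] d[OF t, of 1] d[OF t, of 2] d[OF t, of 3] d[OF t, of 4] by (simp_all add: eval_nat_numeral)
  have 0: "(F 0 has_field_derivative F 1 t) (at t within cball 0 e)" unfolding FF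
   by (rule DERIV_cong[OF DERIV_diff[OF DERIV_mult[OF DERIV_ident DERIV_add[OF dn(2) DERIV_const]] DERIV_cmult[OF DERIV_diff[OF dn(1) DERIV_const]]]])
    (simp add: algebra_simps)
  have 1: "(F 1 has_field_derivative F 2 t) (at t within cball 0 e)" unfolding FF
   by (rule DERIV_cong[OF DERIV_add[OF DERIV_diff[OF DERIV_const dn(2)] DERIV_mult[OF DERIV_ident dn(3)]]]) (simp add: algebra_simps)
  have 2: "(F 2 has_field_derivative F 3 t) (at t within cball 0 e)" unfolding FF
   by (rule DERIV_cong[OF DERIV_mult[OF DERIV_ident dn(4)]]) (simp add: algebra_simps)
  have 3: "(F 3 has_field_derivative F 4 t) (at t within cball 0 e)" unfolding FF
   by (rule DERIV_cong[OF DERIV_add[OF dn(4) DERIV_mult[OF DERIV_ident dn(5)]]]) (simp add: algebra_simps)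
  consider "i = 0" | "i = 1" | "i = 2" | "i = 3" using i by linarith
  then show ?thesis using 0 1 2 3 by cases (simp_all add: eval_nat_numeral)
 qed
 have cD: "continuous_on (cball 0 e) (%t. D k (t + s))" for k
  by (rule continuous_on_compose2[OF holomorphic_on_imp_continuous_on[OF D[of k]]]) (use inS in \<open>auto intro!: continuous_intros\<close>)
 have "continuous_on (cball 0 e) (F 4)" unfolding FF by (intro continuous_intros cD)
 then have "bounded (F 4 ` cball 0 e)" by (intro compact_imp_bounded compact_continuous_image compact_cball)
 then obtain B where B: "\<And>t. t \<in> cball 0 e ==> norm (F 4 t) \<le> B" unfolding bounded_iff by blast
 have bound: "norm (F 0 t / t ^ 3 - D 3 s / 6) \<le> B / 6 * norm t" if t: "t \<in> cball 0 e" "t \<noteq> 0" for t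
 proof -
  have "norm (F 0 t - (\<Sum>i\<le>3. F i 0 * (t - 0) ^ i / fact i)) \<le> B * norm (t - 0) ^ Suc 3 / fact 3"
  proof (rule complex_Taylor[where S = "cball 0 e" and f = F and n = 3])
   show "(F i has_field_derivative F (Suc i) x) (at x within cball 0 e)" if "x \<in> cball 0 e" "i \<le> 3" for i x by (rule dF[OF that])
   show "norm (F (Suc 3) x) \<le> B" if "x \<in> cball 0 e" for x using B[OF that] by (simp add: eval_nat_numeral)
   show "0 \<in> cball (0::complex) e" "t \<in> cball 0 e" using t e by auto
  qed (rule convex_cball)
  also have "(\<Sum>i\<le>3. F i 0 * (t - 0) ^ i / fact i) = D 3 s * t ^ 3 / 6"
   by (simp add: eval_nat_numeral F_def fact_numeral)
  also have "B * norm (t - 0) ^ Suc 3 / fact 3 = B / 6 * norm t * norm (t ^ 3)"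
   by (simp add: norm_power norm_mult fact_numeral eval_nat_numeral)
  finally have "norm (F 0 t - D 3 s * t ^ 3 / 6) / norm (t ^ 3) \<le> B / 6 * norm t"
   using t by (simp add: divide_le_eq)
  moreover have "norm (F 0 t - D 3 s * t ^ 3 / 6) / norm (t ^ 3) = norm (F 0 t / t ^ 3 - D 3 s / 6)"
   unfolding norm_divide[symmetric] using t by (simp add: diff_divide_distrib)
  ultimately show ?thesis by simp
 qed
 have "((%t. F 0 t / t ^ 3 - D 3 s / 6) \<longlongrightarrow> 0) (at 0)"
 proof (rule Lim_null_comparison)
  show "eventually (%t. norm (F 0 t / t ^ 3 - D 3 s / 6) \<le> B / 6 * norm t) (at 0)"
   unfolding eventually_at using e bound by (intro exI[of _ e]) (auto simp: dist_norm)
  show "((%t. B / 6 * norm t) \<longlongrightarrow> 0) (at (0::complex))" by (auto intro!: tendsto_eq_intros)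
 qed
 then have "((%t. F 0 t / t ^ 3) \<longlongrightarrow> D 3 s / 6) (at 0)" by (simp only: Lim_null[symmetric])
 moreover have "F 0 t = t * (deriv f (t + s) + deriv f s) - 2 * (f (t + s) - f s)" for t by (simp add: F_def D_def)
 moreover have "D 3 s = deriv (deriv (deriv f)) s" by (simp add: D_def eval_nat_numeral)
 ultimately show ?thesis by simp
qed

text \<open>Evenness kills the derivative at 0, so z can be divided out twice. The quotient is even
  again, which lets the lemma be iterated.\<close>

lemma even_factor:
 fixes f :: "complex => complex"
 assumes f: "f holomorphic_on ball 0 e" and even: "\<And>z. z \<in> ball 0 e ==> f (- z) = f z" and e: "e > 0"
 shows "\<exists>g. g holomorphic_on ball 0 e \<and> (\<forall>z\<in>ball 0 e. g (- z) = g z) \<and> (\<forall>z\<in>ball 0 e. f z = f 0 + z\<^sup>2 * g z)"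
proof -
 have 0: "(0::complex) \<in> ball 0 e" and i0: "(0::complex) \<in> interior (ball 0 e)" using e by auto
 define g1 where "g1 = (%z. if z = 0 then deriv f 0 else (f z - f 0) / (z - 0))"
 have g1: "g1 holomorphic_on ball 0 e" unfolding g1_def by (rule pole_lemma[OF f i0])
 have "(f has_field_derivative deriv f 0) (at (- 0))" using holomorphic_derivI[OF f open_ball 0] by simp
 from DERIV_chain2[where g = uminus, OF this DERIV_minus[OF DERIV_ident]]
 have "((%z. f (- z)) has_field_derivative - deriv f 0) (at 0)" by simp
 then have "(f has_field_derivative - deriv f 0) (at 0)"
  by (rule has_field_derivative_transform_within_open[OF _ open_ball 0]) (rule even)
 then have "deriv f 0 = - deriv f 0" by (rule DERIV_imp_deriv)
 then have g10: "g1 0 = 0" by (simp add: g1_def)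
 define g where "g = (%z. if z = 0 then deriv g1 0 else (g1 z - g1 0) / (z - 0))"
 have g: "g holomorphic_on ball 0 e" unfolding g_def by (rule pole_lemma[OF g1 i0])
 have "g (- z) = g z" if "z \<in> ball 0 e" for z using even[OF that] g10 by (simp add: g_def g1_def)
 moreover have "f z = f 0 + z\<^sup>2 * g z" for z using g10 by (simp add: g_def g1_def power2_eq_square)
 ultimately show ?thesis using g by blast
qed

lemma deriv_parity:
 fixes f :: "complex => complex"
 assumes f: "f holomorphic_on S" "open S" and S: "\<And>z. z \<in> S ==> - z \<in> S"
  and par: "\<And>z. z \<in> S ==> f (- z) = \<sigma> * f z" and z: "z \<in> S" and \<sigma>: "\<sigma> * \<sigma> = 1"
 shows "deriv f (- z) = (- \<sigma>) * deriv f z"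
proof -
 have "(f has_field_derivative deriv f (- z)) (at (- z))"
  by (rule holomorphic_derivI[OF f S[OF z]])
 from DERIV_chain2[where g = uminus, OF this DERIV_minus[OF DERIV_ident]]
 have "((%z. f (- z)) has_field_derivative - deriv f (- z)) (at z)" by simp
 then have "((%z. \<sigma> * f z) has_field_derivative - deriv f (- z)) (at z)"
  by (rule has_field_derivative_transform_within_open[OF _ f(2) z]) (rule par)
 moreover have "((%z. \<sigma> * f z) has_field_derivative \<sigma> * deriv f z) (at z)"
  by (rule DERIV_cmult[OF holomorphic_derivI[OF f z]])
 ultimately have "- deriv f (- z) = \<sigma> * deriv f z" by (rule DERIV_unique)
 then have "deriv f (- z) = - (\<sigma> * deriv f z)" by (metis minus_minus)
 then show ?thesis by simp
qed

text \<open>G is what \<open>three_form\<close> leaves when two of its points collide. With v = c q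
  the equation G = 0 becomes q''' = 12 q q', the differentiated Weierstrass equation.\<close>

locale even_double_pole =
 fixes e :: real and c :: complex and \<rho> v w G :: "complex => complex"
 defines "v \<equiv> %z. c / z\<^sup>2 + \<rho> z" and "w \<equiv> deriv v"
  and "G \<equiv> %z. c / 6 * deriv (deriv w) z - 2 * v z * w z"
 assumes e: "e > 0" and c: "c \<noteq> 0" and hol: "\<rho> holomorphic_on ball 0 e" and \<rho>0: "\<rho> 0 = 0"
  and even: "\<And>z. z \<in> ball 0 e ==> \<rho> (- z) = \<rho> z"
begin

abbreviation B :: "complex set" where "B \<equiv> ball 0 e - {0}"

lemma open_B: "open B" by (intro open_delete open_ball)
lemma uminus_B: "z \<in> B ==> - z \<in> B" by simp

lemma hol_v: "v holomorphic_on B" unfolding v_def by (rule holomorphic_double_pole[OF hol])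
lemma hol_w: "w holomorphic_on B" unfolding w_def by (rule holomorphic_deriv[OF hol_v open_B])
lemma hol_w': "deriv w holomorphic_on B" by (rule holomorphic_deriv[OF hol_w open_B])
lemma hol_w'': "deriv (deriv w) holomorphic_on B" by (rule holomorphic_deriv[OF hol_w' open_B])
lemma hol_G: "G holomorphic_on B" unfolding G_def by (intro holomorphic_intros hol_v hol_w hol_w'')

lemma v_even: "z \<in> B ==> v (- z) = v z" using even by (simp add: v_def)
lemma w_odd: "z \<in> B ==> w (- z) = - w z"
 unfolding w_def using deriv_parity[OF hol_v open_B uminus_B, of 1 z] v_even by simp
lemma w'_even: "z \<in> B ==> deriv w (- z) = deriv w z"
 using deriv_parity[OF hol_w open_B uminus_B, of "-1" z] w_odd by simp
lemma w''_odd: "z \<in> B ==> deriv (deriv w) (- z) = - deriv (deriv w) z"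
 using deriv_parity[OF hol_w' open_B uminus_B, of 1 z] w'_even by simp
lemma G_odd: "z \<in> B ==> G (- z) = - G z"
 unfolding G_def by (simp only: v_even w_odd w''_odd) (simp add: algebra_simps)

lemma real_in_B: "complex_of_real x \<in> B \<longleftrightarrow> \<bar>x\<bar> < e \<and> x \<noteq> 0" by auto

lemma cont_B:
 assumes "f holomorphic_on B" "complex_of_real x \<in> B" "(g \<longlongrightarrow> x) F"
 shows "((%t. f (of_real (g t))) \<longlongrightarrow> f (of_real x)) F"
proof -
 have "isCont f (of_real x)"
  using holomorphic_on_imp_continuous_on[OF assms(1)] assms(2) open_B by (simp add: continuous_on_eq_continuous_at)
 then show ?thesis by (rule isCont_tendsto_compose) (intro tendsto_of_real assms(3))
qed

abbreviation T :: "real => real => real => complex" where "T \<equiv> three_form v w"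

abbreviation adm :: "real => real => real => bool" where
 "adm a b z \<equiv> a \<noteq> b \<and> a \<noteq> z \<and> b \<noteq> z \<and> \<bar>a - b\<bar> < e \<and> \<bar>a - z\<bar> < e \<and> \<bar>b - z\<bar> < e"

lemma T_continuous:
 assumes "adm a b z" "(f \<longlongrightarrow> a) F" "(g \<longlongrightarrow> b) F" "(h \<longlongrightarrow> z) F"
 shows "((%t. T (f t) (g t) (h t)) \<longlongrightarrow> T a b z) F"
proof -
 have r: "complex_of_real (a - b) \<in> B" "complex_of_real (b - a) \<in> B" "complex_of_real (a - z) \<in> B"
  "complex_of_real (z - a) \<in> B" "complex_of_real (b - z) \<in> B" "complex_of_real (z - b) \<in> B"
  using assms(1) unfolding real_in_B by auto
 note d = tendsto_diff[OF assms(2,3)] tendsto_diff[OF assms(3,2)] tendsto_diff[OF assms(2,4)]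
  tendsto_diff[OF assms(4,2)] tendsto_diff[OF assms(3,4)] tendsto_diff[OF assms(4,3)]
 show ?thesis unfolding three_form_def
  by (intro tendsto_add tendsto_mult cont_B[OF hol_v] cont_B[OF hol_w] r d)
qed

lemma T_odd:
 assumes "adm a b z"
 shows "T (- a) (- b) (- z) = - T a b z"
proof -
 have r: "complex_of_real (a - b) \<in> B" "complex_of_real (b - a) \<in> B" "complex_of_real (a - z) \<in> B"
  "complex_of_real (z - a) \<in> B" "complex_of_real (b - z) \<in> B" "complex_of_real (z - b) \<in> B"
  using assms(1) unfolding real_in_B by auto
 have m: "complex_of_real (- x - - y) = - complex_of_real (x - y)" for x y by simp
 show ?thesis unfolding three_form_def m by (simp only: v_even w_odd r) (simp add: algebra_simps)
qed

text \<open>With s = y - z the colliding pair contributes v \<tau> (w (\<tau> + s) + w s) + w \<tau>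
  (v (\<tau> + s) - v s). The polar parts c / \<tau>^2 and -2 c / \<tau>^3 combine to c times the
  quotient of \<open>third_derivative_limit\<close> for v; the terms without the colliding
  difference tend to -2 v s * w s.\<close>

lemma T_diagonal_limit:
 assumes yz: "y \<noteq> z" "\<bar>y - z\<bar> < e"
 shows "((%t. T (y + t) y z) \<longlongrightarrow> G (of_real (y - z))) (at_right 0)"
proof -
 define s where "s = complex_of_real (y - z)"
 have s: "s \<in> B" using yz unfolding s_def real_in_B by simp
 have l0: "((%t. complex_of_real t) \<longlongrightarrow> 0) (at_right 0)" by (rule tendsto_eq_intros refl | simp)+
 have ev0: "eventually (%t::real. t > 0) (at_right 0)" by (rule eventually_at_right_less)
 have lat: "filterlim complex_of_real (at 0) (at_right 0)"
  unfolding filterlim_at using l0 ev0 by (auto elim: eventually_mono)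
 have ls: "((%t. y + t - z) \<longlongrightarrow> y - z) (at_right 0)" by (rule tendsto_eq_intros refl | simp)+
 have evB: "eventually (%t. complex_of_real (y + t - z) \<in> B) (at_right 0)"
  by (rule topological_tendstoD[OF tendsto_of_real[OF ls] open_B]) (use s in \<open>simp add: s_def\<close>)
 have eve: "eventually (%t::real. t < e) (at_right 0)"
  using e by (intro eventually_at_rightI[of 0 e]) auto
 have lv: "((%t. v (of_real (y + t - z))) \<longlongrightarrow> v s) (at_right 0)" and lw: "((%t. w (of_real (y + t - z))) \<longlongrightarrow> w s) (at_right 0)"
  unfolding s_def by (intro cont_B[OF hol_v] cont_B[OF hol_w] s[unfolded s_def] ls)+
 have c\<rho>: "isCont \<rho> 0" using holomorphic_on_imp_continuous_on[OF hol] e by (simp add: continuous_on_eq_continuous_at)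
 have c\<rho>': "isCont (deriv \<rho>) 0" using holomorphic_on_imp_continuous_on[OF holomorphic_deriv[OF hol open_ball]] e by (simp add: continuous_on_eq_continuous_at)
 have l\<rho>: "((%t. \<rho> (of_real t)) \<longlongrightarrow> 0) (at_right 0)" using isCont_tendsto_compose[OF c\<rho> l0] unfolding \<rho>0 .
 have l\<rho>': "((%t. deriv \<rho> (of_real t)) \<longlongrightarrow> deriv \<rho> 0) (at_right 0)" by (rule isCont_tendsto_compose[OF c\<rho>' l0])
 define N where "N = (%\<tau>. (\<tau> * (deriv v (\<tau> + s) + deriv v s) - 2 * (v (\<tau> + s) - v s)) / \<tau> ^ 3)"
 have "(N \<longlongrightarrow> deriv (deriv (deriv v)) s / 6) (at 0)" unfolding N_def by (rule third_derivative_limit[OF hol_v open_B s])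
 then have lN: "((%t. N (of_real t)) \<longlongrightarrow> deriv (deriv w) s / 6) (at_right 0)"
  unfolding w_def by (rule filterlim_compose[OF _ lat])
 define E where "E = (%t::real. c * N (of_real t) + \<rho> (of_real t) * (w (of_real (y + t - z)) + w s)
   + deriv \<rho> (of_real t) * (v (of_real (y + t - z)) - v s) - v (of_real (y + t - z)) * w s - v s * w (of_real (y + t - z)))"
 have "(E \<longlongrightarrow> c * (deriv (deriv w) s / 6) + 0 * (w s + w s) + deriv \<rho> 0 * (v s - v s) - v s * w s - v s * w s) (at_right 0)"
  unfolding E_def by (intro tendsto_add tendsto_diff tendsto_mult tendsto_const lN l\<rho> l\<rho>' lv lw)
 then have "(E \<longlongrightarrow> G s) (at_right 0)" by (simp add: G_def mult.assoc)
 moreover have "eventually (%t. E t = T (y + t) y z) (at_right 0)"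
  using ev0 evB eve
 proof eventually_elim
  case (elim t)
  define \<tau> where "\<tau> = complex_of_real t"
  have \<tau>: "\<tau> \<in> B" using elim unfolding \<tau>_def real_in_B by simp
  have \<tau>s: "complex_of_real (y + t - z) = \<tau> + s" by (simp add: \<tau>_def s_def)
  have \<tau>sB: "\<tau> + s \<in> B" using elim unfolding \<tau>s by simp
  have a: "complex_of_real (y + t - y) = \<tau>" "complex_of_real (y - (y + t)) = - \<tau>" "complex_of_real (y - z) = s"
   "complex_of_real (z - y) = - s" "complex_of_real (z - (y + t)) = - (\<tau> + s)"
   by (simp_all add: \<tau>_def s_def)
  have wt: "w \<tau> = - 2 * c / \<tau> ^ 3 + deriv \<rho> \<tau>" unfolding w_def v_def
   by (rule deriv_double_pole[OF hol open_ball]) (use \<tau> in auto)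
  have vt: "v \<tau> = c / \<tau>\<^sup>2 + \<rho> \<tau>" by (simp add: v_def)
  have N: "c * N \<tau> = c / \<tau>\<^sup>2 * (w (\<tau> + s) + w s) + (- 2 * c / \<tau> ^ 3) * (v (\<tau> + s) - v s)"
   using \<tau> unfolding N_def w_def[symmetric] by (simp add: diff_divide_distrib right_diff_distrib power2_eq_square power3_eq_cube mult_ac)
  have "T (y + t) y z = v \<tau> * (w (\<tau> + s) + w s) + w \<tau> * (v (\<tau> + s) - v s) - v (\<tau> + s) * w s - v s * w (\<tau> + s)"
   unfolding three_form_def \<tau>s a by (simp only: v_even[OF \<tau>] v_even[OF \<tau>sB] v_even[OF s] w_odd[OF \<tau>] w_odd[OF \<tau>sB] w_odd[OF s]) (simp add: algebra_simps)
  also have "\<dots> = E t" unfolding E_def \<tau>_def[symmetric] \<tau>s N vt wt by (simp add: algebra_simps)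
  finally show ?case by simp
 qed
 ultimately show ?thesis unfolding s_def by (rule Lim_transform_eventually)
qed

text \<open>As t -> 0 the first two points collide at 0, and oddness of G and T folds the two sides
  into one relation between G z and three values of T. As z -> q two of these values become G q and
  G (2 q), and the third tends to 0.\<close>

lemma G_doubling:
 assumes \<eta>: "0 < \<eta>" "2 * \<eta> \<le> e"
  and alt: "\<And>t q z. t \<in> {0<..<\<eta>} ==> q \<in> {0<..<\<eta>} ==> z \<in> {0<..<\<eta>} ==> t \<noteq> q ==> t \<noteq> z ==> q \<noteq> z ==>
   T t 0 z - T q 0 z - T t (- q) z + T q (- q) z = T t 0 (- z) - T q 0 (- z) - T t (- q) (- z) + T q (- q) (- z)"
  and q: "0 < q" "q < \<eta>"
 shows "G (of_real (2 * q)) = 2 * G (of_real q)"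
proof -
 have cyc: "T a b z = T b z a" "T a b z = T z a b" "T a b z = T b a z" for a b z
  using three_form_commute by metis+
 have step: "G (of_real z) + T q 0 z + T 0 (- q) z = T q (- q) z" if z: "0 < z" "z < \<eta>" "z \<noteq> q" for z
 proof -
  have lt: "((%t. t) \<longlongrightarrow> 0) (at_right (0::real))" by (rule tendsto_ident_at)
  have g1: "((%t. T t 0 z) \<longlongrightarrow> G (of_real (0 - z))) (at_right 0)" using T_diagonal_limit[of 0 z] z \<eta> by simp
  have g2: "((%t. T t 0 (- z)) \<longlongrightarrow> G (of_real (0 - - z))) (at_right 0)" using T_diagonal_limit[of 0 "- z"] z \<eta> by simp
  have g3: "((%t. T t (- q) z) \<longlongrightarrow> T 0 (- q) z) (at_right 0)"
   by (rule T_continuous[OF _ lt tendsto_const tendsto_const]) (use z q \<eta> in auto)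
  have g4: "((%t. T t (- q) (- z)) \<longlongrightarrow> T 0 (- q) (- z)) (at_right 0)"
   by (rule T_continuous[OF _ lt tendsto_const tendsto_const]) (use z q \<eta> in auto)
  have "((%t. T t 0 z - T q 0 z - T t (- q) z + T q (- q) z) \<longlongrightarrow> G (of_real (0 - z)) - T q 0 z - T 0 (- q) z + T q (- q) z) (at_right 0)"
   by (intro tendsto_add tendsto_diff tendsto_const g1 g3)
  moreover have "eventually (%t. T t 0 z - T q 0 z - T t (- q) z + T q (- q) z = T t 0 (- z) - T q 0 (- z) - T t (- q) (- z) + T q (- q) (- z)) (at_right 0)"
  proof (rule eventually_at_rightI[of 0 "min q z"])
   fix t assume t: "t \<in> {0<..<min q z}"
   show "T t 0 z - T q 0 z - T t (- q) z + T q (- q) z = T t 0 (- z) - T q 0 (- z) - T t (- q) (- z) + T q (- q) (- z)"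
    by (rule alt) (use t q z in auto)
  qed (use q z in auto)
  ultimately have "((%t. T t 0 (- z) - T q 0 (- z) - T t (- q) (- z) + T q (- q) (- z)) \<longlongrightarrow> G (of_real (0 - z)) - T q 0 z - T 0 (- q) z + T q (- q) z) (at_right 0)"
   by (rule Lim_transform_eventually)
  moreover have "((%t. T t 0 (- z) - T q 0 (- z) - T t (- q) (- z) + T q (- q) (- z)) \<longlongrightarrow> G (of_real (0 - - z)) - T q 0 (- z) - T 0 (- q) (- z) + T q (- q) (- z)) (at_right 0)"
   by (intro tendsto_add tendsto_diff tendsto_const g2 g4)
  ultimately have eq: "G (of_real (0 - z)) - T q 0 z - T 0 (- q) z + T q (- q) z = G (of_real (0 - - z)) - T q 0 (- z) - T 0 (- q) (- z) + T q (- q) (- z)"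
   by (rule tendsto_unique[OF trivial_limit_at_right_real])
  have "complex_of_real z \<in> B" unfolding real_in_B using z \<eta> by simp
  then have Gz: "G (of_real (0 - z)) = - G (of_real z)" using G_odd by simp
  have "T q 0 (- z) = - T (- q) 0 z" using T_odd[of "- q" 0 z] z q \<eta> by simp
  then have 1: "T q 0 (- z) = - T 0 (- q) z" using cyc(3) by metis
  have "T 0 (- q) (- z) = - T 0 q z" using T_odd[of 0 q z] z q \<eta> by simp
  then have 2: "T 0 (- q) (- z) = - T q 0 z" using cyc(3) by metis
  have "T q (- q) (- z) = - T (- q) q z" using T_odd[of "- q" q z] z q \<eta> by simp
  then have 3: "T q (- q) (- z) = - T q (- q) z" using cyc(3) by metis
  have "2 * (G (of_real z) + T q 0 z + T 0 (- q) z - T q (- q) z) = 0"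
   using eq unfolding Gz 1 2 3 by (simp add: algebra_simps)
  then have "G (of_real z) + T q 0 z + T 0 (- q) z - T q (- q) z = 0" by (simp only: mult_eq_0_iff zero_neq_numeral[symmetric] simp_thms)
  then show ?thesis by (simp only: right_minus_eq)
 qed
 have lq: "((%t. q + t) \<longlongrightarrow> q) (at_right 0)" by (rule tendsto_eq_intros refl | simp)+
 have "complex_of_real q \<in> B" unfolding real_in_B using q \<eta> by simp
 then have h0: "((%t. G (of_real (q + t))) \<longlongrightarrow> G (of_real q)) (at_right 0)" by (rule cont_B[OF hol_G _ lq])
 have "((%t. T (q + t) q 0) \<longlongrightarrow> G (of_real (q - 0))) (at_right 0)" by (rule T_diagonal_limit) (use q \<eta> in auto)
 then have h1: "((%t. T q 0 (q + t)) \<longlongrightarrow> G (of_real q)) (at_right 0)" unfolding cyc(1)[of "q + t" q 0 for t] by simp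
 have "((%t. T (q + t) q (- q)) \<longlongrightarrow> G (of_real (q - - q))) (at_right 0)" by (rule T_diagonal_limit) (use q \<eta> in auto)
 then have h3: "((%t. T q (- q) (q + t)) \<longlongrightarrow> G (of_real (2 * q))) (at_right 0)" unfolding cyc(1)[of "q + t" q "- q" for t] by simp
 have h2: "((%t. T 0 (- q) (q + t)) \<longlongrightarrow> T 0 (- q) q) (at_right 0)"
  by (rule T_continuous[OF _ tendsto_const tendsto_const lq]) (use q \<eta> in auto)
 \<comment> \<open>The triple 0, q, -q is invariant under reflection; T is odd under it and
   symmetric in its arguments, so the value is 0.\<close>
 have "T 0 (- q) q = - T 0 q (- q)" using T_odd[of 0 q "- q"] q \<eta> by simp
 moreover have "T 0 q (- q) = T 0 (- q) q" using cyc by metis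
 ultimately have T0: "T 0 (- q) q = 0" by simp
 have "((%t. G (of_real (q + t)) + T q 0 (q + t) + T 0 (- q) (q + t)) \<longlongrightarrow> G (of_real q) + G (of_real q) + 0) (at_right 0)"
  by (intro tendsto_add h0 h1 h2[unfolded T0])
 moreover have "eventually (%t. G (of_real (q + t)) + T q 0 (q + t) + T 0 (- q) (q + t) = T q (- q) (q + t)) (at_right 0)"
 proof (rule eventually_at_rightI[of 0 "\<eta> - q"])
  fix t assume t: "t \<in> {0<..<\<eta> - q}"
  show "G (of_real (q + t)) + T q 0 (q + t) + T 0 (- q) (q + t) = T q (- q) (q + t)"
   by (rule step) (use t q in auto)
 qed (use q in auto)
 ultimately have "((%t. T q (- q) (q + t)) \<longlongrightarrow> G (of_real q) + G (of_real q) + 0) (at_right 0)" by (rule Lim_transform_eventually)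
 from tendsto_unique[OF trivial_limit_at_right_real h3 this] show ?thesis by simp
qed

text \<open>With \<rho> = a z^2 + b z^4 + O(z^6) the terms of G in z^-5, z^-1 and z cancel, so G has
  order at least 3 at 0. The vanishing of the coefficient of z is the essential one, since a linear
  G satisfies the doubling rule.\<close>

lemma G_small: "((%s. G (of_real s) / of_real s) \<longlongrightarrow> 0) (at_right 0)"
proof -
 let ?B = "ball 0 e :: complex set"
 obtain g where g: "g holomorphic_on ?B" "\<And>z. z \<in> ?B ==> g (- z) = g z" "\<And>z. z \<in> ?B ==> \<rho> z = \<rho> 0 + z\<^sup>2 * g z"
  using even_factor[OF hol even e] by blast
 obtain g2 where g2: "g2 holomorphic_on ?B" "\<And>z. z \<in> ?B ==> g2 (- z) = g2 z" "\<And>z. z \<in> ?B ==> g z = g 0 + z\<^sup>2 * g2 z"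
  using even_factor[OF g(1,2) e] by blast
 obtain k where k: "k holomorphic_on ?B" "\<And>z. z \<in> ?B ==> g2 z = g2 0 + z\<^sup>2 * k z"
  using even_factor[OF g2(1,2) e] by blast
 \<comment> \<open>c = 6 c' makes all coefficients below integral, so that polynomial identities can
   be decided without fractions.\<close>
 define a b c' where "a = g 0" and "b = g2 0" and "c' = c / 6"
 have cc: "c = 6 * c'" by (simp add: c'_def)
 have \<rho>: "\<rho> z = a * z\<^sup>2 + b * z ^ 4 + z ^ 6 * k z" if z: "z \<in> ?B" for z
  unfolding g(3)[OF z] g2(3)[OF z] k(2)[OF z] \<rho>0 a_def b_def by algebra
 define k1 k2 k3 where "k1 = deriv k" and "k2 = deriv k1" and "k3 = deriv k2"
 have hk: "k1 holomorphic_on ?B" "k2 holomorphic_on ?B" "k3 holomorphic_on ?B"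
  unfolding k3_def k2_def k1_def by (intro holomorphic_deriv k(1) open_ball)+
 define v0 where "v0 = (%z. c / z\<^sup>2 + (a * z\<^sup>2 + b * z ^ 4 + z ^ 6 * k z))"
 define v1 where "v1 = (%z. - 2 * c / z ^ 3 + (2 * a * z + 4 * b * z ^ 3 + 6 * z ^ 5 * k z + z ^ 6 * k1 z))"
 define v2 where "v2 = (%z. 6 * c / z ^ 4 + (2 * a + 12 * b * z ^ 2 + 30 * z ^ 4 * k z + 12 * z ^ 5 * k1 z + z ^ 6 * k2 z))"
 define v3 where "v3 = (%z. - 24 * c / z ^ 5 + (24 * b * z + 120 * z ^ 3 * k z + 90 * z ^ 4 * k1 z + 18 * z ^ 5 * k2 z + z ^ 6 * k3 z))"
 have dv: "(v0 has_field_derivative v1 z) (at z)" "(v1 has_field_derivative v2 z) (at z)" "(v2 has_field_derivative v3 z) (at z)"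
  if zB: "z \<in> B" for z
 proof -
  have z: "z \<in> ?B" "z \<noteq> 0" using zB by auto
  have dk: "(k has_field_derivative k1 z) (at z)" "(k1 has_field_derivative k2 z) (at z)" "(k2 has_field_derivative k3 z) (at z)"
   unfolding k1_def k2_def k3_def
   using holomorphic_derivI[OF k(1) open_ball z(1)] holomorphic_derivI[OF hk(1) open_ball z(1)] holomorphic_derivI[OF hk(2) open_ball z(1)]
   by (simp_all add: k1_def k2_def)
  show "(v0 has_field_derivative v1 z) (at z)" unfolding v0_def v1_def
  proof (rule DERIV_add)
   show "((%z. c / z\<^sup>2) has_field_derivative - 2 * c / z ^ 3) (at z)"
    using z by (auto intro!: derivative_eq_intros simp: field_simps eval_nat_numeral)
   show "((%z. a * z\<^sup>2 + b * z ^ 4 + z ^ 6 * k z) has_field_derivative 2 * a * z + 4 * b * z ^ 3 + 6 * z ^ 5 * k z + z ^ 6 * k1 z) (at z)"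
    by (rule derivative_eq_intros dk refl | simp add: algebra_simps)+
  qed
  show "(v1 has_field_derivative v2 z) (at z)" unfolding v1_def v2_def
  proof (rule DERIV_add)
   show "((%z. - 2 * c / z ^ 3) has_field_derivative 6 * c / z ^ 4) (at z)"
    using z by (auto intro!: derivative_eq_intros simp: field_simps eval_nat_numeral)
   show "((%z. 2 * a * z + 4 * b * z ^ 3 + 6 * z ^ 5 * k z + z ^ 6 * k1 z) has_field_derivative 2 * a + 12 * b * z ^ 2 + 30 * z ^ 4 * k z + 12 * z ^ 5 * k1 z + z ^ 6 * k2 z) (at z)"
    by (rule derivative_eq_intros dk refl | simp add: algebra_simps)+
  qed
  show "(v2 has_field_derivative v3 z) (at z)" unfolding v2_def v3_def
  proof (rule DERIV_add)
   show "((%z. 6 * c / z ^ 4) has_field_derivative - 24 * c / z ^ 5) (at z)"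
    using z by (auto intro!: derivative_eq_intros simp: field_simps eval_nat_numeral)
   show "((%z. 2 * a + 12 * b * z ^ 2 + 30 * z ^ 4 * k z + 12 * z ^ 5 * k1 z + z ^ 6 * k2 z) has_field_derivative 24 * b * z + 120 * z ^ 3 * k z + 90 * z ^ 4 * k1 z + 18 * z ^ 5 * k2 z + z ^ 6 * k3 z) (at z)"
    by (rule derivative_eq_intros dk refl | simp add: algebra_simps)+
  qed
 qed
 have v: "v z = v0 z" if "z \<in> B" for z using \<rho> that by (simp add: v_def v0_def)
 have w: "w z = v1 z" if z: "z \<in> B" for z
  unfolding w_def by (rule trans[OF deriv_eq_on_open[OF open_B z v] DERIV_imp_deriv[OF dv(1)[OF z]]])
 have w': "deriv w z = v2 z" if z: "z \<in> B" for z
  by (rule trans[OF deriv_eq_on_open[OF open_B z w] DERIV_imp_deriv[OF dv(2)[OF z]]])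
 have w'': "deriv (deriv w) z = v3 z" if z: "z \<in> B" for z
  by (rule trans[OF deriv_eq_on_open[OF open_B z w'] DERIV_imp_deriv[OF dv(3)[OF z]]])
 define m1 where "m1 = (%z. 6 * k z + z * k1 z)"
 define m3 where "m3 = (%z. 120 * k z + 90 * z * k1 z + 18 * z\<^sup>2 * k2 z + z ^ 3 * k3 z)"
 define Q where "Q = (%z. c' * m3 z - 12 * c' * m1 z + 24 * c' * k z - 2 * (a + b * z\<^sup>2 + z ^ 4 * k z) * (2 * a + 4 * b * z\<^sup>2 + z ^ 4 * m1 z))"
 have GQ: "G z / z = z\<^sup>2 * Q z" if zB: "z \<in> B" for z
 proof -
  have z: "z \<noteq> 0" using zB by auto
  have V0: "z\<^sup>2 * v0 z = 6 * c' + z ^ 4 * (a + b * z\<^sup>2 + z ^ 4 * k z)"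
   using z unfolding v0_def cc distrib_left[of "z\<^sup>2" "6 * c' / z\<^sup>2"] by simp algebra
  have V1: "z ^ 3 * v1 z = - 12 * c' + z ^ 4 * (2 * a + 4 * b * z\<^sup>2 + z ^ 4 * m1 z)"
   using z unfolding v1_def m1_def cc distrib_left[of "z ^ 3" "- 2 * (6 * c') / z ^ 3"] by simp algebra
  have V3: "z ^ 5 * v3 z = - 144 * c' + z ^ 6 * (24 * b + z\<^sup>2 * m3 z)"
   using z unfolding v3_def m3_def cc distrib_left[of "z ^ 5" "- 24 * (6 * c') / z ^ 5"] by simp algebra
  have "z ^ 5 * G z = c' * (z ^ 5 * v3 z) - 2 * (z\<^sup>2 * v0 z) * (z ^ 3 * v1 z)"
   unfolding G_def w''[OF zB] v[OF zB] w[OF zB] c'_def[symmetric] by algebra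
  also have "\<dots> = z ^ 6 * (z\<^sup>2 * Q z)" unfolding V0 V1 V3 Q_def by algebra
  finally have "z ^ 5 * G z = z ^ 5 * (z * (z\<^sup>2 * Q z))" by algebra
  then have "G z = z * (z\<^sup>2 * Q z)" using z by simp
  then show ?thesis using z by simp
 qed
 have hQ: "Q holomorphic_on ?B" unfolding Q_def m1_def m3_def by (intro holomorphic_intros k(1) hk)
 have cQ: "isCont Q 0" using holomorphic_on_imp_continuous_on[OF hQ] e by (simp add: continuous_on_eq_continuous_at)
 have l0: "((%t. complex_of_real t) \<longlongrightarrow> 0) (at_right 0)" by (rule tendsto_eq_intros refl | simp)+
 have "((%s. (of_real s)\<^sup>2 * Q (of_real s)) \<longlongrightarrow> 0\<^sup>2 * Q 0) (at_right 0)"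
  by (intro tendsto_mult tendsto_power l0 isCont_tendsto_compose[OF cQ])
 then have "((%s. (of_real s)\<^sup>2 * Q (of_real s)) \<longlongrightarrow> 0) (at_right 0)" by simp
 moreover have "eventually (%s. (of_real s)\<^sup>2 * Q (of_real s) = G (of_real s) / of_real s) (at_right 0)"
  by (rule eventually_at_rightI[of 0 e]) (use e GQ in \<open>auto simp: real_in_B\<close>)
 ultimately show ?thesis by (rule Lim_transform_eventually)
qed

text \<open>G(s) / s is invariant under halving s and tends to 0, so it is 0 on a real interval; the
  identity theorem does the rest.\<close>

lemma G_zero:
 assumes \<eta>: "0 < \<eta>" "\<eta> \<le> e" and dbl: "\<And>q. 0 < q ==> q < \<eta> ==> G (of_real (2 * q)) = 2 * G (of_real q)"
  and z: "z \<in> B"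
 shows "G z = 0"
proof -
 have real: "G (of_real s) = 0" if s: "0 < s" "s < \<eta>" for s :: real
 proof -
  define g where "g = (%s::real. G (of_real s) / of_real s)"
  have g: "g (s / 2 ^ n) = g s" for n
  proof (induction n)
   case (Suc n)
   have p: "(1::real) \<le> 2 ^ Suc n" by (rule one_le_power) simp
   have "s / 2 ^ Suc n \<le> s / 1" using s p by (intro divide_left_mono) auto
   then have "0 < s / 2 ^ Suc n" "s / 2 ^ Suc n < \<eta>" using s by auto
   from dbl[OF this] have "G (of_real (s / 2 ^ n)) = 2 * G (of_real (s / 2 ^ Suc n))" by simp
   then have "g (s / 2 ^ n) = g (s / 2 ^ Suc n)" using s by (simp add: g_def)
   then show ?case using Suc by simp
  qed simp
  have "filterlim (%n. s / 2 ^ n) (at_right 0) sequentially"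
   unfolding filterlim_at
  proof
   have "((%n. s * (1 / 2) ^ n) \<longlongrightarrow> s * 0) sequentially" by (intro tendsto_mult tendsto_const LIMSEQ_power_zero) simp
   then show "((%n. s / 2 ^ n) \<longlongrightarrow> 0) sequentially" by (simp add: power_divide)
   show "eventually (%n. s / 2 ^ n \<in> {0<..} \<and> s / 2 ^ n \<noteq> 0) sequentially" using s by simp
  qed
  from filterlim_compose[OF G_small[folded g_def] this] have "((%n::nat. g s) \<longlongrightarrow> 0) sequentially" unfolding g .
  then have "g s = 0" by (simp add: tendsto_const_iff)
  then show ?thesis using s by (simp add: g_def)
 qed
 show ?thesis
 proof (rule holomorphic_zero_of_zero_on_reals[OF hol_G open_B _ _ _ _ z])
  show "connected B" by (intro connected_punctured_ball) simp
  show "complex_of_real (\<eta> / 2) \<in> B" unfolding real_in_B using \<eta> by simp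
  show "\<eta> / 2 > 0" using \<eta> by simp
  show "G (of_real (\<eta> / 2) + of_real t) = 0" if t: "0 < t" "t < \<eta> / 2" for t :: real
   using real[of "\<eta> / 2 + t"] t \<eta> by simp
 qed
qed

lemma lattice_sum_of_G_zero:
 assumes G0: "\<And>z. z \<in> B ==> G z = 0"
 obtains \<omega>1 \<omega>2 \<delta> r where "primitive_half_periods \<omega>1 \<omega>2" "discrete_subgroup (period_lattice \<omega>1 \<omega>2) \<delta>" "r > 0"
  "\<And>z. z \<in> ball 0 r ==> \<rho> z = c * lattice_sum (period_lattice \<omega>1 \<omega>2) z"
proof -
 define q where "q = (%z. 1 / z\<^sup>2 + \<rho> z / c)"
 have qv: "q z = v z * (1 / c)" for z using c by (simp add: q_def v_def add_divide_distrib)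
 have step: "deriv f z = deriv g z * (1 / c)" if "g holomorphic_on B" "\<And>z. z \<in> B ==> f z = g z * (1 / c)" "z \<in> B" for f g z
 proof -
  have "deriv f z = deriv (%z. g z * (1 / c)) z" by (rule deriv_eq_on_open[OF open_B that(3,2)])
  also have "\<dots> = deriv g z * (1 / c)"
   by (rule DERIV_imp_deriv) (rule DERIV_cmult_right[OF holomorphic_derivI[OF that(1) open_B that(3)]])
  finally show ?thesis .
 qed
 have q1: "deriv q z = w z * (1 / c)" if "z \<in> B" for z unfolding w_def by (rule step[OF hol_v qv that])
 have q2: "deriv (deriv q) z = deriv w z * (1 / c)" if "z \<in> B" for z by (rule step[OF hol_w q1 that])
 have q3: "deriv (deriv (deriv q)) z = deriv (deriv w) z * (1 / c)" if "z \<in> B" for z by (rule step[OF hol_w' q2 that])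
 have ode: "deriv (deriv (deriv q)) z = 12 * q z * deriv q z" if z: "z \<in> B" for z
 proof -
  have "c * deriv (deriv w) z = 12 * v z * w z" using G0[OF z] by (simp add: G_def field_simps)
  then have "deriv (deriv w) z = 12 * v z * w z / c" using c by (simp add: field_simps)
  then show ?thesis unfolding q3[OF z] q1[OF z] qv by simp
 qed
 have h: "(%z. \<rho> z / c) holomorphic_on ball 0 e" using c by (intro holomorphic_intros hol) auto
 show thesis
 proof (rule third_order_ode_lattice_sum[OF e h _ _ _ ode])
  show "\<rho> (- z) / c = \<rho> z / c" if "z \<in> ball 0 e" for z using even[OF that] by simp
  show "\<rho> 0 / c = 0" by (simp add: \<rho>0)
  show "q z = 1 / z\<^sup>2 + \<rho> z / c" for z by (simp add: q_def)
 next
  fix \<omega>1 \<omega>2 \<delta> r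
  assume h: "primitive_half_periods \<omega>1 \<omega>2" "discrete_subgroup (period_lattice \<omega>1 \<omega>2) \<delta>" "r > 0"
   "\<And>z. z \<in> ball 0 r ==> \<rho> z / c = lattice_sum (period_lattice \<omega>1 \<omega>2) z"
  have "\<rho> z = c * lattice_sum (period_lattice \<omega>1 \<omega>2) z" if "z \<in> ball 0 r" for z
   using h(4)[OF that, symmetric] c by simp
  then show thesis by (rule that[OF h(1-3)])
 qed
qed

end

subsection \<open>Continuation along the domain\<close>

context discrete_subgroup
begin

text \<open>The point 0 counts as regular because the term 1 / t^2 is not part of
  \<open>lattice_sum\<close>.\<close>

definition regular :: "complex => bool" where
 "regular z \<longleftrightarrow> z \<notin> \<Lambda> - {0}"

text \<open>In the parameter s of a real line with slope \<beta>, a lattice pole has leading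
  coefficient 1 / \<beta>^2 > 0. For \<beta> = 0 the argument does not move, so regularity must be
  known at \<alpha>.\<close>

lemma lattice_sum_local_expansion:
 fixes \<alpha> \<beta> t :: real
 assumes reg: "\<beta> = 0 ==> regular (of_real \<alpha>)"
 shows "\<exists>e>0. \<exists>h. \<exists>\<kappa>::real. h holomorphic_on ball 0 e \<and> \<kappa> \<ge> 0 \<and>
  (\<forall>s\<in>ball 0 e - {0}. regular (of_real (\<alpha> + \<beta> * t) + of_real \<beta> * s) \<and>
   lattice_sum \<Lambda> (of_real (\<alpha> + \<beta> * t) + of_real \<beta> * s) = of_real \<kappa> / s\<^sup>2 + h s) \<and>
  (\<kappa> = 0 --> regular (of_real (\<alpha> + \<beta> * t)) \<and> h 0 = lattice_sum \<Lambda> (of_real (\<alpha> + \<beta> * t)))"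
proof -
 define w where "w = complex_of_real (\<alpha> + \<beta> * t)"
 have lin: "(%s. w + of_real \<beta> * s) holomorphic_on A" for A by (intro holomorphic_intros)
 show ?thesis unfolding w_def[symmetric]
 proof (cases "regular w")
  case True
  have "open (- (\<Lambda> - {0}))" by (rule open_Compl[OF closed_subset]) blast
  moreover have "w \<in> - (\<Lambda> - {0})" using True by (auto simp: regular_def)
  ultimately obtain r where r: "r > 0" "ball w r \<subseteq> - (\<Lambda> - {0})" by (meson openE)
  define e where "e = r / (\<bar>\<beta>\<bar> + 1)"
  have b: "\<bar>\<beta>\<bar> + 1 > 0" by simp
  have e: "e > 0" using r b by (simp add: e_def)
  have inb: "w + of_real \<beta> * s \<in> - (\<Lambda> - {0})" if s: "s \<in> ball 0 e" for s
  proof -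
   have "\<bar>\<beta>\<bar> * norm s \<le> (\<bar>\<beta>\<bar> + 1) * norm s" by (simp add: mult_right_mono)
   also have "\<dots> < (\<bar>\<beta>\<bar> + 1) * e" using s b by simp
   also have "\<dots> = r" using b by (simp add: e_def)
   finally have "w + of_real \<beta> * s \<in> ball w r" by (simp add: dist_norm norm_mult)
   then show ?thesis using r by blast
  qed
  have "(lattice_sum \<Lambda> \<circ> (%s. w + of_real \<beta> * s)) holomorphic_on ball 0 e"
   by (rule holomorphic_on_compose_gen[OF lin lattice_sum_holomorphic]) (use inb in blast)
  then have h: "(%s. lattice_sum \<Lambda> (w + of_real \<beta> * s)) holomorphic_on ball 0 e" by (simp add: o_def)
  have reg': "regular (w + of_real \<beta> * s)" if "s \<in> ball 0 e" for s using inb[OF that] unfolding regular_def by blast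
  show "\<exists>e>0. \<exists>h. \<exists>\<kappa>::real. h holomorphic_on ball 0 e \<and> \<kappa> \<ge> 0 \<and>
   (\<forall>s\<in>ball 0 e - {0}. regular (w + of_real \<beta> * s) \<and> lattice_sum \<Lambda> (w + of_real \<beta> * s) = of_real \<kappa> / s\<^sup>2 + h s) \<and>
   (\<kappa> = 0 --> regular w \<and> h 0 = lattice_sum \<Lambda> w)"
   by (rule exI[of _ e], rule conjI[OF e], rule exI[of _ "%s. lattice_sum \<Lambda> (w + of_real \<beta> * s)"], rule exI[of _ 0])
    (use h reg' True in auto)
 next
  case False
  then have w: "w \<in> \<Lambda>" "w \<noteq> 0" by (auto simp: regular_def)
  have \<beta>: "\<beta> \<noteq> 0" using reg False by (auto simp: w_def)
  obtain g where g: "g holomorphic_on ball w \<delta>" and gL: "\<And>t. t \<in> ball w \<delta> - {w} ==> lattice_sum \<Lambda> t = 1 / (t - w)\<^sup>2 + g t"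
   by (rule lattice_sum_pole[OF w]) blast
  define e where "e = \<delta> / \<bar>\<beta>\<bar>"
  have e: "e > 0" using pos \<beta> by (simp add: e_def)
  have inb: "w + of_real \<beta> * s \<in> ball w \<delta>" if s: "s \<in> ball 0 e" for s
  proof -
   have "\<bar>\<beta>\<bar> * norm s < \<bar>\<beta>\<bar> * e" using s \<beta> by simp
   also have "\<dots> = \<delta>" using \<beta> by (simp add: e_def)
   finally show ?thesis by (simp add: dist_norm norm_mult)
  qed
  have "(g \<circ> (%s. w + of_real \<beta> * s)) holomorphic_on ball 0 e"
   by (rule holomorphic_on_compose_gen[OF lin g]) (use inb in blast)
  then have h: "(%s. g (w + of_real \<beta> * s)) holomorphic_on ball 0 e" by (simp add: o_def)
  have "regular (w + of_real \<beta> * s) \<and> lattice_sum \<Lambda> (w + of_real \<beta> * s) = of_real (1 / \<beta>\<^sup>2) / s\<^sup>2 + g (w + of_real \<beta> * s)"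
   if s: "s \<in> ball 0 e - {0}" for s
  proof
   have ne: "w + of_real \<beta> * s \<noteq> w" using s \<beta> by simp
   have B: "w + of_real \<beta> * s \<in> ball w \<delta>" using inb s by blast
   show "regular (w + of_real \<beta> * s)"
    using sep[OF w(1), of "w + of_real \<beta> * s"] ne B by (auto simp: regular_def dist_norm)
   show "lattice_sum \<Lambda> (w + of_real \<beta> * s) = of_real (1 / \<beta>\<^sup>2) / s\<^sup>2 + g (w + of_real \<beta> * s)"
    using gL[of "w + of_real \<beta> * s"] ne B by (simp add: power_mult_distrib)
  qed
  moreover have "(1 / \<beta>\<^sup>2 :: real) > 0" using \<beta> by simp
  ultimately show "\<exists>e>0. \<exists>h. \<exists>\<kappa>::real. h holomorphic_on ball 0 e \<and> \<kappa> \<ge> 0 \<and>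
   (\<forall>s\<in>ball 0 e - {0}. regular (w + of_real \<beta> * s) \<and> lattice_sum \<Lambda> (w + of_real \<beta> * s) = of_real \<kappa> / s\<^sup>2 + h s) \<and>
   (\<kappa> = 0 --> regular w \<and> h 0 = lattice_sum \<Lambda> w)"
   by (intro exI[of _ e] conjI exI[of _ "%s. g (w + of_real \<beta> * s)"] exI[of _ "1 / \<beta>\<^sup>2"] e h ballI) (simp_all add: \<beta>)
 qed
qed

text \<open>Leading coefficients are nonnegative reals, so a vanishing total means that every member
  is regular.\<close>

lemma lattice_sum_family_local_expansion:
 fixes \<alpha> \<beta> :: "'p => real" and t :: real
 assumes I: "finite I" and reg: "\<And>p. p \<in> I ==> \<beta> p = 0 ==> regular (of_real (\<alpha> p))"
 shows "\<exists>e>0. \<exists>h. \<exists>\<kappa>::real. h holomorphic_on ball 0 e \<and> \<kappa> \<ge> 0 \<and>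
  (\<forall>s\<in>ball 0 e - {0}. (\<forall>p\<in>I. regular (of_real (\<alpha> p + \<beta> p * t) + of_real (\<beta> p) * s)) \<and>
   (\<Sum>p\<in>I. lattice_sum \<Lambda> (of_real (\<alpha> p + \<beta> p * t) + of_real (\<beta> p) * s)) = of_real \<kappa> / s\<^sup>2 + h s) \<and>
  (\<kappa> = 0 --> (\<forall>p\<in>I. regular (of_real (\<alpha> p + \<beta> p * t))) \<and> h 0 = (\<Sum>p\<in>I. lattice_sum \<Lambda> (of_real (\<alpha> p + \<beta> p * t))))"
 using I reg
proof (induction I)
 case empty
 show ?case by (intro exI[of _ 1] conjI exI[of _ "%_. 0"] exI[of _ 0]) auto
next
 case (insert p I)
 obtain e h \<kappa> where 1: "e > 0" "h holomorphic_on ball 0 e" "\<kappa> \<ge> 0"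
  "\<And>s. s \<in> ball 0 e - {0} ==> \<forall>p\<in>I. regular (of_real (\<alpha> p + \<beta> p * t) + of_real (\<beta> p) * s)"
  "\<And>s. s \<in> ball 0 e - {0} ==> (\<Sum>p\<in>I. lattice_sum \<Lambda> (of_real (\<alpha> p + \<beta> p * t) + of_real (\<beta> p) * s)) = of_real \<kappa> / s\<^sup>2 + h s"
  "\<kappa> = 0 ==> (\<forall>p\<in>I. regular (of_real (\<alpha> p + \<beta> p * t))) \<and> h 0 = (\<Sum>p\<in>I. lattice_sum \<Lambda> (of_real (\<alpha> p + \<beta> p * t)))"
  using insert.IH[OF insert.prems] by blast
 have "\<beta> p = 0 ==> regular (of_real (\<alpha> p))" using insert.prems by blast
 from lattice_sum_local_expansion[where t = t, OF this]
 obtain e' h' \<kappa>' where 2: "e' > 0" "h' holomorphic_on ball 0 e'" "\<kappa>' \<ge> 0"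
  "\<And>s. s \<in> ball 0 e' - {0} ==> regular (of_real (\<alpha> p + \<beta> p * t) + of_real (\<beta> p) * s)"
  "\<And>s. s \<in> ball 0 e' - {0} ==> lattice_sum \<Lambda> (of_real (\<alpha> p + \<beta> p * t) + of_real (\<beta> p) * s) = of_real \<kappa>' / s\<^sup>2 + h' s"
  "\<kappa>' = 0 ==> regular (of_real (\<alpha> p + \<beta> p * t)) \<and> h' 0 = lattice_sum \<Lambda> (of_real (\<alpha> p + \<beta> p * t))"
  by blast
 show ?case
 proof (rule exI[of _ "min e e'"], intro exI[of _ "%s. h' s + h s"] exI[of _ "\<kappa>' + \<kappa>"] conjI ballI impI)
  show "min e e' > 0" "\<kappa>' + \<kappa> \<ge> 0" using 1 2 by auto
  show "(%s. h' s + h s) holomorphic_on ball 0 (min e e')"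
   by (intro holomorphic_on_add holomorphic_on_subset[OF 1(2)] holomorphic_on_subset[OF 2(2)]) auto
  fix s :: complex assume "s \<in> ball 0 (min e e') - {0}"
  then have s: "s \<in> ball 0 e - {0}" "s \<in> ball 0 e' - {0}" by auto
  show "regular (of_real (\<alpha> q + \<beta> q * t) + of_real (\<beta> q) * s)" if "q \<in> insert p I" for q
   using 1(4)[OF s(1)] 2(4)[OF s(2)] that by blast
  show "(\<Sum>p\<in>insert p I. lattice_sum \<Lambda> (of_real (\<alpha> p + \<beta> p * t) + of_real (\<beta> p) * s)) = of_real (\<kappa>' + \<kappa>) / s\<^sup>2 + (h' s + h s)"
   unfolding sum.insert[OF insert.hyps] 1(5)[OF s(1)] 2(5)[OF s(2)] by (simp add: add_divide_distrib)
 next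
  assume "\<kappa>' + \<kappa> = 0"
  then have k: "\<kappa>' = 0" "\<kappa> = 0" using 1(3) 2(3) by auto
  show "regular (of_real (\<alpha> q + \<beta> q * t))" if "q \<in> insert p I" for q using 1(6)[OF k(2)] 2(6)[OF k(1)] that by blast
  show "h' 0 + h 0 = (\<Sum>p\<in>insert p I. lattice_sum \<Lambda> (of_real (\<alpha> p + \<beta> p * t)))"
   unfolding sum.insert[OF insert.hyps] using 1(6)[OF k(2)] 2(6)[OF k(1)] by simp
 qed
qed

text \<open>The coefficient of a pole of the lattice sums met on the way would be a sum of positive numbers
 \<open>1 / \<beta>\<^sup>2\<close>, whereas \<open>f\<close> stays bounded; hence no pole is met.\<close>

lemma lattice_sum_continuation_segment:
 fixes \<alpha> \<beta> :: "'p => real" and f :: "real => complex"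
 assumes I: "finite I" and c: "c \<noteq> 0"
  and f: "\<And>t. t \<in> {0..1} ==> \<exists>e>0. \<exists>F. F holomorphic_on ball 0 e \<and> (\<forall>s. \<bar>s\<bar> < e --> f (t + s) = F (of_real s))"
  and \<eta>: "\<eta> > 0"
  and start: "\<And>s. \<bar>s\<bar> < \<eta> ==> (\<forall>p\<in>I. regular (of_real (\<alpha> p + \<beta> p * s))) \<and> f s = c * (\<Sum>p\<in>I. lattice_sum \<Lambda> (of_real (\<alpha> p + \<beta> p * s))) + d"
 shows "(\<forall>p\<in>I. regular (of_real (\<alpha> p + \<beta> p))) \<and> f 1 = c * (\<Sum>p\<in>I. lattice_sum \<Lambda> (of_real (\<alpha> p + \<beta> p))) + d"
proof -
 define good where "good = (%s. (\<forall>p\<in>I. regular (of_real (\<alpha> p + \<beta> p * s))) \<and> f s = c * (\<Sum>p\<in>I. lattice_sum \<Lambda> (of_real (\<alpha> p + \<beta> p * s))) + d)"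
 \<comment> \<open>Demanding validity on a whole neighbourhood makes A open at once and gives an
   interval to start the identity theorem from at a limit point.\<close>
 define A where "A = {t \<in> {0..1}. \<exists>e>0. \<forall>s\<in>ball t e. good s}"
 have reg0: "regular (of_real (\<alpha> p))" if "p \<in> I" "\<beta> p = 0" for p using start[of 0] \<eta> that by auto
 have "openin (top_of_set {0..1}) A"
 proof -
  have "open {t. \<exists>e>0. \<forall>s\<in>ball t e. good s}"
   unfolding open_contains_ball
  proof
   fix t assume "t \<in> {t. \<exists>e>0. \<forall>s\<in>ball t e. good s}"
   then obtain e where e: "e > 0" "\<forall>s\<in>ball t e. good s" by blast
   have "ball t e \<subseteq> {t. \<exists>e>0. \<forall>s\<in>ball t e. good s}"
   proof
    fix u assume "u \<in> ball t e"
    then obtain e' where "e' > 0" "ball u e' \<subseteq> ball t e" using open_contains_ball open_ball by meson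
    then show "u \<in> {t. \<exists>e>0. \<forall>s\<in>ball t e. good s}" using e by blast
   qed
   then show "\<exists>e>0. ball t e \<subseteq> {t. \<exists>e>0. \<forall>s\<in>ball t e. good s}" using e by blast
  qed
  moreover have "A = {0..1} \<inter> {t. \<exists>e>0. \<forall>s\<in>ball t e. good s}" by (auto simp: A_def)
  ultimately show ?thesis by (auto simp: openin_open)
 qed
 moreover have "closedin (top_of_set {0..1}) A"
  unfolding closedin_limpt
 proof (intro conjI allI impI)
  show "A \<subseteq> {0..1}" by (auto simp: A_def)
  fix t assume t: "t islimpt A \<and> t \<in> {0..1}"
  obtain e1 F where e1: "e1 > 0" and F: "F holomorphic_on ball 0 e1" and fF: "\<And>s. \<bar>s\<bar> < e1 ==> f (t + s) = F (of_real s)"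
   using f t by blast
  obtain e2 h \<kappa> where e2: "e2 > 0" and h: "h holomorphic_on ball 0 e2"
   and sr: "\<And>s. s \<in> ball 0 e2 - {0} ==> \<forall>p\<in>I. regular (of_real (\<alpha> p + \<beta> p * t) + of_real (\<beta> p) * s)"
   and sL: "\<And>s. s \<in> ball 0 e2 - {0} ==> (\<Sum>p\<in>I. lattice_sum \<Lambda> (of_real (\<alpha> p + \<beta> p * t) + of_real (\<beta> p) * s)) = of_real \<kappa> / s\<^sup>2 + h s"
   and \<kappa>0: "\<kappa> = 0 ==> (\<forall>p\<in>I. regular (of_real (\<alpha> p + \<beta> p * t))) \<and> h 0 = (\<Sum>p\<in>I. lattice_sum \<Lambda> (of_real (\<alpha> p + \<beta> p * t)))"
   using lattice_sum_family_local_expansion[where \<alpha> = \<alpha> and \<beta> = \<beta> and t = t, OF I reg0] by blast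
  define e where "e = min e1 e2"
  have e: "e > 0" using e1 e2 by (simp add: e_def)
  have shift: "of_real (\<alpha> p + \<beta> p * t) + of_real (\<beta> p) * of_real s = complex_of_real (\<alpha> p + \<beta> p * (t + s))" for p s
   by (simp add: algebra_simps)
  have goodF: "good (t + s) \<longleftrightarrow> F (of_real s) = c * (of_real \<kappa> / (of_real s)\<^sup>2 + h (of_real s)) + d" if s: "\<bar>s\<bar> < e" "s \<noteq> 0" for s :: real
  proof -
   have sB: "complex_of_real s \<in> ball 0 e2 - {0}" using s by (simp add: e_def)
   show ?thesis using sr[OF sB] sL[OF sB] fF[of s] s unfolding shift good_def by (simp add: e_def)
  qed
  obtain t1 where t1: "t1 \<in> A" "t1 \<noteq> t" "dist t1 t < e" using t e unfolding islimpt_approachable by blast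
  obtain e3 where e3: "e3 > 0" "\<And>s. s \<in> ball t1 e3 ==> good s" using t1 by (auto simp: A_def)
  define s1 where "s1 = t1 - t"
  have s1: "s1 \<noteq> 0" "\<bar>s1\<bar> < e" using t1 by (auto simp: s1_def dist_real_def)
  define \<Phi> where "\<Phi> = (%s. F s - (c * (of_real \<kappa> / s\<^sup>2 + h s) + d))"
  let ?B = "ball (0::complex) e - {0}"
  have hF: "F holomorphic_on ball 0 e" "h holomorphic_on ball 0 e"
   by (rule holomorphic_on_subset[OF F]; auto simp: e_def) (rule holomorphic_on_subset[OF h]; auto simp: e_def)
  have hFB: "F holomorphic_on ?B" "h holomorphic_on ?B" using hF by (auto intro: holomorphic_on_subset)
  have h\<Phi>: "\<Phi> holomorphic_on ?B" unfolding \<Phi>_def by (intro holomorphic_intros hFB) auto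
  \<comment> \<open>The identity is known only on a small interval to one side of t. The punctured
    complex disc is connected, so it passes around t to the other side.\<close>
  have \<Phi>0: "\<Phi> s = 0" if sB: "s \<in> ?B" for s
  proof (rule holomorphic_zero_of_zero_on_reals[OF h\<Phi> _ _ _ _ _ sB])
   show "open ?B" by (intro open_delete open_ball)
   show "connected ?B" by (intro connected_punctured_ball) simp
   show "complex_of_real s1 \<in> ?B" using s1 by simp
   show "min e3 (min (e - \<bar>s1\<bar>) \<bar>s1\<bar>) > 0" using e3 s1 by simp
   fix \<tau> :: real assume \<tau>: "0 < \<tau>" "\<tau> < min e3 (min (e - \<bar>s1\<bar>) \<bar>s1\<bar>)"
   have "good (t + (s1 + \<tau>))" using e3(2)[of "t1 + \<tau>"] \<tau> by (simp add: s1_def dist_real_def)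
   moreover have "\<bar>s1 + \<tau>\<bar> < e" "s1 + \<tau> \<noteq> 0" using \<tau> by linarith+
   ultimately show "\<Phi> (of_real s1 + of_real \<tau>) = 0" using goodF[of "s1 + \<tau>"] by (simp add: \<Phi>_def)
  qed
  have cont: "isCont F 0" "isCont h 0"
   using holomorphic_on_imp_continuous_on[OF hF(1)] holomorphic_on_imp_continuous_on[OF hF(2)] e
   by (simp_all add: continuous_on_eq_continuous_at)
  have evB: "eventually (%s. s \<in> ?B) (at 0)"
   using e by (intro eventually_at_in_open) auto
  have "((%s. s\<^sup>2 * (F s - c * h s - d)) \<longlongrightarrow> 0\<^sup>2 * (F 0 - c * h 0 - d)) (at 0)"
   using cont by (intro tendsto_intros) (auto simp: isCont_def)
  moreover have "eventually (%s. s\<^sup>2 * (F s - c * h s - d) = c * of_real \<kappa>) (at 0)"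
   using evB
  proof eventually_elim
   case (elim s)
   then have s0: "s \<noteq> 0" by simp
   have "F s - c * h s - d = c * of_real \<kappa> / s\<^sup>2" using \<Phi>0[OF elim] by (simp add: \<Phi>_def algebra_simps)
   then show ?case using s0 by simp
  qed
  ultimately have "((%s::complex. c * of_real \<kappa>) \<longlongrightarrow> 0\<^sup>2 * (F 0 - c * h 0 - d)) (at 0)" by (rule Lim_transform_eventually)
  then have "c * of_real \<kappa> = 0" by (simp add: tendsto_const_iff)
  then have \<kappa>: "\<kappa> = 0" using c by simp
  have "((%s. F s - (c * h s + d)) \<longlongrightarrow> F 0 - (c * h 0 + d)) (at 0)"
   using cont by (intro tendsto_intros) (auto simp: isCont_def)
  moreover have "eventually (%s. F s - (c * h s + d) = 0) (at 0)"
   using evB by eventually_elim (use \<Phi>0 \<kappa> in \<open>auto simp: \<Phi>_def\<close>)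
  ultimately have "((%s::complex. 0) \<longlongrightarrow> F 0 - (c * h 0 + d)) (at 0)" by (rule Lim_transform_eventually)
  then have F0: "F 0 = c * h 0 + d" by (simp add: tendsto_const_iff)
  have "good u" if u: "u \<in> ball t e" for u
  proof (cases "u = t")
   case True
   show ?thesis using \<kappa>0[OF \<kappa>] F0 fF[of 0] e1 unfolding True good_def by simp
  next
   case False
   have s: "\<bar>u - t\<bar> < e" "u - t \<noteq> 0" using u False by (auto simp: dist_real_def)
   have "complex_of_real (u - t) \<in> ?B" using s by (simp del: of_real_diff)
   then show ?thesis using goodF[OF s] \<Phi>0 by (simp add: \<Phi>_def del: of_real_diff)
  qed
  then show "t \<in> A" using t e by (auto simp: A_def)
 qed
 moreover have "0 \<in> A"
  unfolding A_def using start \<eta> by (auto simp: good_def dist_real_def intro!: exI[of _ \<eta>])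
 ultimately have "A = {0..1}" using connected_Icc[of 0 "1::real"] unfolding connected_clopen by blast
 then have "1 \<in> A" by simp
 then obtain e where "e > 0" "\<forall>s\<in>ball 1 e. good s" by (auto simp: A_def)
 then have "good 1" by simp
 then show ?thesis by (simp add: good_def)
qed

text \<open>At a limit point x of the good set a whole ball about x is good: each of its points is
  joined by a segment to a good point of the same ball, and the result along segments applies. So
  the good set is open and closed in \<Omega>.\<close>

lemma lattice_sum_continuation:
 fixes \<Omega> :: "(real^'n::finite) set" and I :: "('n \<times> 'n) set"
 assumes \<Omega>: "open \<Omega>" "connected \<Omega>" "0 \<in> \<Omega>" and f: "real_analytic_on \<Omega> f" and c: "c \<noteq> 0"
  and r: "r > 0" and near: "\<And>x. x \<in> ball 0 r ==> f x = c * (\<Sum>(i,j)\<in>I. lattice_sum \<Lambda> (of_real (x $ i - x $ j))) + d"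
  and x: "x \<in> \<Omega>"
 shows "f x = c * (\<Sum>(i,j)\<in>I. lattice_sum \<Lambda> (of_real (x $ i - x $ j))) + d"
proof -
 define g where "g = (%x::real^'n. c * (\<Sum>p\<in>I. lattice_sum \<Lambda> (of_real (x $ fst p - x $ snd p))) + d)"
 define good where "good = (%x::real^'n. (\<forall>p\<in>I. regular (of_real (x $ fst p - x $ snd p))) \<and> f x = g x)"
 define A where "A = {x \<in> \<Omega>. \<exists>e>0. \<forall>y\<in>ball x e. good y}"
 have "openin (top_of_set \<Omega>) A"
 proof -
  have "open {x. \<exists>e>0. \<forall>y\<in>ball x e. good y}"
   unfolding open_contains_ball
  proof
   fix t assume "t \<in> {x. \<exists>e>0. \<forall>y\<in>ball x e. good y}"
   then obtain e where e: "e > 0" "\<forall>s\<in>ball t e. good s" by blast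
   have "ball t e \<subseteq> {x. \<exists>e>0. \<forall>y\<in>ball x e. good y}"
   proof
    fix u assume "u \<in> ball t e"
    then obtain e' where "e' > 0" "ball u e' \<subseteq> ball t e" using open_contains_ball open_ball by meson
    then show "u \<in> {x. \<exists>e>0. \<forall>y\<in>ball x e. good y}" using e by blast
   qed
   then show "\<exists>e>0. ball t e \<subseteq> {x. \<exists>e>0. \<forall>y\<in>ball x e. good y}" using e by blast
  qed
  moreover have "A = \<Omega> \<inter> {x. \<exists>e>0. \<forall>y\<in>ball x e. good y}" by (auto simp: A_def)
  ultimately show ?thesis by (auto simp: openin_open)
 qed
 moreover have "closedin (top_of_set \<Omega>) A"
  unfolding closedin_limpt
 proof (intro conjI allI impI)
  show "A \<subseteq> \<Omega>" by (auto simp: A_def)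
  fix x assume x: "x islimpt A \<and> x \<in> \<Omega>"
  obtain \<rho> where \<rho>: "\<rho> > 0" "ball x \<rho> \<subseteq> \<Omega>" using \<Omega> x by (meson openE)
  obtain y where y: "y \<in> A" "dist y x < \<rho>" using x \<rho> unfolding islimpt_approachable by blast
  obtain e where e: "e > 0" "\<And>z. z \<in> ball y e ==> good z" using y by (auto simp: A_def)
  have "good z" if z: "z \<in> ball x \<rho>" for z
  proof -
   define \<alpha> where "\<alpha> = (%p. y $ fst p - y $ snd p)"
   define \<beta> where "\<beta> = (%p. (z - y) $ fst p - (z - y) $ snd p)"
   define X where "X = (%t::real. y + t *\<^sub>R (z - y))"
   have Xab: "X t $ fst p - X t $ snd p = \<alpha> p + \<beta> p * t" for t p by (simp add: X_def \<alpha>_def \<beta>_def algebra_simps)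
   define N where "N = norm (z - y) + 1"
   have N: "N > 0" "norm (z - y) < N" unfolding N_def by (smt (verit) norm_ge_zero)+
   have "(\<forall>p\<in>I. regular (of_real (\<alpha> p + \<beta> p))) \<and> f (X 1) = c * (\<Sum>p\<in>I. lattice_sum \<Lambda> (of_real (\<alpha> p + \<beta> p))) + d"
   proof (rule lattice_sum_continuation_segment[OF _ c])
    show "finite I" by simp
    show "e / N > 0" using e N by simp
    fix s assume s: "\<bar>s\<bar> < e / N"
    have "\<bar>s\<bar> * norm (z - y) \<le> \<bar>s\<bar> * N" using N by (intro mult_left_mono) auto
    also have "\<dots> < e" using s N by (simp add: pos_less_divide_eq)
    finally have "X s \<in> ball y e" by (simp add: X_def dist_norm)
    from e(2)[OF this] show "(\<forall>p\<in>I. regular (of_real (\<alpha> p + \<beta> p * s))) \<and> f (X s) = c * (\<Sum>p\<in>I. lattice_sum \<Lambda> (of_real (\<alpha> p + \<beta> p * s))) + d"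
     unfolding good_def g_def Xab .
   next
    fix t :: real assume t: "t \<in> {0..1}"
    have "X t = (1 - t) *\<^sub>R y + t *\<^sub>R z" by (simp add: X_def algebra_simps)
    moreover have "y \<in> ball x \<rho>" using y by (simp add: dist_commute)
    ultimately have "X t \<in> ball x \<rho>" using convexD_alt[OF convex_ball _ z, of y t] t by simp
    then have "real_analytic_at f (X t)" using \<rho> f by (auto simp: real_analytic_on_def)
    from real_analytic_at_line[OF this, of "z - y"]
    obtain e F where e: "e > 0" "F holomorphic_on ball 0 e" "\<forall>s. \<bar>s\<bar> < e --> f (X t + s *\<^sub>R (z - y)) = F (of_real s)" by blast
    have "X t + s *\<^sub>R (z - y) = X (t + s)" for s by (simp add: X_def scaleR_left_distrib)
    with e show "\<exists>e>0. \<exists>F. F holomorphic_on ball 0 e \<and> (\<forall>s. \<bar>s\<bar> < e --> f (X (t + s)) = F (of_real s))" by auto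
   qed
   note main = this
   have X1: "X 1 = z" by (simp add: X_def)
   have eq: "z $ fst p - z $ snd p = \<alpha> p + \<beta> p" for p by (simp add: \<alpha>_def \<beta>_def)
   show ?thesis using main unfolding good_def g_def eq X1 .
  qed
  then show "x \<in> A" using x \<rho> by (auto simp: A_def)
 qed
 moreover have "0 \<in> A"
 proof -
  have "good y" if y: "y \<in> ball 0 (min r (\<delta> / 2))" for y
  proof -
   have "regular (of_real (y $ i - y $ j))" for i j
   proof -
    have "\<bar>y $ i - y $ j\<bar> < \<delta>" using abs_component_difference_le[of y i j] y by simp
    then show ?thesis using min_norm[of "of_real (y $ i - y $ j)"] unfolding regular_def by (auto simp del: of_real_diff)
   qed
   then show ?thesis using near[of y] y by (simp add: good_def g_def case_prod_beta)
  qed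
  then show ?thesis using \<Omega> r pos by (auto simp: A_def intro!: exI[of _ "min r (\<delta> / 2)"])
 qed
 ultimately have "A = \<Omega>" using \<Omega>(2) unfolding connected_clopen by blast
 then have "x \<in> A" using x by simp
 then obtain e where "e > 0" "\<forall>s\<in>ball x e. good s" by (auto simp: A_def)
 then have "good x" by simp
 then show ?thesis by (simp add: good_def g_def case_prod_beta)
qed

end

section \<open>From the hypotheses to the local form of the potential\<close>

lemma sum_less_pairs:
 fixes f :: "'n::{finite,linorder} => 'n => complex"
 assumes sym: "\<And>i j. f j i = f i j" and diag: "\<And>i. f i i = 0"
 shows "(\<Sum>(i,j)\<in>{(i,j). i < j}. f i j) = (\<Sum>i\<in>UNIV. \<Sum>j\<in>UNIV. f i j) / 2"
proof -
 have "(\<Sum>i\<in>UNIV. \<Sum>j\<in>UNIV. f i j) = (\<Sum>(i,j)\<in>UNIV. f i j)"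
  by (simp add: sum.cartesian_product)
 also have "\<dots> = (\<Sum>(i,j)\<in>{(i,j). i < j} \<union> {(i,j). j < i}. f i j)"
 proof (rule sum.mono_neutral_right)
  show "\<forall>p\<in>UNIV - ({(i, j). i < j} \<union> {(i, j). j < i}). (case p of (i, j) => f i j) = 0"
  proof
   fix p :: "'n \<times> 'n" assume "p \<in> UNIV - ({(i, j). i < j} \<union> {(i, j). j < i})"
   then have "fst p = snd p" by (auto simp: not_less_iff_gr_or_eq)
   then show "(case p of (i, j) => f i j) = 0" by (simp add: case_prod_beta diag)
  qed
 qed auto
 also have "\<dots> = (\<Sum>(i,j)\<in>{(i,j). i < j}. f i j) + (\<Sum>(i,j)\<in>{(i,j). j < i}. f i j)"
  by (rule sum.union_disjoint) auto
 also have "(\<Sum>(i,j)\<in>{(i,j). j < i}. f i j) = (\<Sum>(i,j)\<in>{(i,j). i < j}. f i j)"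
  by (rule sum.reindex_bij_witness[of _ prod.swap prod.swap]) (auto simp: sym)
 finally show ?thesis by simp
qed

lemma partial3_cong:
 assumes W: "open W" "x \<in> W" and fg: "\<And>y. y \<in> W ==> f y = g y"
 shows "partial i f x = partial i g x" "partial i (partial j (partial k f)) x = partial i (partial j (partial k g)) x"
proof -
 have 1: "partial k f y = partial k g y" if "y \<in> W" for k y by (rule partial_cong[OF W(1) that fg])
 have 2: "partial j (partial k f) y = partial j (partial k g) y" if "y \<in> W" for y by (rule partial_cong[OF W(1) that 1])
 show "partial i f x = partial i g x" by (rule 1[OF W(2)])
 show "partial i (partial j (partial k f)) x = partial i (partial j (partial k g)) x" by (rule partial_cong[OF W 2])
qed

lemma partial3_diff:
 assumes W: "open W" "x \<in> W" and sm: "smooth_on W f" "smooth_on W g"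
 shows "partial i (%x. f x - g x) x = partial i f x - partial i g x"
  and "partial i (partial j (partial k (%x. f x - g x))) x = partial i (partial j (partial k f)) x - partial i (partial j (partial k g)) x"
proof -
 have 1: "partial k (%x. f x - g x) y = partial k f y - partial k g y" if "smooth_on W f" "smooth_on W g" "y \<in> W" for f g k y
  by (rule partial_diff[OF smooth_on_differentiable[OF that(1,3)] smooth_on_differentiable[OF that(2,3)]])
 have 2: "partial j (partial k (%x. f x - g x)) y = partial j (%x. partial k f x - partial k g x) y" if "y \<in> W" for y
  by (rule partial_cong[OF W(1) that 1[OF sm]])
 have 3: "partial j (partial k (%x. f x - g x)) y = partial j (partial k f) y - partial j (partial k g) y" if y: "y \<in> W" for y
  unfolding 2[OF y] by (rule 1[OF smooth_on_partial[OF sm(1)] smooth_on_partial[OF sm(2)] y])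
 have 4: "partial i (partial j (partial k (%x. f x - g x))) x = partial i (%x. partial j (partial k f) x - partial j (partial k g) x) x"
  by (rule partial_cong[OF W 3])
 show "partial i (%x. f x - g x) x = partial i f x - partial i g x" by (rule 1[OF sm W(2)])
 show "partial i (partial j (partial k (%x. f x - g x))) x = partial i (partial j (partial k f)) x - partial i (partial j (partial k g)) x"
  unfolding 4 by (rule 1[OF smooth_on_partial[OF smooth_on_partial[OF sm(1)]] smooth_on_partial[OF smooth_on_partial[OF sm(2)]] W(2)])
qed

text \<open>If M were a proper union of components, the sum of the coordinates in M would vanish on
  all root vectors and hence on their span, but not on the difference of axis vectors from inside
  and outside M.\<close>

lemma irreducible_connected:
 fixes C :: "'n::{finite,linorder} => 'n => complex"
 assumes irr: "irreducible_in (root_vectors C) {x. (\<Sum>i\<in>UNIV. x $ i) = 0}"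
  and M: "M \<noteq> {}" and closed: "\<And>a b. a < b ==> C a b \<noteq> 0 ==> a \<in> M \<longleftrightarrow> b \<in> M"
 shows "M = UNIV"
proof (rule ccontr)
 assume "M \<noteq> UNIV"
 then obtain a b where ab: "a \<in> M" "b \<notin> M" using M by blast
 then have ne: "a \<noteq> b" by blast
 define f where "f = (%x::real^'n::{finite,linorder}. \<Sum>i\<in>M. x $ i)"
 have ax: "(\<Sum>x\<in>M. (axis i (1::real) :: real^'n::{finite,linorder}) $ x) = of_bool (i \<in> M)" for i
  by (simp add: axis_def)
 have f_axis: "f (axis i 1 - axis j 1) = of_bool (i \<in> M) - of_bool (j \<in> M)" for i j
  by (simp add: f_def sum_subtractf ax)
 have "span (root_vectors C) \<subseteq> {x. f x = 0}"
 proof (rule span_minimal)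
  show "root_vectors C \<subseteq> {x. f x = 0}"
  proof
   fix x assume "x \<in> root_vectors C"
   then obtain i j where "x = axis i 1 - axis j 1" "i < j" "C i j \<noteq> 0" unfolding root_vectors_def by blast
   then show "x \<in> {x. f x = 0}" using closed[of i j] f_axis[of i j] by simp
  qed
  show "subspace {x. f x = 0}"
   by (simp add: subspace_def f_def sum.distrib sum_distrib_left[symmetric])
 qed
 moreover have "(\<Sum>i\<in>UNIV. (axis a 1 - axis b (1::real) :: real^'n::{finite,linorder}) $ i) = 0"
  by (simp add: sum_subtractf axis_def)
 then have "axis a 1 - axis b 1 \<in> span (root_vectors C)" using irr by (simp add: irreducible_in_def)
 ultimately have "f (axis a 1 - axis b 1) = 0" by blast
 then show False using ab by (simp add: f_axis)
qed

text \<open>Off the walls R satisfies the three relations by commutation, and the singular pair sum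
  satisfies them identically, so their difference Rt does. Since Rt is smooth across the walls,
  density extends the relations to the ball.\<close>

lemma analytic_part_derivatives:
 fixes R Rt a0 :: "real^'n::{finite,linorder} => complex" and Cs :: "'n => 'n => complex"
 assumes cp: "commuting_pair U R a0 a1" and Cs: "\<And>i j. Cs j i = Cs i j" "\<And>i. Cs i i = 0"
  and Rt: "smooth_on (ball 0 \<rho>) Rt"
  and DU: "\<And>x. x \<in> ball 0 \<rho> ==> (\<And>i j. i \<noteq> j ==> x $ i \<noteq> x $ j) ==> x \<in> U \<and> R x = pair_sum (%i j z. Cs i j / z\<^sup>2) x + Rt x"
  and x: "x \<in> ball 0 \<rho>"
 shows "(\<Sum>i\<in>UNIV. partial i Rt x) = 0"
  and "j \<noteq> k ==> j \<noteq> l ==> k \<noteq> l ==> partial j (partial k (partial l Rt)) x = 0"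
  and "j \<noteq> k ==> partial j (partial j (partial k Rt)) x + partial k (partial j (partial k Rt)) x = 0"
proof -
 interpret C: commuting_pair U R a0 a1 by (rule cp)
 define s where "s = (%i j z. Cs i j / z\<^sup>2)"
 define D where "D = {x::real^'n::{finite,linorder}. x \<in> ball 0 \<rho> \<and> (\<forall>i j. i \<noteq> j --> x $ i \<noteq> x $ j)}"
 interpret P: pair_functions s "ball 0 (2 * \<rho>) - {0}" D
  unfolding D_def
 proof (rule pair_functions_punctured_ball)
  show "s i j holomorphic_on ball 0 (2 * \<rho>) - {0}" for i j
   unfolding s_def by (intro holomorphic_intros) auto
 qed (simp_all add: s_def Cs)
 have DU': "y \<in> U" "R y = pair_sum s y + Rt y" if "y \<in> D" for y
  using DU[of y] that by (auto simp: D_def s_def)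
 have smR: "smooth_on D R" by (rule smooth_on_subset[OF C.R]) (use DU' in auto)
 have Rt_D: "Rt y = R y - pair_sum s y" if "y \<in> D" for y using DU'(2)[OF that] by simp
 have 1: "partial i Rt y = partial i R y - partial i (pair_sum s) y" if "y \<in> D" for i y
  using partial3_cong(1)[OF P.W that Rt_D] partial3_diff(1)[OF P.W that smR P.smooth_pair_sum] by simp
 have 3: "partial i (partial j (partial k Rt)) y = partial i (partial j (partial k R)) y - partial i (partial j (partial k (pair_sum s))) y"
  if "y \<in> D" for i j k y
  using partial3_cong(2)[OF P.W that Rt_D] partial3_diff(2)[OF P.W that smR P.smooth_pair_sum] by simp
 have inD: "y \<in> D" if "y \<in> ball 0 \<rho>" "\<And>i j. i \<noteq> j ==> y $ i \<noteq> y $ j" for y :: "real^'n::{finite,linorder}" using that by (simp add: D_def)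
 have d1: "partial i Rt differentiable (at x)" for i by (intro smooth_on_differentiable[OF _ x] smooth_on_partial Rt)
 have d3: "partial i (partial j (partial k Rt)) differentiable (at x)" for i j k by (intro smooth_on_differentiable[OF _ x] smooth_on_partial Rt)
 show "(\<Sum>i\<in>UNIV. partial i Rt x) = 0"
 proof (rule zero_on_dense[OF open_ball x])
  show "(%x. \<Sum>i\<in>UNIV. partial i Rt x) differentiable (at x)" by (rule differentiable_sum) (use d1 in auto)
  fix y :: "real^'n::{finite,linorder}" assume "y \<in> ball 0 \<rho>" "\<And>i j. i \<noteq> j ==> y $ i \<noteq> y $ j"
  then have y: "y \<in> D" by (rule inD)
  show "(\<Sum>i\<in>UNIV. partial i Rt y) = 0"
   using C.sum_partial_R[OF DU'(1)[OF y]] P.sum_partial_pair_sum[OF y] by (simp add: 1[OF y] sum_subtractf)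
 qed
 show "partial j (partial k (partial l Rt)) x = 0" if d: "j \<noteq> k" "j \<noteq> l" "k \<noteq> l"
 proof (rule zero_on_dense[OF open_ball x d3])
  fix y :: "real^'n::{finite,linorder}" assume "y \<in> ball 0 \<rho>" "\<And>i j. i \<noteq> j ==> y $ i \<noteq> y $ j"
  then have y: "y \<in> D" by (rule inD)
  show "partial j (partial k (partial l Rt)) y = 0"
   using C.partial3_R[OF DU'(1)[OF y] d] P.partial3_pair_sum[OF y d(3)[symmetric], of j] d by (simp add: 3[OF y])
 qed
 show "partial j (partial j (partial k Rt)) x + partial k (partial j (partial k Rt)) x = 0" if d: "j \<noteq> k"
 proof (rule zero_on_dense[OF open_ball x])
  show "(%x. partial j (partial j (partial k Rt)) x + partial k (partial j (partial k Rt)) x) differentiable (at x)"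
   by (intro differentiable_add d3)
  fix y :: "real^'n::{finite,linorder}" assume "y \<in> ball 0 \<rho>" "\<And>i j. i \<noteq> j ==> y $ i \<noteq> y $ j"
  then have y: "y \<in> D" by (rule inD)
  show "partial j (partial j (partial k Rt)) y + partial k (partial j (partial k Rt)) y = 0"
  proof -
   have "partial j (partial j (partial k (pair_sum s))) y + partial k (partial j (partial k (pair_sum s))) y = 0"
    unfolding P.partial3_pair_sum[OF y d[symmetric]] using d by simp
   moreover have "(a - p) + (b - q) = (a + b) - (p + q)" for a b p q :: complex by simp
   ultimately show ?thesis unfolding 3[OF y] using C.partial3_R'[OF DU'(1)[OF y] d] by (simp only: diff_zero)
  qed
 qed
qed

text \<open>The points ordered like a vector with distinct coordinates form a convex open chamber,
  on which affine functions can be recovered by integration along segments.\<close>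

lemma chamber_exists:
 assumes \<epsilon>: "\<epsilon> > 0"
 obtains K :: "(real^'n::finite) set" and x0 where "open K" "convex K" "x0 \<in> K"
  "K \<subseteq> {x. x \<in> ball 0 \<epsilon> \<and> (\<forall>i j. i \<noteq> j --> x $ i \<noteq> x $ j)}"
proof -
 obtain y :: "real^'n" where y: "\<forall>i j. i \<noteq> j --> y $ i \<noteq> y $ j" using inj_vec_exists by blast
 define K where "K = ball 0 \<epsilon> \<inter> (\<Inter>p\<in>{p. y $ fst p < y $ snd p}. {x::real^'n. x $ fst p < x $ snd p})"
 define N where "N = norm y + 1"
 have N: "N > 0" "norm y < N" unfolding N_def by (smt (verit) norm_ge_zero)+
 have "\<epsilon> / N * norm y < \<epsilon> / N * N" using N \<epsilon> by (intro mult_strict_left_mono) auto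
 then have nx: "norm ((\<epsilon> / N) *\<^sub>R y) < \<epsilon>" using N \<epsilon> by simp
 show thesis
 proof (rule that[of K "(\<epsilon> / N) *\<^sub>R y"])
  show "open K" unfolding K_def
   by (intro open_Int open_ball open_INT finite ballI open_Collect_less continuous_intros)
  show "convex K" unfolding K_def
  proof (intro convex_Int convex_ball convex_INT)
   fix p :: "'n \<times> 'n"
   show "convex {x::real^'n. x $ fst p < x $ snd p}"
   proof (rule convexI)
    fix x z :: "real^'n" and a b :: real
    assume h: "x \<in> {x. x $ fst p < x $ snd p}" "z \<in> {x. x $ fst p < x $ snd p}" "0 \<le> a" "0 \<le> b" "a + b = 1"
    show "a *\<^sub>R x + b *\<^sub>R z \<in> {x. x $ fst p < x $ snd p}"
    proof (cases "a = 0")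
     case False
     then have "a * x $ fst p < a * x $ snd p" using h by simp
     moreover have "b * z $ fst p \<le> b * z $ snd p" using h by (simp add: mult_left_mono)
     ultimately show ?thesis by simp
    qed (use h in simp)
   qed
  qed
  show "(\<epsilon> / N) *\<^sub>R y \<in> K" using nx N \<epsilon> by (auto simp: K_def intro!: divide_strict_right_mono mult_strict_left_mono)
  show "K \<subseteq> {x. x \<in> ball 0 \<epsilon> \<and> (\<forall>i j. i \<noteq> j --> x $ i \<noteq> x $ j)}"
  proof (intro subsetI CollectI conjI allI impI)
   fix x :: "real^'n" and i j :: 'n assume x: "x \<in> K"
   then show "x \<in> ball 0 \<epsilon>" by (simp add: K_def)
   assume "i \<noteq> j"
   then have "y $ i < y $ j \<or> y $ j < y $ i" using y by (metis linorder_neqE_linordered_idom)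
   then show "x $ i \<noteq> x $ j" using x by (force simp: K_def)
  qed
 qed
qed

text \<open>The conclusion concerns Rt because it lives on a full ball, walls included, where it is
  described by \<open>lattice_sum\<close>; the double poles of R are kept in
  \<open>Cs\<close>.\<close>

lemma local_form:
 fixes R Rt a0 :: "real^'n::{finite,linorder} => complex" and Cs :: "'n => 'n => complex"
 assumes cp: "commuting_pair U R a0 a1" and Cs: "\<And>i j. Cs j i = Cs i j" "\<And>i. Cs i i = 0"
  and \<rho>: "\<rho> > 0" and Rt: "real_analytic_on (ball 0 \<rho>) Rt"
  and DU: "\<And>x. x \<in> ball 0 \<rho> ==> (\<And>i j. i \<noteq> j ==> x $ i \<noteq> x $ j) ==> x \<in> U \<and> R x = pair_sum (%i j z. Cs i j / z\<^sup>2) x + Rt x"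
  and conn: "\<And>M. M \<noteq> {} ==> (\<And>a b. Cs a b \<noteq> 0 ==> a \<in> M \<longleftrightarrow> b \<in> M) ==> M = UNIV"
  and three: "CARD('n) \<ge> 3"
 obtains c d \<omega>1 \<omega>2 \<delta> \<epsilon> where "c \<noteq> 0" "\<And>i j. i \<noteq> j ==> Cs i j = c" "primitive_half_periods \<omega>1 \<omega>2"
  "discrete_subgroup (period_lattice \<omega>1 \<omega>2) \<delta>" "\<epsilon> > 0"
  "\<And>x. x \<in> ball 0 \<epsilon> ==> Rt x = c * (\<Sum>(i,j)\<in>{(i,j). i < j}. lattice_sum (period_lattice \<omega>1 \<omega>2) (of_real (x $ i - x $ j))) + d"
proof -
 note smRt = real_analytic_on_imp_smooth_on[OF Rt]
 obtain \<epsilon> r d where \<epsilon>: "0 < \<epsilon>" "\<epsilon> \<le> \<rho>" and hol: "\<And>i j. r i j holomorphic_on ball 0 (2 * \<epsilon>)"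
  and r: "\<And>i z. r i i z = 0" "\<And>i j. r i j 0 = 0" "\<And>i j z. z \<in> ball 0 (2 * \<epsilon>) ==> r j i (- z) = r i j z"
  and Rr: "\<And>x. x \<in> ball 0 \<epsilon> ==> Rt x = pair_sum r x + d"
 proof (rule pair_representation[OF \<rho> Rt])
  show "(\<Sum>i\<in>UNIV. partial i Rt x) = 0" if "x \<in> ball 0 \<rho>" for x
   by (rule analytic_part_derivatives(1)[OF cp Cs smRt DU that])
  show "partial j (partial k (partial l Rt)) x = 0" if "x \<in> ball 0 \<rho>" "j \<noteq> k" "j \<noteq> l" "k \<noteq> l" for x j k l
   by (rule analytic_part_derivatives(2)[OF cp Cs smRt DU that])
  show "partial j (partial j (partial k Rt)) x + partial k (partial j (partial k Rt)) x = 0" if "x \<in> ball 0 \<rho>" "j \<noteq> k" for x j k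
   by (rule analytic_part_derivatives(3)[OF cp Cs smRt DU that])
 next
  fix \<epsilon> r d assume "0 < \<epsilon>" "\<epsilon> \<le> \<rho>" "\<And>i j. r i j holomorphic_on ball 0 (2 * \<epsilon>)" "\<And>i z. r i i z = 0" "\<And>i j. r i j 0 = 0"
   "\<And>i j z. z \<in> ball 0 (2 * \<epsilon>) ==> r j i (- z) = r i j z" "\<And>x. x \<in> ball 0 \<epsilon> ==> Rt x = pair_sum r x + d"
  then show thesis by (rule that)
 qed
 define u where "u = (%i j z. Cs i j / z\<^sup>2 + r i j z)"
 define D where "D = {x::real^'n::{finite,linorder}. x \<in> ball 0 \<epsilon> \<and> (\<forall>i j. i \<noteq> j --> x $ i \<noteq> x $ j)}"
 have hol_u: "u i j holomorphic_on ball 0 (2 * \<epsilon>) - {0}" for i j unfolding u_def by (rule holomorphic_double_pole[OF hol])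
 have pf: "pair_functions u (ball 0 (2 * \<epsilon>) - {0}) D" unfolding D_def
  by (rule pair_functions_punctured_ball[OF hol_u]) (auto simp: u_def Cs r)
 have D: "x \<in> U" "R x = pair_sum u x + d" if "x \<in> D" for x
  using DU[of x] Rr[of x] that \<epsilon> by (auto simp: D_def u_def pair_sum_def sum.distrib add_divide_distrib)
 obtain K x0 where K: "open K" "convex K" "x0 \<in> K" "K \<subseteq> D" unfolding D_def by (rule chamber_exists[OF \<epsilon>(1)])
 have DU2: "D \<subseteq> U" using D by blast
 obtain lam mu where lam: "\<And>i. lam i i = 0" "\<And>i. (\<Sum>j\<in>UNIV. lam i j) = 0" "\<And>i j. lam i j + lam j i = 0"
  and idK: "\<And>x. x \<in> K ==> (\<Sum>i\<in>UNIV. (row_sum u i x - 2 * (mu i + (\<Sum>j\<in>UNIV. lam i j * of_real (x $ j)))) * row_sum (deriv2 u) i x) = 0"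
 proof (rule affine_coefficients[OF cp pf DU2 K(4,1,2,3)])
  show "R x = pair_sum u x + d" if "x \<in> D" for x by (rule D(2)[OF that])
 next
  fix lam mu assume "\<And>i. lam i i = 0" "\<And>i. (\<Sum>j\<in>UNIV. lam i j) = 0" "\<And>i j. lam i j + lam j i = 0"
   "\<And>x. x \<in> K ==> (\<Sum>i\<in>UNIV. (row_sum u i x - 2 * (mu i + (\<Sum>j\<in>UNIV. lam i j * of_real (x $ j)))) * row_sum (deriv2 u) i x) = 0"
  then show thesis by (rule that)
 qed
 have diag_u: "u i i = (%_. 0)" for i by (simp add: u_def Cs r)
 have idD: "(\<Sum>i\<in>UNIV. (row_sum u i x - 2 * (mu i + (\<Sum>j\<in>UNIV. lam i j * of_real (x $ j)))) * row_sum (deriv2 u) i x) = 0"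
  if "x \<in> ball 0 \<epsilon>" "\<And>i j. i \<noteq> j ==> x $ i \<noteq> x $ j" for x :: "real^'n::{finite,linorder}"
  by (rule pair_identity_continuation[OF hol_u diag_u K(1) K(4)[unfolded D_def] K(3) idK that])
 note idD' = idD[unfolded u_def]
 interpret W: equal_walls \<epsilon> Cs r lam mu u "%i x. 2 * (mu i + (\<Sum>j\<in>UNIV. lam i j * of_real (x $ j)))"
  by unfold_locales (fact | rule u_def[THEN eq_reflection] | rule reflexive)+
 obtain c q where all: "c \<noteq> 0 \<and> (\<forall>i j. i \<noteq> j --> Cs i j = c) \<and> q holomorphic_on ball 0 (2 * \<epsilon>) \<and> q 0 = 0 \<and>
  (\<forall>z\<in>ball 0 (2 * \<epsilon>). q (- z) = q z) \<and> (\<forall>x\<in>ball 0 \<epsilon>. pair_sum r x = pair_sum (off_diagonal q) x) \<and>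
  (\<forall>x\<in>(ball 0 \<epsilon> :: (real^'n::{finite,linorder}) set). (\<forall>i j. i \<noteq> j --> x $ i \<noteq> x $ j) -->
   (\<Sum>i\<in>UNIV. row_sum (off_diagonal (%z. c / z\<^sup>2 + q z)) i x * row_sum (off_diagonal (deriv (%z. c / z\<^sup>2 + q z))) i x) = 0)"
  using W.reduced_identity by (elim exE) (rule that)
 have c: "c \<noteq> 0" and Cc: "\<And>i j. i \<noteq> j ==> Cs i j = c" and hq: "q holomorphic_on ball 0 (2 * \<epsilon>)" and q0: "q 0 = 0"
  and qe: "\<And>z. z \<in> ball 0 (2 * \<epsilon>) ==> q (- z) = q z" and rq: "\<And>x. x \<in> ball 0 \<epsilon> ==> pair_sum r x = pair_sum (off_diagonal q) x"
  and idv: "\<And>x::real^'n::{finite,linorder}. x \<in> ball 0 \<epsilon> ==> (\<And>i j. i \<noteq> j ==> x $ i \<noteq> x $ j) ==>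
   (\<Sum>i\<in>UNIV. row_sum (off_diagonal (%z. c / z\<^sup>2 + q z)) i x * row_sum (off_diagonal (deriv (%z. c / z\<^sup>2 + q z))) i x) = 0"
 proof -
  note a = all[THEN conjunct2] note b = a[THEN conjunct2] note d = b[THEN conjunct2] note e = d[THEN conjunct2] note f = e[THEN conjunct2]
  show "c \<noteq> 0" by (rule all[THEN conjunct1])
  show "Cs i j = c" if "i \<noteq> j" for i j by (rule a[THEN conjunct1, rule_format, OF that])
  show "q holomorphic_on ball 0 (2 * \<epsilon>)" "q 0 = 0" by (rule b[THEN conjunct1], rule d[THEN conjunct1])
  show "q (- z) = q z" if "z \<in> ball 0 (2 * \<epsilon>)" for z by (rule e[THEN conjunct1, rule_format, OF that])
  show "pair_sum r x = pair_sum (off_diagonal q) x" if "x \<in> ball 0 \<epsilon>" for x by (rule f[THEN conjunct1, rule_format, OF that])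
  show "(\<Sum>i\<in>UNIV. row_sum (off_diagonal (%z. c / z\<^sup>2 + q z)) i x * row_sum (off_diagonal (deriv (%z. c / z\<^sup>2 + q z))) i x) = 0"
   if "x \<in> ball 0 \<epsilon>" "\<And>i j. i \<noteq> j ==> x $ i \<noteq> x $ j" for x :: "real^'n::{finite,linorder}"
   by (rule f[THEN conjunct2, rule_format, OF that])
 qed
 define v where "v = (%z. c / z\<^sup>2 + q z)"
 obtain \<eta> where \<eta>: "0 < \<eta>" "\<eta> \<le> \<epsilon>" and alt: "\<And>t q z. t \<in> {0<..<\<eta>} ==> q \<in> {0<..<\<eta>} ==> z \<in> {0<..<\<eta>} ==> t \<noteq> q ==> t \<noteq> z ==> q \<noteq> z ==>
  three_form v (deriv v) t 0 z - three_form v (deriv v) q 0 z - three_form v (deriv v) t (- q) z + three_form v (deriv v) q (- q) z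
  = three_form v (deriv v) t 0 (- z) - three_form v (deriv v) q 0 (- z) - three_form v (deriv v) t (- q) (- z) + three_form v (deriv v) q (- q) (- z)"
 proof (rule three_form_alternation_eventually[OF \<epsilon>(1) three])
  show "(\<Sum>i\<in>UNIV. row_sum (off_diagonal v) i x * row_sum (off_diagonal (deriv v)) i x) = 0"
   if "x \<in> ball 0 \<epsilon>" "\<And>i j. i \<noteq> j ==> x $ i \<noteq> x $ j" for x :: "real^'n::{finite,linorder}"
   unfolding v_def by (rule idv[OF that])
 next
  fix \<eta> assume "0 < \<eta>" "\<eta> \<le> \<epsilon>" "\<And>t q z. t \<in> {0<..<\<eta>} ==> q \<in> {0<..<\<eta>} ==> z \<in> {0<..<\<eta>} ==> t \<noteq> q ==> t \<noteq> z ==> q \<noteq> z ==>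
  three_form v (deriv v) t 0 z - three_form v (deriv v) q 0 z - three_form v (deriv v) t (- q) z + three_form v (deriv v) q (- q) z
  = three_form v (deriv v) t 0 (- z) - three_form v (deriv v) q 0 (- z) - three_form v (deriv v) t (- q) (- z) + three_form v (deriv v) q (- q) (- z)"
  then show thesis by (rule that)
 qed
 define G where "G = (%z. c / 6 * deriv (deriv (deriv v)) z - 2 * v z * deriv v z)"
 have e2: "0 < 2 * \<epsilon>" using \<epsilon>(1) by simp
 interpret E: even_double_pole "2 * \<epsilon>" c q v "deriv v" G
  by unfold_locales (fact | rule v_def[THEN eq_reflection] | rule G_def[THEN eq_reflection] | rule reflexive)+
 have dbl: "G (of_real (2 * q')) = 2 * G (of_real q')" if "0 < q'" "q' < \<eta>" for q' :: real
 proof (rule E.G_doubling[OF \<eta>(1) _ _ that])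
  show "2 * \<eta> \<le> 2 * \<epsilon>" using \<eta> by simp
 qed (rule alt)
 have G0: "G z = 0" if z: "z \<in> ball 0 (2 * \<epsilon>) - {0}" for z
 proof (rule E.G_zero[OF \<eta>(1) _ _ z])
  show "\<eta> \<le> 2 * \<epsilon>" using \<eta> \<epsilon> by simp
 qed (rule dbl)
 obtain \<omega>1 \<omega>2 \<delta> r' where L: "primitive_half_periods \<omega>1 \<omega>2" "discrete_subgroup (period_lattice \<omega>1 \<omega>2) \<delta>" "r' > 0"
  and qL: "\<And>z. z \<in> ball 0 r' ==> q z = c * lattice_sum (period_lattice \<omega>1 \<omega>2) z"
 proof (rule E.lattice_sum_of_G_zero)
  show "G z = 0" if "z \<in> ball 0 (2 * \<epsilon>) - {0}" for z by (rule G0[OF that])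
 next
  fix \<omega>1 \<omega>2 \<delta> r' assume "primitive_half_periods \<omega>1 \<omega>2" "discrete_subgroup (period_lattice \<omega>1 \<omega>2) \<delta>" "r' > 0"
   "\<And>z. z \<in> ball 0 r' ==> q z = c * lattice_sum (period_lattice \<omega>1 \<omega>2) z"
  then show thesis by (rule that)
 qed
 show thesis
 proof (rule that[OF c _ L(1,2)])
  show "Cs i j = c" if "i \<noteq> j" for i j by (rule Cc[OF that])
  show "min \<epsilon> (r' / 2) > 0" using \<epsilon> L by simp
  fix x :: "real^'n::{finite,linorder}" assume x: "x \<in> ball 0 (min \<epsilon> (r' / 2))"
  have xB: "complex_of_real (x $ i - x $ j) \<in> ball 0 r'" "complex_of_real (x $ i - x $ j) \<in> ball 0 (2 * \<epsilon>)" for i j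
   using abs_component_difference_le[of x i j] x by (simp_all del: of_real_diff)
  have sym: "off_diagonal q j i (of_real (x $ j - x $ i)) = off_diagonal q i j (of_real (x $ i - x $ j))" for i j
   using qe[OF xB(2)[of i j]] by (simp add: off_diagonal_def)
  have "Rt x = (\<Sum>i\<in>UNIV. \<Sum>j\<in>UNIV. off_diagonal q i j (of_real (x $ i - x $ j))) / 2 + d"
   using Rr[of x] rq[of x] x by (simp add: pair_sum_def)
  also have "(\<Sum>i\<in>UNIV. \<Sum>j\<in>UNIV. off_diagonal q i j (of_real (x $ i - x $ j))) / 2 = (\<Sum>(i,j)\<in>{(i,j). i < j}. off_diagonal q i j (of_real (x $ i - x $ j)))"
   by (rule sum_less_pairs[symmetric]) (rule sym, simp add: off_diagonal_def)
  also have "\<dots> = (\<Sum>(i,j)\<in>{(i,j). i < j}. c * lattice_sum (period_lattice \<omega>1 \<omega>2) (of_real (x $ i - x $ j)))"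
   by (intro sum.cong refl) (use qL[OF xB(1)] in \<open>auto simp: off_diagonal_def simp del: of_real_diff\<close>)
  also have "\<dots> = c * (\<Sum>(i,j)\<in>{(i,j). i < j}. lattice_sum (period_lattice \<omega>1 \<omega>2) (of_real (x $ i - x $ j)))"
   by (simp add: sum_distrib_left case_prod_beta)
  finally show "Rt x = c * (\<Sum>(i,j)\<in>{(i,j). i < j}. lattice_sum (period_lattice \<omega>1 \<omega>2) (of_real (x $ i - x $ j))) + d" .
 qed
qed

theorem theorem6p2:
  fixes C :: "'n::{finite,linorder} \<Rightarrow> 'n \<Rightarrow> complex"
    and R Rt a0 :: "real^'n::{finite,linorder} \<Rightarrow> complex"
    and a1 :: "'n \<Rightarrow> real^'n::{finite,linorder} \<Rightarrow> complex"
    and \<Omega> U :: "(real^'n::{finite,linorder}) set"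
  assumes "CARD('n) \<ge> 3"
    and "open \<Omega>" and "connected \<Omega>" and "0 \<in> \<Omega>"
    and "real_analytic_on \<Omega> Rt"
    and "U = {x \<in> \<Omega>. \<forall>i j. i < j \<and> C i j \<noteq> 0 \<longrightarrow> x $ i \<noteq> x $ j}"
    and "\<forall>x\<in>U. R x = (\<Sum>(i,j)\<in>{(i,j). i < j}. C i j / of_real ((x $ i - x $ j)\<^sup>2)) + Rt x"
    and "commute_on U (schroedinger R) Delta1"
    and "irreducible_in (root_vectors C) {x. (\<Sum>i\<in>UNIV. x $ i) = 0}"
    and "generic C"
    and "\<forall>i. real_analytic_on U (a1 i)" and "real_analytic_on U a0"
    and "commute_on U (cubic_operator a1 a0) Delta1"
    and "commute_on U (schroedinger R) (cubic_operator a1 a0)"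
  shows "\<exists>c1 c2 \<omega>1 \<omega>2. primitive_half_periods \<omega>1 \<omega>2 \<and>
    (\<forall>x\<in>U. R x =
       c1 * (\<Sum>(i,j)\<in>{(i,j). i < j}. weierstrass_p \<omega>1 \<omega>2 (of_real (x $ i - x $ j))) + c2)"
proof -
 note three = assms(1) and \<Omega> = assms(2-4) and Rt = assms(5) and U_eq = assms(6) and R_eq = assms(7)
  and comm_R = assms(8) and irr = assms(9) and a1 = assms(11) and a0 = assms(12) and comm_P = assms(13) and comm = assms(14)
 have U\<Omega>: "U \<subseteq> \<Omega>" using U_eq by blast
 have "U = \<Omega> \<inter> (\<Inter>p\<in>{p. fst p < snd p \<and> C (fst p) (snd p) \<noteq> 0}. {x. x $ fst p \<noteq> x $ snd p})"
  unfolding U_eq by auto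
 moreover have "open \<dots>"
  by (intro open_Int \<Omega> open_INT finite ballI open_Collect_neq continuous_intros)
 ultimately have openU: "open U" by simp
 have sm_term: "smooth_on U (\<lambda>x. C i j / of_real ((x $ i - x $ j)\<^sup>2))" if ij: "i < j" for i j
 proof (cases "C i j = 0")
  case True
  then show ?thesis by (simp add: smooth_on_const)
 next
  case False
  have "(\<lambda>z. C i j / z\<^sup>2) holomorphic_on - {0}" by (intro holomorphic_intros) auto
  then have "smooth_on U (\<lambda>x. C i j / (of_real (x $ i - x $ j))\<^sup>2)"
  proof (rule smooth_on_holomorphic_difference[rotated 3])
   show "open (- {0::complex})" by (intro open_Compl) simp
   show "of_real (x $ i - x $ j) \<in> - {0::complex}" if "x \<in> U" for x using that ij False unfolding U_eq by auto
  qed (rule openU)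
  then show ?thesis by simp
 qed
 have "smooth_on U (\<lambda>x. (\<Sum>p\<in>{(i,j). i < j}. C (fst p) (snd p) / of_real ((x $ fst p - x $ snd p)\<^sup>2)) + Rt x)"
  by (intro smooth_on_add smooth_on_sum openU smooth_on_subset[OF real_analytic_on_imp_smooth_on[OF Rt] U\<Omega>] sm_term) auto
 then have sm_R: "smooth_on U R"
  by (rule smooth_on_cong[OF openU, rotated]) (use R_eq in \<open>auto simp: case_prod_beta\<close>)
 have cp: "commuting_pair U R a0 a1"
  by (rule commuting_pair.intro[OF openU sm_R _ _ comm_R comm_P comm]) (use a1 a0 real_analytic_on_imp_smooth_on in blast)+
 \<comment> \<open>The constants C i j are meaningful for i < j only; the local theory works with a
   symmetric table.\<close>
 define Cs where "Cs = (\<lambda>i j. if i < j then C i j else if j < i then C j i else 0)"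
 obtain \<rho> where \<rho>: "\<rho> > 0" "ball 0 \<rho> \<subseteq> \<Omega>" using \<Omega> by (meson openE)
 have Rt\<rho>: "real_analytic_on (ball 0 \<rho>) Rt" using Rt \<rho> by (auto simp: real_analytic_on_def)
 have R_pair: "x \<in> U \<and> R x = pair_sum (\<lambda>i j z. Cs i j / z\<^sup>2) x + Rt x"
  if x: "x \<in> ball 0 \<rho>" and dis: "\<And>i j. i \<noteq> j \<Longrightarrow> x $ i \<noteq> x $ j" for x :: "real^'n::{finite,linorder}"
 proof
  show xU: "x \<in> U" unfolding U_eq using x \<rho> dis by (auto simp: less_imp_neq)
  have "(\<Sum>(i,j)\<in>{(i,j). i < j}. C i j / of_real ((x $ i - x $ j)\<^sup>2)) = (\<Sum>(i,j)\<in>{(i,j). i < j}. Cs i j / (of_real (x $ i - x $ j))\<^sup>2)"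
   by (intro sum.cong refl) (auto simp: Cs_def)
  also have "\<dots> = (\<Sum>i\<in>UNIV. \<Sum>j\<in>UNIV. Cs i j / (of_real (x $ i - x $ j))\<^sup>2) / 2"
   by (rule sum_less_pairs) (auto simp: Cs_def power2_commute)
  finally show "R x = pair_sum (\<lambda>i j z. Cs i j / z\<^sup>2) x + Rt x" using R_eq xU by (simp add: pair_sum_def)
 qed
 have conn: "M = UNIV" if "M \<noteq> {}" "\<And>a b. Cs a b \<noteq> 0 \<Longrightarrow> a \<in> M \<longleftrightarrow> b \<in> M" for M
  by (rule irreducible_connected[OF irr that(1)]) (use that(2) in \<open>auto simp: Cs_def\<close>)
 have Cs: "Cs j i = Cs i j" "Cs i i = 0" for i j by (auto simp: Cs_def)
 obtain c d \<omega>1 \<omega>2 \<delta> \<epsilon> where c: "c \<noteq> 0" "\<And>i j. i \<noteq> j \<Longrightarrow> Cs i j = c" and prim: "primitive_half_periods \<omega>1 \<omega>2"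
  and lat: "discrete_subgroup (period_lattice \<omega>1 \<omega>2) \<delta>" and \<epsilon>: "\<epsilon> > 0"
  and near: "\<And>x. x \<in> ball 0 \<epsilon> \<Longrightarrow> Rt x = c * (\<Sum>(i,j)\<in>{(i,j). i < j}. lattice_sum (period_lattice \<omega>1 \<omega>2) (of_real (x $ i - x $ j))) + d"
 proof (rule local_form[OF cp Cs \<rho>(1) Rt\<rho> _ _ three])
  show "x \<in> U \<and> R x = pair_sum (\<lambda>i j z. Cs i j / z\<^sup>2) x + Rt x"
   if "x \<in> ball 0 \<rho>" "\<And>i j. i \<noteq> j \<Longrightarrow> x $ i \<noteq> x $ j" for x :: "real^'n::{finite,linorder}"
   by (rule R_pair[OF that])
  show "M = UNIV" if "M \<noteq> {}" "\<And>a b. Cs a b \<noteq> 0 \<Longrightarrow> a \<in> M \<longleftrightarrow> b \<in> M" for M by (rule conn[OF that])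
 next
  fix c d \<omega>1 \<omega>2 \<delta> \<epsilon> assume "c \<noteq> 0" "\<And>i j. i \<noteq> j \<Longrightarrow> Cs i j = c" "primitive_half_periods \<omega>1 \<omega>2"
   "discrete_subgroup (period_lattice \<omega>1 \<omega>2) \<delta>" "\<epsilon> > 0" "\<And>x. x \<in> ball 0 \<epsilon> \<Longrightarrow> Rt x = c * (\<Sum>(i,j)\<in>{(i,j). i < j}. lattice_sum (period_lattice \<omega>1 \<omega>2) (of_real (x $ i - x $ j))) + d"
  then show thesis by (rule that)
 qed
 have Cc: "C i j = c" if "i < j" for i j using c(2)[of i j] that by (simp add: Cs_def)
 have "R x = c * (\<Sum>(i,j)\<in>{(i,j). i < j}. weierstrass_p \<omega>1 \<omega>2 (of_real (x $ i - x $ j))) + d" if x: "x \<in> U" for x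
 proof -
  \<comment> \<open>The continuation is carried out for Rt on the connected set \<Omega>, since the
    walls may disconnect U.\<close>
  have "Rt x = c * (\<Sum>(i,j)\<in>{(i,j). i < j}. lattice_sum (period_lattice \<omega>1 \<omega>2) (of_real (x $ i - x $ j))) + d"
   by (rule discrete_subgroup.lattice_sum_continuation[OF lat \<Omega> Rt c(1) \<epsilon> near]) (use x U\<Omega> in auto)
  moreover have "(\<Sum>(i,j)\<in>{(i,j). i < j}. C i j / of_real ((x $ i - x $ j)\<^sup>2)) = c * (\<Sum>(i,j)\<in>{(i,j). i < j}. 1 / (of_real (x $ i - x $ j))\<^sup>2)"
   unfolding sum_distrib_left by (intro sum.cong refl) (auto simp: Cc)
  ultimately show ?thesis
   using R_eq x by (simp add: weierstrass_p_eq case_prod_beta sum.distrib algebra_simps)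
 qed
 then show ?thesis using prim by blast
qed

end
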